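(* Consider either the Kac model or the soft spheres model, with collision kernel $B$ and (for soft spheres) modulation function $h$. Let $f^N(t)$ be the solution of the corresponding $N$-particle master equation, started from a symmetric probability density $f^N(0)$, with $j$-particle marginals $f^N_j(t)$. Let $f(0)$ be a one-particle probability density, let $f(t)$ be the solution of the corresponding kinetic equation (homogeneous Boltzmann equation for the Kac model, Povzner equation for soft spheres) with initial condition $f(0)$, and let $$E_j(0)=\sum_{K\subset\{1,\dots,j\}}(-1)^{|K|}f^N_{\{1,\dots,j\}\setminus K}(0)\,f(0)^{\otimes K}.$$ Suppose that $B$ is bounded, that for some $C_0\ge1$ $$\|E_j(0)\|_{L^1}\le C_0^{\,j}\left(\frac{j}{\sqrt N}\right)^{j},\qquad j=2,\dots,N,$$ and that $\|E_1(0)\|_{L^1}\le B_0/N$ for some $B_0>0$. Then, for both models, for all $t>0$ and all $j=1,\dots,N$, $$\left\|f^N_j(\cdot,t)-f^{\otimes j}(\cdot,t)\right\|_{L^1}\le D_2\,e^{2D_1t\|B\|_\infty(2\pi+\|h\|_\infty)}\,\frac{j^2}{N},$$ where $D_2=\sup\{B_2,8(eC_2)^2\}$, $D_1=\sup\{B_1,2C_1\}$ and $$C_1=4\,\frac{16(2e)^{\frac1{12e}+1}}{\left|\log\left(1-\frac1{24e}\right)\right|},\quad C_2=16(2e)^{1+\frac1{12e}}C_0,\quad B_1=2C_1,\quad B_2=B_0+\frac12+\frac{16C_2^2}{C_1-2}.$$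
   Context: **Collisions.** For velocities $v_i,v_j\in\mathbb R^3$ and a unit vector $\omega$, the outgoing velocities are $v_i'=v_i-[\omega\cdot(v_i-v_j)]\omega$, $v_j'=v_j+[\omega\cdot(v_i-v_j)]\omega$. For $\mathcal V_N=\{v_1,\dots,v_N\}$, $\mathcal V_N^{i,j}$ is $\mathcal V_N$ with $v_i,v_j$ replaced by $v_i',v_j'$. The kernel $B(\omega;w)\ge0$ is a measurable function of a unit vector $\omega$ and of $w\in\mathbb R^3$ ($B(\omega;w)/|w|$ is the differential cross-section), with the usual symmetries $B(\omega;w)=B(-\omega;w)=B(\omega;-w)=B(\omega;w-2(\omega\cdot w)\omega)$. **Kac model.** Unknown $f^N(\mathcal V_N,t)$, a probability density on $\mathbb R^{3N}$: $$\partial_tf^N(\mathcal V_N,t)=\frac1N\sum_{i<j}\int d\omega\,B(\omega;v_i-v_j)\{f^N(\mathcal V_N^{i,j},t)-f^N(\mathcal V_N,t)\}.$$ Kinetic equation: $$\partial_tf(v,t)=\int_{\mathbb R^3}dv_1\int d\omega\,B(\omega;v-v_1)\{f(v',t)f(v_1',t)-f(v,t)f(v_1,t)\}.$$ Here $\omega$ is integrated over the hemisphere of unit vectors with $\omega\cdot(v_i-v_j)\ge0$ (respectively $\omega\cdot(v-v_1)\ge0$), of area $2\pi$. **Soft spheres model.** $h:\mathbb R^+\to\mathbb R^+$ is a positive bounded function with compact support. Unknown $f^N(X_N,\mathcal V_N,t)$, $X_N=\{x_1,\dots,x_N\}\in\mathbb R^{3N}$, a probability density on $\mathbb R^{6N}$: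 $$\partial_tf^N+\sum_{i=1}^Nv_i\cdot\nabla_{x_i}f^N=\frac1N\sum_{i<j}h(|x_i-x_j|)\,B\!\left(\tfrac{x_i-x_j}{|x_i-x_j|};v_i-v_j\right)\{f^N(X_N,\mathcal V_N^{i,j},t)-f^N(X_N,\mathcal V_N,t)\},$$ the collision $(i,j)$ using $\omega=\frac{x_i-x_j}{|x_i-x_j|}$. Kinetic equation: $$\partial_tf+v\cdot\nabla_xf=\int dv_1\int dx_1\,h(|x-x_1|)\,B\!\left(\tfrac{x-x_1}{|x-x_1|};v-v_1\right)\{f(x,v',t)f(x_1,v_1',t)-f(x,v,t)f(x_1,v_1,t)\},$$ with $\omega=\frac{x-x_1}{|x-x_1|}$ in the collision. For the Kac model the quantity $\|h\|_\infty$ in the bound is irrelevant (it may be taken to be $0$). **Conventions.** Solutions are mild solutions in $L^1$. Write $z_i=v_i$ (Kac) or $z_i=(x_i,v_i)$ (soft spheres). Symmetric means invariant under permutations of $z_1,\dots,z_N$. $f^N_j$ is the marginal of $f^N$ in $(z_1,\dots,z_j)$. For a set $A$ of indices, $f^N_A$ is $f^N_{|A|}$ evaluated at $\{z_i\}_{i\in A}$, and $f^{\otimes K}$ is $f^{\otimes|K|}$ evaluated at $\{z_i\}_{i\in K}$ (both equal to $1$ for the empty set). *)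

theory Defs
  imports "HOL-Analysis.Analysis"
begin

type_synonym vec3 = "real^3"

subsection \<open>Densities, marginals and the correlation error\<close>

text \<open>
  A state of \<open>n\<close> particles is an element of \<^term>\<open>space (phase n)\<close>, i.e. a function
  \<open>nat \<Rightarrow> 'z\<close> that is extensional on \<^term>\<open>{1..n}\<close>. The one-particle space \<open>'z\<close> is
  \<^typ>\<open>vec3\<close> for the Kac model and \<^typ>\<open>vec3 \<times> vec3\<close> (position, velocity) for soft spheres.
\<close>

abbreviation phase :: "nat \<Rightarrow> (nat \<Rightarrow> 'z::euclidean_space) measure" where
  "phase n \<equiv> PiM {1..n} (\<lambda>_. lborel)"

definition L1_norm :: "'b measure \<Rightarrow> ('b \<Rightarrow> real) \<Rightarrow> ennreal" where
  "L1_norm M F = (\<integral>\<^sup>+z. ennreal \<bar>F z\<bar> \<partial>M)"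

definition prob_density :: "'b measure \<Rightarrow> ('b \<Rightarrow> real) \<Rightarrow> bool" where
  "prob_density M F \<longleftrightarrow> integrable M F \<and> (AE z in M. 0 \<le> F z) \<and> (\<integral>z. F z \<partial>M) = 1"

definition symmetric :: "nat \<Rightarrow> ((nat \<Rightarrow> 'z::euclidean_space) \<Rightarrow> real) \<Rightarrow> bool" where
  "symmetric N F \<longleftrightarrow>
     (\<forall>\<pi>. \<pi> permutes {1..N} \<longrightarrow> (AE z in phase N. F (\<lambda>i. z (\<pi> i)) = F z))"

definition marginal ::
  "nat \<Rightarrow> ((nat \<Rightarrow> 'z::euclidean_space) \<Rightarrow> real) \<Rightarrow> nat \<Rightarrow> (nat \<Rightarrow> 'z) \<Rightarrow> real" where
  "marginal N F j z =
     (\<integral>y. F (merge {1..j} {j+1..N} (z, y)) \<partial>PiM {j+1..N} (\<lambda>_. lborel))"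

text \<open>The \<open>|A|\<close>-particle marginal evaluated at the \<open>z i\<close>, \<open>i \<in> A\<close>, taken in increasing order of \<open>i\<close>.\<close>

definition marginal_on ::
  "nat \<Rightarrow> ((nat \<Rightarrow> 'z::euclidean_space) \<Rightarrow> real) \<Rightarrow> nat set \<Rightarrow> (nat \<Rightarrow> 'z) \<Rightarrow> real" where
  "marginal_on N F A z =
     marginal N F (card A) (\<lambda>k\<in>{1..card A}. z (sorted_list_of_set A ! (k - 1)))"

definition tensor :: "('z \<Rightarrow> real) \<Rightarrow> nat set \<Rightarrow> (nat \<Rightarrow> 'z) \<Rightarrow> real" where
  "tensor g K z = (\<Prod>i\<in>K. g (z i))"

definition corr_error ::
  "nat \<Rightarrow> ((nat \<Rightarrow> 'z::euclidean_space) \<Rightarrow> real) \<Rightarrow> ('z \<Rightarrow> real) \<Rightarrow> nat \<Rightarrow> (nat \<Rightarrow> 'z) \<Rightarrow> real" where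
  "corr_error N F g j z =
     (\<Sum>K\<in>Pow {1..j}. (-1) ^ card K * marginal_on N F ({1..j} - K) z * tensor g K z)"

lemma marginal_on_empty:
  assumes "prob_density (phase N) F"
  shows "marginal_on N F {} z = 1"
proof -
  have "marginal_on N F {} z = (\<integral>y. F y \<partial>phase N)"
    unfolding marginal_on_def marginal_def
    by (intro Bochner_Integration.integral_cong)
       (auto simp: merge_def space_PiM PiE_def extensional_def intro!: arg_cong[of _ _ F])
  with assms show ?thesis by (simp add: prob_density_def)
qed

subsection \<open>Mild solutions in L1\<close>

text \<open>
  Mild solutions of \<open>\<partial>\<^sub>t u + T u = Q u\<close>, where \<open>T\<close> generates the group \<open>u \<mapsto> u \<circ> S (-t)\<close>: \<open>L\<^sup>1\<close>-continuous
  curves satisfying Duhamel's formula. Joint measurability in \<open>(t, z)\<close> selects a representative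
  (every continuous curve in \<open>L\<^sup>1\<close> has one) for which the time integral makes sense pointwise.
\<close>

definition mild_solution ::
  "'b measure \<Rightarrow> (real \<Rightarrow> 'b \<Rightarrow> 'b) \<Rightarrow> (('b \<Rightarrow> real) \<Rightarrow> 'b \<Rightarrow> real) \<Rightarrow> (real \<Rightarrow> 'b \<Rightarrow> real) \<Rightarrow> bool" where
  "mild_solution M S Q u \<longleftrightarrow>
     (\<lambda>(t, z). u t z) \<in> borel_measurable (restrict_space borel {0..} \<Otimes>\<^sub>M M) \<and>
     (\<forall>t\<ge>0. integrable M (u t)) \<and>
     (\<forall>t\<ge>0. ((\<lambda>s. L1_norm M (\<lambda>z. u s z - u t z)) \<longlongrightarrow> 0) (at t within {0..})) \<and>
     (\<forall>t\<ge>0. AE z in M. u t z =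
        u 0 (S (- t) z) + (LINT s:{0..t}|lborel. Q (u s) (S (- (t - s)) z)))"

subsection \<open>Collisions\<close>

definition post1 :: "vec3 \<Rightarrow> vec3 \<Rightarrow> vec3 \<Rightarrow> vec3" where
  "post1 \<omega> v w = v - (\<omega> \<bullet> (v - w)) *\<^sub>R \<omega>"

definition post2 :: "vec3 \<Rightarrow> vec3 \<Rightarrow> vec3 \<Rightarrow> vec3" where
  "post2 \<omega> v w = w + (\<omega> \<bullet> (v - w)) *\<^sub>R \<omega>"

text \<open>
  Only the values of \<open>B \<omega> w\<close> at unit vectors \<open>\<omega>\<close> matter. Measurability is imposed on the total
  function, which is no restriction, since \<open>B\<close> can be set to \<open>0\<close> off the unit sphere.
\<close>

definition collision_kernel :: "(vec3 \<Rightarrow> vec3 \<Rightarrow> real) \<Rightarrow> bool" where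
  "collision_kernel B \<longleftrightarrow>
     (\<lambda>(\<omega>, w). B \<omega> w) \<in> borel_measurable borel \<and>
     (\<forall>\<omega> w. norm \<omega> = 1 \<longrightarrow>
        0 \<le> B \<omega> w \<and> B \<omega> w = B (- \<omega>) w \<and> B \<omega> w = B \<omega> (- w) \<and>
        B \<omega> w = B \<omega> (w - (2 * (\<omega> \<bullet> w)) *\<^sub>R \<omega>))"

definition bounded_kernel :: "(vec3 \<Rightarrow> vec3 \<Rightarrow> real) \<Rightarrow> bool" where
  "bounded_kernel B \<longleftrightarrow> bounded ((\<lambda>(\<omega>, w). B \<omega> w) ` (sphere 0 1 \<times> UNIV))"

definition kernel_norm :: "(vec3 \<Rightarrow> vec3 \<Rightarrow> real) \<Rightarrow> real" where
  "kernel_norm B = (SUP (\<omega>, w)\<in>sphere 0 1 \<times> UNIV. \<bar>B \<omega> w\<bar>)"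

subsection \<open>Kac model\<close>

text \<open>
  Surface measure on the unit sphere of \<open>\<real>\<^sup>3\<close>, as a Borel measure on \<open>\<real>\<^sup>3\<close>: the area of a set \<open>A\<close> of
  unit vectors is three times the volume of the cone \<open>{r \<omega> | 0 < r \<le> 1, \<omega> \<in> A}\<close>.
\<close>

definition sphere_measure :: "vec3 measure" where
  "sphere_measure =
     distr (density lborel (\<lambda>x. 3 * indicator (cball 0 1) x)) borel (\<lambda>x. x /\<^sub>R norm x)"

lemma emeasure_sphere_measure_hemisphere:
  assumes "u \<noteq> 0"
  shows "emeasure sphere_measure {\<omega>. 0 \<le> \<omega> \<bullet> u} = ennreal (2 * pi)"
proof -
  let ?H = "{x :: vec3. 0 \<le> x \<bullet> u} \<inter> cball 0 1"
  let ?H' = "{x :: vec3. x \<bullet> u \<le> 0} \<inter> cball 0 1"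
  let ?P = "{x :: vec3. x \<bullet> u = 0}"
  have H [measurable]: "?H \<in> sets borel" and H' [measurable]: "?H' \<in> sets borel"
    by measurable
  have sign: "(0 \<le> (x /\<^sub>R norm x) \<bullet> u) = (0 \<le> x \<bullet> u)" for x :: vec3
    by (cases "x = 0") (simp_all add: zero_le_mult_iff)
  have "emeasure sphere_measure {\<omega>. 0 \<le> \<omega> \<bullet> u} =
      emeasure (density lborel (\<lambda>x. 3 * indicator (cball 0 1) x)) {x :: vec3. 0 \<le> x \<bullet> u}"
    unfolding sphere_measure_def by (subst emeasure_distr) (simp_all add: sign del: inner_scaleR_left)
  also have "\<dots> = (\<integral>\<^sup>+x. 3 * indicator ?H x \<partial>lborel)"
    by (subst emeasure_density)
       (auto intro!: nn_integral_cong simp: indicator_def)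
  also have "\<dots> = 3 * emeasure lborel ?H"
    by (simp add: nn_integral_cmult)
  finally have *: "emeasure sphere_measure {\<omega>. 0 \<le> \<omega> \<bullet> u} = 3 * emeasure lborel ?H" .
  have "emeasure lborel ?H' = emeasure (distr lborel borel (\<lambda>x :: vec3. - x)) ?H'"
    using lborel_affine[of "-1" "0 :: vec3"]
    by (simp add: density_1 one_ennreal_def[symmetric])
  also have "\<dots> = emeasure lborel ?H"
    by (subst emeasure_distr) (auto intro!: arg_cong[of _ _ "emeasure lborel"])
  finally have eq: "emeasure lborel ?H' = emeasure lborel ?H" .
  have "?P \<in> null_sets lebesgue"
    using negligible_hyperplane[of u 0] assms
    by (simp add: negligible_iff_null_sets inner_commute)
  then have P: "?P \<in> null_sets lborel"
    by (simp add: null_sets_completion_iff)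
  have "emeasure lborel ?H + emeasure lborel ?H' =
      emeasure lborel (?H \<union> ?H') + emeasure lborel (?H \<inter> ?H')"
    by (rule emeasure_Un_Int) (simp_all add: H H')
  also have "?H \<union> ?H' = cball 0 1" by auto
  also have "emeasure lborel (?H \<inter> ?H') = 0"
    by (rule null_setsD1, rule null_sets_subset[OF P]) auto
  also have "emeasure lborel (cball (0 :: vec3) 1) = ennreal (4 / 3 * pi)"
    by (simp add: emeasure_cball unit_ball_vol_3)
  finally have "2 * emeasure lborel ?H = ennreal (4 / 3 * pi)"
    by (simp add: eq mult_2)
  moreover obtain r where r: "0 \<le> r" "emeasure lborel ?H = ennreal r"
  proof (cases "emeasure lborel ?H")
    case top
    with \<open>2 * emeasure lborel ?H = _\<close> show ?thesis by (simp add: ennreal_mult_top)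
  qed (use that in auto)
  ultimately have "ennreal (2 * r) = ennreal (4 / 3 * pi)"
    by (simp add: ennreal_mult)
  then have "r = 2 / 3 * pi"
    using r by (subst (asm) ennreal_inj) auto
  then show ?thesis
    using * r by (simp add: ennreal_mult'[symmetric] flip: ennreal_numeral)
qed

definition kac_master ::
  "(vec3 \<Rightarrow> vec3 \<Rightarrow> real) \<Rightarrow> nat \<Rightarrow> ((nat \<Rightarrow> vec3) \<Rightarrow> real) \<Rightarrow> (nat \<Rightarrow> vec3) \<Rightarrow> real" where
  "kac_master B N F V =
     1 / real N * (\<Sum>i\<in>{1..N}. \<Sum>j\<in>{i<..N}.
       LINT \<omega>:{\<omega>. 0 \<le> \<omega> \<bullet> (V i - V j)}|sphere_measure.
         B \<omega> (V i - V j) *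
         (F (V(i := post1 \<omega> (V i) (V j), j := post2 \<omega> (V i) (V j))) - F V))"

definition kac_kinetic ::
  "(vec3 \<Rightarrow> vec3 \<Rightarrow> real) \<Rightarrow> (vec3 \<Rightarrow> real) \<Rightarrow> vec3 \<Rightarrow> real" where
  "kac_kinetic B g v =
     (\<integral>v1. (LINT \<omega>:{\<omega>. 0 \<le> \<omega> \<bullet> (v - v1)}|sphere_measure.
       B \<omega> (v - v1) * (g (post1 \<omega> v v1) * g (post2 \<omega> v v1) - g v * g v1)) \<partial>lborel)"

definition kac_N_solution ::
  "(vec3 \<Rightarrow> vec3 \<Rightarrow> real) \<Rightarrow> nat \<Rightarrow> (real \<Rightarrow> (nat \<Rightarrow> vec3) \<Rightarrow> real) \<Rightarrow> bool" where
  "kac_N_solution B N fN \<longleftrightarrow>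
     mild_solution (phase N) (\<lambda>_ V. V) (kac_master B N) fN \<and>
     (\<forall>t\<ge>0. prob_density (phase N) (fN t))"

definition boltzmann_solution ::
  "(vec3 \<Rightarrow> vec3 \<Rightarrow> real) \<Rightarrow> (real \<Rightarrow> vec3 \<Rightarrow> real) \<Rightarrow> bool" where
  "boltzmann_solution B f \<longleftrightarrow> mild_solution lborel (\<lambda>_ v. v) (kac_kinetic B) f"

subsection \<open>Soft spheres model\<close>

text \<open>
  \<open>h\<close> is a function on \<open>[0, \<infinity>)\<close>; its values at negative arguments are irrelevant. Positive means
  nonnegative, as forced by the compact support.
\<close>

definition modulation :: "(real \<Rightarrow> real) \<Rightarrow> bool" where
  "modulation h \<longleftrightarrow>
     h \<in> borel_measurable borel \<and> (\<forall>r\<ge>0. 0 \<le> h r) \<and> bounded (h ` {0..}) \<and>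
     compact (closure {r. 0 \<le> r \<and> h r \<noteq> 0})"

definition modulation_norm :: "(real \<Rightarrow> real) \<Rightarrow> real" where
  "modulation_norm h = (SUP r\<in>{0..}. \<bar>h r\<bar>)"

text \<open>For \<open>x = y\<close> this is the zero vector; such configurations form a null set.\<close>

definition direction :: "vec3 \<Rightarrow> vec3 \<Rightarrow> vec3" where
  "direction x y = (x - y) /\<^sub>R norm (x - y)"

definition free_flow1 :: "real \<Rightarrow> vec3 \<times> vec3 \<Rightarrow> vec3 \<times> vec3" where
  "free_flow1 t = (\<lambda>(x, v). (x + t *\<^sub>R v, v))"

definition free_flow :: "nat \<Rightarrow> real \<Rightarrow> (nat \<Rightarrow> vec3 \<times> vec3) \<Rightarrow> (nat \<Rightarrow> vec3 \<times> vec3)" where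
  "free_flow N t z = (\<lambda>i\<in>{1..N}. free_flow1 t (z i))"

definition collide ::
  "vec3 \<Rightarrow> nat \<Rightarrow> nat \<Rightarrow> (nat \<Rightarrow> vec3 \<times> vec3) \<Rightarrow> (nat \<Rightarrow> vec3 \<times> vec3)" where
  "collide \<omega> i j z =
     z(i := (fst (z i), post1 \<omega> (snd (z i)) (snd (z j))),
       j := (fst (z j), post2 \<omega> (snd (z i)) (snd (z j))))"

definition soft_master ::
  "(real \<Rightarrow> real) \<Rightarrow> (vec3 \<Rightarrow> vec3 \<Rightarrow> real) \<Rightarrow> nat \<Rightarrow>
     ((nat \<Rightarrow> vec3 \<times> vec3) \<Rightarrow> real) \<Rightarrow> (nat \<Rightarrow> vec3 \<times> vec3) \<Rightarrow> real" where
  "soft_master h B N F z =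
     1 / real N * (\<Sum>i\<in>{1..N}. \<Sum>j\<in>{i<..N}.
       (let \<omega> = direction (fst (z i)) (fst (z j)) in
         h (norm (fst (z i) - fst (z j))) * B \<omega> (snd (z i) - snd (z j)) *
         (F (collide \<omega> i j z) - F z)))"

definition soft_kinetic ::
  "(real \<Rightarrow> real) \<Rightarrow> (vec3 \<Rightarrow> vec3 \<Rightarrow> real) \<Rightarrow> (vec3 \<times> vec3 \<Rightarrow> real) \<Rightarrow> vec3 \<times> vec3 \<Rightarrow> real" where
  "soft_kinetic h B g = (\<lambda>(x, v).
     (\<integral>v1. (\<integral>x1.
       (let \<omega> = direction x x1 in
         h (norm (x - x1)) * B \<omega> (v - v1) *
         (g (x, post1 \<omega> v v1) * g (x1, post2 \<omega> v v1) - g (x, v) * g (x1, v1)))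
       \<partial>lborel) \<partial>lborel))"

definition soft_N_solution ::
  "(real \<Rightarrow> real) \<Rightarrow> (vec3 \<Rightarrow> vec3 \<Rightarrow> real) \<Rightarrow> nat \<Rightarrow>
     (real \<Rightarrow> (nat \<Rightarrow> vec3 \<times> vec3) \<Rightarrow> real) \<Rightarrow> bool" where
  "soft_N_solution h B N fN \<longleftrightarrow>
     mild_solution (phase N) (free_flow N) (soft_master h B N) fN \<and>
     (\<forall>t\<ge>0. prob_density (phase N) (fN t))"

definition povzner_solution ::
  "(real \<Rightarrow> real) \<Rightarrow> (vec3 \<Rightarrow> vec3 \<Rightarrow> real) \<Rightarrow> (real \<Rightarrow> vec3 \<times> vec3 \<Rightarrow> real) \<Rightarrow> bool" where
  "povzner_solution h B f \<longleftrightarrow> mild_solution lborel free_flow1 (soft_kinetic h B) f"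

subsection \<open>Constants\<close>

definition C1 :: real where
  "C1 = 4 * (16 * (2 * exp 1) powr (1 / (12 * exp 1) + 1) / \<bar>ln (1 - 1 / (24 * exp 1))\<bar>)"

definition C2 :: "real \<Rightarrow> real" where
  "C2 C0 = 16 * (2 * exp 1) powr (1 + 1 / (12 * exp 1)) * C0"

definition B1 :: real where
  "B1 = 2 * C1"

definition B2 :: "real \<Rightarrow> real \<Rightarrow> real" where
  "B2 B0 C0 = B0 + 1 / 2 + 16 * (C2 C0)\<^sup>2 / (C1 - 2)"

definition D1 :: real where
  "D1 = max B1 (2 * C1)"

definition D2 :: "real \<Rightarrow> real \<Rightarrow> real" where
  "D2 B0 C0 = max (B2 B0 C0) (8 * (exp 1 * C2 C0)\<^sup>2)"

end

theory Submission
  imports Defs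
begin

text \<open>
  No correlation errors are needed at positive times, because the allowed exponential growth rate is
  generous. Let \<open>\<mu>\<close> bound the total collision rate of a pair and let \<open>x\<^sub>j\<close> be the distance between the
  \<open>j\<close>-particle marginal and \<open>f\<^sup>\<otimes>\<^sup>j\<close>. Adding fictitious collisions, the hierarchy for the difference has a
  gain term of norm at most \<open>\<mu> j x\<^sub>j\<^sub>+\<^sub>1\<close>, an exact damping term \<open>- \<mu> j x\<^sub>j\<close>, and a remainder of norm
  \<open>3 \<mu> j\<^sup>2 / N\<close> coming from the collisions inside the cluster and from the factor \<open>(N - j) / N\<close>. A multiple of
  \<open>e\<^bsup>6 \<mu> t\<^esup> j\<^sup>2 / N\<close> is a supersolution, and since \<open>x\<^sub>j \<le> 2\<close> the comparison is a finite downward induction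
  on \<open>j\<close>, valid for all times. At time \<open>0\<close>, Moebius inversion bounds \<open>x\<^sub>j\<close> by the sum of
  \<open>(j choose k)\<close> times the norm of the \<open>k\<close>-particle correlation error, which is of order \<open>j\<^sup>2 / N\<close>
  because \<open>k\<^sup>k \<le> k! e\<^sup>k\<close>.
\<close>

text \<open>No differential inequality is available directly: the solutions are known through
  Duhamel's formula almost everywhere at each time, and once the transport is removed the collision
  rates of soft spheres are merely measurable in time. Hence short time intervals are used on which
  the state, but not the rate, is frozen; Lipschitz bounds on both curves make the error quadratic
  in the step length. Distances are suprema over bounded test functions, and the operators act on
  these. The adjoint of a collision enlarges the cluster by its partner, whereas a fictitious
  collision returns the same test function. Therefore only the increment from level j to level j + 1
  enters. For a profile in j^2 this increment is of order j, which is why there is no loss in j and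
  no restriction to short times. Symmetry of the particle density enters at time 0 only; afterwards
  all clusters of a given size are treated at once. Nonnegativity of the kinetic solution at
  positive times is not part of the definition of a solution, so the norm bound 1 on which the
  tensor estimates rely is derived from the damping as well.\<close>

section \<open>Weak form of Duhamel evolutions\<close>

text \<open>A discrete Gronwall argument: \<open>P s e\<close> stands for a bound at time
  \<open>s\<close> that is violated by at most \<open>e\<close>. Each Euler step of length h adds C
  h^2, so n steps of length T / n leave at most X / n. The restriction \<open>h0\<close> on the step
  length lets the applications keep factors such as 1 - \<mu> h nonnegative.\<close>

lemma one_step_comparison:
  fixes P :: "real \<Rightarrow> real \<Rightarrow> bool"
  assumes "0 \<le> T" "0 \<le> L" "0 \<le> C" "0 < h0" "P 0 0" "0 < \<epsilon>"
    and step: "\<And>s t e. 0 \<le> s \<Longrightarrow> s \<le> t \<Longrightarrow> t \<le> T \<Longrightarrow> t - s \<le> h0 \<Longrightarrow> 0 \<le> e \<Longrightarrow> P s e \<Longrightarrow>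
      P t ((1 + L * (t - s)) * e + C * (t - s)\<^sup>2)"
    and mono: "\<And>s e e'. 0 \<le> s \<Longrightarrow> P s e \<Longrightarrow> e \<le> e' \<Longrightarrow> P s e'"
  shows "P T \<epsilon>"
proof -
  define X where "X = C * T\<^sup>2 * exp (L * T)"
  \<comment> \<open>The three entries secure a nonzero \<open>n\<close>, a step of length at most
    \<open>h0\<close>, and a total error \<open>X / n\<close> below \<epsilon>.\<close>
  obtain n :: nat where n: "max 1 (max (T / h0) (X / \<epsilon>)) < real n"
    using reals_Archimedean2 by blast
  from n have n1: "1 < real n" and n2: "T / h0 < real n" and n3: "X / \<epsilon> < real n"
    unfolding max_less_iff_conj by blast+
  define h where "h = T / n"
  have h: "0 \<le> h" "h \<le> h0" "n * h = T"
  proof -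
    have "T < h0 * n" using n2 \<open>0 < h0\<close> by (simp add: pos_divide_less_eq mult.commute)
    then show "h \<le> h0" using n1 by (simp add: h_def pos_divide_le_eq)
  qed (use n1 \<open>0 \<le> T\<close> in \<open>simp_all add: h_def\<close>)
  \<comment> \<open>Every local error is amplified as if it had been committed at time 0, which
    replaces a geometric sum by a closed form.\<close>
  have *: "k \<le> n \<Longrightarrow> P (k * h) (k * C * h\<^sup>2 * (1 + L * h) ^ k)" for k
  proof (induction k)
    case 0
    then show ?case using \<open>P 0 0\<close> by simp
  next
    case (Suc k)
    have kT: "Suc k * h \<le> T"
      using Suc.prems h by (metis mult_right_mono of_nat_mono)
    have dh: "real (Suc k) * h - k * h = h"
      by (simp add: algebra_simps)
    let ?e = "k * C * h\<^sup>2 * (1 + L * h) ^ k"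
    have "P (Suc k * h) ((1 + L * (Suc k * h - k * h)) * ?e + C * (Suc k * h - k * h)\<^sup>2)"
      using Suc.IH Suc.prems h assms(1-4) kT dh by (intro step) simp_all
    then have *: "P (Suc k * h) ((1 + L * h) * ?e + C * h\<^sup>2)"
      unfolding dh .
    have "C * h\<^sup>2 * 1 \<le> C * h\<^sup>2 * (1 + L * h) ^ Suc k"
      using h assms(2,3) by (intro mult_left_mono one_le_power) simp_all
    then have "(1 + L * h) * ?e + C * h\<^sup>2 \<le> Suc k * C * h\<^sup>2 * (1 + L * h) ^ Suc k"
      by (simp add: algebra_simps)
    from mono[OF _ * this] show ?case
      using h(1) by simp
  qed
  have "(1 + L * h) ^ n \<le> exp (L * h) ^ n"
    using h assms(2) by (intro power_mono exp_ge_add_one_self) simp_all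
  also have "\<dots> = exp (L * T)"
    using h by (simp add: exp_of_nat_mult[symmetric] algebra_simps)
  finally have "n * C * h\<^sup>2 * (1 + L * h) ^ n \<le> n * C * h\<^sup>2 * exp (L * T)"
    using assms(3) by (intro mult_left_mono) simp_all
  also have "\<dots> = X / n"
    using n1 by (simp add: h_def X_def power2_eq_square)
  also have "\<dots> \<le> \<epsilon>"
    using n1 n3 \<open>0 < \<epsilon>\<close> by (simp add: field_simps)
  finally have "n * C * h\<^sup>2 * (1 + L * h) ^ n \<le> \<epsilon>" .
  moreover have "P T (n * C * h\<^sup>2 * (1 + L * h) ^ n)"
    using *[OF order_refl] unfolding h(3) .
  ultimately show ?thesis using mono[OF \<open>0 \<le> T\<close>] by blast
qed

section \<open>Bounded test functions and duality for the L1 norm\<close>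

lemma integrable_bounded_mult:
  fixes f g :: "'a \<Rightarrow> real"
  assumes "integrable M f" "g \<in> borel_measurable M" "\<And>x. x \<in> space M \<Longrightarrow> \<bar>g x\<bar> \<le> K"
  shows "integrable M (\<lambda>x. f x * g x)"
proof (rule Bochner_Integration.integrable_bound)
  show "integrable M (\<lambda>x. K * f x)" using assms by simp
  show "AE x in M. norm (f x * g x) \<le> norm (K * f x)"
    using assms by (intro AE_I2) (auto simp: abs_mult mult.commute[of "\<bar>f _\<bar>"] intro!: mult_right_mono order_trans[OF assms(3) abs_ge_self])
qed (use assms in measurable)

lemma abs_integral_mult_le:
  fixes f g :: "'a \<Rightarrow> real"
  assumes "integrable M f" "g \<in> borel_measurable M" "\<And>x. x \<in> space M \<Longrightarrow> \<bar>g x\<bar> \<le> K"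
  shows "\<bar>\<integral>x. f x * g x \<partial>M\<bar> \<le> K * (\<integral>x. \<bar>f x\<bar> \<partial>M)"
proof -
  have "\<bar>\<integral>x. f x * g x \<partial>M\<bar> \<le> (\<integral>x. \<bar>f x * g x\<bar> \<partial>M)"
    by (rule integral_abs_bound)
  also have "\<dots> \<le> (\<integral>x. K * \<bar>f x\<bar> \<partial>M)"
    using assms integrable_bounded_mult[OF assms]
    by (intro integral_mono integrable_abs) (auto simp: abs_mult mult.commute[of "\<bar>f _\<bar>"] intro!: mult_right_mono)
  finally show ?thesis using assms by simp
qed

lemma integral_abs_eq_mult_sgn: "(\<integral>x. \<bar>f x\<bar> \<partial>M) = (\<integral>x. f x * sgn (f x) \<partial>M)" for f :: "'a \<Rightarrow> real"
  by (simp add: abs_sgn)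

text \<open>The sign of \<open>f\<close> is an admissible test function.\<close>

lemma integral_abs_le_by_duality:
  fixes f :: "'a \<Rightarrow> real"
  assumes "f \<in> borel_measurable M"
    and "\<And>\<phi>. \<phi> \<in> borel_measurable M \<Longrightarrow> (\<And>x. \<bar>\<phi> x\<bar> \<le> 1) \<Longrightarrow> (\<integral>x. f x * \<phi> x \<partial>M) \<le> K"
  shows "(\<integral>x. \<bar>f x\<bar> \<partial>M) \<le> K"
  unfolding integral_abs_eq_mult_sgn using assms
  by (intro assms(2)) (auto simp: abs_sgn_eq)

lemma integral_abs_diff_le:
  fixes f g :: "'a \<Rightarrow> real"
  assumes "integrable M f" "integrable M g"
  shows "(\<integral>x. \<bar>f x\<bar> \<partial>M) \<le> (\<integral>x. \<bar>g x\<bar> \<partial>M) + (\<integral>x. \<bar>f x - g x\<bar> \<partial>M)"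
proof -
  have "(\<integral>x. \<bar>f x\<bar> \<partial>M) \<le> (\<integral>x. \<bar>g x\<bar> + \<bar>f x - g x\<bar> \<partial>M)"
    using assms by (intro integral_mono) auto
  then show ?thesis using assms by simp
qed

text \<open>Duhamel's formula without transport. The rate \<open>q\<close> is a separate argument
  because for soft spheres it agrees with the collision operator applied to \<open>u s\<close> only
  almost everywhere at each time. It is measurable on the whole time axis; to this end the curves
  are extended constantly to negative times.\<close>

definition evolves :: "'b measure \<Rightarrow> (real \<Rightarrow> 'b \<Rightarrow> real) \<Rightarrow> (real \<Rightarrow> 'b \<Rightarrow> real) \<Rightarrow> bool" where
  "evolves M q u \<longleftrightarrow>
     (\<forall>t\<ge>0. integrable M (u t)) \<and>
     (\<lambda>(s, z). q s z) \<in> borel_measurable (borel \<Otimes>\<^sub>M M) \<and>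
     (\<forall>t\<ge>0. AE z in M. u t z = u 0 z + (LINT s:{0..t}|lborel. q s z))"

text \<open>Fubini's theorem, with the tested rate dominated by \<open>K\<close> on
  \<open>{0..t}\<close>, turns a formula that holds almost everywhere for each \<open>t\<close> into
  an identity between numbers for each test function.\<close>

lemma evolves_weak_0:
  fixes q u :: "real \<Rightarrow> 'b \<Rightarrow> real"
  assumes M: "sigma_finite_measure M" and ev: "evolves M q u"
    and q: "\<And>s. 0 \<le> s \<Longrightarrow> s \<le> t \<Longrightarrow> integrable M (q s) \<and> (\<integral>z. \<bar>q s z\<bar> \<partial>M) \<le> K"
    and \<phi> [measurable]: "\<phi> \<in> borel_measurable M" and \<phi>1: "\<And>z. z \<in> space M \<Longrightarrow> \<bar>\<phi> z\<bar> \<le> 1"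
    and t: "0 \<le> t"
  shows "set_integrable lborel {0..t} (\<lambda>r. \<integral>z. q r z * \<phi> z \<partial>M)"
    and "(\<integral>z. u t z * \<phi> z \<partial>M) - (\<integral>z. u 0 z * \<phi> z \<partial>M)
           = (LINT r:{0..t}|lborel. (\<integral>z. q r z * \<phi> z \<partial>M))"
proof -
  interpret M: sigma_finite_measure M by fact
  interpret P: pair_sigma_finite lborel M by unfold_locales
  have qm [measurable]: "(\<lambda>(s, z). q s z) \<in> borel_measurable (borel \<Otimes>\<^sub>M M)"
    and u: "\<And>t. t \<ge> 0 \<Longrightarrow> integrable M (u t)"
    and duh: "AE z in M. u t z = u 0 z + (LINT s:{0..t}|lborel. q s z)"
    using ev t by (auto simp: evolves_def)
  have qm' [measurable]: "(\<lambda>x. q (fst x) (snd x)) \<in> borel_measurable (lborel \<Otimes>\<^sub>M M)"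
    using qm by (simp add: case_prod_beta' measurable_lborel1 cong: measurable_cong_sets)
  let ?g = "\<lambda>r z. indicator {0..t} r * q r z * \<phi> z"
  have int: "integrable (lborel \<Otimes>\<^sub>M M) (\<lambda>(r, z). ?g r z)"
  proof (rule P.Fubini_integrable)
    show "(\<lambda>(r, z). ?g r z) \<in> borel_measurable (lborel \<Otimes>\<^sub>M M)"
      by measurable
    show "AE r in lborel. integrable M (\<lambda>z. case (r, z) of (r, z) \<Rightarrow> ?g r z)"
      using q \<phi>1 by (intro AE_I2) (auto simp: indicator_def intro!: integrable_bounded_mult[where K=1])
    show "integrable lborel (\<lambda>r. \<integral>z. norm (case (r, z) of (r, z) \<Rightarrow> ?g r z) \<partial>M)"
    proof (rule Bochner_Integration.integrable_bound)
      show "integrable lborel (\<lambda>r. K * indicator {0..t} r)"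
        by (intro integrable_mult_right integrable_real_indicator) (auto simp: emeasure_lborel_Icc_eq)
      show "(\<lambda>r. \<integral>z. norm (case (r, z) of (r, z) \<Rightarrow> ?g r z) \<partial>M) \<in> borel_measurable lborel"
        by measurable
      show "AE r in lborel. norm (\<integral>z. norm (case (r, z) of (r, z) \<Rightarrow> ?g r z) \<partial>M) \<le> norm (K * indicator {0..t} r)"
      proof (intro AE_I2)
        fix r
        show "norm (\<integral>z. norm (case (r, z) of (r, z) \<Rightarrow> ?g r z) \<partial>M) \<le> norm (K * indicator {0..t} r)"
        proof (cases "r \<in> {0..t}")
          case True
          then have qr: "integrable M (q r)" "(\<integral>z. \<bar>q r z\<bar> \<partial>M) \<le> K" using q by auto
          have "(\<integral>z. \<bar>q r z * \<phi> z\<bar> \<partial>M) \<le> (\<integral>z. \<bar>q r z\<bar> \<partial>M)"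
            using qr \<phi>1
            by (intro integral_mono integrable_abs integrable_bounded_mult[where K=1])
               (auto simp: abs_mult mult_left_le)
          with qr True show ?thesis
            by (auto intro!: order_trans[OF _ abs_ge_self] simp: integral_nonneg)
        qed simp
      qed
    qed
  qed
  have gi: "integrable lborel (\<lambda>r. \<integral>z. ?g r z \<partial>M)"
    using P.integrable_fst'[OF int] by simp
  then show "set_integrable lborel {0..t} (\<lambda>r. \<integral>z. q r z * \<phi> z \<partial>M)"
    unfolding set_integrable_def by (simp add: mult.assoc)
  have int2: "integrable M (\<lambda>z. \<integral>r. ?g r z \<partial>lborel)"
    using P.integrable_snd[OF int] by simp
  have "(\<integral>z. u t z * \<phi> z \<partial>M) = (\<integral>z. u 0 z * \<phi> z + (\<integral>r. ?g r z \<partial>lborel) \<partial>M)"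
  proof (rule integral_cong_AE)
    show "(\<lambda>z. u t z * \<phi> z) \<in> borel_measurable M" using u[OF t] by measurable
    show "(\<lambda>z. u 0 z * \<phi> z + (\<integral>r. ?g r z \<partial>lborel)) \<in> borel_measurable M"
      using u[of 0] borel_measurable_integrable[OF int2] by measurable
    show "AE z in M. u t z * \<phi> z = u 0 z * \<phi> z + (\<integral>r. ?g r z \<partial>lborel)"
      using duh by eventually_elim (simp add: set_lebesgue_integral_def algebra_simps)
  qed
  also have "\<dots> = (\<integral>z. u 0 z * \<phi> z \<partial>M) + (\<integral>z. (\<integral>r. ?g r z \<partial>lborel) \<partial>M)"
    using int2 u[of 0] \<phi>1 by (intro Bochner_Integration.integral_add integrable_bounded_mult[where K=1]) auto
  also have "(\<integral>z. (\<integral>r. ?g r z \<partial>lborel) \<partial>M) = (\<integral>r. (\<integral>z. ?g r z \<partial>M) \<partial>lborel)"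
    using P.Fubini_integral[OF int] by simp
  finally show "(\<integral>z. u t z * \<phi> z \<partial>M) - (\<integral>z. u 0 z * \<phi> z \<partial>M)
           = (LINT r:{0..t}|lborel. (\<integral>z. q r z * \<phi> z \<partial>M))"
    by (simp add: set_lebesgue_integral_def mult.assoc)
qed

text \<open>The difference of the formulas for two end times. The interval is open on the left so
  that \<open>{0..t}\<close> is a disjoint union.\<close>

lemma evolves_weak:
  fixes q u :: "real \<Rightarrow> 'b \<Rightarrow> real"
  assumes M: "sigma_finite_measure M" and ev: "evolves M q u"
    and q: "\<And>s. 0 \<le> s \<Longrightarrow> s \<le> T \<Longrightarrow> integrable M (q s) \<and> (\<integral>z. \<bar>q s z\<bar> \<partial>M) \<le> K"
    and \<phi> [measurable]: "\<phi> \<in> borel_measurable M" and \<phi>1: "\<And>z. z \<in> space M \<Longrightarrow> \<bar>\<phi> z\<bar> \<le> 1"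
    and st: "0 \<le> s" "s \<le> t" "t \<le> T"
  shows "set_integrable lborel {s<..t} (\<lambda>r. \<integral>z. q r z * \<phi> z \<partial>M)"
    and "(\<integral>z. u t z * \<phi> z \<partial>M) - (\<integral>z. u s z * \<phi> z \<partial>M)
           = (LINT r:{s<..t}|lborel. (\<integral>z. q r z * \<phi> z \<partial>M))"
proof -
  let ?f = "\<lambda>r. \<integral>z. q r z * \<phi> z \<partial>M"
  have t: "set_integrable lborel {0..t} ?f"
    "(\<integral>z. u t z * \<phi> z \<partial>M) - (\<integral>z. u 0 z * \<phi> z \<partial>M) = (LINT r:{0..t}|lborel. ?f r)"
    using q st by (intro evolves_weak_0[OF M ev _ \<phi> \<phi>1, where K=K]; simp)+
  have s: "set_integrable lborel {0..s} ?f"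
    "(\<integral>z. u s z * \<phi> z \<partial>M) - (\<integral>z. u 0 z * \<phi> z \<partial>M) = (LINT r:{0..s}|lborel. ?f r)"
    using q st by (intro evolves_weak_0[OF M ev _ \<phi> \<phi>1, where K=K]; simp)+
  show st': "set_integrable lborel {s<..t} ?f"
    using st by (intro set_integrable_subset[OF t(1)]) auto
  have "{0..t} = {0..s} \<union> {s<..t}" using st by auto
  then have "(LINT r:{0..t}|lborel. ?f r) = (LINT r:{0..s}|lborel. ?f r) + (LINT r:{s<..t}|lborel. ?f r)"
    by (simp only:, intro set_integral_Un s st') auto
  then show "(\<integral>z. u t z * \<phi> z \<partial>M) - (\<integral>z. u s z * \<phi> z \<partial>M) = (LINT r:{s<..t}|lborel. ?f r)"
    using s(2) t(2) by simp
qed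

lemma set_integral_Ioc_le:
  fixes f :: "real \<Rightarrow> real"
  assumes "set_integrable lborel {s<..t} f" "s \<le> t" "\<And>r. s < r \<Longrightarrow> r \<le> t \<Longrightarrow> f r \<le> c"
  shows "(LINT r:{s<..t}|lborel. f r) \<le> c * (t - s)"
proof -
  have "(LINT r:{s<..t}|lborel. f r) \<le> (LINT r:{s<..t}|lborel. c)"
    using assms by (intro set_integral_mono) (auto simp: set_integrable_def)
  also have "\<dots> = c * (t - s)"
    using assms by (simp add: set_lebesgue_integral_def)
  finally show ?thesis .
qed

text \<open>By duality it suffices to integrate the bound \<open>K\<close> on the tested rate over
  time.\<close>

lemma evolves_lipschitz:
  fixes q u :: "real \<Rightarrow> 'b \<Rightarrow> real"
  assumes M: "sigma_finite_measure M" and ev: "evolves M q u"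
    and q: "\<And>s. 0 \<le> s \<Longrightarrow> s \<le> T \<Longrightarrow> integrable M (q s) \<and> (\<integral>z. \<bar>q s z\<bar> \<partial>M) \<le> K"
    and st: "0 \<le> s" "s \<le> t" "t \<le> T"
  shows "(\<integral>z. \<bar>u t z - u s z\<bar> \<partial>M) \<le> K * (t - s)"
proof (rule integral_abs_le_by_duality)
  have u: "integrable M (u t)" "integrable M (u s)"
    using ev st by (auto simp: evolves_def)
  then show "(\<lambda>z. u t z - u s z) \<in> borel_measurable M" by measurable
  fix \<phi> :: "'b \<Rightarrow> real" assume \<phi>: "\<phi> \<in> borel_measurable M" "\<And>x. \<bar>\<phi> x\<bar> \<le> 1"
  have "(\<integral>z. (u t z - u s z) * \<phi> z \<partial>M) = (\<integral>z. u t z * \<phi> z \<partial>M) - (\<integral>z. u s z * \<phi> z \<partial>M)"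
    using u \<phi> by (simp add: left_diff_distrib integrable_bounded_mult[where K=1])
  also have "\<dots> = (LINT r:{s<..t}|lborel. (\<integral>z. q r z * \<phi> z \<partial>M))"
    using evolves_weak[OF M ev _ \<phi>(1) _ st, of K] q \<phi> by simp
  also have "\<dots> \<le> K * (t - s)"
  proof (rule set_integral_Ioc_le)
    show "set_integrable lborel {s<..t} (\<lambda>r. \<integral>z. q r z * \<phi> z \<partial>M)"
      using evolves_weak[OF M ev _ \<phi>(1) _ st, of K] q \<phi> by simp
    fix r assume "s < r" "r \<le> t"
    then have "integrable M (q r)" "(\<integral>z. \<bar>q r z\<bar> \<partial>M) \<le> K"
      using q[of r] st by auto
    with abs_integral_mult_le[of M "q r" \<phi> 1] \<phi> show "(\<integral>z. q r z * \<phi> z \<partial>M) \<le> K"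
      by auto
  qed (use st in auto)
  finally show "(\<integral>z. (u t z - u s z) * \<phi> z \<partial>M) \<le> K * (t - s)" .
qed

section \<open>Collision models\<close>

lemma product_sigma_finite_lborel: "product_sigma_finite (\<lambda>_. lborel)"
  by unfold_locales

lemma sigma_finite_PiM_lborel: "finite I \<Longrightarrow> sigma_finite_measure (PiM I (\<lambda>_. lborel))"
  using product_sigma_finite.sigma_finite[OF product_sigma_finite_lborel] .

text \<open>Common form of both models. The parameter \<omega> is the scattering direction for the
  Kac model and ranges over a single point for soft spheres, where the positions determine the
  direction. One function describes a collision: \<open>c t \<omega> z w\<close> is the outgoing
  state of the particle in state \<open>z\<close>, and its partner leaves in state
  \<open>c t \<omega> w z\<close>. The time argument accommodates the free flow of soft spheres.
  Involution, invariance of the rate and invariance of Lebesgue measure form the micro-reversibility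
  that makes pair operators self-adjoint.\<close>

locale collision_model =
  fixes \<nu> :: "'w measure"
    and b :: "real \<Rightarrow> 'w \<Rightarrow> 'z::euclidean_space \<Rightarrow> 'z \<Rightarrow> real"
    and c :: "real \<Rightarrow> 'w \<Rightarrow> 'z \<Rightarrow> 'z \<Rightarrow> 'z"
    and \<mu> :: real
  assumes sigma_finite_nu: "sigma_finite_measure \<nu>"
    and b_measurable: "(\<lambda>(t, \<omega>, z, w). b t \<omega> z w) \<in> borel_measurable (borel \<Otimes>\<^sub>M \<nu> \<Otimes>\<^sub>M borel \<Otimes>\<^sub>M borel)"
    and c_measurable: "(\<lambda>(t, \<omega>, z, w). c t \<omega> z w) \<in> borel_measurable (borel \<Otimes>\<^sub>M \<nu> \<Otimes>\<^sub>M borel \<Otimes>\<^sub>M borel)"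
    and b_nonneg: "0 \<le> b t \<omega> z w"
    and b_sym: "b t \<omega> w z = b t \<omega> z w"
    and b_inv: "b t \<omega> (c t \<omega> z w) (c t \<omega> w z) = b t \<omega> z w"
    and c_invol: "c t \<omega> (c t \<omega> z w) (c t \<omega> w z) = z"
    and c_preserves: "\<omega> \<in> space \<nu> \<Longrightarrow> (\<lambda>(z, w). G z w) \<in> borel_measurable (borel \<Otimes>\<^sub>M borel) \<Longrightarrow>
      (\<integral>\<^sup>+z. (\<integral>\<^sup>+w. G (c t \<omega> z w) (c t \<omega> w z) \<partial>lborel) \<partial>lborel) = (\<integral>\<^sup>+z. (\<integral>\<^sup>+w. (G z w :: ennreal) \<partial>lborel) \<partial>lborel)"
    and rate_le: "(\<integral>\<^sup>+\<omega>. ennreal (b t \<omega> z w) \<partial>\<nu>) \<le> ennreal \<mu>"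
    and mu_nonneg: "0 \<le> \<mu>"
begin

sublocale nu: sigma_finite_measure \<nu>
  by (rule sigma_finite_nu)

sublocale lb: product_sigma_finite "\<lambda>_::nat. lborel :: 'z measure"
  by (rule product_sigma_finite_lborel)

abbreviation ph :: "nat set \<Rightarrow> (nat \<Rightarrow> 'z) measure" where
  "ph I \<equiv> PiM I (\<lambda>_. lborel)"

lemma b_meas [measurable (raw)]:
  assumes "t \<in> borel_measurable M" "\<omega> \<in> measurable M \<nu>" "z \<in> borel_measurable M" "w \<in> borel_measurable M"
  shows "(\<lambda>x. b (t x) (\<omega> x) (z x) (w x)) \<in> borel_measurable M"
proof -
  have "(\<lambda>x. (t x, \<omega> x, z x, w x)) \<in> measurable M (borel \<Otimes>\<^sub>M \<nu> \<Otimes>\<^sub>M borel \<Otimes>\<^sub>M borel)"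
    using assms by measurable
  from measurable_compose[OF this b_measurable] show ?thesis by simp
qed

lemma c_meas [measurable (raw)]:
  assumes "t \<in> borel_measurable M" "\<omega> \<in> measurable M \<nu>" "z \<in> borel_measurable M" "w \<in> borel_measurable M"
  shows "(\<lambda>x. c (t x) (\<omega> x) (z x) (w x)) \<in> borel_measurable M"
proof -
  have "(\<lambda>x. (t x, \<omega> x, z x, w x)) \<in> measurable M (borel \<Otimes>\<^sub>M \<nu> \<Otimes>\<^sub>M borel \<Otimes>\<^sub>M borel)"
    using assms by measurable
  from measurable_compose[OF this c_measurable] show ?thesis by simp
qed

definition col :: "real \<Rightarrow> 'w \<Rightarrow> nat \<Rightarrow> nat \<Rightarrow> (nat \<Rightarrow> 'z) \<Rightarrow> nat \<Rightarrow> 'z" where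
  "col t \<omega> i k z = z(i := c t \<omega> (z i) (z k), k := c t \<omega> (z k) (z i))"

definition pair_op :: "real \<Rightarrow> nat \<Rightarrow> nat \<Rightarrow> ((nat \<Rightarrow> 'z) \<Rightarrow> real) \<Rightarrow> (nat \<Rightarrow> 'z) \<Rightarrow> real" where
  "pair_op t i k F z = (\<integral>\<omega>. b t \<omega> (z i) (z k) * (F (col t \<omega> i k z) - F z) \<partial>\<nu>)"

lemma component_meas:
  assumes "z \<in> measurable M (ph I)" "i \<in> I"
  shows "(\<lambda>x. z x i) \<in> borel_measurable M"
  using measurable_compose[OF assms(1) measurable_component_singleton[OF assms(2)]] by simp

lemma col_meas:
  assumes "t \<in> borel_measurable M" "\<omega> \<in> measurable M \<nu>" "z \<in> measurable M (ph I)" "i \<in> I" "k \<in> I"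
  shows "(\<lambda>x. col (t x) (\<omega> x) i k (z x)) \<in> measurable M (ph I)"
  unfolding col_def
proof (intro measurable_fun_upd[where J=I])
  note [measurable] = component_meas[OF assms(3) assms(4)] component_meas[OF assms(3) assms(5)]
    assms(1,2)
  show "(\<lambda>x. c (t x) (\<omega> x) (z x i) (z x k)) \<in> measurable M lborel"
    "(\<lambda>x. c (t x) (\<omega> x) (z x k) (z x i)) \<in> measurable M lborel" by measurable
qed (use assms in auto)

lemma col_commute: "i \<noteq> k \<Longrightarrow> col t \<omega> i k = col t \<omega> k i"
  by (auto simp: col_def fun_eq_iff)

lemma col_col: "i \<noteq> k \<Longrightarrow> col t \<omega> i k (col t \<omega> i k z) = z"
  by (auto simp: col_def fun_eq_iff c_invol)

lemma col_space: "z \<in> space (ph I) \<Longrightarrow> i \<in> I \<Longrightarrow> k \<in> I \<Longrightarrow> col t \<omega> i k z \<in> space (ph I)"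
  by (auto simp: col_def space_PiM PiE_def extensional_def)

lemma col_app: "i \<noteq> k \<Longrightarrow> col t \<omega> i k z i = c t \<omega> (z i) (z k)" "col t \<omega> i k z k = c t \<omega> (z k) (z i)"
  by (auto simp: col_def)

lemma pair_op_commute: "i \<noteq> k \<Longrightarrow> pair_op t i k = pair_op t k i"
  by (simp add: pair_op_def fun_eq_iff col_commute b_sym)

lemma nn_integral_insert2:
  assumes "finite J" "i \<notin> J" "k \<notin> J" "i \<noteq> k" "f \<in> borel_measurable (ph (insert i (insert k J)))"
  shows "(\<integral>\<^sup>+z. f z \<partial>ph (insert i (insert k J))) =
     (\<integral>\<^sup>+y. (\<integral>\<^sup>+w. (\<integral>\<^sup>+v. f (y(k := w, i := v)) \<partial>lborel) \<partial>lborel) \<partial>ph J)"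
proof -
  have "(\<lambda>(x, v). x(i := v)) \<in> measurable (ph (insert k J) \<Otimes>\<^sub>M lborel) (ph (insert i (insert k J)))"
    unfolding case_prod_beta'
    by (intro measurable_fun_upd[where J="insert k J"]) auto
  from measurable_compose[OF this assms(5)]
  have [measurable]: "(\<lambda>(x, v). f (x(i := v))) \<in> borel_measurable (ph (insert k J) \<Otimes>\<^sub>M lborel)"
    by (simp add: case_prod_beta')
  show ?thesis
    using assms
    by (subst lb.product_nn_integral_insert; (subst lb.product_nn_integral_insert)?) simp_all
qed

text \<open>Only the coordinates \<open>i\<close> and \<open>k\<close> move; with the others fixed
  this is \<open>c_preserves\<close>.\<close>

lemma nn_integral_col:
  assumes "finite I" "i \<in> I" "k \<in> I" "i \<noteq> k" "\<omega> \<in> space \<nu>" "f \<in> borel_measurable (ph I)"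
  shows "(\<integral>\<^sup>+z. f (col t \<omega> i k z) \<partial>ph I) = (\<integral>\<^sup>+z. f z \<partial>ph I)"
proof -
  define J where "J = I - {i, k}"
  have I: "I = insert i (insert k J)" and J: "finite J" "i \<notin> J" "k \<notin> J"
    using assms by (auto simp: J_def)
  have m: "(\<lambda>z. f (col t \<omega> i k z)) \<in> borel_measurable (ph I)"
    using assms by (intro measurable_compose[OF col_meas assms(6)]) auto
  have "(\<integral>\<^sup>+w. (\<integral>\<^sup>+v. f (col t \<omega> i k (y(k := w, i := v))) \<partial>lborel) \<partial>lborel) =
    (\<integral>\<^sup>+w. (\<integral>\<^sup>+v. f (y(k := w, i := v)) \<partial>lborel) \<partial>lborel)" if "y \<in> space (ph J)" for y
  proof -
    have "(\<lambda>x. y(k := fst x, i := snd x)) \<in> measurable (borel \<Otimes>\<^sub>M borel) (ph I)"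
      unfolding I using that
      by (intro measurable_fun_upd[where J="insert k J"] measurable_fun_upd[where J=J] measurable_const) auto
    from measurable_compose[OF this assms(6)]
    have "(\<lambda>(w, v). f (y(k := w, i := v))) \<in> borel_measurable (borel \<Otimes>\<^sub>M borel)"
      by (simp add: case_prod_beta')
    from c_preserves[OF assms(5) this, of t] show ?thesis
      using assms(4) by (simp add: col_def fun_upd_twist)
  qed
  then show ?thesis
    unfolding I using assms J m
    by (simp add: nn_integral_insert2 I[symmetric] cong: nn_integral_cong)
qed

lemma distr_col:
  assumes "finite I" "i \<in> I" "k \<in> I" "i \<noteq> k" "\<omega> \<in> space \<nu>"
  shows "distr (ph I) (ph I) (col t \<omega> i k) = ph I"
proof (rule measure_eqI)
  fix A assume "A \<in> sets (distr (ph I) (ph I) (col t \<omega> i k))"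
  then have A: "A \<in> sets (ph I)" by simp
  have m: "col t \<omega> i k \<in> measurable (ph I) (ph I)"
    using assms by (intro col_meas[where z="\<lambda>z. z"]) auto
  have "emeasure (distr (ph I) (ph I) (col t \<omega> i k)) A = (\<integral>\<^sup>+z. indicator A z \<partial>distr (ph I) (ph I) (col t \<omega> i k))"
    using A by simp
  also have "\<dots> = (\<integral>\<^sup>+z. indicator A (col t \<omega> i k z) \<partial>ph I)"
    using A m by (subst nn_integral_distr) auto
  also have "\<dots> = emeasure (ph I) A"
    using A assms by (subst nn_integral_col) auto
  finally show "emeasure (distr (ph I) (ph I) (col t \<omega> i k)) A = emeasure (ph I) A" .
qed simp

lemma integral_col:
  fixes f :: "(nat \<Rightarrow> 'z) \<Rightarrow> real"
  assumes "finite I" "i \<in> I" "k \<in> I" "i \<noteq> k" "\<omega> \<in> space \<nu>" "f \<in> borel_measurable (ph I)"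
  shows "(\<integral>z. f (col t \<omega> i k z) \<partial>ph I) = (\<integral>z. f z \<partial>ph I)"
proof -
  have m: "col t \<omega> i k \<in> measurable (ph I) (ph I)"
    using assms by (intro col_meas[where z="\<lambda>z. z"]) auto
  have "(\<integral>z. f z \<partial>ph I) = (\<integral>z. f z \<partial>distr (ph I) (ph I) (col t \<omega> i k))"
    using assms by (simp add: distr_col)
  also have "\<dots> = (\<integral>z. f (col t \<omega> i k z) \<partial>ph I)"
    by (rule integral_distr[OF m assms(6)])
  finally show ?thesis ..
qed

lemma integrable_b: "integrable \<nu> (\<lambda>\<omega>. b t \<omega> z w)"
proof (rule integrableI_nonneg)
  show "(\<lambda>\<omega>. b t \<omega> z w) \<in> borel_measurable \<nu>" by measurable
  show "(\<integral>\<^sup>+ \<omega>. ennreal (b t \<omega> z w) \<partial>\<nu>) < \<infinity>"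
    using rate_le[of t z w] by (auto simp: less_top[symmetric] top_unique)
qed (simp add: b_nonneg)

lemma integral_b_le: "(\<integral>\<omega>. b t \<omega> z w \<partial>\<nu>) \<le> \<mu>"
  using rate_le[of t z w] b_nonneg mu_nonneg integrable_b[of t z w]
  by (simp add: nn_integral_eq_integral)

lemma pair_op_meas:
  assumes u: "(\<lambda>(t, z). u t z) \<in> borel_measurable (borel \<Otimes>\<^sub>M ph I)" and ik: "i \<in> I" "k \<in> I"
  shows "(\<lambda>(t, z). pair_op t i k (u t) z) \<in> borel_measurable (borel \<Otimes>\<^sub>M ph I)"
proof -
  have [measurable]: "(\<lambda>x. snd (fst x) i) \<in> borel_measurable ((borel \<Otimes>\<^sub>M ph I) \<Otimes>\<^sub>M \<nu>)"
    "(\<lambda>x. snd (fst x) k) \<in> borel_measurable ((borel \<Otimes>\<^sub>M ph I) \<Otimes>\<^sub>M \<nu>)"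
    using ik by (auto intro: component_meas)
  have "(\<lambda>x. (fst (fst x), col (fst (fst x)) (snd x) i k (snd (fst x))))
      \<in> measurable ((borel \<Otimes>\<^sub>M ph I) \<Otimes>\<^sub>M \<nu>) (borel \<Otimes>\<^sub>M ph I)"
    using ik by (intro measurable_Pair col_meas) auto
  from measurable_compose[OF this u]
  have [measurable]: "(\<lambda>x. u (fst (fst x)) (col (fst (fst x)) (snd x) i k (snd (fst x))))
      \<in> borel_measurable ((borel \<Otimes>\<^sub>M ph I) \<Otimes>\<^sub>M \<nu>)"
    by simp
  have [measurable]: "(\<lambda>x. u (fst (fst x)) (snd (fst x))) \<in> borel_measurable ((borel \<Otimes>\<^sub>M ph I) \<Otimes>\<^sub>M \<nu>)"
    using measurable_compose[OF measurable_fst u, of \<nu>] by (simp add: case_prod_beta')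
  show ?thesis
    unfolding pair_op_def case_prod_beta'
    by (rule nu.borel_measurable_lebesgue_integral) (simp add: case_prod_beta', measurable)
qed

lemma pair_op_meas':
  assumes "F \<in> borel_measurable (ph I)" and ik: "i \<in> I" "k \<in> I"
  shows "pair_op t i k F \<in> borel_measurable (ph I)"
proof -
  have "(\<lambda>(t, z). F z) \<in> borel_measurable (borel \<Otimes>\<^sub>M ph I)"
    using assms by measurable
  from pair_op_meas[OF this ik]
  have "(\<lambda>x. case (t, x) of (t, z) \<Rightarrow> pair_op t i k F z) \<in> borel_measurable (ph I)"
    by (intro measurable_compose[OF measurable_Pair1']) auto
  then show ?thesis by simp
qed

text \<open>Uniformization: fictitious collisions raise the total rate to exactly \<open>\<mu>\<close>, so that the gain part
  \<open>pair_op + \<mu>\<close> has norm at most \<open>\<mu>\<close>.\<close>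

lemma pair_op_bound:
  assumes \<psi>: "\<psi> \<in> borel_measurable (ph I)" "\<And>z. z \<in> space (ph I) \<Longrightarrow> \<bar>\<psi> z\<bar> \<le> K"
    and z: "z \<in> space (ph I)" and ik: "i \<in> I" "k \<in> I"
  shows "\<bar>pair_op t i k \<psi> z + \<mu> * \<psi> z\<bar> \<le> \<mu> * K"
proof -
  let ?b = "\<lambda>\<omega>. b t \<omega> (z i) (z k)"
  have m [measurable]: "(\<lambda>\<omega>. \<psi> (col t \<omega> i k z)) \<in> borel_measurable \<nu>"
    using ik z by (intro measurable_compose[OF col_meas \<psi>(1)] measurable_const) auto
  have c: "\<bar>\<psi> (col t \<omega> i k z)\<bar> \<le> K" for \<omega>
    using col_space[OF z ik] \<psi>(2) by auto
  have int: "integrable \<nu> (\<lambda>\<omega>. ?b \<omega> * \<psi> (col t \<omega> i k z))"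
    using c by (intro integrable_bounded_mult[where K=K] integrable_b m) auto
  have "pair_op t i k \<psi> z = (\<integral>\<omega>. ?b \<omega> * \<psi> (col t \<omega> i k z) \<partial>\<nu>) - (\<integral>\<omega>. ?b \<omega> \<partial>\<nu>) * \<psi> z"
    unfolding pair_op_def using int integrable_b by (simp add: right_diff_distrib)
  moreover have "\<bar>\<integral>\<omega>. ?b \<omega> * \<psi> (col t \<omega> i k z) \<partial>\<nu>\<bar> \<le> K * (\<integral>\<omega>. ?b \<omega> \<partial>\<nu>)"
    using abs_integral_mult_le[OF integrable_b[of t "z i" "z k"] m, of K] c b_nonneg by simp
  \<comment> \<open>The fictitious rate is nonnegative because the true rate is at most \<mu>; its
    share and that of the gain add up to exactly \<mu> K.\<close>
  moreover have "\<bar>(\<mu> - (\<integral>\<omega>. ?b \<omega> \<partial>\<nu>)) * \<psi> z\<bar> \<le> (\<mu> - (\<integral>\<omega>. ?b \<omega> \<partial>\<nu>)) * K"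
    using \<psi>(2)[OF z] integral_b_le[of t "z i" "z k"] by (auto simp: abs_mult intro!: mult_left_mono)
  moreover have "(\<mu> - (\<integral>\<omega>. ?b \<omega> \<partial>\<nu>)) * \<psi> z = \<mu> * \<psi> z - (\<integral>\<omega>. ?b \<omega> \<partial>\<nu>) * \<psi> z"
    "(\<mu> - (\<integral>\<omega>. ?b \<omega> \<partial>\<nu>)) * K = \<mu> * K - K * (\<integral>\<omega>. ?b \<omega> \<partial>\<nu>)"
    by (simp_all add: algebra_simps)
  ultimately show ?thesis
    by linarith
qed

lemma pair_op_abs_le:
  assumes \<psi>: "\<psi> \<in> borel_measurable (ph I)" "\<And>z. z \<in> space (ph I) \<Longrightarrow> \<bar>\<psi> z\<bar> \<le> K"
    and z: "z \<in> space (ph I)" and ik: "i \<in> I" "k \<in> I"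
  shows "\<bar>pair_op t i k \<psi> z\<bar> \<le> 2 * \<mu> * K"
proof -
  have "\<bar>\<mu> * \<psi> z\<bar> \<le> \<mu> * K"
    using \<psi>(2)[OF z] mu_nonneg by (auto simp: abs_mult intro!: mult_left_mono)
  with pair_op_bound[OF assms, of t] show ?thesis by linarith
qed

text \<open>At fixed \<omega> the substitution by \<open>col\<close> preserves the measure and the
  rate and is its own inverse, so it moves the collision from \<open>F\<close> to the test function.
  The loss term is symmetric as it stands.\<close>

lemma pair_op_self_adjoint:
  assumes I: "finite I" "i \<in> I" "k \<in> I" "i \<noteq> k" and F: "integrable (ph I) F"
    and \<psi> [measurable]: "\<psi> \<in> borel_measurable (ph I)" and \<psi>1: "\<And>z. z \<in> space (ph I) \<Longrightarrow> \<bar>\<psi> z\<bar> \<le> 1"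
  shows "integrable (ph I) (pair_op t i k F)"
    and "(\<integral>z. pair_op t i k F z * \<psi> z \<partial>ph I) = (\<integral>z. F z * pair_op t i k \<psi> z \<partial>ph I)"
proof -
  interpret ph: sigma_finite_measure "ph I" by (rule sigma_finite_PiM_lborel[OF I(1)])
  interpret P: pair_sigma_finite "ph I" \<nu> by unfold_locales
  have Fm [measurable]: "F \<in> borel_measurable (ph I)" using F by auto
  let ?P = "ph I \<Otimes>\<^sub>M \<nu>"
  let ?b = "\<lambda>x. b t (snd x) (fst x i) (fst x k)"
  let ?c = "\<lambda>x. col t (snd x) i k (fst x)"
  have bm [measurable]: "?b \<in> borel_measurable ?P"
    using I by (intro b_meas measurable_const component_meas[where I=I]) auto
  have cm: "?c \<in> measurable ?P (ph I)"
    using I by (intro col_meas) auto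
  note [measurable] = measurable_compose[OF cm Fm] measurable_compose[OF cm \<psi>]
  have cs: "x \<in> space ?P \<Longrightarrow> ?c x \<in> space (ph I)" for x
    using I by (intro col_space) (auto simp: space_pair_measure)
  have b_col: "b t \<omega> (col t \<omega> i k z i) (col t \<omega> i k z k) = b t \<omega> (z i) (z k)" for z \<omega>
    using I by (simp add: col_app b_inv)
  \<comment> \<open>Integrating over \<omega> first produces the total rate, which is at most
    \<mu>.\<close>
  have intF: "integrable ?P (\<lambda>x. ?b x * F (fst x))"
  proof (rule integrableI_bounded)
    have "(\<integral>\<^sup>+x. ennreal (norm (?b x * F (fst x))) \<partial>?P) = (\<integral>\<^sup>+z. \<integral>\<^sup>+\<omega>. ennreal \<bar>F z\<bar> * ennreal (b t \<omega> (z i) (z k)) \<partial>\<nu> \<partial>ph I)"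
      by (subst nu.nn_integral_fst[symmetric])
         (auto simp: abs_mult b_nonneg ennreal_mult mult.commute)
    also have "\<dots> = (\<integral>\<^sup>+z. ennreal \<bar>F z\<bar> * (\<integral>\<^sup>+\<omega>. ennreal (b t \<omega> (z i) (z k)) \<partial>\<nu>) \<partial>ph I)"
      by (intro nn_integral_cong nn_integral_cmult) measurable
    also have "\<dots> \<le> (\<integral>\<^sup>+z. ennreal \<bar>F z\<bar> * ennreal \<mu> \<partial>ph I)"
      by (intro nn_integral_mono mult_left_mono rate_le) auto
    also have "\<dots> < \<infinity>"
      using F by (simp add: nn_integral_multc ennreal_mult_less_top integrable_iff_bounded)
    finally show "(\<integral>\<^sup>+x. ennreal (norm (?b x * F (fst x))) \<partial>?P) < \<infinity>" .
  qed measurable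
  \<comment> \<open>Integrating over \<open>z\<close> first, at fixed \<omega>, allows the change of
    variables that reduces the gain to the previous case.\<close>
  have intFc: "integrable ?P (\<lambda>x. ?b x * F (?c x))"
  proof (rule integrableI_bounded)
    have "(\<integral>\<^sup>+x. ennreal (norm (?b x * F (?c x))) \<partial>?P) =
      (\<integral>\<^sup>+\<omega>. \<integral>\<^sup>+z. ennreal (norm (b t \<omega> (z i) (z k) * F (col t \<omega> i k z))) \<partial>ph I \<partial>\<nu>)"
      by (subst P.nn_integral_snd[symmetric]) (auto simp: case_prod_beta')
    also have "\<dots> = (\<integral>\<^sup>+\<omega>. \<integral>\<^sup>+z. ennreal (norm (b t \<omega> (z i) (z k) * F z)) \<partial>ph I \<partial>\<nu>)"
    proof (rule nn_integral_cong)
      fix \<omega> assume \<omega>: "\<omega> \<in> space \<nu>"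
      have "(\<lambda>z. b t \<omega> (z i) (z k)) \<in> borel_measurable (ph I)"
        using I \<omega> by (intro b_meas measurable_const component_meas[where I=I]) auto
      then have "(\<lambda>z. ennreal (norm (b t \<omega> (z i) (z k) * F z))) \<in> borel_measurable (ph I)"
        by measurable
      from nn_integral_col[OF I \<omega> this, of t]
      show "(\<integral>\<^sup>+z. ennreal (norm (b t \<omega> (z i) (z k) * F (col t \<omega> i k z))) \<partial>ph I) =
        (\<integral>\<^sup>+z. ennreal (norm (b t \<omega> (z i) (z k) * F z)) \<partial>ph I)"
        by (simp add: b_col)
    qed
    also have "\<dots> = (\<integral>\<^sup>+x. ennreal (norm (?b x * F (fst x))) \<partial>?P)"
      by (subst P.nn_integral_snd[symmetric]) (auto simp: case_prod_beta')
    also have "\<dots> < \<infinity>"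
      using intF by (simp add: integrable_iff_bounded)
    finally show "(\<integral>\<^sup>+x. ennreal (norm (?b x * F (?c x))) \<partial>?P) < \<infinity>" .
  qed measurable
  have int0: "integrable ?P (\<lambda>(z, \<omega>). b t \<omega> (z i) (z k) * (F (col t \<omega> i k z) - F z))"
    using Bochner_Integration.integrable_diff[OF intFc intF] by (simp add: case_prod_beta' right_diff_distrib)
  show "integrable (ph I) (pair_op t i k F)"
    using P.integrable_fst'[OF int0] by (simp add: pair_op_def[abs_def])
  have i1: "integrable ?P (\<lambda>x. ?b x * F (?c x) * \<psi> (fst x))"
    and i2: "integrable ?P (\<lambda>x. ?b x * F (fst x) * \<psi> (fst x))"
    and i3: "integrable ?P (\<lambda>x. ?b x * F (fst x) * \<psi> (?c x))"
    using \<psi>1 cs by (intro integrable_bounded_mult[where K=1] intF intFc; auto simp: space_pair_measure)+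
  have "(\<integral>z. pair_op t i k F z * \<psi> z \<partial>ph I) = (\<integral>z. \<integral>\<omega>. b t \<omega> (z i) (z k) * F (col t \<omega> i k z) * \<psi> z
      - b t \<omega> (z i) (z k) * F z * \<psi> z \<partial>\<nu> \<partial>ph I)"
    unfolding pair_op_def
    by (intro Bochner_Integration.integral_cong refl, subst integral_mult_left_zero[symmetric])
       (simp add: algebra_simps)
  also have "\<dots> = (\<integral>x. ?b x * F (?c x) * \<psi> (fst x) - ?b x * F (fst x) * \<psi> (fst x) \<partial>?P)"
    using P.integral_fst'[OF Bochner_Integration.integrable_diff[OF i1 i2]] by simp
  also have "\<dots> = (\<integral>x. ?b x * F (?c x) * \<psi> (fst x) \<partial>?P) - (\<integral>x. ?b x * F (fst x) * \<psi> (fst x) \<partial>?P)"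
    using i1 i2 by simp
  also have "(\<integral>x. ?b x * F (?c x) * \<psi> (fst x) \<partial>?P) =
     (\<integral>\<omega>. \<integral>z. b t \<omega> (z i) (z k) * F (col t \<omega> i k z) * \<psi> z \<partial>ph I \<partial>\<nu>)"
    using P.integral_snd[of "\<lambda>z \<omega>. b t \<omega> (z i) (z k) * F (col t \<omega> i k z) * \<psi> z"] i1 by (simp add: case_prod_beta')
  also have "\<dots> = (\<integral>\<omega>. \<integral>z. b t \<omega> (z i) (z k) * F z * \<psi> (col t \<omega> i k z) \<partial>ph I \<partial>\<nu>)"
  proof (rule Bochner_Integration.integral_cong[OF refl])
    fix \<omega> assume \<omega>: "\<omega> \<in> space \<nu>"
    have [measurable]: "(\<lambda>z. b t \<omega> (z i) (z k)) \<in> borel_measurable (ph I)"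
      using I \<omega> by (intro b_meas measurable_const component_meas[where I=I]) auto
    have [measurable]: "(\<lambda>z. \<psi> (col t \<omega> i k z)) \<in> borel_measurable (ph I)"
      using I \<omega> by (intro measurable_compose[OF col_meas \<psi>] measurable_const) auto
    have "(\<lambda>z. b t \<omega> (z i) (z k) * F z * \<psi> (col t \<omega> i k z)) \<in> borel_measurable (ph I)"
      by measurable
    from integral_col[OF I \<omega> this, of t] I(4)
    show "(\<integral>z. b t \<omega> (z i) (z k) * F (col t \<omega> i k z) * \<psi> z \<partial>ph I) =
        (\<integral>z. b t \<omega> (z i) (z k) * F z * \<psi> (col t \<omega> i k z) \<partial>ph I)"
      by (simp add: b_col col_col)
  qed
  also have "\<dots> = (\<integral>x. ?b x * F (fst x) * \<psi> (?c x) \<partial>?P)"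
    using P.integral_snd[of "\<lambda>z \<omega>. b t \<omega> (z i) (z k) * F z * \<psi> (col t \<omega> i k z)"] i3 by (simp add: case_prod_beta')
  also have "\<dots> - (\<integral>x. ?b x * F (fst x) * \<psi> (fst x) \<partial>?P) =
      (\<integral>x. ?b x * F (fst x) * \<psi> (?c x) - ?b x * F (fst x) * \<psi> (fst x) \<partial>?P)"
    using i2 i3 by simp
  also have "\<dots> = (\<integral>z. \<integral>\<omega>. b t \<omega> (z i) (z k) * F z * \<psi> (col t \<omega> i k z)
      - b t \<omega> (z i) (z k) * F z * \<psi> z \<partial>\<nu> \<partial>ph I)"
    using P.integral_fst'[OF Bochner_Integration.integrable_diff[OF i3 i2]] by simp
  also have "\<dots> = (\<integral>z. F z * pair_op t i k \<psi> z \<partial>ph I)"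
    unfolding pair_op_def
    by (intro Bochner_Integration.integral_cong refl, subst integral_mult_right_zero[symmetric])
       (simp add: algebra_simps)
  finally show "(\<integral>z. pair_op t i k F z * \<psi> z \<partial>ph I) = (\<integral>z. F z * pair_op t i k \<psi> z \<partial>ph I)" .
qed

text \<open>Dual to the pointwise bound on bounded functions; the factor 2 counts gain and
  loss.\<close>

lemma pair_op_L1:
  assumes I: "finite I" "i \<in> I" "k \<in> I" "i \<noteq> k" and F: "integrable (ph I) F"
  shows "(\<integral>z. \<bar>pair_op t i k F z\<bar> \<partial>ph I) \<le> 2 * \<mu> * (\<integral>z. \<bar>F z\<bar> \<partial>ph I)"
proof (rule integral_abs_le_by_duality)
  show "pair_op t i k F \<in> borel_measurable (ph I)"
    using pair_op_self_adjoint(1)[OF I F, of "\<lambda>_. 0" t] by auto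
  fix \<phi> :: "_ \<Rightarrow> real" assume \<phi>: "\<phi> \<in> borel_measurable (ph I)" "\<And>x. \<bar>\<phi> x\<bar> \<le> 1"
  have "(\<integral>z. pair_op t i k F z * \<phi> z \<partial>ph I) = (\<integral>z. F z * pair_op t i k \<phi> z \<partial>ph I)"
    using pair_op_self_adjoint(2)[OF I F \<phi>(1)] \<phi>(2) by auto
  also have "\<dots> \<le> 2 * \<mu> * (\<integral>z. \<bar>F z\<bar> \<partial>ph I)"
    using \<phi> I by (intro order_trans[OF abs_ge_self abs_integral_mult_le[OF F]] pair_op_meas')
      (auto intro: order_trans[OF pair_op_abs_le[where K=1]])
  finally show "(\<integral>z. pair_op t i k F z * \<phi> z \<partial>ph I) \<le> 2 * \<mu> * (\<integral>z. \<bar>F z\<bar> \<partial>ph I)" .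
qed

end

section \<open>Tensor products and the kinetic equation\<close>

context product_sigma_finite
begin

text \<open>The iterated integral formula in the form of an identity of measures, from which
  integrability and iterated Bochner integrals in both orders follow.\<close>

lemma distr_insert:
  assumes "finite K" "k \<notin> K"
  shows "distr (PiM K M \<Otimes>\<^sub>M M k) (PiM (insert k K) M) (\<lambda>x. (fst x)(k := snd x)) = PiM (insert k K) M"
    (is "distr _ _ ?f = _")
proof (rule measure_eqI)
  interpret K: finite_product_sigma_finite M K by standard fact
  interpret pair_sigma_finite "PiM K M" "M k" by unfold_locales
  have f [measurable]: "?f \<in> measurable (PiM K M \<Otimes>\<^sub>M M k) (PiM (insert k K) M)"
    by (intro measurable_fun_upd[where J=K]) auto
  fix A assume "A \<in> sets (distr (PiM K M \<Otimes>\<^sub>M M k) (PiM (insert k K) M) ?f)"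
  then have A [measurable]: "A \<in> sets (PiM (insert k K) M)" by simp
  have "emeasure (distr (PiM K M \<Otimes>\<^sub>M M k) (PiM (insert k K) M) ?f) A
      = (\<integral>\<^sup>+z. indicator A z \<partial>distr (PiM K M \<Otimes>\<^sub>M M k) (PiM (insert k K) M) ?f)"
    by simp
  also have "\<dots> = (\<integral>\<^sup>+z. indicator A (?f z) \<partial>(PiM K M \<Otimes>\<^sub>M M k))"
    by (subst nn_integral_distr) auto
  also have "\<dots> = (\<integral>\<^sup>+x. \<integral>\<^sup>+w. indicator A (x(k := w)) \<partial>M k \<partial>PiM K M)"
    using measurable_compose[OF f borel_measurable_indicator[OF A]]
    by (subst M.nn_integral_fst[symmetric]) auto
  also have "\<dots> = (\<integral>\<^sup>+z. indicator A z \<partial>PiM (insert k K) M)"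
    using assms by (subst product_nn_integral_insert) auto
  also have "\<dots> = emeasure (PiM (insert k K) M) A" by simp
  finally show "emeasure (distr (PiM K M \<Otimes>\<^sub>M M k) (PiM (insert k K) M) ?f) A = emeasure (PiM (insert k K) M) A" .
qed simp

context
  fixes K :: "'i set" and k :: 'i and h :: "('i \<Rightarrow> 'a) \<Rightarrow> real"
  assumes K: "finite K" "k \<notin> K" and h: "integrable (PiM (insert k K) M) h"
begin

lemma integrable_pair_insert: "integrable (PiM K M \<Otimes>\<^sub>M M k) (\<lambda>x. h ((fst x)(k := snd x)))"
proof -
  have "(\<lambda>x. (fst x)(k := snd x)) \<in> measurable (PiM K M \<Otimes>\<^sub>M M k) (PiM (insert k K) M)"
    by (intro measurable_fun_upd[where J=K]) auto
  moreover have "integrable (distr (PiM K M \<Otimes>\<^sub>M M k) (PiM (insert k K) M) (\<lambda>x. (fst x)(k := snd x))) h"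
    using h K by (simp add: distr_insert)
  ultimately show ?thesis by (rule integrable_distr)
qed

lemma integrable_insert_inner: "integrable (PiM K M) (\<lambda>x. \<integral>w. h (x(k := w)) \<partial>M k)"
proof -
  interpret K: finite_product_sigma_finite M K by standard (rule K)
  interpret pair_sigma_finite "PiM K M" "M k" by unfold_locales
  show ?thesis using integrable_fst'[OF integrable_pair_insert] by simp
qed

lemma integral_insert_rev:
  "(\<integral>z. h z \<partial>PiM (insert k K) M) = (\<integral>w. (\<integral>x. h (x(k := w)) \<partial>PiM K M) \<partial>M k)"
proof -
  interpret K: finite_product_sigma_finite M K by standard (rule K)
  interpret pair_sigma_finite "PiM K M" "M k" by unfold_locales
  have int: "integrable (PiM K M \<Otimes>\<^sub>M M k) (\<lambda>(x, w). h (x(k := w)))"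
    using integrable_pair_insert by (simp add: case_prod_beta')
  show ?thesis
    using Fubini_integral[OF int] by (subst product_integral_insert[OF K h]) simp
qed

lemma integrable_insert_inner_rev: "integrable (M k) (\<lambda>w. \<integral>x. h (x(k := w)) \<partial>PiM K M)"
proof -
  interpret K: finite_product_sigma_finite M K by standard (rule K)
  interpret pair_sigma_finite "PiM K M" "M k" by unfold_locales
  have int: "integrable (PiM K M \<Otimes>\<^sub>M M k) (\<lambda>(x, w). h (x(k := w)))"
    using integrable_pair_insert by (simp add: case_prod_beta')
  show ?thesis using integrable_snd[OF int] .
qed

end

end

lemma integrable_tensor:
  fixes g :: "'z::euclidean_space \<Rightarrow> real"
  assumes "finite I" "integrable lborel g"
  shows "integrable (PiM I (\<lambda>_. lborel)) (tensor g I)"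
    and "(\<integral>z. tensor g I z \<partial>PiM I (\<lambda>_. lborel)) = (\<integral>v. g v \<partial>lborel) ^ card I"
    and "(\<integral>z. \<bar>tensor g I z\<bar> \<partial>PiM I (\<lambda>_. lborel)) = (\<integral>v. \<bar>g v\<bar> \<partial>lborel) ^ card I"
proof -
  interpret product_sigma_finite "\<lambda>_::nat. lborel :: 'z measure" by (rule product_sigma_finite_lborel)
  show "integrable (PiM I (\<lambda>_. lborel)) (tensor g I)"
    unfolding tensor_def[abs_def] using assms by (intro product_integrable_prod) auto
  show "(\<integral>z. tensor g I z \<partial>PiM I (\<lambda>_. lborel)) = (\<integral>v. g v \<partial>lborel) ^ card I"
    unfolding tensor_def using assms by (subst product_integral_prod) auto
  show "(\<integral>z. \<bar>tensor g I z\<bar> \<partial>PiM I (\<lambda>_. lborel)) = (\<integral>v. \<bar>g v\<bar> \<partial>lborel) ^ card I"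
    unfolding tensor_def abs_prod using assms by (subst product_integral_prod) auto
qed

lemma integrable_one_factor:
  fixes g d :: "'z::euclidean_space \<Rightarrow> real"
  assumes "finite I" "i \<in> I" "integrable lborel g" "integrable lborel d"
  shows "integrable (PiM I (\<lambda>_. lborel)) (\<lambda>z. d (z i) * tensor g (I - {i}) z)"
    and "(\<integral>z. \<bar>d (z i) * tensor g (I - {i}) z\<bar> \<partial>PiM I (\<lambda>_. lborel)) =
      (\<integral>v. \<bar>d v\<bar> \<partial>lborel) * (\<integral>v. \<bar>g v\<bar> \<partial>lborel) ^ (card I - 1)"
proof -
  interpret product_sigma_finite "\<lambda>_::nat. lborel :: 'z measure" by (rule product_sigma_finite_lborel)
  have *: "d (z i) * tensor g (I - {i}) z = (\<Prod>l\<in>I. (if l = i then d else g) (z l))" for z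
    using assms prod.remove[of I i "\<lambda>l. (if l = i then d else g) (z l)"]
    by (auto simp: tensor_def intro!: prod.cong)
  show "integrable (PiM I (\<lambda>_. lborel)) (\<lambda>z. d (z i) * tensor g (I - {i}) z)"
    unfolding * using assms by (intro product_integrable_prod) auto
  have "(\<integral>z. \<bar>d (z i) * tensor g (I - {i}) z\<bar> \<partial>PiM I (\<lambda>_. lborel)) =
      (\<integral>z. (\<Prod>l\<in>I. (if l = i then (\<lambda>v. \<bar>d v\<bar>) else (\<lambda>v. \<bar>g v\<bar>)) (z l)) \<partial>PiM I (\<lambda>_. lborel))"
    unfolding * abs_prod by (intro Bochner_Integration.integral_cong prod.cong) auto
  also have "\<dots> = (\<Prod>l\<in>I. \<integral>v. (if l = i then (\<lambda>v. \<bar>d v\<bar>) else (\<lambda>v. \<bar>g v\<bar>)) v \<partial>lborel)"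
    using assms by (subst product_integral_prod) auto
  also have "\<dots> = (\<integral>v. \<bar>d v\<bar> \<partial>lborel) * (\<integral>v. \<bar>g v\<bar> \<partial>lborel) ^ (card I - 1)"
    using assms by (subst prod.remove[of I i]) auto
  finally show "(\<integral>z. \<bar>d (z i) * tensor g (I - {i}) z\<bar> \<partial>PiM I (\<lambda>_. lborel)) =
      (\<integral>v. \<bar>d v\<bar> \<partial>lborel) * (\<integral>v. \<bar>g v\<bar> \<partial>lborel) ^ (card I - 1)" .
qed

definition tensor_deriv :: "('z \<Rightarrow> real) \<Rightarrow> ('z \<Rightarrow> real) \<Rightarrow> nat set \<Rightarrow> (nat \<Rightarrow> 'z) \<Rightarrow> real" where
  "tensor_deriv g d I z = (\<Sum>i\<in>I. d (z i) * tensor g (I - {i}) z)"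

lemma integrable_tensor_deriv:
  fixes g d :: "'z::euclidean_space \<Rightarrow> real"
  assumes "finite I" "integrable lborel g" "integrable lborel d"
  shows "integrable (PiM I (\<lambda>_. lborel)) (tensor_deriv g d I)"
  unfolding tensor_deriv_def[abs_def]
  using assms by (intro Bochner_Integration.integrable_sum integrable_one_factor)

lemma tensor_deriv_L1:
  fixes g d :: "'z::euclidean_space \<Rightarrow> real"
  assumes "finite I" "integrable lborel g" "integrable lborel d" "(\<integral>v. \<bar>g v\<bar> \<partial>lborel) \<le> 1"
  shows "(\<integral>z. \<bar>tensor_deriv g d I z\<bar> \<partial>PiM I (\<lambda>_. lborel)) \<le> card I * (\<integral>v. \<bar>d v\<bar> \<partial>lborel)"
proof -
  have "(\<integral>z. \<bar>tensor_deriv g d I z\<bar> \<partial>PiM I (\<lambda>_. lborel)) \<le>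
      (\<integral>z. (\<Sum>i\<in>I. \<bar>d (z i) * tensor g (I - {i}) z\<bar>) \<partial>PiM I (\<lambda>_. lborel))"
    unfolding tensor_deriv_def using assms
    by (intro integral_mono integrable_abs integrable_tensor_deriv[unfolded tensor_deriv_def[abs_def]]
        Bochner_Integration.integrable_sum integrable_one_factor sum_abs) auto
  also have "\<dots> = (\<Sum>i\<in>I. (\<integral>v. \<bar>d v\<bar> \<partial>lborel) * (\<integral>v. \<bar>g v\<bar> \<partial>lborel) ^ (card I - 1))"
    using assms by (subst Bochner_Integration.integral_sum) (auto intro!: integrable_abs integrable_one_factor simp: integrable_one_factor(2))
  also have "\<dots> \<le> (\<Sum>i\<in>I. (\<integral>v. \<bar>d v\<bar> \<partial>lborel))"
    using assms by (intro sum_mono mult_left_le power_le_one) auto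
  finally show ?thesis by simp
qed

lemma tensor_insert: "finite I \<Longrightarrow> a \<notin> I \<Longrightarrow> tensor g (insert a I) z = g (z a) * tensor g I z"
  by (simp add: tensor_def)

lemma tensor_cong: "(\<And>i. i \<in> I \<Longrightarrow> z i = z' i) \<Longrightarrow> tensor g I z = tensor g I z'"
  by (auto simp: tensor_def intro: prod.cong)

text \<open>Induction on the number of factors. The remainder for \<open>insert a I\<close> is
  \<open>f\<close> times the remainder for \<open>I\<close> plus \<open>f - g\<close> times the
  first-order term for \<open>I\<close>. With norms at most 1 and n factors in \<open>I\<close>,
  this adds at most n to a coefficient n^2, and n^2 + n \<le> (n + 1)^2.\<close>

lemma tensor_second_order:
  fixes f g :: "'z::euclidean_space \<Rightarrow> real"
  assumes "finite I" and fg: "integrable lborel f" "integrable lborel g"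
    "(\<integral>v. \<bar>f v\<bar> \<partial>lborel) \<le> 1" "(\<integral>v. \<bar>g v\<bar> \<partial>lborel) \<le> 1"
  shows "(\<integral>z. \<bar>tensor f I z - tensor g I z - tensor_deriv g (\<lambda>v. f v - g v) I z\<bar> \<partial>PiM I (\<lambda>_. lborel))
    \<le> (card I)\<^sup>2 * (\<integral>v. \<bar>f v - g v\<bar> \<partial>lborel)\<^sup>2"
  using assms(1)
proof (induction I)
  case empty
  then show ?case by (simp add: tensor_def tensor_deriv_def)
next
  case (insert a I)
  interpret product_sigma_finite "\<lambda>_::nat. lborel :: 'z measure" by (rule product_sigma_finite_lborel)
  let ?d = "\<lambda>v. f v - g v"
  let ?R = "\<lambda>I z. tensor f I z - tensor g I z - tensor_deriv g ?d I z"
  let ?D = "\<integral>v. \<bar>?d v\<bar> \<partial>lborel"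
  have d: "integrable lborel ?d" using fg by simp
  have R: "integrable (PiM I (\<lambda>_. lborel)) (?R I)" if "finite I" for I
    using fg that by (intro Bochner_Integration.integrable_diff integrable_tensor integrable_tensor_deriv) auto
  have D0: "0 \<le> ?D" by simp
  have deriv: "tensor_deriv g ?d (insert a I) z = ?d (z a) * tensor g I z + g (z a) * tensor_deriv g ?d I z" for z
  proof -
    have "insert a I - {i} = insert a (I - {i})" if "i \<in> I" for i
      using insert that by auto
    then show ?thesis
      using insert unfolding tensor_deriv_def
      by (simp add: tensor_insert sum_distrib_left algebra_simps cong: sum.cong)
  qed
  have step: "?R (insert a I) z = f (z a) * ?R I z + ?d (z a) * tensor_deriv g ?d I z" for z
    using insert unfolding deriv by (simp add: tensor_insert algebra_simps)
  have cong: "tensor h K (x(a := y)) = tensor h K x" if "K \<subseteq> I" for h x y K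
    using insert that by (intro tensor_cong) auto
  have cong': "tensor_deriv g ?d I (x(a := y)) = tensor_deriv g ?d I x" for x y
    using insert unfolding tensor_deriv_def
    by (intro sum.cong) (auto simp: cong)
  have "(\<integral>z. \<bar>?R (insert a I) z\<bar> \<partial>PiM (insert a I) (\<lambda>_. lborel))
     = (\<integral>x. \<integral>y. \<bar>f y * ?R I x + ?d y * tensor_deriv g ?d I x\<bar> \<partial>lborel \<partial>PiM I (\<lambda>_. lborel))"
    using insert(1,2) R[of "insert a I"] by (subst product_integral_insert) (simp_all add: step cong cong')
  also have "\<dots> \<le> (\<integral>x. \<bar>?R I x\<bar> + ?D * \<bar>tensor_deriv g ?d I x\<bar> \<partial>PiM I (\<lambda>_. lborel))"
  proof (rule integral_mono)
    have "integrable (PiM (insert a I) (\<lambda>_. lborel)) (\<lambda>z. \<bar>?R (insert a I) z\<bar>)"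
      using R[of "insert a I"] insert(1) by simp
    from integrable_insert_inner[OF insert(1,2) this]
    show "integrable (PiM I (\<lambda>_. lborel)) (\<lambda>x. \<integral>y. \<bar>f y * ?R I x + ?d y * tensor_deriv g ?d I x\<bar> \<partial>lborel)"
      by (simp add: step cong cong')
    show "integrable (PiM I (\<lambda>_. lborel)) (\<lambda>x. \<bar>?R I x\<bar> + ?D * \<bar>tensor_deriv g ?d I x\<bar>)"
      using insert(1) R d fg integrable_tensor_deriv[of I g ?d] by (intro Bochner_Integration.integrable_add integrable_mult_right integrable_abs) auto
    fix x
    have "(\<integral>y. \<bar>f y * ?R I x + ?d y * tensor_deriv g ?d I x\<bar> \<partial>lborel) \<le>
      (\<integral>y. \<bar>f y\<bar> * \<bar>?R I x\<bar> + \<bar>?d y\<bar> * \<bar>tensor_deriv g ?d I x\<bar> \<partial>lborel)"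
      using fg by (intro integral_mono) (auto simp: abs_mult[symmetric] intro: abs_triangle_ineq)
    also have "\<dots> = (\<integral>y. \<bar>f y\<bar> \<partial>lborel) * \<bar>?R I x\<bar> + ?D * \<bar>tensor_deriv g ?d I x\<bar>"
      using fg by simp
    also have "\<dots> \<le> 1 * \<bar>?R I x\<bar> + ?D * \<bar>tensor_deriv g ?d I x\<bar>"
      using fg by (intro add_mono mult_right_mono) auto
    finally show "(\<integral>y. \<bar>f y * ?R I x + ?d y * tensor_deriv g ?d I x\<bar> \<partial>lborel) \<le>
      \<bar>?R I x\<bar> + ?D * \<bar>tensor_deriv g ?d I x\<bar>" by simp
  qed
  also have "\<dots> = (\<integral>x. \<bar>?R I x\<bar> \<partial>PiM I (\<lambda>_. lborel)) + ?D * (\<integral>x. \<bar>tensor_deriv g ?d I x\<bar> \<partial>PiM I (\<lambda>_. lborel))"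
    using insert(1) R d fg integrable_tensor_deriv[of I g ?d] by simp
  also have "\<dots> \<le> (card I)\<^sup>2 * ?D\<^sup>2 + ?D * (card I * ?D)"
    using insert fg d by (intro add_mono insert.IH mult_left_mono tensor_deriv_L1 D0) auto
  also have "\<dots> = ((card I)\<^sup>2 + card I) * ?D\<^sup>2"
    by (simp add: power2_eq_square algebra_simps)
  also have "\<dots> \<le> (card (insert a I))\<^sup>2 * ?D\<^sup>2"
    using insert by (intro mult_right_mono) (auto simp: power2_eq_square algebra_simps)
  finally show ?case .
qed

section \<open>The kinetic operator as the partial integral of a pair operator on a tensor
  power\<close>

context collision_model
begin

definition kinetic :: "real \<Rightarrow> ('z \<Rightarrow> real) \<Rightarrow> 'z \<Rightarrow> real" where
  "kinetic t g v = (\<integral>w. (\<integral>\<omega>. b t \<omega> v w * (g (c t \<omega> v w) * g (c t \<omega> w v) - g v * g w) \<partial>\<nu>) \<partial>lborel)"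

text \<open>The test function seen by particle \<open>i\<close> when the particles in
  \<open>J\<close> are averaged against \<open>g\<close>. The value 0 for particle \<open>k\<close>
  is a placeholder, as \<psi> will not depend on that coordinate.\<close>

definition partial_test ::
  "nat set \<Rightarrow> nat \<Rightarrow> nat \<Rightarrow> ('z \<Rightarrow> real) \<Rightarrow> ((nat \<Rightarrow> 'z) \<Rightarrow> real) \<Rightarrow> 'z \<Rightarrow> real" where
  "partial_test J i k g \<psi> v = (\<integral>y. tensor g J y * \<psi> (y(i := v, k := 0)) \<partial>ph J)"

lemma tensor_meas:
  assumes "g \<in> borel_measurable borel" "finite I" "J \<subseteq> I"
  shows "tensor g J \<in> borel_measurable (ph I)"
  unfolding tensor_def[abs_def] using assms
  by (intro borel_measurable_prod measurable_compose[OF component_meas[where z="\<lambda>z. z" and I=I] assms(1)]) auto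

lemma kinetic_meas:
  assumes u: "(\<lambda>(t, z). u t z) \<in> borel_measurable (borel \<Otimes>\<^sub>M borel)"
  shows "(\<lambda>(t, z). kinetic t (u t) z) \<in> borel_measurable (borel \<Otimes>\<^sub>M borel)"
proof -
  have u': "(\<lambda>x. u (p x) (q x)) \<in> borel_measurable M" if "p \<in> borel_measurable M" "q \<in> borel_measurable M" for p q M
    using measurable_compose[OF measurable_Pair[OF that] u] by simp
  have [measurable]: "(\<lambda>x. u (fst x) (snd x)) \<in> borel_measurable (borel \<Otimes>\<^sub>M borel)"
    using u by (simp add: case_prod_beta')
  let ?P = "((borel \<Otimes>\<^sub>M borel) \<Otimes>\<^sub>M lborel) \<Otimes>\<^sub>M \<nu>"
  have t [measurable]: "(\<lambda>x. fst (fst (fst x))) \<in> borel_measurable ?P"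
    and [measurable]: "(\<lambda>x. snd (fst (fst x))) \<in> borel_measurable ?P" "(\<lambda>x. snd (fst x)) \<in> borel_measurable ?P"
      "snd \<in> measurable ?P \<nu>"
    by measurable
  have "(\<lambda>x. c (fst (fst (fst x))) (snd x) (snd (fst (fst x))) (snd (fst x))) \<in> borel_measurable ?P"
    "(\<lambda>x. c (fst (fst (fst x))) (snd x) (snd (fst x)) (snd (fst (fst x)))) \<in> borel_measurable ?P"
    by measurable
  note [measurable] = this[THEN u'[OF t]]
  have [measurable]: "(\<lambda>x. u (fst (fst (fst x))) (snd (fst (fst x)))) \<in> borel_measurable ?P"
    "(\<lambda>x. u (fst (fst (fst x))) (snd (fst x))) \<in> borel_measurable ?P"
    by (intro u'; measurable)+
  have "(\<lambda>x. b (fst (fst (fst x))) (snd x) (snd (fst (fst x))) (snd (fst x)) *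
      (u (fst (fst (fst x))) (c (fst (fst (fst x))) (snd x) (snd (fst (fst x))) (snd (fst x))) *
       u (fst (fst (fst x))) (c (fst (fst (fst x))) (snd x) (snd (fst x)) (snd (fst (fst x)))) -
       u (fst (fst (fst x))) (snd (fst (fst x))) * u (fst (fst (fst x))) (snd (fst x)))) \<in> borel_measurable ?P"
    by measurable
  then have "(\<lambda>x. \<integral>w. (\<integral>\<omega>. b (fst x) \<omega> (snd x) w * (u (fst x) (c (fst x) \<omega> (snd x) w) * u (fst x) (c (fst x) \<omega> w (snd x)) - u (fst x) (snd x) * u (fst x) w) \<partial>\<nu>) \<partial>lborel)
    \<in> borel_measurable (borel \<Otimes>\<^sub>M borel)"
    by (intro lborel.borel_measurable_lebesgue_integral, simp only: case_prod_beta',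
        intro nu.borel_measurable_lebesgue_integral, simp only: case_prod_beta')
  then show ?thesis
    unfolding kinetic_def case_prod_beta' .
qed

context
  fixes J :: "nat set" and i k :: nat and g :: "'z \<Rightarrow> real" and \<psi> :: "(nat \<Rightarrow> 'z) \<Rightarrow> real"
  assumes J: "finite J" "i \<notin> J" "k \<notin> J" "i \<noteq> k"
    and g: "integrable lborel g"
    and \<psi>m: "\<psi> \<in> borel_measurable (ph (insert k (insert i J)))"
    and \<psi>1: "\<And>z. z \<in> space (ph (insert k (insert i J))) \<Longrightarrow> \<bar>\<psi> z\<bar> \<le> 1"
    and \<psi>k: "\<And>z w. z \<in> space (ph (insert k (insert i J))) \<Longrightarrow> \<psi> (z(k := w)) = \<psi> z"
begin

private lemma upd_space: "x \<in> space (ph (insert i J)) \<Longrightarrow> x(k := w) \<in> space (ph (insert k (insert i J)))"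
  by (auto simp: space_PiM PiE_def extensional_def)

private lemma \<psi>_upd: "x \<in> space (ph (insert i J)) \<Longrightarrow> \<psi> (x(k := w)) = \<psi> (x(k := 0))"
  using \<psi>k[OF upd_space[of x 0], of w] by simp

private lemma tensor_upd: "tensor h J (x(k := w)) = tensor h J x" "tensor h J (x(i := w)) = tensor h J x"
  using J by (auto intro!: tensor_cong)

lemma partial_test_meas: "partial_test J i k g \<psi> \<in> borel_measurable borel"
proof -
  interpret J: sigma_finite_measure "ph J" by (rule sigma_finite_PiM_lborel[OF J(1)])
  have [measurable]: "g \<in> borel_measurable borel" using g by auto
  have [measurable]: "tensor g J \<in> borel_measurable (ph J)"
    by (intro tensor_meas) (auto simp: J)
  have "(\<lambda>x. (snd x)(i := fst x, k := 0)) \<in> measurable (borel \<Otimes>\<^sub>M ph J) (ph (insert k (insert i J)))"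
    by (intro measurable_fun_upd[where J="insert i J"] measurable_fun_upd[where J=J]) auto
  from measurable_compose[OF this \<psi>m]
  have [measurable]: "(\<lambda>x. \<psi> ((snd x)(i := fst x, k := 0))) \<in> borel_measurable (borel \<Otimes>\<^sub>M ph J)" .
  show ?thesis
    unfolding partial_test_def[abs_def]
    by (rule J.borel_measurable_lebesgue_integral) (simp add: case_prod_beta')
qed

lemma partial_test_le: "\<bar>partial_test J i k g \<psi> v\<bar> \<le> (\<integral>v. \<bar>g v\<bar> \<partial>lborel) ^ card J"
proof -
  have "(\<lambda>y. y(i := v, k := 0)) \<in> measurable (ph J) (ph (insert k (insert i J)))"
    by (intro measurable_fun_upd[where J="insert i J"] measurable_fun_upd[where J=J]) auto
  from measurable_compose[OF this \<psi>m]
  have "(\<lambda>y. \<psi> (y(i := v, k := 0))) \<in> borel_measurable (ph J)" .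
  moreover have "\<bar>\<psi> (y(i := v, k := 0))\<bar> \<le> 1" if "y \<in> space (ph J)" for y
    using that by (intro \<psi>1 upd_space) (auto simp: space_PiM PiE_def extensional_def)
  ultimately show ?thesis
    unfolding partial_test_def
    using abs_integral_mult_le[OF integrable_tensor(1)[OF J(1) g], of "\<lambda>y. \<psi> (y(i := v, k := 0))" 1]
    by (simp add: integrable_tensor(3)[OF J(1) g])
qed

text \<open>Particle \<open>k\<close> integrates to the mass of \<open>g\<close>, and the particles
  in \<open>J\<close> are absorbed into the test function.\<close>

lemma integral_one_factor_partial_test:
  assumes e: "integrable lborel e" and g1: "(\<integral>v. g v \<partial>lborel) = 1"
  shows "(\<integral>z. e (z i) * tensor g (insert k (insert i J) - {i}) z * \<psi> z \<partial>ph (insert k (insert i J))) = (\<integral>v. e v * partial_test J i k g \<psi> v \<partial>lborel)"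
proof -
  have Ii: "insert k (insert i J) - {i} = insert k J" and Ji: "insert i J - {i} = J" using J by auto
  have int: "integrable (ph (insert k (insert i J))) (\<lambda>z. e (z i) * tensor g (insert k (insert i J) - {i}) z * \<psi> z)"
    using J g e \<psi>m \<psi>1 by (intro integrable_bounded_mult[where K=1] integrable_one_factor) auto
  have "(\<integral>z. e (z i) * tensor g (insert k (insert i J) - {i}) z * \<psi> z \<partial>ph (insert k (insert i J))) =
     (\<integral>x. (\<integral>w. e (x i) * (g w * tensor g J x) * \<psi> (x(k := 0)) \<partial>lborel) \<partial>ph (insert i J))"
  proof -
    have *: "e ((x(k := w)) i) * tensor g (insert k (insert i J) - {i}) (x(k := w)) * \<psi> (x(k := w)) =
      e (x i) * (g w * tensor g J x) * \<psi> (x(k := 0))" if "x \<in> space (ph (insert i J))" for x w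
      using J unfolding Ii \<psi>_upd[OF that, of w] by (simp add: tensor_insert tensor_upd)
    have k: "finite (insert i J)" "k \<notin> insert i J" using J by auto
    show ?thesis
      unfolding lb.product_integral_insert[OF k int]
      by (intro Bochner_Integration.integral_cong refl *)
  qed
  also have "\<dots> = (\<integral>x. e (x i) * tensor g J x * \<psi> (x(k := 0)) \<partial>ph (insert i J))"
    using g1 by (simp add: algebra_simps)
  also have "\<dots> = (\<integral>v. (\<integral>y. e v * tensor g J y * \<psi> (y(i := v, k := 0)) \<partial>ph J) \<partial>lborel)"
  proof -
    have "(\<lambda>x. x(k := 0)) \<in> measurable (ph (insert i J)) (ph (insert k (insert i J)))"
      by (intro measurable_fun_upd[where J="insert i J"]) auto
    from measurable_compose[OF this \<psi>m]
    have "integrable (ph (insert i J)) (\<lambda>x. e (x i) * tensor g (insert i J - {i}) x * \<psi> (x(k := 0)))"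
      using J g e \<psi>1[OF upd_space]
      by (intro integrable_bounded_mult[where K=1] integrable_one_factor) auto
    from lb.integral_insert_rev[OF J(1,2) this[unfolded Ji]] show ?thesis
      using J(4) by (simp add: tensor_upd fun_upd_twist)
  qed
  also have "\<dots> = (\<integral>v. e v * partial_test J i k g \<psi> v \<partial>lborel)"
    unfolding partial_test_def by (simp add: mult.assoc)
  finally show ?thesis .
qed

text \<open>The origin of the kinetic equation: since \<psi> ignores particle \<open>k\<close>,
  integrating over it closes the pair operator to a quadratic operator acting on particle
  \<open>i\<close> alone. The second claim, an intermediate Fubini statement, later yields the
  integrability of \<open>kinetic\<close> itself.\<close>

lemma integral_pair_op_tensor:
  "(\<integral>z. pair_op t i k (tensor g (insert k (insert i J))) z * \<psi> z \<partial>ph (insert k (insert i J))) = (\<integral>v. kinetic t g v * partial_test J i k g \<psi> v \<partial>lborel)"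
  "integrable (ph (insert i J)) (\<lambda>x. kinetic t g (x i) * tensor g J x * \<psi> (x(k := 0)))"
proof -
  have fI: "finite (insert k (insert i J))" "i \<in> insert k (insert i J)" "k \<in> insert k (insert i J)" using J by auto
  have int: "integrable (ph (insert k (insert i J))) (\<lambda>z. pair_op t i k (tensor g (insert k (insert i J))) z * \<psi> z)"
    using fI J(4) \<psi>m \<psi>1 g
    by (intro integrable_bounded_mult[where K=1] pair_op_self_adjoint(1) integrable_tensor) auto
  have inner: "(\<integral>w. pair_op t i k (tensor g (insert k (insert i J))) (x(k := w)) * \<psi> (x(k := w)) \<partial>lborel) =
     kinetic t g (x i) * tensor g J x * \<psi> (x(k := 0))" if x: "x \<in> space (ph (insert i J))" for x
  proof -
    have *: "tensor g (insert k (insert i J)) (col t \<omega> i k (x(k := w))) = g (c t \<omega> w (x i)) * (g (c t \<omega> (x i) w) * tensor g J x)"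
      "tensor g (insert k (insert i J)) (x(k := w)) = g w * (g (x i) * tensor g J x)" for \<omega> w
      using J by (simp_all add: tensor_insert col_def tensor_upd)
    have "pair_op t i k (tensor g (insert k (insert i J))) (x(k := w)) =
      (\<integral>\<omega>. b t \<omega> (x i) w * (g (c t \<omega> (x i) w) * g (c t \<omega> w (x i)) - g (x i) * g w) * tensor g J x \<partial>\<nu>)" for w
      unfolding pair_op_def * using J(4)
      by (intro Bochner_Integration.integral_cong) (simp_all add: algebra_simps)
    then have "pair_op t i k (tensor g (insert k (insert i J))) (x(k := w)) * \<psi> (x(k := w)) =
      (\<integral>\<omega>. b t \<omega> (x i) w * (g (c t \<omega> (x i) w) * g (c t \<omega> w (x i)) - g (x i) * g w) \<partial>\<nu>) *
        (tensor g J x * \<psi> (x(k := 0)))" for w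
      using \<psi>_upd[OF x, of w] by simp
    then show ?thesis
      unfolding kinetic_def by simp
  qed
  show "integrable (ph (insert i J)) (\<lambda>x. kinetic t g (x i) * tensor g J x * \<psi> (x(k := 0)))"
    using lb.integrable_insert_inner[OF _ _ int] J
    by (simp add: inner cong: Bochner_Integration.integrable_cong)
  note int2 = this
  have "(\<integral>z. pair_op t i k (tensor g (insert k (insert i J))) z * \<psi> z \<partial>ph (insert k (insert i J))) =
      (\<integral>x. kinetic t g (x i) * tensor g J x * \<psi> (x(k := 0)) \<partial>ph (insert i J))"
    using J by (subst lb.product_integral_insert[OF _ _ int]) (simp_all add: inner cong: Bochner_Integration.integral_cong)
  also have "\<dots> = (\<integral>v. (\<integral>y. kinetic t g v * tensor g J y * \<psi> (y(i := v, k := 0)) \<partial>ph J) \<partial>lborel)"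
    using lb.integral_insert_rev[OF J(1,2) int2] J(4) by (simp add: tensor_upd fun_upd_twist)
  also have "\<dots> = (\<integral>v. kinetic t g v * partial_test J i k g \<psi> v \<partial>lborel)"
    unfolding partial_test_def by (simp add: mult.assoc)
  finally show "(\<integral>z. pair_op t i k (tensor g (insert k (insert i J))) z * \<psi> z \<partial>ph (insert k (insert i J))) = (\<integral>v. kinetic t g v * partial_test J i k g \<psi> v \<partial>lborel)" .
qed

end

end

section \<open>Bounds on the kinetic operator and on its solutions\<close>

context collision_model
begin

text \<open>One function \<eta> of a single particle represents \<psi> both against a perturbation
  of the factor \<open>i\<close> and against the collisions of \<open>i\<close> with
  \<open>k\<close>. The change in time of one factor of the tensor power can thus be compared with
  the collisions with any chosen partner \<open>k\<close> outside the cluster. \<eta> depends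
  neither on the time nor on the perturbation.\<close>

lemma one_factor_test:
  assumes I: "finite I" "i \<in> I" "k \<in> I" "i \<noteq> k"
    and g: "integrable lborel g" "(\<integral>v. \<bar>g v\<bar> \<partial>lborel) \<le> 1" "(\<integral>v. g v \<partial>lborel) = 1"
    and \<psi>: "\<psi> \<in> borel_measurable (ph I)" "\<And>z. z \<in> space (ph I) \<Longrightarrow> \<bar>\<psi> z\<bar> \<le> 1"
      "\<And>z w. z \<in> space (ph I) \<Longrightarrow> \<psi> (z(k := w)) = \<psi> z"
  obtains \<eta> where "\<eta> \<in> borel_measurable borel" "\<And>v. \<bar>\<eta> v\<bar> \<le> 1"
    "\<And>e. integrable lborel e \<Longrightarrow> (\<integral>z. e (z i) * tensor g (I - {i}) z * \<psi> z \<partial>ph I) = (\<integral>v. e v * \<eta> v \<partial>lborel)"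
    "\<And>t. (\<integral>z. tensor g I z * pair_op t i k \<psi> z \<partial>ph I) = (\<integral>v. kinetic t g v * \<eta> v \<partial>lborel)"
proof
  define J where "J = I - {i, k}"
  have J: "finite J" "i \<notin> J" "k \<notin> J" and IJ: "I = insert k (insert i J)"
    using I by (auto simp: J_def)
  note \<psi>J = \<psi>[unfolded IJ]
  let ?\<eta> = "partial_test J i k g \<psi>"
  show "?\<eta> \<in> borel_measurable borel"
    by (rule partial_test_meas[OF J I(4) g(1) \<psi>J])
  have "(\<integral>v. \<bar>g v\<bar> \<partial>lborel) ^ card J \<le> 1"
    using g by (intro power_le_one) auto
  then show "\<bar>?\<eta> v\<bar> \<le> 1" for v
    using partial_test_le[OF J I(4) g(1) \<psi>J, of v] by simp
  show "(\<integral>z. e (z i) * tensor g (I - {i}) z * \<psi> z \<partial>ph I) = (\<integral>v. e v * ?\<eta> v \<partial>lborel)"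
    if "integrable lborel e" for e
    using integral_one_factor_partial_test[OF J I(4) g(1) \<psi>J that g(3)] unfolding IJ .
  show "(\<integral>z. tensor g I z * pair_op t i k \<psi> z \<partial>ph I) = (\<integral>v. kinetic t g v * ?\<eta> v \<partial>lborel)" for t
    using integral_pair_op_tensor(1)[OF J I(4) g(1) \<psi>J, of t]
      pair_op_self_adjoint(2)[OF I integrable_tensor(1)[OF I(1) g(1)] \<psi>(1,2), of t]
    unfolding IJ[symmetric] by simp
qed

text \<open>Used for factors outside the cluster: integrating over their coordinate first gives the
  mass of the perturbation, which is 0.\<close>

lemma integral_one_factor_eq_0:
  assumes I: "finite I" "i \<in> I" and g: "integrable lborel g"
    and e: "integrable lborel e" "(\<integral>v. e v \<partial>lborel) = 0"
    and \<psi>: "\<psi> \<in> borel_measurable (ph I)" "\<And>z. z \<in> space (ph I) \<Longrightarrow> \<bar>\<psi> z\<bar> \<le> 1"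
      "\<And>z w. z \<in> space (ph I) \<Longrightarrow> \<psi> (z(i := w)) = \<psi> z"
  shows "(\<integral>z. e (z i) * tensor g (I - {i}) z * \<psi> z \<partial>ph I) = 0"
proof -
  define J where "J = I - {i}"
  have J: "finite J" "i \<notin> J" and IJ: "I = insert i J"
    using I by (auto simp: J_def)
  have "integrable (ph I) (\<lambda>z. e (z i) * tensor g (I - {i}) z * \<psi> z)"
    using I g e \<psi> by (intro integrable_bounded_mult[where K=1] integrable_one_factor) auto
  note int = this[folded J_def, unfolded IJ]
  have \<psi>i: "\<psi> (x(i := w)) = \<psi> (x(i := 0))" if "x \<in> space (ph J)" for x w
  proof -
    have "x(i := 0) \<in> space (ph I)"
      using that by (auto simp: IJ space_PiM PiE_def extensional_def)
    from \<psi>(3)[OF this, of w] show ?thesis by simp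
  qed
  have *: "e ((x(i := w)) i) * tensor g J (x(i := w)) * \<psi> (x(i := w)) = e w * (tensor g J x * \<psi> (x(i := 0)))"
    if "x \<in> space (ph J)" for x w
  proof -
    have "tensor g J (x(i := w)) = tensor g J x"
      using J by (intro tensor_cong) auto
    then show ?thesis using \<psi>i[OF that, of w] by simp
  qed
  have "(\<integral>z. e (z i) * tensor g J z * \<psi> z \<partial>ph (insert i J)) =
    (\<integral>x. (\<integral>w. e w * (tensor g J x * \<psi> (x(i := 0))) \<partial>lborel) \<partial>ph J)"
    unfolding lb.product_integral_insert[OF J int]
    by (intro Bochner_Integration.integral_cong refl *)
  then show ?thesis
    using e(2) unfolding J_def[symmetric] unfolding IJ by simp
qed

lemma integral_ph_empty: "(\<integral>y. h y \<partial>ph {}) = h (\<lambda>_. undefined)" for h :: "_ \<Rightarrow> real"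
  by (simp add: PiM_empty lebesgue_integral_count_space_finite)

text \<open>The case of two particles, labelled 0 and 1, with \<open>J\<close> empty. It transfers
  the bounds on pair operators to the kinetic operator.\<close>

lemma kinetic_test:
  assumes g: "integrable lborel g" and \<phi>: "\<phi> \<in> borel_measurable borel" "\<And>v. \<bar>\<phi> v\<bar> \<le> 1"
  shows "(\<integral>v. kinetic t g v * \<phi> v \<partial>lborel) =
      (\<integral>z. tensor g {0, 1} z * pair_op t 0 1 (\<lambda>z. \<phi> (z 0)) z \<partial>ph {0, 1})"
proof -
  have I: "insert 1 (insert 0 {}) = {0, 1::nat}" by auto
  have m: "(\<lambda>z. \<phi> (z 0)) \<in> borel_measurable (ph {0, 1})"
    by (intro measurable_compose[OF component_meas[where z="\<lambda>z. z" and I="{0, 1}"] \<phi>(1)]) auto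
  have "(\<integral>v. kinetic t g v * partial_test {} 0 1 g (\<lambda>z. \<phi> (z 0)) v \<partial>lborel) =
     (\<integral>z. pair_op t 0 1 (tensor g {0, 1}) z * \<phi> (z 0) \<partial>ph {0, 1})"
    using \<phi> g m
    by (subst integral_pair_op_tensor(1)[where J="{}" and i=0 and k=1, unfolded I, symmetric]) auto
  also have "\<dots> = (\<integral>z. tensor g {0, 1} z * pair_op t 0 1 (\<lambda>z. \<phi> (z 0)) z \<partial>ph {0, 1})"
    using \<phi> by (intro pair_op_self_adjoint m integrable_tensor g) auto
  finally show ?thesis
    unfolding partial_test_def integral_ph_empty by (simp add: tensor_def)
qed

lemma integrable_kinetic:
  assumes g: "integrable lborel g"
  shows "integrable lborel (kinetic t g)"
proof -
  have "integrable (ph (insert 0 {})) (\<lambda>x. kinetic t g (x 0) * tensor g {} x * 1)"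
    by (rule integral_pair_op_tensor(2)[where k=1 and \<psi>="\<lambda>_. 1"]) (auto simp: g)
  from lb.integrable_insert_inner_rev[OF _ _ this] show ?thesis
    unfolding integral_ph_empty by (simp add: tensor_def)
qed

lemma tensor_pair_diff_L1:
  assumes "integrable lborel f" "integrable lborel g"
  shows "(\<integral>z. \<bar>tensor f {0, 1} z - tensor g {0, 1} z\<bar> \<partial>ph {0, 1}) \<le>
    ((\<integral>v. \<bar>f v\<bar> \<partial>lborel) + (\<integral>v. \<bar>g v\<bar> \<partial>lborel)) * (\<integral>v. \<bar>f v - g v\<bar> \<partial>lborel)"
proof -
  let ?d = "\<lambda>v. f v - g v"
  have d: "integrable lborel ?d" using assms by simp
  have D: "{0, 1} - {1} = {0::nat}" "{0, 1} - {0} = {1::nat}" by auto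
  note one = integrable_one_factor[of "{0, 1}" 1, OF _ _ assms(1) d, unfolded D]
    integrable_one_factor[of "{0, 1}" 0, OF _ _ assms(2) d, unfolded D]
  have "(\<integral>z. \<bar>tensor f {0, 1} z - tensor g {0, 1} z\<bar> \<partial>ph {0, 1}) \<le>
    (\<integral>z. \<bar>?d (z 1) * tensor f {0} z\<bar> + \<bar>?d (z 0) * tensor g {1} z\<bar> \<partial>ph {0, 1})"
  proof (rule integral_mono)
    show "\<bar>tensor f {0, 1} z - tensor g {0, 1} z\<bar> \<le> \<bar>?d (z 1) * tensor f {0} z\<bar> + \<bar>?d (z 0) * tensor g {1} z\<bar>" for z
    proof -
      have "tensor f {0, 1} z - tensor g {0, 1} z = ?d (z 1) * tensor f {0} z + ?d (z 0) * tensor g {1} z"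
        by (simp add: tensor_def algebra_simps)
      then show ?thesis by (simp add: abs_triangle_ineq)
    qed
  qed (use assms one in \<open>auto intro!: integrable_abs Bochner_Integration.integrable_diff integrable_tensor\<close>)
  also have "\<dots> = (\<integral>v. \<bar>?d v\<bar> \<partial>lborel) * (\<integral>v. \<bar>f v\<bar> \<partial>lborel) + (\<integral>v. \<bar>?d v\<bar> \<partial>lborel) * (\<integral>v. \<bar>g v\<bar> \<partial>lborel)"
    using one by simp
  finally show ?thesis by (simp add: algebra_simps)
qed

lemma kinetic_L1_diff:
  assumes f: "integrable lborel f" and g: "integrable lborel g"
  shows "(\<integral>v. \<bar>kinetic t f v - kinetic t g v\<bar> \<partial>lborel) \<le>
    2 * \<mu> * ((\<integral>v. \<bar>f v\<bar> \<partial>lborel) + (\<integral>v. \<bar>g v\<bar> \<partial>lborel)) * (\<integral>v. \<bar>f v - g v\<bar> \<partial>lborel)"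
proof (rule integral_abs_le_by_duality)
  note kf = integrable_kinetic[OF f, of t] and kg = integrable_kinetic[OF g, of t]
  show "(\<lambda>v. kinetic t f v - kinetic t g v) \<in> borel_measurable lborel"
    using kf kg by measurable
  fix \<phi> :: "'z \<Rightarrow> real" assume \<phi>: "\<phi> \<in> borel_measurable lborel" "\<And>x. \<bar>\<phi> x\<bar> \<le> 1"
  let ?\<psi> = "pair_op t 0 1 (\<lambda>z. \<phi> (z 0))"
  have m: "(\<lambda>z. \<phi> (z 0)) \<in> borel_measurable (ph {0, 1})"
    using \<phi> by (intro measurable_compose[OF component_meas[where z="\<lambda>z. z" and I="{0, 1}"]]) auto
  have \<psi>: "?\<psi> \<in> borel_measurable (ph {0, 1})" "\<And>z. z \<in> space (ph {0, 1}) \<Longrightarrow> \<bar>?\<psi> z\<bar> \<le> 2 * \<mu>"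
    using pair_op_meas'[OF m, of 0 1 t] pair_op_abs_le[OF m, of 1 _ 0 1 t] \<phi> by auto
  note tf = integrable_tensor(1)[OF _ f, of "{0, 1}"] and tg = integrable_tensor(1)[OF _ g, of "{0, 1}"]
  have "(\<integral>v. (kinetic t f v - kinetic t g v) * \<phi> v \<partial>lborel) =
      (\<integral>v. kinetic t f v * \<phi> v \<partial>lborel) - (\<integral>v. kinetic t g v * \<phi> v \<partial>lborel)"
    using kf kg \<phi> by (simp add: left_diff_distrib integrable_bounded_mult[where K=1])
  also have "\<dots> = (\<integral>z. tensor f {0, 1} z * ?\<psi> z \<partial>ph {0, 1}) - (\<integral>z. tensor g {0, 1} z * ?\<psi> z \<partial>ph {0, 1})"
    using \<phi> by (simp add: kinetic_test f g)
  also have "\<dots> = (\<integral>z. (tensor f {0, 1} z - tensor g {0, 1} z) * ?\<psi> z \<partial>ph {0, 1})"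
    using tf tg \<psi> by (simp add: left_diff_distrib integrable_bounded_mult[where K="2 * \<mu>"])
  also have "\<dots> \<le> 2 * \<mu> * (\<integral>z. \<bar>tensor f {0, 1} z - tensor g {0, 1} z\<bar> \<partial>ph {0, 1})"
    using tf tg \<psi> by (intro order_trans[OF abs_ge_self abs_integral_mult_le]) auto
  also have "\<dots> \<le> 2 * \<mu> * (((\<integral>v. \<bar>f v\<bar> \<partial>lborel) + (\<integral>v. \<bar>g v\<bar> \<partial>lborel)) * (\<integral>v. \<bar>f v - g v\<bar> \<partial>lborel))"
    using mu_nonneg by (intro mult_left_mono tensor_pair_diff_L1 f g) auto
  finally show "(\<integral>v. (kinetic t f v - kinetic t g v) * \<phi> v \<partial>lborel) \<le>
    2 * \<mu> * ((\<integral>v. \<bar>f v\<bar> \<partial>lborel) + (\<integral>v. \<bar>g v\<bar> \<partial>lborel)) * (\<integral>v. \<bar>f v - g v\<bar> \<partial>lborel)"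
    by (simp add: mult.assoc)
qed

lemma kinetic_L1:
  assumes f: "integrable lborel f"
  shows "(\<integral>v. \<bar>kinetic t f v\<bar> \<partial>lborel) \<le> 2 * \<mu> * (\<integral>v. \<bar>f v\<bar> \<partial>lborel)\<^sup>2"
  using kinetic_L1_diff[OF f, of "\<lambda>_. 0" t] by (simp add: kinetic_def power2_eq_square mult.assoc)

text \<open>The constant 1 is a collision invariant.\<close>

lemma kinetic_mass:
  assumes f: "integrable lborel f"
  shows "(\<integral>v. kinetic t f v \<partial>lborel) = 0"
  using kinetic_test[OF f, of "\<lambda>_. 1" t] by (simp add: pair_op_def)

text \<open>Uniformization for the kinetic operator. Mass 1 enters in the damping: particle 1
  integrates to 1, so that the fictitious collisions act on \<open>g\<close> as multiplication by
  -\<mu>.\<close>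

lemma kinetic_test_le:
  assumes g: "integrable lborel g" "(\<integral>v. g v \<partial>lborel) = 1"
    and \<phi>: "\<phi> \<in> borel_measurable borel" "\<And>v. \<bar>\<phi> v\<bar> \<le> 1"
  shows "(\<integral>v. kinetic t g v * \<phi> v \<partial>lborel) \<le> \<mu> * (\<integral>v. \<bar>g v\<bar> \<partial>lborel)\<^sup>2 - \<mu> * (\<integral>v. g v * \<phi> v \<partial>lborel)"
proof -
  let ?\<psi> = "\<lambda>z :: nat \<Rightarrow> 'z. \<phi> (z 0)"
  have m: "?\<psi> \<in> borel_measurable (ph {0, 1})"
    using \<phi> by (intro measurable_compose[OF component_meas[where z="\<lambda>z. z" and I="{0, 1}"]]) auto
  note tg = integrable_tensor[OF _ g(1), of "{0, 1}"]
  have pm: "pair_op t 0 1 ?\<psi> \<in> borel_measurable (ph {0, 1})"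
    by (intro pair_op_meas' m) auto
  have i1: "integrable (ph {0, 1}) (\<lambda>z. tensor g {0, 1} z * pair_op t 0 1 ?\<psi> z)"
    using \<phi> by (intro integrable_bounded_mult[where K="2 * \<mu>"] tg pm) (auto intro: order_trans[OF pair_op_abs_le[OF m, of 1]])
  have i2: "integrable (ph {0, 1}) (\<lambda>z. tensor g {0, 1} z * (\<mu> * ?\<psi> z))"
    using \<phi> m mu_nonneg by (intro integrable_bounded_mult[where K="\<mu>"] tg) (auto simp: abs_mult intro: mult_left_le)
  have "(\<integral>z. g (z 0) * tensor g ({0, 1} - {0}) z * ?\<psi> z \<partial>ph {0, 1}) = (\<integral>v. g v * \<phi> v \<partial>lborel)"
  proof -
    have I: "insert 1 (insert 0 {}) = {0, 1::nat}" by auto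
    have "(\<integral>z. g (z 0) * tensor g ({0, 1} - {0}) z * ?\<psi> z \<partial>ph {0, 1}) =
       (\<integral>v. g v * partial_test {} 0 1 g ?\<psi> v \<partial>lborel)"
      by (rule integral_one_factor_partial_test[where J="{}" and i=0 and k=1, unfolded I])
         (use g m \<phi> in auto)
    then show ?thesis
      unfolding partial_test_def integral_ph_empty by (simp add: tensor_def)
  qed
  then have e: "(\<integral>z. tensor g {0, 1} z * (\<mu> * ?\<psi> z) \<partial>ph {0, 1}) = \<mu> * (\<integral>v. g v * \<phi> v \<partial>lborel)"
    by (simp add: tensor_def mult.left_commute[of _ \<mu>])
  have "(\<integral>v. kinetic t g v * \<phi> v \<partial>lborel) + \<mu> * (\<integral>v. g v * \<phi> v \<partial>lborel) =
     (\<integral>z. tensor g {0, 1} z * (pair_op t 0 1 ?\<psi> z + \<mu> * ?\<psi> z) \<partial>ph {0, 1})"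
    unfolding e[symmetric] kinetic_test[OF g(1) \<phi>]
    by (subst Bochner_Integration.integral_add[OF i1 i2, symmetric]) (simp add: distrib_left)
  also have "\<dots> \<le> \<mu> * (\<integral>z. \<bar>tensor g {0, 1} z\<bar> \<partial>ph {0, 1})"
    using tg pm m pair_op_bound[OF m, of 1 _ 0 1 t] \<phi>
    by (intro order_trans[OF abs_ge_self abs_integral_mult_le]) auto
  also have "\<dots> = \<mu> * (\<integral>v. \<bar>g v\<bar> \<partial>lborel)\<^sup>2"
    using tg by (simp add: power2_eq_square)
  finally show ?thesis by simp
qed

text \<open>The norm bound 1 is demanded at time 0 only; later it has to be propagated, starting
  from mere local boundedness in time.\<close>

definition kinetic_curve :: "(real \<Rightarrow> 'z \<Rightarrow> real) \<Rightarrow> (real \<Rightarrow> 'z \<Rightarrow> real) \<Rightarrow> bool" where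
  "kinetic_curve q f \<longleftrightarrow> evolves lborel q f \<and> (\<forall>s\<ge>0. AE v in lborel. q s v = kinetic s (f s) v) \<and>
     (\<forall>T\<ge>0. \<exists>R. \<forall>s. 0 \<le> s \<longrightarrow> s \<le> T \<longrightarrow> (\<integral>v. \<bar>f s v\<bar> \<partial>lborel) \<le> R) \<and>
     (\<integral>v. f 0 v \<partial>lborel) = 1 \<and> (\<integral>v. \<bar>f 0 v\<bar> \<partial>lborel) \<le> 1"

lemma kinetic_curve_rate:
  assumes "kinetic_curve q f" "0 \<le> s"
  shows "integrable lborel (q s)" and "(\<integral>v. \<bar>q s v\<bar> \<partial>lborel) \<le> 2 * \<mu> * (\<integral>v. \<bar>f s v\<bar> \<partial>lborel)\<^sup>2"
    and "\<phi> \<in> borel_measurable borel \<Longrightarrow> (\<integral>v. q s v * \<phi> v \<partial>lborel) = (\<integral>v. kinetic s (f s) v * \<phi> v \<partial>lborel)"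
proof -
  have f: "integrable lborel (f s)" and qm: "(\<lambda>(s, z). q s z) \<in> borel_measurable (borel \<Otimes>\<^sub>M lborel)"
    and ae: "AE v in lborel. q s v = kinetic s (f s) v"
    using assms by (auto simp: kinetic_curve_def evolves_def)
  have [measurable]: "q s \<in> borel_measurable borel"
    using measurable_compose[OF measurable_Pair1'[of s] qm] by simp
  have k: "integrable lborel (kinetic s (f s))" by (rule integrable_kinetic[OF f])
  then have [measurable]: "kinetic s (f s) \<in> borel_measurable borel" by auto
  show "integrable lborel (q s)"
    using ae k by (subst integrable_cong_AE[where g="kinetic s (f s)"]) auto
  have "(\<integral>v. \<bar>q s v\<bar> \<partial>lborel) = (\<integral>v. \<bar>kinetic s (f s) v\<bar> \<partial>lborel)"
    using ae by (intro integral_cong_AE) auto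
  then show "(\<integral>v. \<bar>q s v\<bar> \<partial>lborel) \<le> 2 * \<mu> * (\<integral>v. \<bar>f s v\<bar> \<partial>lborel)\<^sup>2"
    using kinetic_L1[OF f, of s] by simp
  assume [measurable]: "\<phi> \<in> borel_measurable borel"
  show "(\<integral>v. q s v * \<phi> v \<partial>lborel) = (\<integral>v. kinetic s (f s) v * \<phi> v \<partial>lborel)"
    using ae by (intro integral_cong_AE) auto
qed

lemma kinetic_curve_mass:
  assumes f: "kinetic_curve q f" and t: "0 \<le> t"
  shows "(\<integral>v. f t v \<partial>lborel) = 1"
proof -
  obtain R where R: "\<And>s. 0 \<le> s \<Longrightarrow> s \<le> t \<Longrightarrow> (\<integral>v. \<bar>f s v\<bar> \<partial>lborel) \<le> R"
    using f t unfolding kinetic_curve_def by blast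
  have ev: "evolves lborel q f" using f by (simp add: kinetic_curve_def)
  then have fi: "\<And>s. s \<ge> 0 \<Longrightarrow> integrable lborel (f s)" by (simp add: evolves_def)
  have q: "integrable lborel (q s) \<and> (\<integral>v. \<bar>q s v\<bar> \<partial>lborel) \<le> 2 * \<mu> * R\<^sup>2" if "0 \<le> s" "s \<le> t" for s
  proof -
    have "2 * \<mu> * (\<integral>v. \<bar>f s v\<bar> \<partial>lborel)\<^sup>2 \<le> 2 * \<mu> * R\<^sup>2"
      using R that mu_nonneg by (intro mult_left_mono power_mono) auto
    then show ?thesis using kinetic_curve_rate(1,2)[OF f that(1)] by simp
  qed
  have "(\<integral>v. f t v * 1 \<partial>lborel) - (\<integral>v. f 0 v * 1 \<partial>lborel) = (LINT r:{0..t}|lborel. (\<integral>v. q r v * 1 \<partial>lborel))"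
    by (rule evolves_weak_0(2)[OF lborel.sigma_finite_measure_axioms ev q _ _ t, of "\<lambda>_. 1"]) auto
  also have "\<dots> = (LINT r:{0..t}|lborel. 0)"
  proof (rule set_lebesgue_integral_cong)
    show "\<forall>r. r \<in> {0..t} \<longrightarrow> (\<integral>v. q r v * 1 \<partial>lborel) = 0"
      using kinetic_curve_rate(3)[OF f, of _ "\<lambda>_. 1"] kinetic_mass[OF fi] by auto
  qed simp
  finally show ?thesis using f by (simp add: kinetic_curve_def)
qed

text \<open>The norm \<open>x\<close> of the solution satisfies \<open>x' \<le> \<mu> x\<^sup>2 - \<mu> x\<close> and \<open>x 0 = 1\<close>. No positivity is involved.\<close>

lemma kinetic_curve_L1:
  assumes f: "kinetic_curve q f" and T: "0 \<le> T"
  shows "(\<integral>v. \<bar>f T v\<bar> \<partial>lborel) \<le> 1"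
proof (rule field_le_epsilon)
  fix \<epsilon> :: real assume \<epsilon>: "0 < \<epsilon>"
  obtain R0 where R0: "\<And>s. 0 \<le> s \<Longrightarrow> s \<le> T \<Longrightarrow> (\<integral>v. \<bar>f s v\<bar> \<partial>lborel) \<le> R0"
    using f T unfolding kinetic_curve_def by blast
  define R where "R = \<bar>R0\<bar>"
  have R: "0 \<le> R" "\<And>s. 0 \<le> s \<Longrightarrow> s \<le> T \<Longrightarrow> (\<integral>v. \<bar>f s v\<bar> \<partial>lborel) \<le> R"
    using R0 unfolding R_def by (auto intro: order_trans[OF _ abs_ge_self])
  define K where "K = 2 * \<mu> * R\<^sup>2"
  have K: "0 \<le> K" using mu_nonneg by (simp add: K_def)
  have ev: "evolves lborel q f" using f by (simp add: kinetic_curve_def)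
  then have fi: "\<And>s. s \<ge> 0 \<Longrightarrow> integrable lborel (f s)" by (simp add: evolves_def)
  have q: "integrable lborel (q s) \<and> (\<integral>v. \<bar>q s v\<bar> \<partial>lborel) \<le> K" if "0 \<le> s" "s \<le> T" for s
  proof -
    have "2 * \<mu> * (\<integral>v. \<bar>f s v\<bar> \<partial>lborel)\<^sup>2 \<le> K"
      unfolding K_def using R that mu_nonneg by (intro mult_left_mono power_mono) auto
    then show ?thesis using kinetic_curve_rate(1,2)[OF f that(1)] by simp
  qed
  have lip: "(\<integral>v. \<bar>f t v - f s v\<bar> \<partial>lborel) \<le> K * (t - s)" if "0 \<le> s" "s \<le> t" "t \<le> T" for s t
    using that q by (intro evolves_lipschitz[OF lborel.sigma_finite_measure_axioms ev, of T]) auto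
  define P where "P = (\<lambda>t e. (\<integral>v. \<bar>f t v\<bar> \<partial>lborel) \<le> 1 + e)"
  have "P T \<epsilon>"
  \<comment> \<open>\<open>P t e\<close> bounds the excess of the norm over 1 by \<open>e\<close>.
    \<open>L\<close> bounds the growth rate of the excess, as x (x - 1) \<le> R e when x \<le> 1 +
    e. \<open>C\<close> is the Lipschitz bound 2 \<mu> (R + R) of the quadratic operator times the
    Lipschitz constant \<open>K\<close> of the curve. The step length ensures \<mu> h \<le>
    1.\<close>
  proof (rule one_step_comparison[where L="\<mu> * R" and C="4 * \<mu> * R * K" and ?h0.0="1 / (\<mu> + 1)"])
    show "P 0 0" using f by (simp add: P_def kinetic_curve_def)
  next
    fix s t e :: real
    assume st: "0 \<le> s" "s \<le> t" "t \<le> T" "t - s \<le> 1 / (\<mu> + 1)" and e: "0 \<le> e" "P s e"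
    define h where "h = t - s"
    define x where "x = (\<integral>v. \<bar>f s v\<bar> \<partial>lborel)"
    have x: "0 \<le> x" "x \<le> 1 + e" "x \<le> R" using e R st by (auto simp: x_def P_def)
    have h: "0 \<le> h" "h * (\<mu> + 1) \<le> 1" using st mu_nonneg by (auto simp: h_def field_simps)
    then have \<mu>h: "\<mu> * h \<le> 1" by (simp add: algebra_simps)
    have "(\<integral>v. \<bar>f t v\<bar> \<partial>lborel) \<le> 1 + ((1 + \<mu> * R * h) * e + 4 * \<mu> * R * K * h\<^sup>2)"
    proof (rule integral_abs_le_by_duality)
      show "f t \<in> borel_measurable lborel" using fi[of t] st by auto
      fix \<phi> :: "'z \<Rightarrow> real" assume \<phi>: "\<phi> \<in> borel_measurable lborel" "\<And>x. \<bar>\<phi> x\<bar> \<le> 1"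
      define p where "p = (\<integral>v. f s v * \<phi> v \<partial>lborel)"
      have px: "p \<le> x"
        using abs_integral_mult_le[OF fi[OF st(1)] \<phi>(1), of 1] \<phi>(2) by (simp add: p_def x_def)
      have w: "set_integrable lborel {s<..t} (\<lambda>r. \<integral>v. q r v * \<phi> v \<partial>lborel)"
        "(\<integral>v. f t v * \<phi> v \<partial>lborel) - p = (LINT r:{s<..t}|lborel. (\<integral>v. q r v * \<phi> v \<partial>lborel))"
        unfolding p_def by (rule evolves_weak[OF lborel.sigma_finite_measure_axioms ev q \<phi>(1)]; use \<phi> st in simp)+
      have "(\<integral>v. f t v * \<phi> v \<partial>lborel) - p \<le> (\<mu> * x\<^sup>2 - \<mu> * p + 4 * \<mu> * R * K * h) * (t - s)"
        unfolding w(2)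
      proof (rule set_integral_Ioc_le[OF w(1) st(2)])
        fix r assume r: "s < r" "r \<le> t"
        then have rs: "0 \<le> r" "r \<le> T" using st by auto
        note k1 = integrable_kinetic[OF fi[OF rs(1)], of r] and k2 = integrable_kinetic[OF fi[OF st(1)], of r]
        have "(\<integral>v. q r v * \<phi> v \<partial>lborel) = (\<integral>v. kinetic r (f r) v * \<phi> v \<partial>lborel)"
          using kinetic_curve_rate(3)[OF f rs(1), of \<phi>] \<phi> by simp
        also have "\<dots> = (\<integral>v. kinetic r (f s) v * \<phi> v \<partial>lborel) + (\<integral>v. (kinetic r (f r) v - kinetic r (f s) v) * \<phi> v \<partial>lborel)"
          using k1 k2 \<phi> by (simp add: left_diff_distrib integrable_bounded_mult[where K=1])
        also have "\<dots> \<le> (\<mu> * x\<^sup>2 - \<mu> * p) + 4 * \<mu> * R * K * h"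
        proof (rule add_mono)
          show "(\<integral>v. kinetic r (f s) v * \<phi> v \<partial>lborel) \<le> \<mu> * x\<^sup>2 - \<mu> * p"
            using kinetic_test_le[OF fi[OF st(1)] kinetic_curve_mass[OF f st(1)]] \<phi> by (auto simp: x_def p_def)
          have "(\<integral>v. (kinetic r (f r) v - kinetic r (f s) v) * \<phi> v \<partial>lborel) \<le> (\<integral>v. \<bar>kinetic r (f r) v - kinetic r (f s) v\<bar> \<partial>lborel)"
            using abs_integral_mult_le[OF Bochner_Integration.integrable_diff[OF k1 k2] \<phi>(1), of 1] \<phi> by auto
          also have "\<dots> \<le> 2 * \<mu> * ((\<integral>v. \<bar>f r v\<bar> \<partial>lborel) + (\<integral>v. \<bar>f s v\<bar> \<partial>lborel)) * (\<integral>v. \<bar>f r v - f s v\<bar> \<partial>lborel)"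
            by (rule kinetic_L1_diff[OF fi[OF rs(1)] fi[OF st(1)]])
          also have "\<dots> \<le> 2 * \<mu> * (R + R) * (K * (r - s))"
            using R rs st r mu_nonneg K lip[of s r] by (intro mult_mono add_mono) auto
          also have "\<dots> \<le> 2 * \<mu> * (R + R) * (K * h)"
            using R r mu_nonneg K by (intro mult_left_mono) (auto simp: h_def)
          finally show "(\<integral>v. (kinetic r (f r) v - kinetic r (f s) v) * \<phi> v \<partial>lborel) \<le> 4 * \<mu> * R * K * h"
            by (simp add: algebra_simps)
        qed
        finally show "(\<integral>v. q r v * \<phi> v \<partial>lborel) \<le> \<mu> * x\<^sup>2 - \<mu> * p + 4 * \<mu> * R * K * h" .
      qed
      then have "(\<integral>v. f t v * \<phi> v \<partial>lborel) \<le> (1 - \<mu> * h) * p + \<mu> * h * x\<^sup>2 + 4 * \<mu> * R * K * h\<^sup>2"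
        by (simp add: h_def[symmetric] algebra_simps power2_eq_square)
      \<comment> \<open>The coefficient of \<open>p\<close> is nonnegative, so \<open>p\<close> may
        be replaced by its upper bound \<open>x\<close>: damping of the tested quantity becomes
        damping of the norm.\<close>
      also have "\<dots> \<le> (1 - \<mu> * h) * x + \<mu> * h * x\<^sup>2 + 4 * \<mu> * R * K * h\<^sup>2"
        using mult_left_mono[OF px, of "1 - \<mu> * h"] \<mu>h by simp
      also have "\<dots> = x + \<mu> * h * (x * (x - 1)) + 4 * \<mu> * R * K * h\<^sup>2"
        by (simp add: algebra_simps power2_eq_square)
      also have "\<dots> \<le> 1 + e + \<mu> * h * (R * e) + 4 * \<mu> * R * K * h\<^sup>2"
      proof -
        have "x * (x - 1) \<le> x * e" using x by (intro mult_left_mono) auto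
        also have "\<dots> \<le> R * e" using x e by (intro mult_right_mono) auto
        finally have "\<mu> * h * (x * (x - 1)) \<le> \<mu> * h * (R * e)"
          using h mu_nonneg by (intro mult_left_mono) auto
        then show ?thesis using x by linarith
      qed
      finally show "(\<integral>v. f t v * \<phi> v \<partial>lborel) \<le> 1 + ((1 + \<mu> * R * h) * e + 4 * \<mu> * R * K * h\<^sup>2)"
        by (simp add: algebra_simps)
    qed
    then show "P t ((1 + \<mu> * R * (t - s)) * e + 4 * \<mu> * R * K * (t - s)\<^sup>2)"
      by (simp add: P_def h_def)
  next
    show "0 < 1 / (\<mu> + 1)" "0 \<le> \<mu> * R" "0 \<le> 4 * \<mu> * R * K"
      using R(1) K mu_nonneg by simp_all
  qed (use T \<epsilon> in \<open>auto simp: P_def\<close>)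
  then show "(\<integral>v. \<bar>f T v\<bar> \<partial>lborel) \<le> 1 + \<epsilon>" by (simp add: P_def)
qed

end

section \<open>Comparison of the hierarchies\<close>

lemma sum_pairs_symmetric:
  fixes a :: "nat \<Rightarrow> nat \<Rightarrow> real"
  assumes sym: "\<And>i k. i \<noteq> k \<Longrightarrow> a i k = a k i"
  shows "2 * (\<Sum>i\<in>{1..N}. \<Sum>k\<in>{i<..N}. a i k) = (\<Sum>i\<in>{1..N}. \<Sum>k\<in>{1..N} - {i}. a i k)"
proof -
  let ?I = "{1..N}"
  have 1: "(\<Sum>i\<in>?I. \<Sum>k\<in>{i<..N}. a i k) = (\<Sum>i\<in>?I. \<Sum>k\<in>?I. if i < k then a i k else 0)"
    by (intro sum.cong refl sum.mono_neutral_cong_left) auto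
  have 2: "(\<Sum>i\<in>?I. \<Sum>k\<in>?I. if i < k then a i k else 0) = (\<Sum>i\<in>?I. \<Sum>k\<in>?I. if k < i then a i k else 0)"
    by (subst sum.swap, intro sum.cong refl) (use sym in \<open>auto split: if_splits\<close>)
  have 3: "(\<Sum>k\<in>?I - {i}. a i k) = (\<Sum>k\<in>?I. if i < k then a i k else 0) + (\<Sum>k\<in>?I. if k < i then a i k else 0)"
    if "i \<in> ?I" for i
    unfolding sum.distrib[symmetric]
    by (intro sum.mono_neutral_cong_left) auto
  have "(\<Sum>i\<in>?I. \<Sum>k\<in>?I - {i}. a i k) =
    (\<Sum>i\<in>?I. (\<Sum>k\<in>?I. if i < k then a i k else 0) + (\<Sum>k\<in>?I. if k < i then a i k else 0))"
    by (intro sum.cong refl 3)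
  then show ?thesis using 1 2 by (simp add: sum.distrib)
qed

text \<open>Of the error \<open>3 m j\<^sup>2 / N\<close>, one third is due to the pairs inside \<open>A\<close> and two thirds to replacing \<open>1 / N\<close> by
  \<open>1 / (N - j)\<close> for the pairs that have exactly one member in \<open>A\<close>.\<close>

lemma sum_pairs_split_le:
  fixes a b :: "nat \<Rightarrow> nat \<Rightarrow> real"
  assumes sym: "\<And>i k. i \<noteq> k \<Longrightarrow> a i k = a k i"
    and out: "\<And>i k. i \<in> {1..N} - A \<Longrightarrow> k \<in> {1..N} - A \<Longrightarrow> a i k = 0"
    and bd: "\<And>i k. i \<in> {1..N} \<Longrightarrow> k \<in> {1..N} \<Longrightarrow> i \<noteq> k \<Longrightarrow> \<bar>a i k\<bar> \<le> 2 * m"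
    and A: "A \<subseteq> {1..N}" "card A = j" "0 < j" "j < N"
    and ab: "\<And>i k. i \<in> A \<Longrightarrow> k \<in> {1..N} - A \<Longrightarrow> a i k - b i k \<le> c"
    and m: "0 \<le> m"
  shows "1 / N * (\<Sum>i\<in>{1..N}. \<Sum>k\<in>{i<..N}. a i k) - 1 / real (N - j) * (\<Sum>i\<in>A. \<Sum>k\<in>{1..N} - A. b i k)
    \<le> j * c + 3 * m * (real j)\<^sup>2 / N"
proof -
  let ?I = "{1..N}"
  let ?B = "?I - A"
  have fA: "finite A" using A finite_subset by auto
  have cB: "real (card ({Suc 0..N} - A)) = real N - j"
    using A fA by (simp add: card_Diff_subset of_nat_diff)
  define S where "S = (\<Sum>i\<in>A. \<Sum>k\<in>?B. a i k)"
  define U where "U = (\<Sum>i\<in>A. \<Sum>k\<in>A - {i}. a i k)"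
  have split: "(\<Sum>k\<in>?I - {i}. a i k) = (\<Sum>k\<in>A - {i}. a i k) + (\<Sum>k\<in>?B. a i k)" if "i \<in> A" for i
  proof -
    have I: "?I - {i} = (A - {i}) \<union> ?B" using A that by auto
    show ?thesis unfolding I using fA by (intro sum.union_disjoint) auto
  qed
  have split': "(\<Sum>k\<in>?I - {i}. a i k) = (\<Sum>k\<in>A. a i k)" if "i \<in> ?B" for i
    using A that out by (intro sum.mono_neutral_right) auto
  have "(\<Sum>i\<in>?I. \<Sum>k\<in>?I - {i}. a i k) = (\<Sum>i\<in>A. \<Sum>k\<in>?I - {i}. a i k) + (\<Sum>i\<in>?B. \<Sum>k\<in>?I - {i}. a i k)"
    using A fA by (subst sum.subset_diff[OF A(1)]) auto
  also have "(\<Sum>i\<in>A. \<Sum>k\<in>?I - {i}. a i k) = U + S"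
    unfolding U_def S_def sum.distrib[symmetric] by (intro sum.cong refl split)
  also have "(\<Sum>i\<in>?B. \<Sum>k\<in>?I - {i}. a i k) = (\<Sum>i\<in>?B. \<Sum>k\<in>A. a i k)"
    by (intro sum.cong refl split')
  also have "\<dots> = S"
    unfolding S_def by (subst sum.swap, intro sum.cong refl sym) auto
  \<comment> \<open>\<open>U\<close> runs over ordered pairs inside \<open>A\<close>, hence the
    factor 1/2; each mixed pair occurs once in \<open>S\<close>; pairs outside \<open>A\<close>
    vanish.\<close>
  finally have total: "(\<Sum>i\<in>?I. \<Sum>k\<in>{i<..N}. a i k) = U / 2 + S"
    using sum_pairs_symmetric[of a N, OF sym] by simp
  have "\<bar>U\<bar> \<le> (\<Sum>i\<in>A. \<Sum>k\<in>A - {i}. 2 * m)"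
    unfolding U_def using A by (intro order_trans[OF sum_abs] sum_mono order_trans[OF sum_abs] bd) auto
  also have "\<dots> = j * ((real j - 1) * (2 * m))"
    using A fA by (simp add: of_nat_diff)
  also have "\<dots> \<le> j * (j * (2 * m))"
    using m by (intro mult_left_mono mult_right_mono) auto
  finally have U: "U / 2 \<le> m * (real j)\<^sup>2" by (simp add: power2_eq_square algebra_simps)
  have "\<bar>S\<bar> \<le> (\<Sum>i\<in>A. \<Sum>k\<in>?B. 2 * m)"
    unfolding S_def using A by (intro order_trans[OF sum_abs] sum_mono order_trans[OF sum_abs] bd) auto
  also have "\<dots> = j * ((real N - j) * (2 * m))"
    using A by (simp add: cB)
  finally have S: "\<bar>S\<bar> \<le> 2 * m * j * (real N - j)" by (simp add: algebra_simps)
  have "S - (\<Sum>i\<in>A. \<Sum>k\<in>?B. b i k) = (\<Sum>i\<in>A. \<Sum>k\<in>?B. a i k - b i k)"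
    by (simp add: S_def sum_subtractf)
  also have "\<dots> \<le> (\<Sum>i\<in>A. \<Sum>k\<in>?B. c)"
    by (intro sum_mono ab) auto
  also have "\<dots> = j * ((real N - j) * c)"
    using A by (simp add: cB)
  finally have d: "S - (\<Sum>i\<in>A. \<Sum>k\<in>?B. b i k) \<le> j * ((real N - j) * c)" .
  define M where "M = real N - j"
  have M: "0 < M" "real (N - j) = M" "real N = M + j" using A by (auto simp: M_def of_nat_diff)
  have N0: "0 < M + real j" using M by simp
  have "(S - (\<Sum>i\<in>A. \<Sum>k\<in>?B. b i k)) / M \<le> j * c"
    using d M unfolding M_def[symmetric] by (simp add: pos_divide_le_eq mult_ac)
  then have e1: "S / M - (\<Sum>i\<in>A. \<Sum>k\<in>?B. b i k) / M \<le> j * c" by (simp add: diff_divide_distrib)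
  \<comment> \<open>\<open>q\<close> is the difference of 1 / (N - j) and 1 / N, with M = N -
    j.\<close>
  define q where "q = j / (M * (M + j))"
  have q: "0 \<le> q" using M N0 by (simp add: q_def)
  have "1 / M = 1 / (M + j) + q"
    using M(1) N0 by (simp add: q_def divide_simps)
  then have "S * (1 / M) = S * (1 / (M + j)) + S * q"
    by (simp only: distrib_left)
  then have "S / (M + j) = S / M - S * q"
    by simp
  also have "\<dots> \<le> S / M + (2 * m * j * M) * q"
  proof -
    have "- S \<le> 2 * m * j * M" using S by (simp add: M_def)
    from mult_right_mono[OF this q] show ?thesis by simp
  qed
  also have "(2 * m * j * M) * q = 2 * m * (real j)\<^sup>2 / (M + j)"
    using M(1) by (simp add: q_def power2_eq_square)
  finally have e2: "S / (M + j) \<le> S / M + 2 * m * (real j)\<^sup>2 / (M + j)" .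
  have "(U / 2) / (M + j) \<le> m * (real j)\<^sup>2 / (M + j)"
    using U N0 by (intro divide_right_mono) auto
  with e1 e2 have "(U / 2) / (M + j) + S / (M + j) - (\<Sum>i\<in>A. \<Sum>k\<in>?B. b i k) / M
      \<le> j * c + (2 * m * (real j)\<^sup>2 / (M + j) + m * (real j)\<^sup>2 / (M + j))" by linarith
  also have "2 * m * (real j)\<^sup>2 / (M + j) + m * (real j)\<^sup>2 / (M + j) = 3 * m * (real j)\<^sup>2 / (M + j)"
    by (simp add: add_divide_distrib[symmetric] algebra_simps)
  finally show ?thesis
    unfolding total M(2,3) by (simp add: add_divide_distrib)
qed

text \<open>Marginals are compared by duality. A test function of the particles in \<open>A\<close> is a function of all \<open>N\<close>
  particles that depends on the coordinates in \<open>A\<close> only, so that no marginal has to be formed.\<close>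

definition test_on :: "nat \<Rightarrow> nat set \<Rightarrow> ((nat \<Rightarrow> 'z::euclidean_space) \<Rightarrow> real) \<Rightarrow> bool" where
  "test_on N A \<psi> \<longleftrightarrow> \<psi> \<in> borel_measurable (phase N) \<and> (\<forall>z\<in>space (phase N). \<bar>\<psi> z\<bar> \<le> 1) \<and>
     (\<forall>z\<in>space (phase N). \<forall>z'\<in>space (phase N). (\<forall>i\<in>A. z i = z' i) \<longrightarrow> \<psi> z = \<psi> z')"

text \<open>The pairing of \<psi> with the difference of the two densities. For a function
  \<open>g\<close> of mass 1, its supremum over the test functions on \<open>{1..j}\<close> is the
  L1 distance between the j-particle marginal and the tensor power, by
  \<open>L1_marginal_le_of_gap\<close> and \<open>gap_le_L1_marginal\<close>.\<close>

definition gap :: "nat \<Rightarrow> ((nat \<Rightarrow> 'z::euclidean_space) \<Rightarrow> real) \<Rightarrow> ('z \<Rightarrow> real) \<Rightarrow> ((nat \<Rightarrow> 'z) \<Rightarrow> real) \<Rightarrow> real" where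
  "gap N F g \<psi> = (\<integral>z. F z * \<psi> z \<partial>phase N) - (\<integral>z. tensor g {1..N} z * \<psi> z \<partial>phase N)"

section \<open>The master operator in weak form\<close>

context collision_model
begin

definition master :: "real \<Rightarrow> nat \<Rightarrow> ((nat \<Rightarrow> 'z) \<Rightarrow> real) \<Rightarrow> (nat \<Rightarrow> 'z) \<Rightarrow> real" where
  "master t N F z = 1 / real N * (\<Sum>i\<in>{1..N}. \<Sum>k\<in>{i<..N}. pair_op t i k F z)"

text \<open>After the collision the coordinates in \<open>A\<close> are functions of those in
  \<open>A\<close> and of the colliding pair. This is how the hierarchy climbs by one
  particle.\<close>

lemma pair_op_depends:
  assumes "test_on N A \<psi>" "i \<in> {1..N}" "k \<in> {1..N}" "i \<noteq> k"
    and z: "z \<in> space (phase N)" "z' \<in> space (phase N)" "\<And>l. l \<in> A \<union> {i, k} \<Longrightarrow> z l = z' l"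
  shows "pair_op t i k \<psi> z = pair_op t i k \<psi> z'"
proof -
  have "\<psi> (col t \<omega> i k z) = \<psi> (col t \<omega> i k z')" for \<omega>
  proof -
    have "\<forall>l\<in>A. col t \<omega> i k z l = col t \<omega> i k z' l"
      using z(3) by (auto simp: col_def)
    then show ?thesis
      using assms(1-3) col_space[OF z(1)] col_space[OF z(2)] unfolding test_on_def by blast
  qed
  moreover have "\<psi> z = \<psi> z'"
    using assms(1) z unfolding test_on_def by blast
  ultimately show ?thesis
    using z(3) by (simp add: pair_op_def)
qed

text \<open>A collision between two particles outside \<open>A\<close> leaves the coordinates in
  \<open>A\<close> unchanged.\<close>

lemma pair_op_eq_0:
  assumes "test_on N A \<psi>" "i \<in> {1..N}" "k \<in> {1..N}" "i \<notin> A" "k \<notin> A" and z: "z \<in> space (phase N)"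
  shows "pair_op t i k \<psi> z = 0"
proof -
  have "\<psi> (col t \<omega> i k z) = \<psi> z" for \<omega>
  proof -
    have "\<forall>l\<in>A. col t \<omega> i k z l = z l"
      using assms by (auto simp: col_def)
    then show ?thesis
      using assms(1-3) col_space[OF z] z unfolding test_on_def by blast
  qed
  then show ?thesis by (simp add: pair_op_def)
qed

text \<open>Only the partner \<open>k\<close> is new, since \<open>i\<close> belongs to
  \<open>A\<close> already. Normalized by \<mu>, the gain can be inserted into the bound for the
  next level of the hierarchy.\<close>

lemma test_on_gain:
  assumes \<psi>: "test_on N A \<psi>" and ik: "i \<in> A" "k \<in> {1..N} - A" "A \<subseteq> {1..N}" and \<mu>: "0 < \<mu>"
  shows "test_on N (insert k A) (\<lambda>z. (pair_op t i k \<psi> z + \<mu> * \<psi> z) / \<mu>)"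
  unfolding test_on_def
proof (intro conjI ballI impI)
  have \<psi>': "\<psi> \<in> borel_measurable (phase N)" "\<And>z. z \<in> space (phase N) \<Longrightarrow> \<bar>\<psi> z\<bar> \<le> 1"
    using \<psi> unfolding test_on_def by blast+
  have IK: "i \<in> {1..N}" "k \<in> {1..N}" "i \<noteq> k" using ik by auto
  show "(\<lambda>z. (pair_op t i k \<psi> z + \<mu> * \<psi> z) / \<mu>) \<in> borel_measurable (phase N)"
    using \<psi>'(1) pair_op_meas'[OF \<psi>'(1) IK(1,2), of t] by measurable
  fix z :: "nat \<Rightarrow> 'z" assume z: "z \<in> space (phase N)"
  show "\<bar>(pair_op t i k \<psi> z + \<mu> * \<psi> z) / \<mu>\<bar> \<le> 1"
    using pair_op_bound[OF \<psi>' z IK(1,2), of t] \<mu> by (simp add: abs_divide pos_divide_le_eq)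
  fix z' :: "nat \<Rightarrow> 'z" assume z': "z' \<in> space (phase N)" and eq: "\<forall>l\<in>insert k A. z l = z' l"
  then have "pair_op t i k \<psi> z = pair_op t i k \<psi> z'"
    using ik by (intro pair_op_depends[OF \<psi> IK z z']) blast
  moreover have "\<psi> z = \<psi> z'"
    using \<psi> z z' eq unfolding test_on_def by blast
  ultimately show "(pair_op t i k \<psi> z + \<mu> * \<psi> z) / \<mu> = (pair_op t i k \<psi> z' + \<mu> * \<psi> z') / \<mu>"
    by simp
qed

text \<open>The norm bound is crude, N^2 pairs over N. It affects only errors that are quadratic in
  the time step and disappear in the limit.\<close>

lemma
  assumes F: "integrable (phase N) F"
  shows integrable_master: "integrable (phase N) (master t N F)"
    and master_L1: "(\<integral>z. \<bar>master t N F z\<bar> \<partial>phase N) \<le> 2 * \<mu> * N * (\<integral>z. \<bar>F z\<bar> \<partial>phase N)"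
    and master_adjoint: "\<psi> \<in> borel_measurable (phase N) \<Longrightarrow> (\<And>z. z \<in> space (phase N) \<Longrightarrow> \<bar>\<psi> z\<bar> \<le> 1) \<Longrightarrow>
      (\<integral>z. master t N F z * \<psi> z \<partial>phase N) =
      1 / real N * (\<Sum>i\<in>{1..N}. \<Sum>k\<in>{i<..N}. \<integral>z. F z * pair_op t i k \<psi> z \<partial>phase N)"
proof -
  let ?n = "\<integral>z. \<bar>F z\<bar> \<partial>phase N"
  have p: "integrable (phase N) (pair_op t i k F)" "(\<integral>z. \<bar>pair_op t i k F z\<bar> \<partial>phase N) \<le> 2 * \<mu> * ?n"
    if "i \<in> {1..N}" "k \<in> {i<..N}" for i k
    using that pair_op_L1[OF _ _ _ _ F, of i k t] pair_op_self_adjoint(1)[OF _ _ _ _ F, of i k "\<lambda>_. 0" t] by auto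
  show m: "integrable (phase N) (master t N F)"
    unfolding master_def[abs_def]
    by (intro integrable_mult_right Bochner_Integration.integrable_sum p)
  have "(\<integral>z. \<bar>master t N F z\<bar> \<partial>phase N) \<le> (\<integral>z. 1 / real N * (\<Sum>i\<in>{1..N}. \<Sum>k\<in>{i<..N}. \<bar>pair_op t i k F z\<bar>) \<partial>phase N)"
  proof (rule integral_mono)
    show "integrable (phase N) (\<lambda>z. \<bar>master t N F z\<bar>)" using m by (rule integrable_abs)
    show "integrable (phase N) (\<lambda>z. 1 / real N * (\<Sum>i\<in>{1..N}. \<Sum>k\<in>{i<..N}. \<bar>pair_op t i k F z\<bar>))"
      by (intro integrable_mult_right Bochner_Integration.integrable_sum integrable_abs p)
    show "\<bar>master t N F z\<bar> \<le> 1 / real N * (\<Sum>i\<in>{1..N}. \<Sum>k\<in>{i<..N}. \<bar>pair_op t i k F z\<bar>)" for z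
      unfolding master_def abs_mult
      by (intro mult_mono order_trans[OF sum_abs] sum_mono sum_abs) auto
  qed
  also have "\<dots> = 1 / real N * (\<Sum>i\<in>{1..N}. \<Sum>k\<in>{i<..N}. \<integral>z. \<bar>pair_op t i k F z\<bar> \<partial>phase N)"
    by (subst integral_mult_right_zero, subst Bochner_Integration.integral_sum,
        intro Bochner_Integration.integrable_sum integrable_abs p, simp, simp)
       (intro arg_cong2[where f="(*)"] refl sum.cong Bochner_Integration.integral_sum integrable_abs p | simp)+
  also have "\<dots> \<le> 1 / real N * (\<Sum>i\<in>{1..N}. \<Sum>k\<in>{1..N}. 2 * \<mu> * ?n)"
  proof (intro mult_left_mono sum_mono)
    fix i assume i: "i \<in> {1..N}"
    have "(\<Sum>k\<in>{i<..N}. \<integral>z. \<bar>pair_op t i k F z\<bar> \<partial>phase N) \<le> (\<Sum>k\<in>{i<..N}. 2 * \<mu> * ?n)"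
      by (intro sum_mono p i)
    also have "\<dots> \<le> (\<Sum>k\<in>{1..N}. 2 * \<mu> * ?n)"
      using i mu_nonneg by (intro sum_mono2) auto
    finally show "(\<Sum>k\<in>{i<..N}. \<integral>z. \<bar>pair_op t i k F z\<bar> \<partial>phase N) \<le> (\<Sum>k\<in>{1..N}. 2 * \<mu> * ?n)" .
  qed simp
  also have "\<dots> = 2 * \<mu> * N * ?n" by (cases "N = 0") simp_all
  finally show "(\<integral>z. \<bar>master t N F z\<bar> \<partial>phase N) \<le> 2 * \<mu> * N * ?n" .
  assume \<psi>: "\<psi> \<in> borel_measurable (phase N)" "\<And>z. z \<in> space (phase N) \<Longrightarrow> \<bar>\<psi> z\<bar> \<le> 1"
  have p\<psi>: "integrable (phase N) (\<lambda>z. pair_op t i k F z * \<psi> z)" if "i \<in> {1..N}" "k \<in> {i<..N}" for i k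
    by (intro integrable_bounded_mult[where K=1] p that \<psi>)
  have "(\<integral>z. master t N F z * \<psi> z \<partial>phase N) =
      (\<integral>z. 1 / real N * (\<Sum>i\<in>{1..N}. \<Sum>k\<in>{i<..N}. pair_op t i k F z * \<psi> z) \<partial>phase N)"
    unfolding master_def by (simp add: sum_distrib_right mult.assoc)
  also have "\<dots> = 1 / real N * (\<Sum>i\<in>{1..N}. \<integral>z. (\<Sum>k\<in>{i<..N}. pair_op t i k F z * \<psi> z) \<partial>phase N)"
    unfolding integral_mult_right_zero
    by (subst Bochner_Integration.integral_sum, rule Bochner_Integration.integrable_sum, rule p\<psi>, assumption+, rule refl)
  also have "\<dots> = 1 / real N * (\<Sum>i\<in>{1..N}. \<Sum>k\<in>{i<..N}. \<integral>z. pair_op t i k F z * \<psi> z \<partial>phase N)"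
    by (intro arg_cong2[where f="(*)"] refl sum.cong Bochner_Integration.integral_sum p\<psi>)
  also have "\<dots> = 1 / real N * (\<Sum>i\<in>{1..N}. \<Sum>k\<in>{i<..N}. \<integral>z. F z * pair_op t i k \<psi> z \<partial>phase N)"
    by (intro arg_cong2[where f="(*)"] refl sum.cong pair_op_self_adjoint(2) F \<psi>) auto
  finally show "(\<integral>z. master t N F z * \<psi> z \<partial>phase N) =
      1 / real N * (\<Sum>i\<in>{1..N}. \<Sum>k\<in>{i<..N}. \<integral>z. F z * pair_op t i k \<psi> z \<partial>phase N)" .
qed

end

declare One_nat_def [simp del]

lemma gap_le_2:
  fixes F :: "(nat \<Rightarrow> 'z::euclidean_space) \<Rightarrow> real"
  assumes F: "integrable (phase N) F" "(\<integral>z. \<bar>F z\<bar> \<partial>phase N) \<le> 1"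
    and g: "integrable lborel g" "(\<integral>v. \<bar>g v\<bar> \<partial>lborel) \<le> 1" and \<psi>: "test_on N A \<psi>"
  shows "gap N F g \<psi> \<le> 2"
proof -
  have \<psi>': "\<psi> \<in> borel_measurable (phase N)" "\<And>z. z \<in> space (phase N) \<Longrightarrow> \<bar>\<psi> z\<bar> \<le> 1"
    using \<psi> unfolding test_on_def by blast+
  have "(\<integral>z. \<bar>tensor g {1..N} z\<bar> \<partial>phase N) \<le> 1"
    using g integrable_tensor(3)[of "{1..N}" g] by (simp add: power_le_one)
  then show ?thesis
    using abs_integral_mult_le[OF F(1) \<psi>'] F
      abs_integral_mult_le[OF integrable_tensor(1)[of "{1..N}", OF _ g(1)] \<psi>'] g
    by (auto simp: gap_def)
qed

section \<open>The Euler step and the induction on the size of the cluster\<close>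

context collision_model
begin

definition master_curve :: "nat \<Rightarrow> (real \<Rightarrow> (nat \<Rightarrow> 'z) \<Rightarrow> real) \<Rightarrow> (real \<Rightarrow> (nat \<Rightarrow> 'z) \<Rightarrow> real) \<Rightarrow> bool" where
  "master_curve N q F \<longleftrightarrow> evolves (phase N) q F \<and> (\<forall>s\<ge>0. AE z in phase N. q s z = master s N (F s) z) \<and>
     (\<forall>s\<ge>0. (\<integral>z. \<bar>F s z\<bar> \<partial>phase N) \<le> 1)"

lemma master_curve_rate:
  assumes "master_curve N q F" "0 \<le> s"
  shows "integrable (phase N) (q s)" and "(\<integral>z. \<bar>q s z\<bar> \<partial>phase N) \<le> 2 * \<mu> * N"
    and "\<psi> \<in> borel_measurable (phase N) \<Longrightarrow>
      (\<integral>z. q s z * \<psi> z \<partial>phase N) = (\<integral>z. master s N (F s) z * \<psi> z \<partial>phase N)"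
proof -
  have F: "integrable (phase N) (F s)" "(\<integral>z. \<bar>F s z\<bar> \<partial>phase N) \<le> 1"
    and qm: "(\<lambda>(s, z). q s z) \<in> borel_measurable (borel \<Otimes>\<^sub>M phase N)"
    and ae: "AE z in phase N. q s z = master s N (F s) z"
    using assms by (auto simp: master_curve_def evolves_def)
  have [measurable]: "q s \<in> borel_measurable (phase N)"
    using measurable_compose[OF measurable_Pair1'[of s] qm] by simp
  have k: "integrable (phase N) (master s N (F s))" by (rule integrable_master[OF F(1)])
  then have [measurable]: "master s N (F s) \<in> borel_measurable (phase N)" by (rule borel_measurable_integrable)
  show "integrable (phase N) (q s)"
    using ae k by (subst integrable_cong_AE[where g="master s N (F s)"]) simp_all
  have "(\<integral>z. \<bar>q s z\<bar> \<partial>phase N) = (\<integral>z. \<bar>master s N (F s) z\<bar> \<partial>phase N)"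
    by (rule integral_cong_AE) (use ae in \<open>simp_all, auto\<close>)
  also have "\<dots> \<le> 2 * \<mu> * N * (\<integral>z. \<bar>F s z\<bar> \<partial>phase N)"
    by (rule master_L1[OF F(1)])
  also have "\<dots> \<le> 2 * \<mu> * N * 1"
    using F mu_nonneg by (intro mult_left_mono) auto
  finally show "(\<integral>z. \<bar>q s z\<bar> \<partial>phase N) \<le> 2 * \<mu> * N" by simp
  assume [measurable]: "\<psi> \<in> borel_measurable (phase N)"
  show "(\<integral>z. q s z * \<psi> z \<partial>phase N) = (\<integral>z. master s N (F s) z * \<psi> z \<partial>phase N)"
    by (rule integral_cong_AE) (use ae in \<open>simp_all, auto\<close>)
qed

text \<open>With \<psi>' the normalized gain, the pair operator maps \<psi> to \<mu> \<psi>' - \<mu>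
  \<psi>, and \<open>gap\<close> is linear in the test function. Only the gain is estimated; the
  damping involves the same \<psi> and stays an equality. For \<mu> = 0 there is no normalization,
  but then the operator vanishes.\<close>

lemma gap_pair_op_le:
  assumes F: "integrable (phase N) F" and g: "integrable lborel g"
    and \<psi>: "test_on N A \<psi>" and ik: "i \<in> A" "k \<in> {1..N} - A" "A \<subseteq> {1..N}"
    and X: "\<And>\<psi>'. test_on N (insert k A) \<psi>' \<Longrightarrow> gap N F g \<psi>' \<le> X"
  shows "gap N F g (pair_op t i k \<psi>) \<le> \<mu> * (X - gap N F g \<psi>)"
proof -
  have \<psi>': "\<psi> \<in> borel_measurable (phase N)" "\<And>z. z \<in> space (phase N) \<Longrightarrow> \<bar>\<psi> z\<bar> \<le> 1"
    using \<psi> unfolding test_on_def by blast+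
  have IK: "i \<in> {1..N}" "k \<in> {1..N}" using ik by auto
  note tg = integrable_tensor(1)[of "{1..N}", OF _ g]
  show ?thesis
  proof (cases "\<mu> = 0")
    case True
    have "pair_op t i k \<psi> z = 0" if "z \<in> space (phase N)" for z
      using pair_op_bound[OF \<psi>' that IK, of t] True by simp
    then have "gap N F g (pair_op t i k \<psi>) = 0"
      unfolding gap_def by (simp cong: Bochner_Integration.integral_cong)
    then show ?thesis using True by simp
  next
    case False
    then have \<mu>: "0 < \<mu>" using mu_nonneg by simp
    let ?\<psi>' = "\<lambda>z. (pair_op t i k \<psi> z + \<mu> * \<psi> z) / \<mu>"
    have t': "test_on N (insert k A) ?\<psi>'"
      by (rule test_on_gain[OF \<psi> ik \<mu>])
    then have \<psi>2: "?\<psi>' \<in> borel_measurable (phase N)" "\<And>z. z \<in> space (phase N) \<Longrightarrow> \<bar>?\<psi>' z\<bar> \<le> 1"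
      unfolding test_on_def by blast+
    have eq: "pair_op t i k \<psi> z = \<mu> * ?\<psi>' z - \<mu> * \<psi> z" for z
      using \<mu> by simp
    have lin: "(\<integral>z. H z * pair_op t i k \<psi> z \<partial>phase N) =
      \<mu> * (\<integral>z. H z * ?\<psi>' z \<partial>phase N) - \<mu> * (\<integral>z. H z * \<psi> z \<partial>phase N)" if H: "integrable (phase N) H" for H
    proof -
      have "(\<integral>z. H z * pair_op t i k \<psi> z \<partial>phase N) = (\<integral>z. \<mu> * (H z * ?\<psi>' z) - \<mu> * (H z * \<psi> z) \<partial>phase N)"
        by (intro Bochner_Integration.integral_cong refl, subst eq) (simp add: algebra_simps)
      also have "\<dots> = (\<integral>z. \<mu> * (H z * ?\<psi>' z) \<partial>phase N) - (\<integral>z. \<mu> * (H z * \<psi> z) \<partial>phase N)"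
        by (intro Bochner_Integration.integral_diff integrable_mult_right
            integrable_bounded_mult[OF H \<psi>2] integrable_bounded_mult[OF H \<psi>'])
      finally show ?thesis by (simp only: integral_mult_right_zero)
    qed
    have "gap N F g (pair_op t i k \<psi>) = \<mu> * gap N F g ?\<psi>' - \<mu> * gap N F g \<psi>"
      unfolding gap_def lin[OF F] lin[OF tg, simplified] by (simp add: right_diff_distrib)
    also have "\<dots> \<le> \<mu> * X - \<mu> * gap N F g \<psi>"
      using X[OF t'] \<mu> by (intro diff_right_mono mult_left_mono) auto
    finally show ?thesis by (simp add: right_diff_distrib)
  qed
qed

text \<open>One explicit Euler step of the hierarchy for the set \<open>A\<close>. The tensor power of \<open>f\<close> is expanded to second
  order around time \<open>s\<close> instead of being differentiated.\<close>

lemma gap_one_step: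
  assumes F: "master_curve N q F" and f: "kinetic_curve p f"
    and A: "A \<subseteq> {1..N}" "card A = j" "0 < j" "j < N" and \<psi>: "test_on N A \<psi>"
    and st: "0 \<le> s" "s \<le> t"
    and X: "\<And>k \<psi>'. k \<in> {1..N} - A \<Longrightarrow> test_on N (insert k A) \<psi>' \<Longrightarrow> gap N (F s) (f s) \<psi>' \<le> X"
  shows "gap N (F t) (f t) \<psi> \<le> gap N (F s) (f s) \<psi>
    + (t - s) * (j * (\<mu> * (X - gap N (F s) (f s) \<psi>)) + 3 * \<mu> * (real j)\<^sup>2 / N)
    + (8 * \<mu>\<^sup>2 * (real N)\<^sup>2 + 8 * \<mu>\<^sup>2 * N) * (t - s)\<^sup>2"
proof -
  let ?I = "{1..N}"
  let ?B = "?I - A"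
  define h where "h = t - s"
  have h: "0 \<le> h" using st by (simp add: h_def)
  have t0: "0 \<le> t" using st by simp
  have fA: "finite A" using A finite_subset by auto
  have \<psi>': "\<psi> \<in> borel_measurable (phase N)" "\<And>z. z \<in> space (phase N) \<Longrightarrow> \<bar>\<psi> z\<bar> \<le> 1"
    using \<psi> unfolding test_on_def by blast+
  have \<psi>upd: "\<psi> (z(k := w)) = \<psi> z" if "k \<in> ?B" "z \<in> space (phase N)" for k z w
  proof -
    have "z(k := w) \<in> space (phase N)" "\<forall>i\<in>A. (z(k := w)) i = z i"
      using that by (auto simp: space_PiM PiE_def extensional_def)
    then show ?thesis using \<psi> that(2) unfolding test_on_def by blast
  qed
  have evF: "evolves (phase N) q F" and Fi: "\<And>r. 0 \<le> r \<Longrightarrow> integrable (phase N) (F r)"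
    and F1: "\<And>r. 0 \<le> r \<Longrightarrow> (\<integral>z. \<bar>F r z\<bar> \<partial>phase N) \<le> 1"
    using F by (auto simp: master_curve_def evolves_def)
  have evf: "evolves lborel p f" and fi: "\<And>r. 0 \<le> r \<Longrightarrow> integrable lborel (f r)"
    using f by (auto simp: kinetic_curve_def evolves_def)
  note f1 = kinetic_curve_L1[OF f] and fm = kinetic_curve_mass[OF f]
  have sf: "sigma_finite_measure (phase N :: (nat \<Rightarrow> 'z) measure)" by (rule sigma_finite_PiM_lborel) simp
  have pb: "integrable lborel (p r) \<and> (\<integral>v. \<bar>p r v\<bar> \<partial>lborel) \<le> 2 * \<mu>" if "0 \<le> r" for r
  proof -
    have "2 * \<mu> * (\<integral>v. \<bar>f r v\<bar> \<partial>lborel)\<^sup>2 \<le> 2 * \<mu> * 1"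
      using f1[OF that] mu_nonneg by (intro mult_left_mono power_le_one) auto
    then show ?thesis using kinetic_curve_rate(1,2)[OF f that] by simp
  qed
  have qb: "integrable (phase N) (q r) \<and> (\<integral>z. \<bar>q r z\<bar> \<partial>phase N) \<le> 2 * \<mu> * N" if "0 \<le> r" for r
    using master_curve_rate(1,2)[OF F that] by simp
  have lipf: "(\<integral>v. \<bar>f r v - f s v\<bar> \<partial>lborel) \<le> 2 * \<mu> * h" if "s \<le> r" "r \<le> t" for r
  proof -
    have "(\<integral>v. \<bar>f r v - f s v\<bar> \<partial>lborel) \<le> 2 * \<mu> * (r - s)"
      using that st pb by (intro evolves_lipschitz[OF lborel.sigma_finite_measure_axioms evf, of t]) auto
    also have "\<dots> \<le> 2 * \<mu> * h"
      using that mu_nonneg by (intro mult_left_mono) (auto simp: h_def)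
    finally show ?thesis .
  qed
  have lipF: "(\<integral>z. \<bar>F r z - F s z\<bar> \<partial>phase N) \<le> 2 * \<mu> * N * h" if "s \<le> r" "r \<le> t" for r
  proof -
    have "(\<integral>z. \<bar>F r z - F s z\<bar> \<partial>phase N) \<le> 2 * \<mu> * N * (r - s)"
      using that st qb by (intro evolves_lipschitz[OF sf evF, of t]) auto
    also have "\<dots> \<le> 2 * \<mu> * N * h"
      using that mu_nonneg by (intro mult_left_mono) (auto simp: h_def)
    finally show ?thesis .
  qed
  let ?T = "tensor (f s) ?I"
  have Ti: "integrable (phase N) ?T" by (rule integrable_tensor(1)[OF _ fi[OF st(1)]]) simp
  \<comment> \<open>The state is frozen at time \<open>s\<close> while the collisions keep their
    time \<open>r\<close>: the curves are Lipschitz in time, the rates are only measurable.\<close>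
  define a where "a = (\<lambda>r i k. \<integral>z. F s z * pair_op r i k \<psi> z \<partial>phase N)"
  define b' where "b' = (\<lambda>r i k. \<integral>z. ?T z * pair_op r i k \<psi> z \<partial>phase N)"
  define \<alpha> where "\<alpha> = (\<lambda>r. \<integral>z. q r z * \<psi> z \<partial>phase N)"
  have wF: "set_integrable lborel {s<..t} \<alpha>"
    "(\<integral>z. F t z * \<psi> z \<partial>phase N) - (\<integral>z. F s z * \<psi> z \<partial>phase N) = (LINT r:{s<..t}|lborel. \<alpha> r)"
    unfolding \<alpha>_def using qb st \<psi>'(2)
    by (intro evolves_weak[OF sf evF _ \<psi>'(1), of t "2 * \<mu> * N" s t]; simp)+
  \<comment> \<open>Freezing the state costs the norm 2 \<mu> N of the master operator times the
    Lipschitz bound 2 \<mu> N h.\<close>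
  have \<alpha>: "\<alpha> r \<le> 1 / N * (\<Sum>i\<in>?I. \<Sum>k\<in>{i<..N}. a r i k) + 4 * \<mu>\<^sup>2 * (real N)\<^sup>2 * h" if r: "s < r" "r \<le> t" for r
  proof -
    have r0: "0 \<le> r" using r st by simp
    let ?D = "\<lambda>z. F r z - F s z"
    have Di: "integrable (phase N) ?D" using Fi[OF r0] Fi[OF st(1)] by (rule Bochner_Integration.integrable_diff)
    have pm: "pair_op r i k \<psi> \<in> borel_measurable (phase N)"
        "\<And>z. z \<in> space (phase N) \<Longrightarrow> \<bar>pair_op r i k \<psi> z\<bar> \<le> 2 * \<mu>"
      if "i \<in> ?I" "k \<in> {i<..N}" for i k
    proof -
      have k: "k \<in> ?I" using that by auto
      show "pair_op r i k \<psi> \<in> borel_measurable (phase N)" by (rule pair_op_meas'[OF \<psi>'(1) that(1) k])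
      show "\<And>z. z \<in> space (phase N) \<Longrightarrow> \<bar>pair_op r i k \<psi> z\<bar> \<le> 2 * \<mu>"
        using pair_op_abs_le[OF \<psi>' _ that(1) k] by simp
    qed
    have lin: "(\<integral>z. F r z * pair_op r i k \<psi> z \<partial>phase N) = a r i k + (\<integral>z. ?D z * pair_op r i k \<psi> z \<partial>phase N)"
      if "i \<in> ?I" "k \<in> {i<..N}" for i k
      unfolding a_def left_diff_distrib
      using integrable_bounded_mult[OF Fi[OF r0] pm[OF that]] integrable_bounded_mult[OF Fi[OF st(1)] pm[OF that]]
      by (subst Bochner_Integration.integral_diff) simp_all
    have "\<alpha> r = (\<integral>z. master r N (F r) z * \<psi> z \<partial>phase N)"
      unfolding \<alpha>_def by (rule master_curve_rate(3)[OF F r0 \<psi>'(1)])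
    also have "\<dots> = 1 / N * (\<Sum>i\<in>?I. \<Sum>k\<in>{i<..N}. \<integral>z. F r z * pair_op r i k \<psi> z \<partial>phase N)"
      by (rule master_adjoint[OF Fi[OF r0] \<psi>'])
    also have "\<dots> = 1 / N * (\<Sum>i\<in>?I. \<Sum>k\<in>{i<..N}. a r i k + (\<integral>z. ?D z * pair_op r i k \<psi> z \<partial>phase N))"
      by (intro arg_cong2[where f="(*)"] refl sum.cong lin)
    also have "\<dots> = 1 / N * (\<Sum>i\<in>?I. \<Sum>k\<in>{i<..N}. a r i k) +
        1 / N * (\<Sum>i\<in>?I. \<Sum>k\<in>{i<..N}. \<integral>z. ?D z * pair_op r i k \<psi> z \<partial>phase N)"
      by (simp only: sum.distrib distrib_left)
    also have "1 / N * (\<Sum>i\<in>?I. \<Sum>k\<in>{i<..N}. \<integral>z. ?D z * pair_op r i k \<psi> z \<partial>phase N) =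
        (\<integral>z. master r N ?D z * \<psi> z \<partial>phase N)"
      by (rule master_adjoint[OF Di \<psi>', symmetric])
    also have "\<dots> \<le> 1 * (\<integral>z. \<bar>master r N ?D z\<bar> \<partial>phase N)"
      by (rule order_trans[OF abs_ge_self abs_integral_mult_le[OF integrable_master[OF Di] \<psi>']])
    also have "\<dots> \<le> 2 * \<mu> * N * (\<integral>z. \<bar>?D z\<bar> \<partial>phase N)"
      using master_L1[OF Di] by simp
    also have "\<dots> \<le> 2 * \<mu> * N * (2 * \<mu> * N * h)"
      using lipF r mu_nonneg by (intro mult_left_mono) auto
    finally show ?thesis by (simp add: power2_eq_square algebra_simps)
  qed
  \<comment> \<open>The conclusions of \<open>one_factor_test\<close> as a predicate, so that one
    function per pair can be chosen.\<close>
  define E where "E = (\<lambda>i k \<eta>. \<eta> \<in> borel_measurable borel \<and> (\<forall>v. \<bar>\<eta> v\<bar> \<le> 1) \<and>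
    (\<forall>e. integrable lborel e \<longrightarrow> (\<integral>z. e (z i) * tensor (f s) (?I - {i}) z * \<psi> z \<partial>phase N) = (\<integral>v. e v * \<eta> v \<partial>lborel)) \<and>
    (\<forall>r. b' r i k = (\<integral>v. kinetic r (f s) v * \<eta> v \<partial>lborel)))"
  have ex: "\<exists>\<eta>. E i k \<eta>" if "i \<in> A" "k \<in> ?B" for i k
  proof -
    have ik: "i \<in> ?I" "k \<in> ?I" "i \<noteq> k" using that A by auto
    show ?thesis
      using \<psi>upd[OF that(2)]
      by (rule_tac one_factor_test[OF _ ik fi[OF st(1)] f1[OF st(1)] fm[OF st(1)] \<psi>'])
         (auto simp: E_def b'_def)
  qed
  define \<eta> where "\<eta> = (\<lambda>i k. SOME \<eta>. E i k \<eta>)"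
  have \<eta>: "E i k (\<eta> i k)" if "i \<in> A" "k \<in> ?B" for i k
    unfolding \<eta>_def by (rule someI_ex[OF ex[OF that]])
  define \<beta> where "\<beta> = (\<lambda>i k r. \<integral>v. p r v * \<eta> i k v \<partial>lborel)"
  let ?e = "\<lambda>v. f t v - f s v"
  have ei: "integrable lborel ?e" using fi[OF t0] fi[OF st(1)] by (rule Bochner_Integration.integrable_diff)
  define Tm where "Tm = (\<lambda>i. \<integral>z. ?e (z i) * tensor (f s) (?I - {i}) z * \<psi> z \<partial>phase N)"
  \<comment> \<open>The first-order contribution \<open>Tm i\<close> of the factor \<open>i\<close>
    is the same whichever partner \<open>k\<close> outside \<open>A\<close> is used to write it as a
    collision integral.\<close>
  have \<beta>i: "set_integrable lborel {s<..t} (\<beta> i k)" and Tm: "Tm i = (LINT r:{s<..t}|lborel. \<beta> i k r)"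
    if "i \<in> A" "k \<in> ?B" for i k
  proof -
    have \<eta>m: "\<eta> i k \<in> borel_measurable lborel" "\<And>v. \<bar>\<eta> i k v\<bar> \<le> 1"
      using \<eta>[OF that] by (auto simp: E_def)
    have w: "set_integrable lborel {s<..t} (\<beta> i k)"
      "(\<integral>v. f t v * \<eta> i k v \<partial>lborel) - (\<integral>v. f s v * \<eta> i k v \<partial>lborel) = (LINT r:{s<..t}|lborel. \<beta> i k r)"
      unfolding \<beta>_def using pb st \<eta>m(2)
      by (intro evolves_weak[OF lborel.sigma_finite_measure_axioms evf _ \<eta>m(1), of t "2 * \<mu>" s t]; simp)+
    show "set_integrable lborel {s<..t} (\<beta> i k)" by (rule w(1))
    have "Tm i = (\<integral>v. ?e v * \<eta> i k v \<partial>lborel)"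
      using \<eta>[OF that] ei unfolding E_def Tm_def by blast
    also have "\<dots> = (\<integral>v. f t v * \<eta> i k v \<partial>lborel) - (\<integral>v. f s v * \<eta> i k v \<partial>lborel)"
      unfolding left_diff_distrib
      by (intro Bochner_Integration.integral_diff integrable_bounded_mult[OF fi[OF t0] \<eta>m]
          integrable_bounded_mult[OF fi[OF st(1)] \<eta>m])
    finally show "Tm i = (LINT r:{s<..t}|lborel. \<beta> i k r)" unfolding w(2) .
  qed
  \<comment> \<open>Freezing \<open>f\<close> in the quadratic operator costs 2 \<mu> (1 + 1) times
    2 \<mu> h.\<close>
  have \<beta>: "b' r i k - 8 * \<mu>\<^sup>2 * h \<le> \<beta> i k r" if ik: "i \<in> A" "k \<in> ?B" and r: "s < r" "r \<le> t" for i k r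
  proof -
    have r0: "0 \<le> r" using r st by simp
    have \<eta>m: "\<eta> i k \<in> borel_measurable lborel" "\<And>v. \<bar>\<eta> i k v\<bar> \<le> 1"
      using \<eta>[OF ik] by (auto simp: E_def)
    note k1 = integrable_kinetic[OF fi[OF st(1)], of r] and k2 = integrable_kinetic[OF fi[OF r0], of r]
    have "b' r i k - \<beta> i k r = (\<integral>v. kinetic r (f s) v * \<eta> i k v \<partial>lborel) - (\<integral>v. kinetic r (f r) v * \<eta> i k v \<partial>lborel)"
      using \<eta>[OF ik] kinetic_curve_rate(3)[OF f r0, of "\<eta> i k"] unfolding E_def \<beta>_def by simp
    also have "\<dots> = (\<integral>v. (kinetic r (f s) v - kinetic r (f r) v) * \<eta> i k v \<partial>lborel)"
      unfolding left_diff_distrib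
      by (intro Bochner_Integration.integral_diff[symmetric] integrable_bounded_mult[OF k1 \<eta>m]
          integrable_bounded_mult[OF k2 \<eta>m])
    also have "\<dots> \<le> 1 * (\<integral>v. \<bar>kinetic r (f s) v - kinetic r (f r) v\<bar> \<partial>lborel)"
      by (rule order_trans[OF abs_ge_self abs_integral_mult_le[OF Bochner_Integration.integrable_diff[OF k1 k2] \<eta>m]])
    also have "\<dots> \<le> 2 * \<mu> * ((\<integral>v. \<bar>f s v\<bar> \<partial>lborel) + (\<integral>v. \<bar>f r v\<bar> \<partial>lborel)) * (\<integral>v. \<bar>f s v - f r v\<bar> \<partial>lborel)"
      using kinetic_L1_diff[OF fi[OF st(1)] fi[OF r0], of r] by simp
    also have "\<dots> \<le> 2 * \<mu> * (1 + 1) * (2 * \<mu> * h)"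
      using lipf[of r] r f1[OF r0] f1[OF st(1)] mu_nonneg
      by (intro mult_mono add_mono) (auto simp: abs_minus_commute)
    finally show ?thesis by (simp add: power2_eq_square)
  qed
  \<comment> \<open>Both \<open>f t\<close> and \<open>f s\<close> have mass 1, so their difference
    has mass 0.\<close>
  have Tm0: "Tm i = 0" if "i \<in> ?B" for i
    unfolding Tm_def using that fm[OF t0] fm[OF st(1)] fi[OF t0] fi[OF st(1)] \<psi>upd[OF that] \<psi>'
    by (intro integral_one_factor_eq_0 fi[OF st(1)] ei) auto
  \<comment> \<open>\<open>Tm i\<close> is written as an average over the N - j possible partners,
    which exist because \<open>j < N\<close>. The kinetic collisions then match the mixed pairs of
    the master equation one by one.\<close>
  define \<beta>s where "\<beta>s = (\<lambda>r. 1 / (N - j) * (\<Sum>i\<in>A. \<Sum>k\<in>?B. \<beta> i k r))"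
  have \<beta>si: "set_integrable lborel {s<..t} \<beta>s"
    unfolding \<beta>s_def set_integrable_def real_scaleR_def sum_distrib_left mult.left_commute[of "indicator _ _"]
    using \<beta>i unfolding set_integrable_def real_scaleR_def
    by (intro Bochner_Integration.integrable_sum integrable_mult_right) auto
  have cB: "real (card ?B) = real (N - j)"
    using A fA by (simp add: card_Diff_subset)
  have Nj: "0 < real (N - j)" using A by simp
  have deriv: "(\<integral>z. tensor_deriv (f s) ?e ?I z * \<psi> z \<partial>phase N) = (LINT r:{s<..t}|lborel. \<beta>s r)"
  proof -
    have oi: "integrable (phase N) (\<lambda>z. ?e (z i) * tensor (f s) (?I - {i}) z * \<psi> z)" if "i \<in> ?I" for i
      using that by (intro integrable_bounded_mult[OF _ \<psi>'] integrable_one_factor fi[OF st(1)] ei) auto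
    have "(\<integral>z. tensor_deriv (f s) ?e ?I z * \<psi> z \<partial>phase N) = (\<Sum>i\<in>?I. Tm i)"
      unfolding tensor_deriv_def Tm_def sum_distrib_right
      by (rule Bochner_Integration.integral_sum) (rule oi)
    also have "\<dots> = (\<Sum>i\<in>A. Tm i)"
      using A Tm0 by (intro sum.mono_neutral_right) auto
    also have "\<dots> = (\<Sum>i\<in>A. 1 / (N - j) * (\<Sum>k\<in>?B. Tm i))"
      unfolding sum_constant cB using Nj by (intro sum.cong refl) simp
    also have "\<dots> = (\<Sum>i\<in>A. 1 / (N - j) * (\<Sum>k\<in>?B. LINT r:{s<..t}|lborel. \<beta> i k r))"
      by (intro arg_cong2[where f="(*)"] refl sum.cong Tm)
    also have "\<dots> = (LINT r:{s<..t}|lborel. \<beta>s r)"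
      unfolding \<beta>s_def set_lebesgue_integral_def real_scaleR_def
      using \<beta>i unfolding set_integrable_def real_scaleR_def sum_distrib_left mult.left_commute[of "indicator _ _"]
      by (subst Bochner_Integration.integral_sum, intro Bochner_Integration.integrable_sum integrable_mult_right, simp,
          intro sum.cong refl, subst Bochner_Integration.integral_sum, intro integrable_mult_right, simp) simp
    finally show ?thesis .
  qed
  \<comment> \<open>The second-order remainder is at most N^2 times the squared distance (2 \<mu>
    h)^2.\<close>
  have second: "(\<integral>z. tensor (f t) ?I z * \<psi> z \<partial>phase N) - (\<integral>z. ?T z * \<psi> z \<partial>phase N)
      \<ge> (LINT r:{s<..t}|lborel. \<beta>s r) - 4 * \<mu>\<^sup>2 * (real N)\<^sup>2 * h\<^sup>2"
  proof -
    let ?R = "\<lambda>z. tensor (f t) ?I z - ?T z - tensor_deriv (f s) ?e ?I z"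
    have T1: "integrable (phase N) (tensor (f t) ?I)" by (rule integrable_tensor(1)[OF _ fi[OF t0]]) simp
    have T2: "integrable (phase N) (tensor_deriv (f s) ?e ?I)"
      by (rule integrable_tensor_deriv[OF _ fi[OF st(1)] ei]) simp
    have Ri: "integrable (phase N) ?R"
      by (intro Bochner_Integration.integrable_diff T1 Ti T2)
    have "(\<integral>z. ?R z * \<psi> z \<partial>phase N) = (\<integral>z. tensor (f t) ?I z * \<psi> z \<partial>phase N) - (\<integral>z. ?T z * \<psi> z \<partial>phase N)
        - (\<integral>z. tensor_deriv (f s) ?e ?I z * \<psi> z \<partial>phase N)"
      unfolding left_diff_distrib
      using integrable_bounded_mult[OF T1 \<psi>'] integrable_bounded_mult[OF Ti \<psi>'] integrable_bounded_mult[OF T2 \<psi>']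
      by simp
    moreover have "\<bar>\<integral>z. ?R z * \<psi> z \<partial>phase N\<bar> \<le> 4 * \<mu>\<^sup>2 * (real N)\<^sup>2 * h\<^sup>2"
    proof -
      have "\<bar>\<integral>z. ?R z * \<psi> z \<partial>phase N\<bar> \<le> 1 * (\<integral>z. \<bar>?R z\<bar> \<partial>phase N)"
        by (rule abs_integral_mult_le[OF Ri \<psi>'])
      also have "\<dots> \<le> (real (card ?I))\<^sup>2 * (\<integral>v. \<bar>?e v\<bar> \<partial>lborel)\<^sup>2"
        using tensor_second_order[OF _ fi[OF t0] fi[OF st(1)] f1[OF t0] f1[OF st(1)], of ?I] by simp
      also have "\<dots> \<le> (real (card ?I))\<^sup>2 * (2 * \<mu> * h)\<^sup>2"
        using lipf[of t] st by (intro mult_left_mono power_mono) auto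
      finally show ?thesis by (simp add: power_mult_distrib mult_ac)
    qed
    ultimately show ?thesis unfolding deriv by linarith
  qed
  define c' where "c' = j * (\<mu> * (X - gap N (F s) (f s) \<psi>)) + 3 * \<mu> * (real j)\<^sup>2 / N"
  have bound: "\<alpha> r - \<beta>s r \<le> c' + (4 * \<mu>\<^sup>2 * (real N)\<^sup>2 + 8 * \<mu>\<^sup>2 * N) * h" if r: "s < r" "r \<le> t" for r
  proof -
    have "1 / N * (\<Sum>i\<in>?I. \<Sum>k\<in>{i<..N}. a r i k) - 1 / (N - j) * (\<Sum>i\<in>A. \<Sum>k\<in>?B. b' r i k) \<le> c'"
      unfolding c'_def
    proof (rule sum_pairs_split_le[where a="a r" and b="b' r" and c="\<mu> * (X - gap N (F s) (f s) \<psi>)" and m=\<mu> and A=A and j=j and N=N])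
      show "a r i k = a r k i" if "i \<noteq> k" for i k
        using that by (simp add: a_def pair_op_commute)
      show "a r i k = 0" if "i \<in> ?B" "k \<in> ?B" for i k
      proof -
        have "a r i k = (\<integral>z. 0 \<partial>(phase N :: (nat \<Rightarrow> 'z) measure))"
          unfolding a_def using pair_op_eq_0[OF \<psi>, of i k] that
          by (intro Bochner_Integration.integral_cong) auto
        then show ?thesis by simp
      qed
      show "\<bar>a r i k\<bar> \<le> 2 * \<mu>" if ik: "i \<in> ?I" "k \<in> ?I" for i k
      proof -
        have "\<bar>a r i k\<bar> \<le> (2 * \<mu>) * (\<integral>z. \<bar>F s z\<bar> \<partial>phase N)"
          unfolding a_def using pair_op_abs_le[OF \<psi>' _ ik, of _ r]
          by (intro abs_integral_mult_le Fi[OF st(1)] pair_op_meas'[OF \<psi>'(1) ik]) auto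
        also have "\<dots> \<le> 2 * \<mu> * 1"
          using F1[OF st(1)] mu_nonneg by (intro mult_left_mono) auto
        finally show ?thesis by simp
      qed
      show "a r i k - b' r i k \<le> \<mu> * (X - gap N (F s) (f s) \<psi>)" if "i \<in> A" "k \<in> ?B" for i k
        using gap_pair_op_le[OF Fi[OF st(1)] fi[OF st(1)] \<psi> that A(1) X[OF that(2)], of r]
        unfolding gap_def[of _ _ _ "pair_op r i k \<psi>"] a_def b'_def .
    qed (use A mu_nonneg in auto)
    \<comment> \<open>After averaging over partners one freezing error 8 \<mu>^2 h remains per
      particle of \<open>A\<close>, and there are at most N of them.\<close>
    moreover have "1 / (N - j) * (\<Sum>i\<in>A. \<Sum>k\<in>?B. b' r i k) - \<beta>s r \<le> 8 * \<mu>\<^sup>2 * N * h"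
    proof -
      have "(\<Sum>i\<in>A. \<Sum>k\<in>?B. b' r i k) - (\<Sum>i\<in>A. \<Sum>k\<in>?B. \<beta> i k r) = (\<Sum>i\<in>A. \<Sum>k\<in>?B. b' r i k - \<beta> i k r)"
        by (simp add: sum_subtractf)
      also have "\<dots> \<le> (\<Sum>i\<in>A. \<Sum>k\<in>?B. 8 * \<mu>\<^sup>2 * h)"
        using \<beta>[OF _ _ r] by (intro sum_mono) (auto simp: algebra_simps)
      also have "\<dots> = real (N - j) * (j * (8 * \<mu>\<^sup>2 * h))"
        unfolding sum_constant cB A(2) by simp
      finally have "1 / (N - j) * ((\<Sum>i\<in>A. \<Sum>k\<in>?B. b' r i k) - (\<Sum>i\<in>A. \<Sum>k\<in>?B. \<beta> i k r)) \<le>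
          1 / (N - j) * (real (N - j) * (j * (8 * \<mu>\<^sup>2 * h)))"
        by (intro mult_left_mono) auto
      also have "\<dots> = j * (8 * \<mu>\<^sup>2 * h)" using Nj by simp
      also have "\<dots> \<le> N * (8 * \<mu>\<^sup>2 * h)"
        using A h by (intro mult_right_mono) auto
      finally show ?thesis unfolding \<beta>s_def by (simp add: right_diff_distrib mult_ac)
    qed
    ultimately show ?thesis using \<alpha>[OF r] by (simp add: distrib_right)
  qed
  have "(LINT r:{s<..t}|lborel. \<alpha> r) - (LINT r:{s<..t}|lborel. \<beta>s r) = (LINT r:{s<..t}|lborel. \<alpha> r - \<beta>s r)"
    using wF(1) \<beta>si by (rule set_integral_diff(2)[symmetric])
  also have "\<dots> \<le> (c' + (4 * \<mu>\<^sup>2 * (real N)\<^sup>2 + 8 * \<mu>\<^sup>2 * N) * h) * (t - s)"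
    using bound st by (intro set_integral_Ioc_le set_integral_diff(1) wF(1) \<beta>si) auto
  finally have "gap N (F t) (f t) \<psi> - gap N (F s) (f s) \<psi> \<le>
      (c' + (4 * \<mu>\<^sup>2 * (real N)\<^sup>2 + 8 * \<mu>\<^sup>2 * N) * h) * h + 4 * \<mu>\<^sup>2 * (real N)\<^sup>2 * h\<^sup>2"
    using wF(2) second unfolding gap_def h_def[symmetric] by linarith
  also have "\<dots> = h * c' + (8 * \<mu>\<^sup>2 * (real N)\<^sup>2 + 8 * \<mu>\<^sup>2 * N) * h\<^sup>2"
    by (simp add: power2_eq_square algebra_simps)
  finally show ?thesis unfolding c'_def h_def by linarith
qed

text \<open>The functions \<open>\<phi> j t = D e\<^bsup>6 \<mu> t\<^esup> j\<^sup>2 / N\<close> form a supersolution of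
  \<open>x\<^sub>j' = \<mu> j (x\<^sub>j\<^sub>+\<^sub>1 - x\<^sub>j) + 3 \<mu> j\<^sup>2 / N\<close>, because \<open>j ((j + 1)\<^sup>2 - j\<^sup>2) \<le> 3 j\<^sup>2\<close>. The induction descends from
  \<open>j = N\<close>, where the bound exceeds the trivial bound \<open>2\<close>.\<close>

theorem gap_bound:
  assumes F: "master_curve N q F" and f: "kinetic_curve p f" and D: "2 \<le> D"
    and init: "\<And>A \<psi>. A \<subseteq> {1..N} \<Longrightarrow> A \<noteq> {} \<Longrightarrow> test_on N A \<psi> \<Longrightarrow> gap N (F 0) (f 0) \<psi> \<le> D * (real (card A))\<^sup>2 / N"
    and A: "A \<subseteq> {1..N}" "A \<noteq> {}" and \<psi>: "test_on N A \<psi>" and t: "0 \<le> t"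
  shows "gap N (F t) (f t) \<psi> \<le> D * exp (6 * \<mu> * t) * (real (card A))\<^sup>2 / N"
proof -
  define \<phi> where "\<phi> = (\<lambda>(j::nat) t. D * exp (6 * \<mu> * t) * (real j)\<^sup>2 / N)"
  have N: "0 < real N" using A by auto
  have Fi: "integrable (phase N) (F r)" and F1: "(\<integral>z. \<bar>F r z\<bar> \<partial>phase N) \<le> 1" if "0 \<le> r" for r
    using F that by (auto simp: master_curve_def evolves_def)
  have fi: "integrable lborel (f r)" if "0 \<le> r" for r
    using f that by (auto simp: kinetic_curve_def evolves_def)
  have "\<forall>t\<ge>0. \<forall>A. \<forall>\<psi> :: (nat \<Rightarrow> 'z) \<Rightarrow> real. A \<subseteq> {1..N} \<longrightarrow> card A = N - n \<longrightarrow> test_on N A \<psi> \<longrightarrow> gap N (F t) (f t) \<psi> \<le> \<phi> (N - n) t"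
    if "n < N" for n
    using that
  proof (induction n)
    case 0
    show ?case
    proof (intro allI impI)
      fix t :: real and A and \<psi> :: "(nat \<Rightarrow> 'z) \<Rightarrow> real"
      assume t: "0 \<le> t" and "test_on N A \<psi>"
      then have "gap N (F t) (f t) \<psi> \<le> 2"
        using gap_le_2[OF Fi F1 fi kinetic_curve_L1[OF f]] by blast
      also have "2 \<le> D * 1 * 1" using D by simp
      also have "\<dots> \<le> D * exp (6 * \<mu> * t) * N"
        using D N t mu_nonneg by (intro mult_mono) auto
      also have "\<dots> = \<phi> (N - 0) t"
        using N by (simp add: \<phi>_def power2_eq_square)
      finally show "gap N (F t) (f t) \<psi> \<le> \<phi> (N - 0) t" .
    qed
  next
    case (Suc n)
    define j where "j = N - Suc n"
    have j: "0 < j" "j < N" "N - n = Suc j" using Suc.prems by (auto simp: j_def)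
    \<comment> \<open>The claim covers all clusters of size \<open>j\<close> at once, because the
      next level is needed for \<open>insert k A\<close> with arbitrary \<open>k\<close>.\<close>
    define P where "P = (\<lambda>t e. \<forall>A. \<forall>\<psi> :: (nat \<Rightarrow> 'z) \<Rightarrow> real. A \<subseteq> {1..N} \<longrightarrow> card A = j \<longrightarrow> test_on N A \<psi> \<longrightarrow> gap N (F t) (f t) \<psi> \<le> \<phi> j t + e)"
    define C where "C = 8 * \<mu>\<^sup>2 * (real N)\<^sup>2 + 8 * \<mu>\<^sup>2 * N"
    have PT: "P T \<epsilon>" if T: "0 \<le> T" and \<epsilon>: "0 < \<epsilon>" for T \<epsilon>
    \<comment> \<open>\<open>L\<close> is 0 because the factor 1 - h \<mu> j in front of the
      previous error is at most 1. The step length keeps this factor nonnegative, so that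
      \<open>G\<close> may be replaced by its upper bound.\<close>
    proof (rule one_step_comparison[where L=0 and C=C and ?h0.0="1 / (\<mu> * j + 1)"])
      show "P 0 0"
      proof (unfold P_def, intro allI impI)
        fix A and \<psi> :: "(nat \<Rightarrow> 'z) \<Rightarrow> real" assume "A \<subseteq> {1..N}" "card A = j" "test_on N A \<psi>"
        moreover from this have "A \<noteq> {}" using j by auto
        ultimately show "gap N (F 0) (f 0) \<psi> \<le> \<phi> j 0 + 0"
          using init[of A \<psi>] by (simp add: \<phi>_def)
      qed
    next
      fix s t e :: real
      assume st: "0 \<le> s" "s \<le> t" "t \<le> T" "t - s \<le> 1 / (\<mu> * j + 1)" and e: "0 \<le> e" "P s e"
      define h where "h = t - s"
      have \<mu>j: "0 \<le> \<mu> * j" using mu_nonneg by simp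
      have h: "0 \<le> h" "h * (\<mu> * j + 1) \<le> 1" using st \<mu>j by (auto simp: h_def pos_le_divide_eq)
      then have \<mu>h: "0 \<le> 1 - h * (\<mu> * j)" by (simp add: distrib_left)
      show "P t ((1 + 0 * (t - s)) * e + C * (t - s)\<^sup>2)"
      proof (unfold P_def, intro allI impI)
        fix A and \<psi> :: "(nat \<Rightarrow> 'z) \<Rightarrow> real" assume A: "A \<subseteq> {1..N}" "card A = j" and \<psi>: "test_on N A \<psi>"
        define G where "G = gap N (F s) (f s) \<psi>"
        have G: "G \<le> \<phi> j s + e"
          using e(2) A \<psi> by (simp add: P_def G_def)
        have fA: "finite A" using A finite_subset by auto
        \<comment> \<open>The level j + 1 is controlled at all times without error term and acts as
          a given source.\<close>
        have X: "gap N (F s) (f s) \<psi>' \<le> \<phi> (Suc j) s" if "k \<in> {1..N} - A" "test_on N (insert k A) \<psi>'" for k \<psi>'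
        proof -
          have "insert k A \<subseteq> {1..N}" "card (insert k A) = N - n" using that A fA j by auto
          with Suc.IH[OF Suc_lessD[OF Suc.prems]] st(1) that(2) show ?thesis unfolding j(3) by blast
        qed
        define E where "E = exp (6 * \<mu> * s)"
        have E: "1 \<le> E" using st mu_nonneg by (simp add: E_def)
        have "gap N (F t) (f t) \<psi> \<le> G + h * (j * (\<mu> * (\<phi> (Suc j) s - G)) + 3 * \<mu> * (real j)\<^sup>2 / N) + C * h\<^sup>2"
          using gap_one_step[OF F f A j(1,2) \<psi> st(1,2) X] unfolding G_def h_def C_def by simp
        also have "\<dots> = (1 - h * (\<mu> * j)) * G + h * (\<mu> * j * \<phi> (Suc j) s + 3 * \<mu> * (real j)\<^sup>2 / N) + C * h\<^sup>2"
          by (simp add: algebra_simps)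
        also have "\<dots> \<le> (1 - h * (\<mu> * j)) * (\<phi> j s + e) + h * (\<mu> * j * \<phi> (Suc j) s + 3 * \<mu> * (real j)\<^sup>2 / N) + C * h\<^sup>2"
          using mult_left_mono[OF G \<mu>h] by linarith
        also have "\<dots> = \<phi> j s + h * (\<mu> * j * (\<phi> (Suc j) s - \<phi> j s) + 3 * \<mu> * (real j)\<^sup>2 / N) + (1 - h * (\<mu> * j)) * e + C * h\<^sup>2"
          by (simp add: algebra_simps)
        \<comment> \<open>The exponent 6 \<mu> is spent in two halves: 3 \<mu> on the increment
          between consecutive levels and 3 \<mu> on the remainder term, which is absorbed because
          \<open>D * E\<close> is at least 1.\<close>
        also have "\<dots> \<le> \<phi> j s + h * (6 * \<mu> * \<phi> j s) + e + C * h\<^sup>2"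
        proof -
          have "\<phi> (Suc j) s - \<phi> j s = D * E * (2 * j + 1) / N"
            by (simp add: \<phi>_def E_def diff_divide_distrib[symmetric] power2_eq_square algebra_simps)
          then have "\<mu> * j * (\<phi> (Suc j) s - \<phi> j s) = \<mu> * (D * E) * (real j * (2 * j + 1)) / N"
            by simp
          also have "\<dots> \<le> \<mu> * (D * E) * (3 * (real j)\<^sup>2) / N"
          proof -
            have "real j * (2 * j + 1) \<le> real j * (3 * j)" using j by (intro mult_left_mono) auto
            then show ?thesis
              using mu_nonneg D E N by (intro divide_right_mono mult_left_mono) (auto simp: power2_eq_square)
          qed
          finally have 1: "\<mu> * j * (\<phi> (Suc j) s - \<phi> j s) \<le> 3 * \<mu> * \<phi> j s"
            by (simp add: \<phi>_def E_def mult_ac)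
          have DE: "1 \<le> D * E" using mult_mono[of 1 D 1 E] D E by simp
          have "3 * \<mu> * (real j)\<^sup>2 / N * 1 \<le> 3 * \<mu> * (real j)\<^sup>2 / N * (D * E)"
            using DE mu_nonneg by (intro mult_left_mono) auto
          also have "\<dots> = 3 * \<mu> * \<phi> j s" by (simp add: \<phi>_def E_def mult_ac)
          finally have "\<mu> * j * (\<phi> (Suc j) s - \<phi> j s) + 3 * \<mu> * (real j)\<^sup>2 / N \<le> 6 * \<mu> * \<phi> j s"
            using 1 by simp
          from mult_left_mono[OF this h(1)]
          have "h * (\<mu> * j * (\<phi> (Suc j) s - \<phi> j s) + 3 * \<mu> * (real j)\<^sup>2 / N) \<le> h * (6 * \<mu> * \<phi> j s)" .
          moreover have "(1 - h * (\<mu> * j)) * e \<le> e"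
            using e(1) h(1) \<mu>j by (simp add: left_diff_distrib)
          ultimately show ?thesis by linarith
        qed
        also have "\<phi> j s + h * (6 * \<mu> * \<phi> j s) \<le> \<phi> j t"
        proof -
          have "\<phi> j s + h * (6 * \<mu> * \<phi> j s) = (D * E * (real j)\<^sup>2 / N) * (1 + 6 * \<mu> * h)"
            by (simp add: \<phi>_def E_def algebra_simps add_divide_distrib)
          also have "\<dots> \<le> (D * E * (real j)\<^sup>2 / N) * exp (6 * \<mu> * h)"
            using D E N exp_ge_add_one_self[of "6 * \<mu> * h"] by (intro mult_left_mono) auto
          also have "\<dots> = \<phi> j t"
            by (simp add: \<phi>_def E_def h_def right_diff_distrib exp_diff)
          finally show ?thesis .
        qed
        finally show "gap N (F t) (f t) \<psi> \<le> \<phi> j t + ((1 + 0 * (t - s)) * e + C * (t - s)\<^sup>2)"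
          by (simp add: h_def)
      qed
    next
      show "0 < 1 / (\<mu> * j + 1)" using mu_nonneg by (intro divide_pos_pos add_nonneg_pos) auto
      show "0 \<le> C" by (simp add: C_def)
      show "P s e'" if "0 \<le> s" "P s e" "e \<le> e'" for s e e'
        unfolding P_def
      proof (intro allI impI)
        fix A and \<psi> :: "(nat \<Rightarrow> 'z) \<Rightarrow> real" assume "A \<subseteq> {1..N}" "card A = j" "test_on N A \<psi>"
        then have "gap N (F s) (f s) \<psi> \<le> \<phi> j s + e" using that(2) unfolding P_def by blast
        then show "gap N (F s) (f s) \<psi> \<le> \<phi> j s + e'" using that(3) by simp
      qed
    qed (use T \<epsilon> in auto)
    show ?case
      unfolding j_def[symmetric]
    proof (intro allI impI)
      fix t :: real and A and \<psi> :: "(nat \<Rightarrow> 'z) \<Rightarrow> real"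
      assume t: "0 \<le> t" and A: "A \<subseteq> {1..N}" "card A = j" "test_on N A \<psi>"
      show "gap N (F t) (f t) \<psi> \<le> \<phi> j t"
      proof (rule field_le_epsilon)
        fix \<epsilon> :: real assume "0 < \<epsilon>"
        from PT[OF t this] show "gap N (F t) (f t) \<psi> \<le> \<phi> j t + \<epsilon>"
          unfolding P_def using A by blast
      qed
    qed
  qed
  note * = this
  have fA: "finite A" using A finite_subset by auto
  have "0 < card A" "card A \<le> N" using A fA card_mono[OF _ A(1)] by (auto simp: card_gt_0_iff)
  then have "N - card A < N" "N - (N - card A) = card A" by auto
  with *[of "N - card A"] A \<psi> t have "gap N (F t) (f t) \<psi> \<le> \<phi> (card A) t" by auto
  then show ?thesis by (simp add: \<phi>_def)
qed

end

section \<open>Marginals and initial data\<close>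

text \<open>All factors being equal, relabelling coordinates preserves the product measure. It
  serves both permutations of all particles and enumerations of a subset.\<close>

lemma distr_PiM_lborel_reindex:
  fixes e :: "nat \<Rightarrow> nat"
  assumes "finite I" "bij_betw e I K"
  shows "distr (PiM K (\<lambda>_. lborel)) (PiM I (\<lambda>_. lborel :: 'z::euclidean_space measure)) (\<lambda>z. \<lambda>i\<in>I. z (e i)) =
    PiM I (\<lambda>_. lborel)" (is "distr ?K ?I ?f = _")
proof -
  interpret product_sigma_finite "\<lambda>_::nat. lborel :: 'z measure" by (rule product_sigma_finite_lborel)
  have fK: "finite K" and eK: "e ` I = K" and inj: "inj_on e I"
    using assms by (auto simp: bij_betw_def)
  have f [measurable]: "?f \<in> measurable ?K ?I"
    using eK by (intro measurable_restrict measurable_component_singleton) auto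
  show ?thesis
  proof (rule PiM_eqI)
    fix A :: "nat \<Rightarrow> 'z set" assume A: "\<And>i. i \<in> I \<Longrightarrow> A i \<in> sets lborel"
    define A' where "A' = (\<lambda>k. A (the_inv_into I e k))"
    have A'e: "A' (e i) = A i" if "i \<in> I" for i
      using that inj by (simp add: A'_def the_inv_into_f_f)
    have A': "A' k \<in> sets lborel" if "k \<in> K" for k
      using that eK A A'e by fastforce
    have pre: "?f -` (PiE I A) \<inter> space ?K = PiE K A'"
      using A'e unfolding space_PiM eK[symmetric]
      by (auto simp: PiE_iff)
    have "emeasure (distr ?K ?I ?f) (PiE I A) = emeasure ?K (PiE K A')"
      using A assms(1) by (subst emeasure_distr) (auto simp: pre[symmetric] intro!: sets_PiM_I_finite)
    also have "\<dots> = (\<Prod>k\<in>K. emeasure lborel (A' k))"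
      using A' fK by (intro emeasure_PiM) auto
    also have "\<dots> = (\<Prod>i\<in>I. emeasure lborel (A i))"
      unfolding eK[symmetric] using inj by (simp add: prod.reindex A'e)
    finally show "emeasure (distr ?K ?I ?f) (PiE I A) = (\<Prod>i\<in>I. emeasure lborel (A i))" .
  qed (simp_all add: assms(1))
qed

text \<open>Fubini along the splitting of the coordinates. It identifies the marginals with pairings
  of the full density.\<close>

lemma
  fixes F :: "(nat \<Rightarrow> 'z::euclidean_space) \<Rightarrow> real"
  assumes F: "integrable (phase N) F" and j: "j \<le> N"
  shows integrable_marginal: "integrable (phase j) (marginal N F j)"
    and integral_marginal: "\<phi> \<in> borel_measurable (phase j) \<Longrightarrow> (\<And>x. x \<in> space (phase j) \<Longrightarrow> \<bar>\<phi> x\<bar> \<le> 1) \<Longrightarrow>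
      (\<integral>z. F z * \<phi> (restrict z {1..j}) \<partial>phase N) = (\<integral>x. marginal N F j x * \<phi> x \<partial>phase j)"
proof -
  interpret product_sigma_finite "\<lambda>_::nat. lborel :: 'z measure" by (rule product_sigma_finite_lborel)
  let ?J = "{j+1..N}"
  have IJ: "{1..j} \<union> ?J = {1..N}" "{1..j} \<inter> ?J = {}" using j by auto
  interpret I: finite_product_sigma_finite "\<lambda>_. lborel :: 'z measure" "{1..j}" by standard simp
  interpret J: finite_product_sigma_finite "\<lambda>_. lborel :: 'z measure" ?J by standard simp
  interpret P: pair_sigma_finite "phase j :: (nat \<Rightarrow> 'z) measure" "PiM ?J (\<lambda>_. lborel :: 'z measure)" ..
  have "integrable (phase j \<Otimes>\<^sub>M PiM ?J (\<lambda>_. lborel)) (\<lambda>x. F (merge {1..j} ?J x))"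
  proof -
    have "merge {1..j} ?J \<in> measurable (phase j \<Otimes>\<^sub>M PiM ?J (\<lambda>_. lborel :: 'z measure)) (phase N)"
      using measurable_merge[of "{1..j}" ?J "\<lambda>_::nat. lborel :: 'z measure"] unfolding IJ(1) .
    moreover have "integrable (distr (phase j \<Otimes>\<^sub>M PiM ?J (\<lambda>_. lborel)) (phase N) (merge {1..j} ?J)) F"
      using distr_merge[OF IJ(2)] F unfolding IJ(1) by simp
    ultimately show ?thesis by (rule integrable_distr)
  qed
  from P.integrable_fst'[OF this] show "integrable (phase j) (marginal N F j)"
    by (simp add: marginal_def[abs_def])
  assume \<phi>: "\<phi> \<in> borel_measurable (phase j)" "\<And>x. x \<in> space (phase j) \<Longrightarrow> \<bar>\<phi> x\<bar> \<le> 1"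
  have r: "(\<lambda>z. restrict z {1..j}) \<in> measurable (phase N) (phase j :: (nat \<Rightarrow> 'z) measure)"
    using j by (intro measurable_restrict_subset) auto
  have int: "integrable (phase N) (\<lambda>z. F z * \<phi> (restrict z {1..j}))"
    using measurable_space[OF r] \<phi>(2)
    by (intro integrable_bounded_mult[OF F measurable_compose[OF r \<phi>(1)], where K=1]) blast
  have res: "restrict (merge {1..j} ?J (x, y)) {1..j} = x" if "x \<in> space (phase j)" for x y :: "nat \<Rightarrow> 'z"
    using that by (auto simp: merge_def space_PiM PiE_def extensional_def fun_eq_iff)
  have "(\<integral>z. F z * \<phi> (restrict z {1..j}) \<partial>phase N) =
     (\<integral>x. (\<integral>y. F (merge {1..j} ?J (x, y)) * \<phi> (restrict (merge {1..j} ?J (x, y)) {1..j}) \<partial>PiM ?J (\<lambda>_. lborel)) \<partial>phase j)"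
    using product_integral_fold[OF IJ(2) _ _ int[folded IJ(1)]] unfolding IJ(1) by simp
  also have "\<dots> = (\<integral>x. marginal N F j x * \<phi> x \<partial>phase j)"
    unfolding marginal_def
    by (intro Bochner_Integration.integral_cong refl) (simp only: res integral_mult_left_zero)
  finally show "(\<integral>z. F z * \<phi> (restrict z {1..j}) \<partial>phase N) = (\<integral>x. marginal N F j x * \<phi> x \<partial>phase j)" .
qed

lemma marginal_tensor:
  fixes g :: "'z::euclidean_space \<Rightarrow> real"
  assumes g: "integrable lborel g" "(\<integral>v. g v \<partial>lborel) = 1" and j: "j \<le> N"
  shows "marginal N (tensor g {1..N}) j = tensor g {1..j}"
proof
  fix x :: "nat \<Rightarrow> 'z"
  have "tensor g {1..N} (merge {1..j} {j+1..N} (x, y)) = tensor g {1..j} x * tensor g {j+1..N} y" for y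
  proof -
    have I: "{1..N} = {1..j} \<union> {j+1..N}" using j by auto
    show ?thesis
      unfolding tensor_def I
      by (subst prod.union_disjoint) (auto intro!: arg_cong2[where f="(*)"] prod.cong simp: merge_def)
  qed
  then show "marginal N (tensor g {1..N}) j x = tensor g {1..j} x"
    using g by (simp add: marginal_def integrable_tensor(2))
qed

lemma gap_eq_marginal:
  fixes F :: "(nat \<Rightarrow> 'z::euclidean_space) \<Rightarrow> real"
  assumes F: "integrable (phase N) F" and g: "integrable lborel g" "(\<integral>v. g v \<partial>lborel) = 1" and j: "j \<le> N"
    and \<phi>: "\<phi> \<in> borel_measurable (phase j)" "\<And>x. x \<in> space (phase j) \<Longrightarrow> \<bar>\<phi> x\<bar> \<le> 1"
  shows "gap N F g (\<lambda>z. \<phi> (restrict z {1..j})) = (\<integral>x. (marginal N F j x - tensor g {1..j} x) * \<phi> x \<partial>phase j)"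
proof -
  note tN = integrable_tensor(1)[of "{1..N}", OF _ g(1)] and tj = integrable_tensor(1)[of "{1..j}", OF _ g(1)]
  have "gap N F g (\<lambda>z. \<phi> (restrict z {1..j})) =
      (\<integral>x. marginal N F j x * \<phi> x \<partial>phase j) - (\<integral>x. tensor g {1..j} x * \<phi> x \<partial>phase j)"
    unfolding gap_def using integral_marginal[OF F j \<phi>] integral_marginal[OF tN j \<phi>] marginal_tensor[OF g j]
    by simp
  also have "\<dots> = (\<integral>x. (marginal N F j x - tensor g {1..j} x) * \<phi> x \<partial>phase j)"
    using integrable_bounded_mult[OF integrable_marginal[OF F j] \<phi>] integrable_bounded_mult[OF tj \<phi>]
    by (simp add: left_diff_distrib)
  finally show ?thesis .
qed

lemma L1_norm_eq_integral: "integrable M f \<Longrightarrow> L1_norm M f = ennreal (\<integral>x. \<bar>f x\<bar> \<partial>M)"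
  unfolding L1_norm_def by (intro nn_integral_eq_integral) auto

text \<open>A test function on \<open>phase j\<close> lifts to one on the whole phase space by
  restriction of the argument, so duality applies.\<close>

lemma L1_marginal_le_of_gap:
  fixes F :: "(nat \<Rightarrow> 'z::euclidean_space) \<Rightarrow> real"
  assumes F: "integrable (phase N) F" and g: "integrable lborel g" "(\<integral>v. g v \<partial>lborel) = 1" and j: "j \<le> N"
    and K: "\<And>\<psi>. test_on N {1..j} \<psi> \<Longrightarrow> gap N F g \<psi> \<le> K"
  shows "L1_norm (phase j) (\<lambda>z. marginal N F j z - tensor g {1..j} z) \<le> ennreal K"
proof -
  have d: "integrable (phase j) (\<lambda>z. marginal N F j z - tensor g {1..j} z)"
    using integrable_marginal[OF F j] integrable_tensor(1)[of "{1..j}", OF _ g(1)] by simp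
  have "(\<integral>z. \<bar>marginal N F j z - tensor g {1..j} z\<bar> \<partial>phase j) \<le> K"
  proof (rule integral_abs_le_by_duality)
    fix \<phi> :: "(nat \<Rightarrow> 'z) \<Rightarrow> real" assume \<phi>: "\<phi> \<in> borel_measurable (phase j)" "\<And>x. \<bar>\<phi> x\<bar> \<le> 1"
    have r: "(\<lambda>z. restrict z {1..j}) \<in> measurable (phase N) (phase j :: (nat \<Rightarrow> 'z) measure)"
      using j by (intro measurable_restrict_subset) auto
    have eq: "restrict z {1..j} = restrict z' {1..j}" if "\<forall>i\<in>{1..j}. z i = z' i" for z z' :: "nat \<Rightarrow> 'z"
      using that by (auto simp: fun_eq_iff)
    have "test_on N {1..j} (\<lambda>z. \<phi> (restrict z {1..j}))"
      unfolding test_on_def using \<phi>(2) measurable_compose[OF r \<phi>(1)] eq by metis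
    from K[OF this] show "(\<integral>x. (marginal N F j x - tensor g {1..j} x) * \<phi> x \<partial>phase j) \<le> K"
      using gap_eq_marginal[OF F g j \<phi>(1)] \<phi>(2) by simp
  qed (rule borel_measurable_integrable[OF d])
  then show ?thesis
    by (simp add: L1_norm_eq_integral[OF d] ennreal_leI)
qed

lemma gap_le_L1_marginal:
  fixes F :: "(nat \<Rightarrow> 'z::euclidean_space) \<Rightarrow> real"
  assumes F: "integrable (phase N) F" and g: "integrable lborel g" "(\<integral>v. g v \<partial>lborel) = 1" and j: "j \<le> N"
    and \<psi>: "test_on N {1..j} \<psi>"
  shows "ennreal (gap N F g \<psi>) \<le> L1_norm (phase j) (\<lambda>z. marginal N F j z - tensor g {1..j} z)"
proof -
  \<comment> \<open>A test function on \<open>{1..j}\<close> is read as a function of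
    \<open>j\<close> coordinates by filling the remaining ones with 0.\<close>
  define \<phi> where "\<phi> = (\<lambda>x :: nat \<Rightarrow> 'z. \<psi> (\<lambda>i\<in>{1..N}. if i \<le> j then x i else 0))"
  have d: "integrable (phase j) (\<lambda>z. marginal N F j z - tensor g {1..j} z)"
    using integrable_marginal[OF F j] integrable_tensor(1)[of "{1..j}", OF _ g(1)] by simp
  have \<psi>': "\<psi> \<in> borel_measurable (phase N)" "\<And>z. z \<in> space (phase N) \<Longrightarrow> \<bar>\<psi> z\<bar> \<le> 1"
    using \<psi> unfolding test_on_def by blast+
  have ext: "(\<lambda>x :: nat \<Rightarrow> 'z. \<lambda>i\<in>{1..N}. if i \<le> j then x i else 0) \<in> measurable (phase j) (phase N)"
  proof (intro measurable_restrict)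
    fix i
    show "(\<lambda>x. if i \<le> j then x i else 0) \<in> measurable (phase j) (lborel :: 'z measure)" if "i \<in> {1..N}"
      using that by (cases "i \<le> j") auto
  qed
  have \<phi>: "\<phi> \<in> borel_measurable (phase j)" "\<And>x. x \<in> space (phase j) \<Longrightarrow> \<bar>\<phi> x\<bar> \<le> 1"
    unfolding \<phi>_def using measurable_compose[OF ext \<psi>'(1)] measurable_space[OF ext] \<psi>'(2) by auto
  have "\<psi> z = \<phi> (restrict z {1..j})" if "z \<in> space (phase N)" for z
  proof -
    have "(\<lambda>i\<in>{1..N}. if i \<le> j then restrict z {1..j} i else 0) \<in> space (phase N)"
      by (auto simp: space_PiM)
    moreover have "\<forall>i\<in>{1..j}. z i = (\<lambda>i\<in>{1..N}. if i \<le> j then restrict z {1..j} i else 0) i"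
      using j by auto
    ultimately show ?thesis
      using \<psi> that unfolding test_on_def \<phi>_def by blast
  qed
  then have "gap N F g \<psi> = gap N F g (\<lambda>z. \<phi> (restrict z {1..j}))"
    unfolding gap_def by (simp cong: Bochner_Integration.integral_cong)
  also have "\<dots> = (\<integral>x. (marginal N F j x - tensor g {1..j} x) * \<phi> x \<partial>phase j)"
    by (rule gap_eq_marginal[OF F g j \<phi>])
  also have "\<dots> \<le> 1 * (\<integral>x. \<bar>marginal N F j x - tensor g {1..j} x\<bar> \<partial>phase j)"
    by (rule order_trans[OF abs_ge_self abs_integral_mult_le[OF d \<phi>]])
  finally show ?thesis
    by (simp add: L1_norm_eq_integral[OF d] ennreal_leI)
qed

lemma exists_permutation_onto_initial:
  assumes "A \<subseteq> {1..N}"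
  obtains \<pi> where "\<pi> permutes {1..N}" "\<pi> ` A = {1..card A}"
proof -
  have fA: "finite A" using assms finite_subset by auto
  have c: "card A \<le> N" using card_mono[OF _ assms] by simp
  obtain f where f: "bij_betw f A {1..card A}"
    using fA finite_same_card_bij[of A "{1..card A}"] by auto
  have "card ({1..N} - A) = card ({1..N} - {1..card A})"
    using fA assms c by (simp add: card_Diff_subset)
  then obtain g where g: "bij_betw g ({1..N} - A) ({1..N} - {1..card A})"
    using finite_same_card_bij[of "{1..N} - A" "{1..N} - {1..card A}"] by auto
  define \<pi> where "\<pi> = (\<lambda>x. if x \<in> A then f x else if x \<in> {1..N} then g x else x)"
  have fA': "bij_betw \<pi> A {1..card A}"
    using f by (subst bij_betw_cong[where g=f]) (auto simp: \<pi>_def)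
  have gA': "bij_betw \<pi> ({1..N} - A) ({1..N} - {1..card A})"
    using g by (subst bij_betw_cong[where g=g]) (auto simp: \<pi>_def)
  have "bij_betw \<pi> (A \<union> ({1..N} - A)) ({1..card A} \<union> ({1..N} - {1..card A}))"
    by (rule bij_betw_combine[OF fA' gA']) auto
  moreover have "A \<union> ({1..N} - A) = {1..N}" "{1..card A} \<union> ({1..N} - {1..card A}) = {1..N}"
    using assms c by auto
  ultimately have "bij_betw \<pi> {1..N} {1..N}" by simp
  then have "\<pi> permutes {1..N}"
    using assms by (intro bij_imp_permutes) (auto simp: \<pi>_def)
  moreover have "\<pi> ` A = {1..card A}" using fA' by (simp add: bij_betw_def)
  ultimately show ?thesis by (rule that)
qed

text \<open>A permutation carrying \<open>A\<close> to an initial segment preserves the phase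
  measure, the tensor power and, up to a null set, the density. It is applied at time 0, where
  symmetry is given.\<close>

lemma gap_symmetric:
  fixes F :: "(nat \<Rightarrow> 'z::euclidean_space) \<Rightarrow> real"
  assumes F: "integrable (phase N) F" "symmetric N F" and g: "integrable lborel g"
    and A: "A \<subseteq> {1..N}" and \<psi>: "test_on N A \<psi>"
  obtains \<psi>' where "test_on N {1..card A} \<psi>'" "gap N F g \<psi> = gap N F g \<psi>'"
proof -
  obtain \<pi> where \<pi>: "\<pi> permutes {1..N}" "\<pi> ` A = {1..card A}"
    by (rule exists_permutation_onto_initial[OF A])
  let ?T = "\<lambda>z :: nat \<Rightarrow> 'z. \<lambda>i\<in>{1..N}. z (\<pi> i)"
  have T: "?T z = (\<lambda>i. z (\<pi> i))" if "z \<in> space (phase N)" for z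
    using that permutes_not_in[OF \<pi>(1)] by (auto simp: fun_eq_iff space_PiM PiE_def extensional_def)
  have Tm [measurable]: "?T \<in> measurable (phase N) (phase N)"
    using permutes_in_image[OF \<pi>(1)] by (intro measurable_restrict measurable_component_singleton) auto
  have D: "distr (phase N) (phase N) ?T = phase N"
    using permutes_imp_bij[OF \<pi>(1)] by (intro distr_PiM_lborel_reindex) auto
  have \<psi>': "\<psi> \<in> borel_measurable (phase N)" "\<And>z. z \<in> space (phase N) \<Longrightarrow> \<bar>\<psi> z\<bar> \<le> 1"
    using \<psi> unfolding test_on_def by blast+
  have Fm [measurable]: "F \<in> borel_measurable (phase N)" using F by simp
  note [measurable] = \<psi>'(1) measurable_compose[OF Tm \<psi>'(1)] measurable_compose[OF Tm Fm]
  have tm: "tensor g {1..N} \<in> borel_measurable (phase N)"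
    using integrable_tensor(1)[of "{1..N}", OF _ g] by simp
  have inv: "(\<integral>z. H z * \<psi> z \<partial>phase N) = (\<integral>z. H (?T z) * \<psi> (?T z) \<partial>phase N)"
    if "H \<in> borel_measurable (phase N)" for H
  proof -
    have "(\<integral>z. H z * \<psi> z \<partial>phase N) = (\<integral>z. H z * \<psi> z \<partial>distr (phase N) (phase N) ?T)"
      unfolding D ..
    also have "\<dots> = (\<integral>z. H (?T z) * \<psi> (?T z) \<partial>phase N)"
      by (intro integral_distr Tm borel_measurable_times that \<psi>'(1))
    finally show ?thesis .
  qed
  have "(\<integral>z. F (?T z) * \<psi> (?T z) \<partial>phase N) = (\<integral>z. F z * \<psi> (?T z) \<partial>phase N)"
  proof (rule integral_cong_AE)
    have "AE z in phase N. F (\<lambda>i. z (\<pi> i)) = F z"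
      using F(2) \<pi>(1) by (auto simp: symmetric_def)
    then show "AE z in phase N. F (?T z) * \<psi> (?T z) = F z * \<psi> (?T z)"
      using AE_space by eventually_elim (simp only: T)
  qed measurable
  moreover have "tensor g {1..N} (?T z) = tensor g {1..N} z" for z
  proof -
    have "tensor g {1..N} (?T z) = (\<Prod>i\<in>{1..N}. g (z (\<pi> i)))"
      by (simp add: tensor_def)
    also have "\<dots> = (\<Prod>i\<in>{1..N}. g (z i))"
      by (rule prod.permute[OF \<pi>(1), of "\<lambda>i. g (z i)", unfolded comp_def, symmetric])
    finally show ?thesis by (simp add: tensor_def)
  qed
  ultimately have "gap N F g \<psi> = gap N F g (\<lambda>z. \<psi> (?T z))"
    unfolding gap_def inv[OF Fm] inv[OF tm] by simp
  moreover have "test_on N {1..card A} (\<lambda>z. \<psi> (?T z))"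
    unfolding test_on_def
  proof (intro conjI ballI impI)
    show "(\<lambda>z. \<psi> (?T z)) \<in> borel_measurable (phase N)" by measurable
    fix z :: "nat \<Rightarrow> 'z" assume z: "z \<in> space (phase N)"
    then show "\<bar>\<psi> (?T z)\<bar> \<le> 1" using \<psi>'(2) measurable_space[OF Tm] by blast
    fix z' :: "nat \<Rightarrow> 'z" assume z': "z' \<in> space (phase N)" and eq: "\<forall>i\<in>{1..card A}. z i = z' i"
    have "\<forall>i\<in>A. ?T z i = ?T z' i"
      using eq \<pi>(2) A by auto
    then show "\<psi> (?T z) = \<psi> (?T z')"
      using \<psi> measurable_space[OF Tm z] measurable_space[OF Tm z'] unfolding test_on_def by blast
  qed
  ultimately show ?thesis using that by blast
qed

section \<open>Moebius inversion of the correlation errors\<close>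

lemma sum_Pow_insert:
  fixes f :: "'a set \<Rightarrow> real"
  assumes "finite J" "a \<notin> J"
  shows "(\<Sum>K\<in>Pow (insert a J). f K) = (\<Sum>K\<in>Pow J. f K + f (insert a K))"
proof -
  have inj: "inj_on (insert a) (Pow J)"
    using assms(2) by (intro inj_onI) (metis PowD insert_ident subset_iff)
  have "(\<Sum>K\<in>Pow (insert a J). f K) = (\<Sum>K\<in>Pow J. f K) + (\<Sum>K\<in>insert a ` Pow J. f K)"
    unfolding Pow_insert using assms by (intro sum.union_disjoint) auto
  also have "(\<Sum>K\<in>insert a ` Pow J. f K) = (\<Sum>K\<in>Pow J. f (insert a K))"
    using sum.reindex[OF inj] by simp
  finally show ?thesis by (simp add: sum.distrib)
qed

text \<open>Inclusion-exclusion. When the subsets are split according to whether they contain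
  \<open>a\<close>, the values of \<open>h\<close> at sets without \<open>a\<close> cancel; what is
  left is the claim for \<open>J\<close> and the function \<open>h (insert a _)\<close>, hence the
  generalization over \<open>h\<close>.\<close>

lemma moebius_inversion:
  fixes h :: "'a set \<Rightarrow> real"
  assumes "finite J"
  shows "(\<Sum>K\<in>Pow J. \<Sum>L\<in>Pow K. (-1) ^ card L * h (K - L)) = h J"
  using assms
proof (induction J arbitrary: h)
  case empty
  then show ?case by simp
next
  case (insert a J)
  have "(\<Sum>L\<in>Pow K. (-1) ^ card L * h (K - L)) + (\<Sum>L\<in>Pow (insert a K). (-1) ^ card L * h (insert a K - L))
      = (\<Sum>L\<in>Pow K. (-1) ^ card L * h (insert a (K - L)))" if "K \<in> Pow J" for K
  proof -
    have K: "finite K" "a \<notin> K" using insert that finite_subset by auto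
    have "(\<Sum>L\<in>Pow (insert a K). (-1) ^ card L * h (insert a K - L)) =
       (\<Sum>L\<in>Pow K. (-1) ^ card L * h (insert a (K - L)) - (-1) ^ card L * h (K - L))"
      unfolding sum_Pow_insert[OF K]
    proof (intro sum.cong refl)
      fix L assume "L \<in> Pow K"
      then have "finite L" "a \<notin> L" "insert a K - L = insert a (K - L)" "insert a K - insert a L = K - L"
        using K finite_subset by auto
      then show "(-1) ^ card L * h (insert a K - L) + (-1) ^ card (insert a L) * h (insert a K - insert a L) =
        (-1) ^ card L * h (insert a (K - L)) - (-1) ^ card L * h (K - L)"
        by simp
    qed
    then show ?thesis by (simp add: sum_subtractf)
  qed
  then have "(\<Sum>K\<in>Pow (insert a J). \<Sum>L\<in>Pow K. (-1) ^ card L * h (K - L)) =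
     (\<Sum>K\<in>Pow J. \<Sum>L\<in>Pow K. (-1) ^ card L * h (insert a (K - L)))"
    unfolding sum_Pow_insert[OF insert(1,2)] by (intro sum.cong refl) auto
  also have "\<dots> = h (insert a J)"
    by (rule insert.IH)
  finally show ?case .
qed

text \<open>The correlation error of an arbitrary set of particles; the hypotheses speak about
  initial segments only.\<close>

definition corr_error_on ::
  "nat \<Rightarrow> ((nat \<Rightarrow> 'z::euclidean_space) \<Rightarrow> real) \<Rightarrow> ('z \<Rightarrow> real) \<Rightarrow> nat set \<Rightarrow> (nat \<Rightarrow> 'z) \<Rightarrow> real" where
  "corr_error_on N F g K z = (\<Sum>L\<in>Pow K. (-1) ^ card L * marginal_on N F (K - L) z * tensor g L z)"

text \<open>Moebius inversion for the marginal on \<open>M\<close> times the tensor power on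
  \<open>J - M\<close>: the factor on \<open>J - K\<close> completes the factor on \<open>L\<close>
  to the complement of \<open>K - L\<close>.\<close>

lemma corr_error_on_inversion:
  assumes "finite J"
  shows "(\<Sum>K\<in>Pow J. corr_error_on N F g K z * tensor g (J - K) z) = marginal_on N F J z"
proof -
  let ?h = "\<lambda>M. marginal_on N F M z * tensor g (J - M) z"
  have "corr_error_on N F g K z * tensor g (J - K) z = (\<Sum>L\<in>Pow K. (-1) ^ card L * ?h (K - L))" if K: "K \<in> Pow J" for K
    unfolding corr_error_on_def sum_distrib_right
  proof (intro sum.cong refl)
    fix L assume L: "L \<in> Pow K"
    have "J - (K - L) = L \<union> (J - K)" "L \<inter> (J - K) = {}" "finite L" "finite (J - K)"
      using L K assms by (auto intro: finite_subset)
    then have "tensor g (J - (K - L)) z = tensor g L z * tensor g (J - K) z"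
      by (simp add: tensor_def prod.union_disjoint)
    then show "(-1) ^ card L * marginal_on N F (K - L) z * tensor g L z * tensor g (J - K) z = (-1) ^ card L * ?h (K - L)"
      by simp
  qed
  then have "(\<Sum>K\<in>Pow J. corr_error_on N F g K z * tensor g (J - K) z) =
      (\<Sum>K\<in>Pow J. \<Sum>L\<in>Pow K. (-1) ^ card L * ?h (K - L))"
    by (intro sum.cong refl)
  also have "\<dots> = ?h J" by (rule moebius_inversion[OF assms])
  finally show ?thesis by (simp add: tensor_def)
qed

text \<open>Particles are numbered from 1, list positions from 0.\<close>

abbreviation enum_set :: "nat set \<Rightarrow> nat \<Rightarrow> nat" where
  "enum_set K i \<equiv> sorted_list_of_set K ! (i - 1)"

lemma enum_set_bij:
  assumes "finite K"
  shows "bij_betw (enum_set K) {1..card K} K"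
    and "strict_mono_on {1..card K} (enum_set K)"
proof -
  let ?xs = "sorted_list_of_set K"
  have xs: "length ?xs = card K" "set ?xs = K" "distinct ?xs" "sorted_wrt (<) ?xs"
    using assms by auto
  show sm: "strict_mono_on {1..card K} (enum_set K)"
    using xs by (intro strict_mono_onI sorted_wrt_nth_less[OF xs(4)]) auto
  have "enum_set K ` {1..card K} = (\<lambda>i. ?xs ! i) ` {..<length ?xs}"
  proof -
    have "{..<length ?xs} = (\<lambda>i. i - 1) ` Suc ` {..<card K}"
      unfolding xs(1) image_image by simp
    also have "Suc ` {..<card K} = {1..card K}"
      by (auto simp: image_Suc_lessThan)
    finally show ?thesis by (simp add: image_image)
  qed
  also have "\<dots> = K" using xs(2) by (auto simp: set_conv_nth image_def)
  finally show "bij_betw (enum_set K) {1..card K} K"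
    using sm strict_mono_on_imp_inj_on by (auto simp: bij_betw_def)
qed

lemma sorted_list_of_set_image:
  fixes e :: "nat \<Rightarrow> nat"
  assumes "finite S" "strict_mono_on S e"
  shows "sorted_list_of_set (e ` S) = map e (sorted_list_of_set S)"
proof (rule sorted_distinct_set_unique)
  have "sorted_wrt (<) (sorted_list_of_set S)" by simp
  then have "sorted_wrt (\<lambda>x y. e x < e y) (sorted_list_of_set S)"
    by (rule sorted_wrt_mono_rel[rotated]) (use assms in \<open>auto simp: strict_mono_on_def\<close>)
  then have "sorted_wrt (<) (map e (sorted_list_of_set S))" by (simp add: sorted_wrt_map)
  then show "sorted (map e (sorted_list_of_set S))" "distinct (map e (sorted_list_of_set S))"
    by (auto simp: strict_sorted_iff)
qed (use assms in auto)

text \<open>The enumeration of \<open>K\<close> is increasing, so it commutes with the sorting of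
  subsets and the ordered arguments of \<open>marginal_on\<close> correspond term by term.\<close>

lemma corr_error_on_eq:
  assumes "finite K"
  shows "corr_error_on N F g K z = corr_error N F g (card K) (\<lambda>i\<in>{1..card K}. z (enum_set K i))"
proof -
  let ?m = "card K"
  let ?e = "enum_set K"
  let ?w = "\<lambda>i\<in>{1..?m}. z (?e i)"
  note e = enum_set_bij[OF assms]
  have inj: "inj_on ?e {1..?m}" and im: "?e ` {1..?m} = K"
    using e(1) by (auto simp: bij_betw_def)
  have bij: "bij_betw ((`) ?e) (Pow {1..?m}) (Pow K)"
    using bij_betw_Pow[OF e(1)] .
  have "corr_error_on N F g K z = (\<Sum>L\<in>Pow {1..?m}. (-1) ^ card (?e ` L) * marginal_on N F (K - ?e ` L) z * tensor g (?e ` L) z)"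
    unfolding corr_error_on_def by (rule sum.reindex_bij_betw[OF bij, symmetric])
  also have "\<dots> = (\<Sum>L\<in>Pow {1..?m}. (-1) ^ card L * marginal_on N F ({1..?m} - L) ?w * tensor g L ?w)"
  proof (intro sum.cong refl)
    fix L assume L: "L \<in> Pow {1..?m}"
    have injL: "inj_on ?e L" using inj L inj_on_subset by auto
    have c: "card (?e ` L) = card L" by (rule card_image[OF injL])
    have t: "tensor g (?e ` L) z = tensor g L ?w"
      unfolding tensor_def prod.reindex[OF injL] using L by (auto intro!: prod.cong)
    let ?S = "{1..?m} - L"
    have KS: "K - ?e ` L = ?e ` ?S"
      using inj_on_image_set_diff[OF inj, of "{1..?m}" L] L im by auto
    have injS: "inj_on ?e ?S" using inj by (rule inj_on_subset) auto
    have sl: "sorted_list_of_set (?e ` ?S) = map ?e (sorted_list_of_set ?S)"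
      using e(2) by (intro sorted_list_of_set_image) (auto simp: strict_mono_on_def)
    have "(\<lambda>k\<in>{1..card ?S}. z (sorted_list_of_set (?e ` ?S) ! (k - 1))) =
      (\<lambda>k\<in>{1..card ?S}. ?w (sorted_list_of_set ?S ! (k - 1)))"
    proof (intro restrict_ext)
      fix k assume k: "k \<in> {1..card ?S}"
      then have lt: "k - 1 < length (sorted_list_of_set ?S)" by auto
      then have "sorted_list_of_set ?S ! (k - 1) \<in> {1..?m}"
        using nth_mem[OF lt] by auto
      then show "z (sorted_list_of_set (?e ` ?S) ! (k - 1)) = ?w (sorted_list_of_set ?S ! (k - 1))"
        unfolding sl using lt by simp
    qed
    then have m: "marginal_on N F (K - ?e ` L) z = marginal_on N F ?S ?w"
      unfolding KS marginal_on_def card_image[OF injS] by simp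
    show "(-1) ^ card (?e ` L) * marginal_on N F (K - ?e ` L) z * tensor g (?e ` L) z =
      (-1) ^ card L * marginal_on N F ?S ?w * tensor g L ?w"
      unfolding c t m ..
  qed
  finally show ?thesis by (simp add: corr_error_def)
qed

lemma marginal_on_initial: "z \<in> space (phase j) \<Longrightarrow> marginal_on N F {1..j} z = marginal N F j z"
proof -
  assume "z \<in> space (phase j)"
  then have "(\<lambda>k\<in>{1..j}. z (sorted_list_of_set {1..j} ! (k - 1))) = z"
    by (auto simp: fun_eq_iff space_PiM PiE_def extensional_def atLeastAtMost_upt simp del: upt_Suc)
  then show ?thesis by (simp add: marginal_on_def)
qed

lemma corr_error_meas:
  fixes F :: "(nat \<Rightarrow> 'z::euclidean_space) \<Rightarrow> real"
  assumes F: "integrable (phase N) F" and g: "g \<in> borel_measurable borel" and m: "m \<le> N"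
  shows "corr_error N F g m \<in> borel_measurable (phase m)"
  unfolding corr_error_def[abs_def]
proof (intro borel_measurable_sum borel_measurable_times borel_measurable_const)
  fix L assume L: "L \<in> Pow {1..m}"
  have comp: "(\<lambda>z :: nat \<Rightarrow> 'z. z i) \<in> borel_measurable (phase m)" if "i \<in> {1..m}" for i
    using measurable_component_singleton[OF that, of "\<lambda>_. lborel"] by simp
  show "tensor g L \<in> borel_measurable (phase m)"
    unfolding tensor_def[abs_def] using L
    by (intro borel_measurable_prod measurable_compose[OF comp g]) auto
  let ?S = "{1..m} - L"
  have c: "card ?S \<le> N" using card_mono[of "{1..m}" ?S] m by auto
  have "(\<lambda>z :: nat \<Rightarrow> 'z. \<lambda>k\<in>{1..card ?S}. z (sorted_list_of_set ?S ! (k - 1))) \<in> measurable (phase m) (phase (card ?S))"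
  proof (intro measurable_restrict)
    fix k assume k: "k \<in> {1..card ?S}"
    then have lt: "k - 1 < length (sorted_list_of_set ?S)" by auto
    then have "sorted_list_of_set ?S ! (k - 1) \<in> {1..m}"
      using nth_mem[OF lt] by auto
    then show "(\<lambda>z :: nat \<Rightarrow> 'z. z (sorted_list_of_set ?S ! (k - 1))) \<in> measurable (phase m) lborel"
      by (rule measurable_component_singleton)
  qed
  then show "marginal_on N F ?S \<in> borel_measurable (phase m)"
    unfolding marginal_on_def[abs_def]
    by (rule measurable_compose) (use integrable_marginal[OF F c] in auto)
qed

text \<open>The particles outside \<open>K\<close> factor out and contribute at most 1; enumerating
  \<open>K\<close> preserves Lebesgue measure.\<close>

lemma L1_corr_error_on:
  fixes F :: "(nat \<Rightarrow> 'z::euclidean_space) \<Rightarrow> real"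
  assumes F: "integrable (phase N) F" and g: "integrable lborel g" "(\<integral>v. \<bar>g v\<bar> \<partial>lborel) \<le> 1"
    and j: "j \<le> N" and K: "K \<subseteq> {1..j}"
  shows "L1_norm (phase j) (\<lambda>z. corr_error_on N F g K z * tensor g ({1..j} - K) z) \<le>
    L1_norm (phase (card K)) (corr_error N F g (card K))"
proof -
  interpret product_sigma_finite "\<lambda>_::nat. lborel :: 'z measure" by (rule product_sigma_finite_lborel)
  have fK: "finite K" using K finite_subset by auto
  have cK: "card K \<le> N" using card_mono[OF _ K] j by simp
  let ?J = "{1..j} - K"
  have IJ: "K \<union> ?J = {1..j}" "K \<inter> ?J = {}" using K by auto
  interpret K: finite_product_sigma_finite "\<lambda>_::nat. lborel :: 'z measure" K by standard (rule fK)
  interpret J: finite_product_sigma_finite "\<lambda>_::nat. lborel :: 'z measure" ?J by standard simp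
  let ?R = "\<lambda>z :: nat \<Rightarrow> 'z. \<lambda>i\<in>{1..card K}. z (enum_set K i)"
  let ?c = "corr_error N F g (card K)"
  have eK: "enum_set K i \<in> K" if "i \<in> {1..card K}" for i
    using bij_betwE[OF enum_set_bij(1)[OF fK]] that by blast
  have gm: "g \<in> borel_measurable borel" using g by auto
  have cm: "?c \<in> borel_measurable (phase (card K))" by (rule corr_error_meas[OF F gm cK])
  have R: "?R \<in> measurable (PiM I (\<lambda>_. lborel)) (phase (card K))" if "K \<subseteq> I" for I
    using eK that by (intro measurable_restrict measurable_component_singleton) blast
  have t: "tensor g ?J \<in> borel_measurable (PiM I (\<lambda>_. lborel))" if "?J \<subseteq> I" for I
  proof -
    have "(\<lambda>z :: nat \<Rightarrow> 'z. z i) \<in> borel_measurable (PiM I (\<lambda>_. lborel))" if "i \<in> I" for i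
      using measurable_component_singleton[OF that, of "\<lambda>_. lborel"] by simp
    with that show ?thesis
      unfolding tensor_def[abs_def] by (intro borel_measurable_prod measurable_compose[OF _ gm]) auto
  qed
  have m1: "(\<lambda>z. ennreal \<bar>?c (?R z)\<bar>) \<in> borel_measurable (PiM I (\<lambda>_. lborel))" if "K \<subseteq> I" for I
    using measurable_compose[OF R[OF that] cm] by measurable
  have m2: "(\<lambda>z. ennreal \<bar>tensor g ?J z\<bar>) \<in> borel_measurable (PiM I (\<lambda>_. lborel))" if "?J \<subseteq> I" for I
    using t[OF that] by measurable
  have "L1_norm (phase j) (\<lambda>z. corr_error_on N F g K z * tensor g ?J z) =
      (\<integral>\<^sup>+z. ennreal \<bar>?c (?R z)\<bar> * ennreal \<bar>tensor g ?J z\<bar> \<partial>PiM (K \<union> ?J) (\<lambda>_. lborel))"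
    unfolding L1_norm_def IJ(1) by (simp add: corr_error_on_eq[OF fK] abs_mult ennreal_mult)
  also have "\<dots> = (\<integral>\<^sup>+x. (\<integral>\<^sup>+y. ennreal \<bar>?c (?R (merge K ?J (x, y)))\<bar> * ennreal \<bar>tensor g ?J (merge K ?J (x, y))\<bar>
      \<partial>PiM ?J (\<lambda>_. lborel)) \<partial>PiM K (\<lambda>_. lborel))"
    using m1[of "K \<union> ?J"] m2[of "K \<union> ?J"]
    by (intro product_nn_integral_fold IJ(2) fK borel_measurable_times_ennreal) auto
  also have "\<dots> = (\<integral>\<^sup>+x. (\<integral>\<^sup>+y. ennreal \<bar>?c (?R x)\<bar> * ennreal \<bar>tensor g ?J y\<bar> \<partial>PiM ?J (\<lambda>_. lborel)) \<partial>PiM K (\<lambda>_. lborel))"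
  proof -
    have "?R (merge K ?J (x, y)) = ?R x" "tensor g ?J (merge K ?J (x, y)) = tensor g ?J y" for x y
      using eK by (auto simp: merge_def fun_eq_iff intro!: tensor_cong)
    then show ?thesis by simp
  qed
  also have "\<dots> = (\<integral>\<^sup>+x. ennreal \<bar>?c (?R x)\<bar> \<partial>PiM K (\<lambda>_. lborel)) * (\<integral>\<^sup>+y. ennreal \<bar>tensor g ?J y\<bar> \<partial>PiM ?J (\<lambda>_. lborel))"
    using m1[of K] m2[of ?J] by (simp add: nn_integral_cmult nn_integral_multc)
  also have "(\<integral>\<^sup>+y. ennreal \<bar>tensor g ?J y\<bar> \<partial>PiM ?J (\<lambda>_. lborel)) \<le> 1"
  proof -
    have "(\<integral>\<^sup>+y. ennreal \<bar>tensor g ?J y\<bar> \<partial>PiM ?J (\<lambda>_. lborel)) = ennreal (\<integral>y. \<bar>tensor g ?J y\<bar> \<partial>PiM ?J (\<lambda>_. lborel))"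
      using integrable_tensor(1)[of ?J, OF _ g(1)] by (intro nn_integral_eq_integral) auto
    also have "\<dots> \<le> 1"
      using integrable_tensor(3)[of ?J, OF _ g(1)] g(2) by (simp add: power_le_one)
    finally show ?thesis .
  qed
  also have "(\<integral>\<^sup>+x. ennreal \<bar>?c (?R x)\<bar> \<partial>PiM K (\<lambda>_. lborel)) * 1 = L1_norm (phase (card K)) ?c"
  proof -
    have "L1_norm (phase (card K)) ?c = (\<integral>\<^sup>+x. ennreal \<bar>?c x\<bar> \<partial>distr (PiM K (\<lambda>_. lborel)) (phase (card K)) ?R)"
      unfolding L1_norm_def distr_PiM_lborel_reindex[OF finite_atLeastAtMost enum_set_bij(1)[OF fK]] ..
    also have "\<dots> = (\<integral>\<^sup>+x. ennreal \<bar>?c (?R x)\<bar> \<partial>PiM K (\<lambda>_. lborel))"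
      using cm by (intro nn_integral_distr R) auto
    finally show ?thesis by simp
  qed
  finally show ?thesis by (simp add: mult_left_mono)
qed

lemma L1_norm_sum_le:
  assumes "\<And>i. i \<in> A \<Longrightarrow> f i \<in> borel_measurable M"
  shows "L1_norm M (\<lambda>z. \<Sum>i\<in>A. f i z) \<le> (\<Sum>i\<in>A. L1_norm M (f i))"
proof -
  have "L1_norm M (\<lambda>z. \<Sum>i\<in>A. f i z) \<le> (\<integral>\<^sup>+z. (\<Sum>i\<in>A. ennreal \<bar>f i z\<bar>) \<partial>M)"
    unfolding L1_norm_def by (intro nn_integral_mono) (simp add: sum_ennreal sum_abs ennreal_leI)
  also have "\<dots> = (\<Sum>i\<in>A. L1_norm M (f i))"
    unfolding L1_norm_def using assms by (intro nn_integral_sum) auto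
  finally show ?thesis .
qed

text \<open>In the inversion formula the empty set contributes the tensor power itself, as
  \<open>F\<close> has mass 1. The other sets are grouped by size.\<close>

lemma L1_marginal_le_sum_corr_error:
  fixes F :: "(nat \<Rightarrow> 'z::euclidean_space) \<Rightarrow> real"
  assumes F: "prob_density (phase N) F" and g: "integrable lborel g" "(\<integral>v. \<bar>g v\<bar> \<partial>lborel) \<le> 1"
    and j: "j \<le> N"
  shows "L1_norm (phase j) (\<lambda>z. marginal N F j z - tensor g {1..j} z) \<le>
    (\<Sum>k=1..j. of_nat (j choose k) * L1_norm (phase k) (corr_error N F g k))"
proof -
  have Fi: "integrable (phase N) F" using F by (simp add: prob_density_def)
  have gm: "g \<in> borel_measurable borel" using g by auto
  let ?P = "Pow {1..j} - {{}}"
  let ?E = "\<lambda>K z. corr_error_on N F g K z * tensor g ({1..j} - K) z"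
  have "marginal N F j z - tensor g {1..j} z = (\<Sum>K\<in>?P. ?E K z)" if "z \<in> space (phase j)" for z
  proof -
    have "marginal N F j z = (\<Sum>K\<in>Pow {1..j}. ?E K z)"
      using corr_error_on_inversion[of "{1..j}" N F g z] marginal_on_initial[OF that, of N F] by simp
    also have "\<dots> = ?E {} z + (\<Sum>K\<in>?P. ?E K z)"
      by (rule sum.remove) auto
    also have "?E {} z = tensor g {1..j} z"
      using marginal_on_empty[OF F, of z] by (simp add: corr_error_on_def tensor_def)
    finally show ?thesis by simp
  qed
  then have "L1_norm (phase j) (\<lambda>z. marginal N F j z - tensor g {1..j} z) = L1_norm (phase j) (\<lambda>z. \<Sum>K\<in>?P. ?E K z)"
    unfolding L1_norm_def by (intro nn_integral_cong) simp
  also have "\<dots> \<le> (\<Sum>K\<in>?P. L1_norm (phase j) (?E K))"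
  proof (rule L1_norm_sum_le)
    fix K assume "K \<in> ?P"
    then have K: "K \<subseteq> {1..j}" "finite K" using finite_subset by auto
    have cK: "card K \<le> N" using card_mono[OF _ K(1)] j by simp
    have eK: "enum_set K i \<in> {1..j}" if "i \<in> {1..card K}" for i
      using bij_betwE[OF enum_set_bij(1)[OF K(2)]] that K by blast
    have "(\<lambda>z :: nat \<Rightarrow> 'z. \<lambda>i\<in>{1..card K}. z (enum_set K i)) \<in> measurable (phase j) (phase (card K))"
      using eK by (intro measurable_restrict measurable_component_singleton) blast
    from measurable_compose[OF this corr_error_meas[OF Fi gm cK]]
    have "corr_error_on N F g K \<in> borel_measurable (phase j)"
      unfolding corr_error_on_eq[OF K(2), abs_def] .
    moreover have "tensor g ({1..j} - K) \<in> borel_measurable (phase j)"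
    proof -
      have "(\<lambda>z :: nat \<Rightarrow> 'z. z i) \<in> borel_measurable (phase j)" if "i \<in> {1..j}" for i
        using measurable_component_singleton[OF that, of "\<lambda>_. lborel"] by simp
      then show ?thesis
        unfolding tensor_def[abs_def] by (intro borel_measurable_prod measurable_compose[OF _ gm]) auto
    qed
    ultimately show "?E K \<in> borel_measurable (phase j)" by measurable
  qed
  also have "\<dots> \<le> (\<Sum>K\<in>?P. L1_norm (phase (card K)) (corr_error N F g (card K)))"
    by (intro sum_mono L1_corr_error_on[OF Fi g j]) auto
  also have "\<dots> = (\<Sum>k=1..j. \<Sum>K\<in>{K \<in> ?P. card K = k}. L1_norm (phase (card K)) (corr_error N F g (card K)))"
  proof (rule sum.group[symmetric])
    show "card ` ?P \<subseteq> {1..j}"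
    proof (rule image_subsetI)
      fix K assume K: "K \<in> ?P"
      then have "finite K" "K \<noteq> {}" using finite_subset by auto
      moreover have "card K \<le> card {1..j}"
        using K by (intro card_mono finite_atLeastAtMost) auto
      ultimately show "card K \<in> {1..j}" by (simp add: One_nat_def Suc_le_eq card_gt_0_iff)
    qed
  qed auto
  also have "\<dots> = (\<Sum>k=1..j. of_nat (j choose k) * L1_norm (phase k) (corr_error N F g k))"
  proof (rule sum.cong[OF refl])
    fix k assume k: "k \<in> {1..j}"
    have "{K \<in> ?P. card K = k} = {K. K \<subseteq> {1..j} \<and> card K = k}" using k by auto
    then have "card {K \<in> ?P. card K = k} = j choose k" using n_subsets[of "{1..j}" k] by simp
    then show "(\<Sum>K\<in>{K \<in> ?P. card K = k}. L1_norm (phase (card K)) (corr_error N F g (card K))) =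
      of_nat (j choose k) * L1_norm (phase k) (corr_error N F g k)"
      by (simp add: sum_constant)
  qed
  finally show ?thesis .
qed

section \<open>The constants and the bound at time 0\<close>

lemma exp1_ge_1: "1 \<le> exp (1::real)" "1 \<le> 2 * exp (1::real)"
proof -
  show "1 \<le> exp (1::real)" by simp
  then show "1 \<le> 2 * exp (1::real)" by linarith
qed

text \<open>A crude bound, enough to make the denominator \<open>C1 - 2\<close> in \<open>B2\<close>
  positive and the rate \<open>D1\<close> at least 3. The logarithm in the denominator has absolute
  value at most x + 2 x^2 < 1 at x = 1 / (24 e).\<close>

lemma C1_ge_64: "64 \<le> C1"
proof -
  define x :: real where "x = 1 / (24 * exp 1)"
  have x: "0 < x" "x \<le> 1 / 24"
    unfolding x_def using exp1_ge_1(1) by (auto intro!: divide_left_mono)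
  have "ln (1 - x) < 0" using x by simp
  moreover have "- x - 2 * x\<^sup>2 \<le> ln (1 - x)"
    using x by (intro ln_one_minus_pos_lower_bound) auto
  moreover have "x\<^sup>2 \<le> 1 / 24"
    using mult_mono[of x 1 x "1 / 24"] x by (simp add: power2_eq_square)
  ultimately have l: "0 < \<bar>ln (1 - x)\<bar>" "\<bar>ln (1 - x)\<bar> \<le> 1" using x by auto
  define p :: real where "p = (2 * exp 1) powr (1 / (12 * exp 1) + 1)"
  have p: "1 \<le> p"
    unfolding p_def by (intro ge_one_powr_ge_zero exp1_ge_1(2)) auto
  have "64 * 1 \<le> 64 * p / 1" using p by simp
  also have "\<dots> \<le> 64 * p / \<bar>ln (1 - x)\<bar>"
    using p l by (intro divide_left_mono) auto
  also have "\<dots> = C1" by (simp add: C1_def x_def p_def)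
  finally show ?thesis by simp
qed

lemma C2_ge: "0 \<le> C0 \<Longrightarrow> 16 * C0 \<le> C2 C0"
proof -
  assume "0 \<le> C0"
  have "1 \<le> (2 * exp (1::real)) powr (1 + 1 / (12 * exp 1))"
    by (intro ge_one_powr_ge_zero exp1_ge_1(2)) auto
  then have "16 * 1 * C0 \<le> 16 * (2 * exp 1) powr (1 + 1 / (12 * exp 1)) * C0"
    using \<open>0 \<le> C0\<close> by (intro mult_right_mono) auto
  then show ?thesis by (simp add: C2_def)
qed

text \<open>\<open>B0\<close> is a summand of \<open>B2\<close>, and 2048 is 8 * 16^2, with the 16
  from \<open>C2_ge\<close>.\<close>

lemma D2_ge:
  assumes "1 \<le> C0"
  shows "B0 \<le> D2 B0 C0" and "2048 * (exp 1 * C0)\<^sup>2 \<le> D2 B0 C0"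
proof -
  have "0 \<le> 16 * (C2 C0)\<^sup>2 / (C1 - 2)"
    using C1_ge_64 by simp
  then show "B0 \<le> D2 B0 C0" by (simp add: D2_def B2_def)
  have "(16 * C0)\<^sup>2 \<le> (C2 C0)\<^sup>2"
    using C2_ge[of C0] assms by (intro power_mono) auto
  then have "(exp 1)\<^sup>2 * (16 * C0)\<^sup>2 \<le> (exp (1::real))\<^sup>2 * (C2 C0)\<^sup>2"
    by (intro mult_left_mono) auto
  then have "2048 * (exp 1 * C0)\<^sup>2 \<le> 8 * (exp 1 * C2 C0)\<^sup>2"
    by (simp add: power_mult_distrib)
  then show "2048 * (exp 1 * C0)\<^sup>2 \<le> D2 B0 C0"
    by (simp add: D2_def)
qed

lemma D2_ge_2: "1 \<le> C0 \<Longrightarrow> 2 \<le> D2 B0 C0"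
proof -
  assume C0: "1 \<le> C0"
  have "1 * 1 \<le> exp 1 * C0" using C0 exp1_ge_1(1) by (intro mult_mono) auto
  then have "1 \<le> (exp 1 * C0)\<^sup>2" by (simp add: one_le_power)
  then show ?thesis using D2_ge(2)[OF C0, of B0] by linarith
qed

text \<open>A single term of the exponential series at \<open>k\<close>.\<close>

lemma power_le_fact_exp: "real k ^ k \<le> fact k * exp 1 ^ k"
proof -
  have "(\<Sum>i\<in>{k}. (real k) ^ i /\<^sub>R fact i) \<le> (\<Sum>i. (real k) ^ i /\<^sub>R fact i)"
    by (intro sum_le_suminf summable_exp_generic) auto
  then have "real k ^ k / fact k \<le> exp (real k)"
    by (simp add: exp_def divide_inverse mult.commute)
  also have "exp (real k) = exp 1 ^ k"
    by (simp add: exp_of_nat_mult[symmetric])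
  finally show ?thesis by (simp add: field_simps)
qed

text \<open>The factorial of \<open>power_le_fact_exp\<close> is absorbed by the binomial
  coefficient, since \<open>j choose k\<close> times k! is at most j^k.\<close>

lemma binomial_power_le:
  assumes "0 \<le> c"
  shows "(j choose k) * (c ^ k * (real k) ^ k) \<le> (exp 1 * real j * c) ^ k"
proof -
  have "real (j choose k) * real k ^ k \<le> real (j choose k) * (fact k * exp 1 ^ k)"
    by (intro mult_left_mono power_le_fact_exp) auto
  also have "\<dots> = (real (j choose k) * fact k) * exp 1 ^ k" by simp
  also have "real (j choose k) * fact k \<le> real j ^ k"
    using binomial_fact_pow[of j k] by (metis of_nat_fact of_nat_le_iff of_nat_mult of_nat_power)
  finally have "real (j choose k) * real k ^ k \<le> real j ^ k * exp 1 ^ k"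
    by simp
  then have "c ^ k * (real (j choose k) * real k ^ k) \<le> c ^ k * (real j ^ k * exp 1 ^ k)"
    using assms by (intro mult_left_mono) auto
  then show ?thesis by (simp add: power_mult_distrib mult_ac)
qed

lemma geometric_tail_le:
  fixes x :: real
  assumes "0 \<le> x" "x \<le> 1 / 2"
  shows "(\<Sum>k=2..j. x ^ k) \<le> 2 * x\<^sup>2"
proof -
  have s: "summable (\<lambda>k. x ^ (k + 2))"
    using assms by (intro summable_ignore_initial_segment summable_geometric) auto
  have "(\<Sum>k=2..j. x ^ k) \<le> (\<Sum>k\<in>{0..<j}. x ^ (k + 2))"
  proof -
    have "(\<Sum>k=2..j. x ^ k) \<le> (\<Sum>k\<in>{0 + 2..<j + 2}. x ^ k)"
      using assms by (intro sum_mono2) auto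
    also have "\<dots> = (\<Sum>k\<in>{0..<j}. x ^ (k + 2))" by (rule sum.shift_bounds_nat_ivl)
    finally show ?thesis .
  qed
  also have "\<dots> \<le> (\<Sum>k. x ^ (k + 2))"
    using assms by (intro sum_le_suminf s) auto
  also have "(\<Sum>k. x ^ (k + 2)) = (\<Sum>k. x\<^sup>2 * x ^ k)"
    by (simp only: power_add mult.commute)
  also have "\<dots> = x\<^sup>2 * (1 / (1 - x))"
    using assms suminf_geometric[of x] summable_geometric[of x] by (subst suminf_mult) auto
  also have "\<dots> \<le> x\<^sup>2 * 2"
    using assms by (intro mult_left_mono) (auto simp: field_simps)
  finally show ?thesis by simp
qed

text \<open>The k-particle errors contribute at most x^k with x = e C0 j / sqrt N, whose square has
  the required order j^2 / N. For k = 1 this would give only j / sqrt N, and there the separate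
  hypothesis with \<open>B0\<close> is used.\<close>

lemma initial_gap_le:
  fixes F :: "(nat \<Rightarrow> 'z::euclidean_space) \<Rightarrow> real"
  assumes F: "prob_density (phase N) F" "symmetric N F" and g: "prob_density lborel g"
    and C0: "1 \<le> C0" and B0: "0 < B0"
    and E: "\<forall>j\<in>{2..N}. L1_norm (phase j) (corr_error N F g j) \<le> ennreal (C0 ^ j * (real j / sqrt (real N)) ^ j)"
    and E1: "L1_norm (phase 1) (corr_error N F g 1) \<le> ennreal (B0 / real N)"
    and A: "A \<subseteq> {1..N}" "A \<noteq> {}" and \<psi>: "test_on N A \<psi>"
  shows "gap N F g \<psi> \<le> D2 B0 C0 * (real (card A))\<^sup>2 / N"
proof -
  define j where "j = card A"
  define D where "D = D2 B0 C0"
  have fA: "finite A" using A finite_subset by auto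
  have j: "1 \<le> j" "j \<le> N"
    using A fA card_mono[OF _ A(1)] by (auto simp: j_def One_nat_def Suc_le_eq card_gt_0_iff)
  have N: "0 < real N" using j by simp
  note D = D2_ge[OF C0, of B0, folded D_def]
  have Fi: "integrable (phase N) F" and F1: "(\<integral>z. \<bar>F z\<bar> \<partial>phase N) \<le> 1"
  proof -
    show Fi: "integrable (phase N) F" using F by (simp add: prob_density_def)
    have "(\<integral>z. \<bar>F z\<bar> \<partial>phase N) = (\<integral>z. F z \<partial>phase N)"
      using F Fi by (intro integral_cong_AE) (auto simp: prob_density_def)
    then show "(\<integral>z. \<bar>F z\<bar> \<partial>phase N) \<le> 1" using F by (simp add: prob_density_def)
  qed
  have gi: "integrable lborel g" and gm: "(\<integral>v. g v \<partial>lborel) = 1" and g1: "(\<integral>v. \<bar>g v\<bar> \<partial>lborel) \<le> 1"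
  proof -
    show gi: "integrable lborel g" "(\<integral>v. g v \<partial>lborel) = 1" using g by (auto simp: prob_density_def)
    have "(\<integral>v. \<bar>g v\<bar> \<partial>lborel) = (\<integral>v. g v \<partial>lborel)"
      using g gi by (intro integral_cong_AE) (auto simp: prob_density_def)
    then show "(\<integral>v. \<bar>g v\<bar> \<partial>lborel) \<le> 1" using gi by simp
  qed
  define x where "x = exp 1 * real j * (C0 / sqrt N)"
  have x: "0 \<le> x" and x2: "x\<^sup>2 = (exp 1 * C0)\<^sup>2 * (real j)\<^sup>2 / N"
    using C0 N by (auto simp: x_def power_mult_distrib power_divide)
  have DK: "2048 * x\<^sup>2 \<le> D * (real j)\<^sup>2 / N"
  proof -
    have "2048 * x\<^sup>2 = (2048 * (exp 1 * C0)\<^sup>2) * (real j)\<^sup>2 / N"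
      unfolding x2 by simp
    also have "\<dots> \<le> D * (real j)\<^sup>2 / N"
      using D(2) by (intro divide_right_mono mult_right_mono) auto
    finally show ?thesis .
  qed
  \<comment> \<open>For x above 1/2 the claimed bound exceeds the trivial bound 2; for smaller x the
    terms decay geometrically.\<close>
  have "gap N F g \<psi> \<le> D * (real j)\<^sup>2 / N"
  proof (cases "x \<le> 1 / 2")
    case False
    then have "(1 / 2)\<^sup>2 \<le> x\<^sup>2" by (intro power_mono) auto
    then have "2 \<le> D * (real j)\<^sup>2 / N" using DK by (simp add: power_divide)
    then show ?thesis using gap_le_2[OF Fi F1 gi g1 \<psi>] by linarith
  next
    case True
    obtain \<psi>' where \<psi>': "test_on N {1..j} \<psi>'" "gap N F g \<psi> = gap N F g \<psi>'"
      using gap_symmetric[OF Fi F(2) gi A(1) \<psi>] unfolding j_def by blast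
    let ?w = "\<lambda>k. (real k / sqrt N) ^ k"
    have "ennreal (gap N F g \<psi>) \<le> L1_norm (phase j) (\<lambda>z. marginal N F j z - tensor g {1..j} z)"
      unfolding \<psi>'(2) by (rule gap_le_L1_marginal[OF Fi gi gm j(2) \<psi>'(1)])
    also have "\<dots> \<le> (\<Sum>k=1..j. of_nat (j choose k) * L1_norm (phase k) (corr_error N F g k))"
      by (rule L1_marginal_le_sum_corr_error[OF F(1) gi g1 j(2)])
    also have "\<dots> = of_nat j * L1_norm (phase 1) (corr_error N F g 1) +
        (\<Sum>k=2..j. of_nat (j choose k) * L1_norm (phase k) (corr_error N F g k))"
      using j by (subst sum.atLeast_Suc_atMost) (simp_all add: numeral_2_eq_2 One_nat_def)
    also have "\<dots> \<le> ennreal (j * (B0 / N)) + (\<Sum>k=2..j. ennreal (x ^ k))"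
    proof (intro add_mono sum_mono)
      show "of_nat j * L1_norm (phase 1) (corr_error N F g 1) \<le> ennreal (j * (B0 / N))"
      proof -
        have "of_nat j * L1_norm (phase 1) (corr_error N F g 1) \<le> of_nat j * ennreal (B0 / N)"
          by (intro mult_left_mono E1) simp
        also have "\<dots> = ennreal (j * (B0 / N))"
          unfolding ennreal_of_nat_eq_real_of_nat by (rule ennreal_mult[symmetric]) (use B0 in auto)
        finally show ?thesis .
      qed
      fix k assume k: "k \<in> {2..j}"
      have "of_nat (j choose k) * L1_norm (phase k) (corr_error N F g k) \<le>
          of_nat (j choose k) * ennreal (C0 ^ k * ?w k)"
        using E k j by (intro mult_left_mono) auto
      also have "\<dots> = ennreal ((j choose k) * (C0 ^ k * ?w k))"
        using C0 by (simp add: ennreal_mult ennreal_of_nat_eq_real_of_nat)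
      also have "\<dots> \<le> ennreal (x ^ k)"
      proof (rule ennreal_leI)
        have "C0 ^ k * ?w k = (C0 / sqrt N) ^ k * real k ^ k"
          by (simp add: power_divide)
        then show "(j choose k) * (C0 ^ k * ?w k) \<le> x ^ k"
          unfolding x_def using binomial_power_le[of "C0 / sqrt N" j k] C0 by simp
      qed
      finally show "of_nat (j choose k) * L1_norm (phase k) (corr_error N F g k) \<le> ennreal (x ^ k)" .
    qed
    also have "\<dots> = ennreal (j * (B0 / N) + (\<Sum>k=2..j. x ^ k))"
      using x B0 by (subst sum_ennreal) (auto simp: ennreal_plus[symmetric] sum_nonneg simp del: ennreal_plus)
    finally have le: "gap N F g \<psi> \<le> j * (B0 / N) + (\<Sum>k=2..j. x ^ k)"
      using x B0 by (subst (asm) ennreal_le_iff) (auto intro!: add_nonneg_nonneg sum_nonneg)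
    \<comment> \<open>For one particle there are no terms with k \<ge> 2, and the whole of
      \<open>D\<close> is available for \<open>B0\<close>. From two particles on, j \<le> j^2 / 2,
      so each part takes half of the bound.\<close>
    show ?thesis
    proof (cases "j = 1")
      case True
      then have "gap N F g \<psi> \<le> B0 / N" using le by simp
      also have "\<dots> \<le> D / N" using D(1) by (intro divide_right_mono) auto
      finally show ?thesis using True by simp
    next
      case False
      then have j2: "2 \<le> real j" using j by simp
      have "(\<Sum>k=2..j. x ^ k) \<le> 2 * x\<^sup>2"
        by (rule geometric_tail_le[OF x \<open>x \<le> 1 / 2\<close>])
      also have "\<dots> \<le> (2048 * x\<^sup>2) / 2" by simp
      also have "\<dots> \<le> D * (real j)\<^sup>2 / N / 2"
        by (intro divide_right_mono DK) simp
      finally have 1: "(\<Sum>k=2..j. x ^ k) \<le> D * (real j)\<^sup>2 / N / 2" .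
      have "j * (B0 / N) = (real j * 2) * B0 / N / 2" by simp
      also have "\<dots> \<le> (real j)\<^sup>2 * D / N / 2"
        using D(1) B0 j2 by (intro divide_right_mono mult_mono) (auto simp: power2_eq_square)
      finally show ?thesis using 1 le by (simp add: mult.commute)
    qed
  qed
  then show ?thesis by (simp add: j_def D_def)
qed

lemma prob_density_L1: "prob_density M F \<Longrightarrow> (\<integral>z. \<bar>F z\<bar> \<partial>M) = 1"
proof -
  assume F: "prob_density M F"
  then have "(\<integral>z. \<bar>F z\<bar> \<partial>M) = (\<integral>z. F z \<partial>M)"
    by (intro integral_cong_AE) (auto simp: prob_density_def)
  then show ?thesis using F by (simp add: prob_density_def)
qed

context collision_model
begin

text \<open>Assembly for the abstract model, with \<Lambda> an upper bound of the rate \<mu>. The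
  mass of \<open>f t\<close> is stated as well because the passage from gaps to marginals uses
  it.\<close>

lemma chaos_bound:
  assumes F: "evolves (phase N) q F" "\<And>s. 0 \<le> s \<Longrightarrow> AE z in phase N. q s z = master s N (F s) z"
      "\<And>s. 0 \<le> s \<Longrightarrow> (\<integral>z. \<bar>F s z\<bar> \<partial>phase N) \<le> 1"
    and f: "evolves lborel p f" "\<And>s. 0 \<le> s \<Longrightarrow> AE v in lborel. p s v = kinetic s (f s) v"
      "\<And>T. 0 \<le> T \<Longrightarrow> \<exists>R. \<forall>s. 0 \<le> s \<longrightarrow> s \<le> T \<longrightarrow> (\<integral>v. \<bar>f s v\<bar> \<partial>lborel) \<le> R"
    and F0: "prob_density (phase N) (F 0)" "symmetric N (F 0)" and f0: "prob_density lborel (f 0)"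
    and C0: "1 \<le> C0" and B0: "0 < B0"
    and E: "\<forall>j\<in>{2..N}. L1_norm (phase j) (corr_error N (F 0) (f 0) j) \<le> ennreal (C0 ^ j * (real j / sqrt (real N)) ^ j)"
    and E1: "L1_norm (phase 1) (corr_error N (F 0) (f 0) 1) \<le> ennreal (B0 / real N)"
    and \<mu>: "\<mu> \<le> \<Lambda>" and t: "0 \<le> t" and j: "j \<in> {1..N}" and \<psi>: "test_on N {1..j} \<psi>"
  shows "gap N (F t) (f t) \<psi> \<le> D2 B0 C0 * exp (2 * D1 * t * \<Lambda>) * (real j)\<^sup>2 / N"
    and "(\<integral>v. f t v \<partial>lborel) = 1"
proof -
  have mc: "master_curve N q F"
    using F by (simp add: master_curve_def)
  have kc: "kinetic_curve p f"
    using f f0 prob_density_L1[OF f0] by (simp add: kinetic_curve_def prob_density_def)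
  show "(\<integral>v. f t v \<partial>lborel) = 1" by (rule kinetic_curve_mass[OF kc t])
  have D: "2 \<le> D2 B0 C0" by (rule D2_ge_2[OF C0])
  have A: "{1..j} \<subseteq> {1..N}" "{1..j} \<noteq> {}" using j by auto
  have "gap N (F t) (f t) \<psi> \<le> D2 B0 C0 * exp (6 * \<mu> * t) * (real (card {1..j}))\<^sup>2 / N"
    by (rule gap_bound[OF mc kc D initial_gap_le[OF F0 f0 C0 B0 E E1] A \<psi> t])
  also have "\<dots> \<le> D2 B0 C0 * exp (2 * D1 * t * \<Lambda>) * (real (card {1..j}))\<^sup>2 / N"
  proof -
    \<comment> \<open>The proven exponent 6 \<mu> lies far below the stated 2 D1 \<Lambda>.\<close>
    have "3 \<le> D1" using C1_ge_64 by (simp add: D1_def B1_def)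
    then have "6 * \<mu> \<le> 2 * D1 * \<Lambda>" using \<mu> mu_nonneg by (intro mult_mono) auto
    then have "6 * \<mu> * t \<le> 2 * D1 * \<Lambda> * t" using t by (rule mult_right_mono)
    then show ?thesis
      using D by (intro divide_right_mono mult_right_mono mult_left_mono) (auto simp: mult_ac)
  qed
  finally show "gap N (F t) (f t) \<psi> \<le> D2 B0 C0 * exp (2 * D1 * t * \<Lambda>) * (real j)\<^sup>2 / N" by simp
qed

end

section \<open>The Kac model\<close>

text \<open>Continuity in L1 makes the norm continuous in time, hence bounded on compact intervals;
  this is the a priori bound in \<open>kinetic_curve\<close>.\<close>

lemma mild_solution_locally_bounded:
  assumes u: "mild_solution M S Q u" and T: "0 \<le> T"
  shows "\<exists>R. \<forall>s. 0 \<le> s \<longrightarrow> s \<le> T \<longrightarrow> (\<integral>z. \<bar>u s z\<bar> \<partial>M) \<le> R"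
proof -
  have ui: "integrable M (u t)" if "0 \<le> t" for t
    using u that by (simp add: mild_solution_def)
  have "continuous_on {0..T} (\<lambda>s. \<integral>z. \<bar>u s z\<bar> \<partial>M)"
    unfolding continuous_on_def
  proof
    fix t assume t: "t \<in> {0..T}"
    have "((\<lambda>s. L1_norm M (\<lambda>z. u s z - u t z)) \<longlongrightarrow> ennreal 0) (at t within {0..T})"
      using u t tendsto_within_subset[of _ _ t "{0..}" "{0..T}"] by (auto simp: mild_solution_def)
    moreover have "\<forall>\<^sub>F s in at t within {0..T}. L1_norm M (\<lambda>z. u s z - u t z) = ennreal (\<integral>z. \<bar>u s z - u t z\<bar> \<partial>M)"
      using t by (intro eventually_at_filter[THEN iffD2] always_eventually)
        (auto intro!: L1_norm_eq_integral Bochner_Integration.integrable_diff ui)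
    ultimately have "((\<lambda>s. ennreal (\<integral>z. \<bar>u s z - u t z\<bar> \<partial>M)) \<longlongrightarrow> ennreal 0) (at t within {0..T})"
      by (rule Lim_transform_eventually)
    then have d: "((\<lambda>s. \<integral>z. \<bar>u s z - u t z\<bar> \<partial>M) \<longlongrightarrow> 0) (at t within {0..T})"
      by (subst (asm) tendsto_ennreal_iff) (auto intro!: always_eventually)
    have "\<forall>\<^sub>F s in at t within {0..T}. norm ((\<integral>z. \<bar>u s z\<bar> \<partial>M) - (\<integral>z. \<bar>u t z\<bar> \<partial>M)) \<le> (\<integral>z. \<bar>u s z - u t z\<bar> \<partial>M)"
    proof (unfold eventually_at_filter, intro always_eventually allI impI)
      fix s assume "s \<noteq> t" "s \<in> {0..T}"
      then have s: "0 \<le> s" and t0: "0 \<le> t" using t by auto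
      have "(\<integral>z. \<bar>u t z - u s z\<bar> \<partial>M) = (\<integral>z. \<bar>u s z - u t z\<bar> \<partial>M)"
        by (simp add: abs_minus_commute)
      then show "norm ((\<integral>z. \<bar>u s z\<bar> \<partial>M) - (\<integral>z. \<bar>u t z\<bar> \<partial>M)) \<le> (\<integral>z. \<bar>u s z - u t z\<bar> \<partial>M)"
        using integral_abs_diff_le[OF ui[OF s] ui[OF t0]] integral_abs_diff_le[OF ui[OF t0] ui[OF s]] by simp
    qed
    then have "((\<lambda>s. (\<integral>z. \<bar>u s z\<bar> \<partial>M) - (\<integral>z. \<bar>u t z\<bar> \<partial>M)) \<longlongrightarrow> 0) (at t within {0..T})"
      by (rule Lim_null_comparison[OF _ d])
    then show "((\<lambda>s. \<integral>z. \<bar>u s z\<bar> \<partial>M) \<longlongrightarrow> (\<integral>z. \<bar>u t z\<bar> \<partial>M)) (at t within {0..T})"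
      by (simp add: LIM_zero_iff)
  qed
  then have "bounded ((\<lambda>s. \<integral>z. \<bar>u s z\<bar> \<partial>M) ` {0..T})"
    by (intro compact_imp_bounded compact_continuous_image compact_Icc)
  then obtain R where "\<forall>x\<in>(\<lambda>s. \<integral>z. \<bar>u s z\<bar> \<partial>M) ` {0..T}. norm x \<le> R"
    unfolding bounded_iff by blast
  then show ?thesis by (intro exI[of _ R]) auto
qed

lemma mild_solution_measurable:
  assumes "mild_solution M S Q u"
  shows "(\<lambda>(t, z). u (max 0 t) z) \<in> borel_measurable (borel \<Otimes>\<^sub>M M)"
proof -
  have "(\<lambda>x. (max 0 (fst x), snd x)) \<in> measurable (borel \<Otimes>\<^sub>M M) (restrict_space borel {0::real..} \<Otimes>\<^sub>M M)"
    by (intro measurable_Pair measurable_restrict_space2 measurable_snd) auto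
  from measurable_compose[OF this, of "\<lambda>(t, z). u t z"] assms show ?thesis
    by (simp add: mild_solution_def case_prod_beta')
qed

section \<open>Binary collisions preserve Lebesgue measure\<close>

lemma nn_integral_lborel_translate:
  fixes f :: "'a::euclidean_space \<Rightarrow> ennreal"
  assumes [measurable]: "f \<in> borel_measurable borel"
  shows "(\<integral>\<^sup>+x. f (x + a) \<partial>lborel) = (\<integral>\<^sup>+x. f x \<partial>lborel)"
proof -
  have "(\<integral>\<^sup>+x. f x \<partial>lborel) = (\<integral>\<^sup>+x. f x \<partial>distr lborel borel ((+) a))"
    by (simp add: lborel_distr_plus)
  also have "\<dots> = (\<integral>\<^sup>+x. f (x + a) \<partial>lborel)"
    by (subst nn_integral_distr) (auto simp: add.commute)
  finally show ?thesis ..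
qed

definition reflect :: "vec3 \<Rightarrow> vec3 \<Rightarrow> vec3" where
  "reflect \<omega> u = u - (2 * (\<omega> \<bullet> u)) *\<^sub>R \<omega>"

lemma reflect_reflect: "norm \<omega> = 1 \<or> \<omega> = 0 \<Longrightarrow> reflect \<omega> (reflect \<omega> u) = u"
  by (auto simp: reflect_def inner_diff_right dot_square_norm scaleR_left_distrib[symmetric])

lemma orthogonal_reflect:
  assumes "norm \<omega> = 1 \<or> \<omega> = 0"
  shows "orthogonal_transformation (reflect \<omega>)"
proof -
  have "\<omega> \<bullet> \<omega> = 1 \<or> \<omega> = 0"
    using assms by (auto simp: dot_square_norm)
  then show ?thesis
    unfolding orthogonal_transformation_def reflect_def
    by (auto intro!: linearI simp: algebra_simps inner_add_right inner_diff_right inner_diff_left inner_commute)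
qed

text \<open>A reflection is an involution, so preimages of boxes are images, to which the invariance
  of Lebesgue measure under orthogonal maps applies.\<close>

lemma nn_integral_reflect:
  fixes f :: "vec3 \<Rightarrow> ennreal"
  assumes \<omega>: "norm \<omega> = 1 \<or> \<omega> = 0" and f: "f \<in> borel_measurable borel"
  shows "(\<integral>\<^sup>+u. f (reflect \<omega> u) \<partial>lborel) = (\<integral>\<^sup>+u. f u \<partial>lborel)"
proof -
  have [measurable]: "reflect \<omega> \<in> borel_measurable borel"
    unfolding reflect_def[abs_def] by measurable
  have "lborel = distr lborel borel (reflect \<omega>)"
  proof (rule lborel_eqI)
    fix l u :: vec3 assume lu: "\<And>b. b \<in> Basis \<Longrightarrow> l \<bullet> b \<le> u \<bullet> b"
    have pre: "reflect \<omega> -` box l u = reflect \<omega> ` box l u"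
      using reflect_reflect[OF \<omega>] by (auto simp: image_iff) metis
    have bm: "reflect \<omega> ` box l u \<in> sets borel"
    proof -
      have "reflect \<omega> -` box l u \<inter> space borel \<in> sets borel" by measurable
      then show ?thesis by (simp add: pre)
    qed
    have im: "reflect \<omega> ` box l u \<in> lmeasurable"
      by (intro measurable_orthogonal_image orthogonal_reflect[OF \<omega>]) auto
    have "emeasure (distr lborel borel (reflect \<omega>)) (box l u) = emeasure lebesgue (reflect \<omega> ` box l u)"
      using bm by (subst emeasure_distr) (auto simp: pre)
    also have "\<dots> = ennreal (measure lebesgue (reflect \<omega> ` box l u))"
      by (rule emeasure_eq_ennreal_measure[OF fmeasurableD2[OF im]])
    also have "\<dots> = ennreal (measure lebesgue (box l u))"
      by (subst measure_orthogonal_image[OF orthogonal_reflect[OF \<omega>]]) auto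
    also have "\<dots> = ennreal (\<Prod>b\<in>Basis. (u - l) \<bullet> b)"
      using lu by (simp add: measure_lborel_box_eq)
    finally show "emeasure (distr lborel borel (reflect \<omega>)) (box l u) = ennreal (\<Prod>b\<in>Basis. (u - l) \<bullet> b)" .
  qed simp
  then have "(\<integral>\<^sup>+u. f u \<partial>lborel) = (\<integral>\<^sup>+u. f u \<partial>distr lborel borel (reflect \<omega>))" by simp
  also have "\<dots> = (\<integral>\<^sup>+u. f (reflect \<omega> u) \<partial>lborel)"
    using f by (subst nn_integral_distr) auto
  finally show ?thesis ..
qed

text \<open>One function thus describes both outgoing velocities, as the abstract model
  requires.\<close>

lemma post2_eq_post1: "post2 \<omega> v w = post1 \<omega> w v"
  by (simp add: post1_def post2_def inner_diff_right algebra_simps)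

lemma post1_zero [simp]: "post1 0 v w = v"
  by (simp add: post1_def)

lemma post1_minus: "post1 (- \<omega>) v w = post1 \<omega> v w"
  by (simp add: post1_def)

lemma post1_orthogonal: "\<omega> \<bullet> (v - w) = 0 \<Longrightarrow> post1 \<omega> v w = v"
  by (simp add: post1_def)

lemma post1_diff: "post1 \<omega> v w - post1 \<omega> w v = reflect \<omega> (v - w)"
proof -
  have "\<omega> \<bullet> (w - v) = - (\<omega> \<bullet> (v - w))" by (simp add: inner_diff_right)
  moreover have "(2 * (\<omega> \<bullet> (v - w))) *\<^sub>R \<omega> = (\<omega> \<bullet> (v - w)) *\<^sub>R \<omega> + (\<omega> \<bullet> (v - w)) *\<^sub>R \<omega>"
    by (simp only: mult_2 scaleR_left_distrib)
  ultimately show ?thesis by (simp add: post1_def reflect_def)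
qed

text \<open>The collision reverses the component of the relative velocity along \<omega>, so a
  second collision undoes the first.\<close>

lemma post1_post1:
  assumes "norm \<omega> = 1 \<or> \<omega> = 0"
  shows "post1 \<omega> (post1 \<omega> v w) (post1 \<omega> w v) = v"
proof -
  have "\<omega> \<bullet> \<omega> = 1 \<or> \<omega> = 0"
    using assms by (auto simp: dot_square_norm)
  then have "\<omega> \<bullet> reflect \<omega> (v - w) = - (\<omega> \<bullet> (v - w))"
    by (auto simp: reflect_def inner_diff_right)
  then have "post1 \<omega> (post1 \<omega> v w) (post1 \<omega> w v) = post1 \<omega> v w + (\<omega> \<bullet> (v - w)) *\<^sub>R \<omega>"
    using post1_diff[of \<omega> v w] by (simp add: post1_def[of \<omega> "post1 \<omega> v w"])
  then show ?thesis by (simp add: post1_def)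
qed

lemma post1_eq_iff:
  assumes "norm \<omega> = 1 \<or> \<omega> = 0"
  shows "post1 \<omega> v w = post1 \<omega> w v \<longleftrightarrow> v = w"
  by (metis assms post1_post1)

lemma post1_measurable [measurable (raw)]:
  assumes [measurable]: "\<omega> \<in> borel_measurable M" "v \<in> borel_measurable M" "w \<in> borel_measurable M"
  shows "(\<lambda>x. post1 (\<omega> x) (v x) (w x)) \<in> borel_measurable M"
  unfolding post1_def by measurable

text \<open>The collision is a composition of measure-preserving maps: pass to the relative velocity
  u at fixed w, shift w at fixed u, reflect u at fixed w. Tonelli's theorem exchanges the integrals
  between these steps.\<close>

lemma nn_integral_post1:
  fixes G :: "vec3 \<Rightarrow> vec3 \<Rightarrow> ennreal"
  assumes \<omega>: "norm \<omega> = 1 \<or> \<omega> = 0" and G: "(\<lambda>(v, w). G v w) \<in> borel_measurable (borel \<Otimes>\<^sub>M borel)"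
  shows "(\<integral>\<^sup>+v. (\<integral>\<^sup>+w. G (post1 \<omega> v w) (post1 \<omega> w v) \<partial>lborel) \<partial>lborel) = (\<integral>\<^sup>+v. (\<integral>\<^sup>+w. G v w \<partial>lborel) \<partial>lborel)"
proof -
  have Gm: "(\<lambda>x. G (p x) (q x)) \<in> borel_measurable M" if "p \<in> borel_measurable M" "q \<in> borel_measurable M" for p q and M :: "'x measure"
    using measurable_compose[OF measurable_Pair[OF that] G] by simp
  have Gm2: "(\<lambda>x. G (p x) (q x)) \<in> borel_measurable (lborel \<Otimes>\<^sub>M lborel)"
    if "p \<in> borel_measurable (lborel \<Otimes>\<^sub>M lborel)" "q \<in> borel_measurable (lborel \<Otimes>\<^sub>M lborel)"
    for p q :: "vec3 \<times> vec3 \<Rightarrow> vec3"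
    using measurable_compose[OF measurable_Pair[OF that] G] by simp
  have rm [measurable]: "reflect \<omega> \<in> borel_measurable borel"
    unfolding reflect_def[abs_def] by measurable
  have "(\<integral>\<^sup>+v. (\<integral>\<^sup>+w. G (post1 \<omega> v w) (post1 \<omega> w v) \<partial>lborel) \<partial>lborel) =
      (\<integral>\<^sup>+w. (\<integral>\<^sup>+v. G (post1 \<omega> v w) (post1 \<omega> w v) \<partial>lborel) \<partial>lborel)"
    by (rule lborel_pair.Fubini'[symmetric]) (simp only: case_prod_beta', intro Gm2; measurable)
  also have "\<dots> = (\<integral>\<^sup>+w. (\<integral>\<^sup>+u. G (u + w - (\<omega> \<bullet> u) *\<^sub>R \<omega>) (w + (\<omega> \<bullet> u) *\<^sub>R \<omega>) \<partial>lborel) \<partial>lborel)"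
  proof (rule nn_integral_cong)
    fix w :: vec3
    have "(\<lambda>v. G (post1 \<omega> v w) (post1 \<omega> w v)) \<in> borel_measurable borel"
      by (intro Gm) measurable
    from nn_integral_lborel_translate[OF this, of w]
    show "(\<integral>\<^sup>+v. G (post1 \<omega> v w) (post1 \<omega> w v) \<partial>lborel) =
      (\<integral>\<^sup>+u. G (u + w - (\<omega> \<bullet> u) *\<^sub>R \<omega>) (w + (\<omega> \<bullet> u) *\<^sub>R \<omega>) \<partial>lborel)"
      by (simp add: post1_def inner_diff_right)
  qed
  also have "\<dots> = (\<integral>\<^sup>+u. (\<integral>\<^sup>+w. G (u + w - (\<omega> \<bullet> u) *\<^sub>R \<omega>) (w + (\<omega> \<bullet> u) *\<^sub>R \<omega>) \<partial>lborel) \<partial>lborel)"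
    by (rule lborel_pair.Fubini'[symmetric]) (simp only: case_prod_beta', intro Gm2; measurable)
  also have "\<dots> = (\<integral>\<^sup>+u. (\<integral>\<^sup>+w. G (reflect \<omega> u + w) w \<partial>lborel) \<partial>lborel)"
  proof (rule nn_integral_cong)
    fix u :: vec3
    have "(\<lambda>w. G (reflect \<omega> u + w) w) \<in> borel_measurable borel"
      by (intro Gm) measurable
    from nn_integral_lborel_translate[OF this, of "(\<omega> \<bullet> u) *\<^sub>R \<omega>"]
    have "(\<integral>\<^sup>+w. G (reflect \<omega> u + w) w \<partial>lborel) =
      (\<integral>\<^sup>+w. G (reflect \<omega> u + (w + (\<omega> \<bullet> u) *\<^sub>R \<omega>)) (w + (\<omega> \<bullet> u) *\<^sub>R \<omega>) \<partial>lborel)" by simp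
    moreover have "reflect \<omega> u + (w + (\<omega> \<bullet> u) *\<^sub>R \<omega>) = u + w - (\<omega> \<bullet> u) *\<^sub>R \<omega>" for w
    proof -
      have "(2 * (\<omega> \<bullet> u)) *\<^sub>R \<omega> = (\<omega> \<bullet> u) *\<^sub>R \<omega> + (\<omega> \<bullet> u) *\<^sub>R \<omega>"
        by (simp only: mult_2 scaleR_left_distrib)
      then show ?thesis by (simp add: reflect_def)
    qed
    ultimately show "(\<integral>\<^sup>+w. G (u + w - (\<omega> \<bullet> u) *\<^sub>R \<omega>) (w + (\<omega> \<bullet> u) *\<^sub>R \<omega>) \<partial>lborel) =
      (\<integral>\<^sup>+w. G (reflect \<omega> u + w) w \<partial>lborel)" by simp
  qed
  also have "\<dots> = (\<integral>\<^sup>+w. (\<integral>\<^sup>+u. G (reflect \<omega> u + w) w \<partial>lborel) \<partial>lborel)"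
    by (rule lborel_pair.Fubini'[symmetric]) (simp only: case_prod_beta', intro Gm2; measurable)
  also have "\<dots> = (\<integral>\<^sup>+w. (\<integral>\<^sup>+v. G v w \<partial>lborel) \<partial>lborel)"
  proof (rule nn_integral_cong)
    fix w :: vec3
    have "(\<integral>\<^sup>+u. G (reflect \<omega> u + w) w \<partial>lborel) = (\<integral>\<^sup>+u. G (u + w) w \<partial>lborel)"
      by (rule nn_integral_reflect[OF \<omega>, of "\<lambda>u. G (u + w) w"]) (intro Gm; measurable)
    also have "\<dots> = (\<integral>\<^sup>+v. G v w \<partial>lborel)"
      by (rule nn_integral_lborel_translate[of "\<lambda>v. G v w"]) (intro Gm; measurable)
    finally show "(\<integral>\<^sup>+u. G (reflect \<omega> u + w) w \<partial>lborel) = (\<integral>\<^sup>+v. G v w \<partial>lborel)" .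
  qed
  also have "\<dots> = (\<integral>\<^sup>+v. (\<integral>\<^sup>+w. G v w \<partial>lborel) \<partial>lborel)"
    by (rule lborel_pair.Fubini') (simp only: case_prod_beta', intro Gm2; measurable)
  finally show ?thesis .
qed

lemma kernel_norm_bound:
  assumes "bounded_kernel B"
  shows "norm \<omega> = 1 \<Longrightarrow> \<bar>B \<omega> w\<bar> \<le> kernel_norm B" and "0 \<le> kernel_norm B"
proof -
  obtain K where K: "\<And>x. x \<in> (\<lambda>(\<omega>, w). B \<omega> w) ` (sphere 0 1 \<times> UNIV) \<Longrightarrow> norm x \<le> K"
    using assms unfolding bounded_kernel_def bounded_iff by blast
  have "bdd_above ((\<lambda>(\<omega>, w). \<bar>B \<omega> w\<bar>) ` (sphere 0 1 \<times> UNIV))"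
    using K by (intro bdd_aboveI[of _ K]) fastforce
  then have le: "\<bar>B \<omega> w\<bar> \<le> kernel_norm B" if "norm \<omega> = 1" for \<omega> w
    unfolding kernel_norm_def using that
    by (intro cSUP_upper2[of _ _ "(\<omega>, w)"]) auto
  then show "norm \<omega> = 1 \<Longrightarrow> \<bar>B \<omega> w\<bar> \<le> kernel_norm B" .
  have "norm (axis 1 1 :: vec3) = 1" by simp
  from order_trans[OF abs_ge_zero le[OF this]] show "0 \<le> kernel_norm B" .
qed

section \<open>The surface measure and its antipodal symmetry\<close>

lemma sets_sphere_measure [measurable_cong, simp]: "sets sphere_measure = sets borel"
  and space_sphere_measure [simp]: "space sphere_measure = UNIV"
  by (simp_all add: sphere_measure_def)

lemma cball_in_borel [measurable]: "cball (x :: vec3) r \<in> sets borel"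
  by (intro borel_closed closed_cball)

lemma nn_integral_sphere_measure:
  assumes [measurable]: "f \<in> borel_measurable borel"
  shows "(\<integral>\<^sup>+\<omega>. f \<omega> \<partial>sphere_measure) = (\<integral>\<^sup>+x. 3 * indicator (cball 0 1) x * f (x /\<^sub>R norm x) \<partial>lborel)"
  unfolding sphere_measure_def
  by (subst nn_integral_distr; (subst nn_integral_density)?) (auto simp: mult.assoc)

lemma emeasure_sphere_measure_UNIV: "emeasure sphere_measure UNIV = ennreal (4 * pi)"
proof -
  have "emeasure sphere_measure UNIV = (\<integral>\<^sup>+\<omega>. 1 \<partial>sphere_measure)" by simp
  also have "\<dots> = (\<integral>\<^sup>+x. 3 * indicator (cball 0 1) x \<partial>(lborel :: vec3 measure))"
    by (subst nn_integral_sphere_measure) simp_all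
  also have "\<dots> = 3 * ennreal (4 / 3 * pi)"
    by (subst nn_integral_cmult_indicator) (simp_all add: emeasure_cball unit_ball_vol_3)
  also have "\<dots> = ennreal (3 * (4 / 3 * pi))"
    by (subst ennreal_mult') simp_all
  finally show ?thesis by simp
qed

lemma finite_sphere_measure: "finite_measure sphere_measure"
  by (rule finite_measureI) (simp add: emeasure_sphere_measure_UNIV)

text \<open>The radial projection lands on the sphere except at the origin, a null set.\<close>

lemma AE_sphere_measure: "AE \<omega> in sphere_measure. norm \<omega> = 1"
proof -
  have "AE x in lborel. x \<noteq> (0::vec3)"
    by (rule AE_lborel_singleton)
  then have "AE x in lborel. 0 < (3 * indicator (cball 0 1) (x :: vec3) :: ennreal) \<longrightarrow> norm (x /\<^sub>R norm x) = (1::real)"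
    by eventually_elim simp
  then have "AE x in density lborel (\<lambda>x :: vec3. 3 * indicator (cball 0 1) x). norm (x /\<^sub>R norm x) = (1::real)"
    by (subst AE_density) auto
  then show ?thesis
    unfolding sphere_measure_def by (subst AE_distr_iff) auto
qed

lemma nn_integral_lborel_minus:
  fixes f :: "vec3 \<Rightarrow> ennreal"
  assumes [measurable]: "f \<in> borel_measurable borel"
  shows "(\<integral>\<^sup>+x. f (- x) \<partial>lborel) = (\<integral>\<^sup>+x. f x \<partial>lborel)"
proof -
  have "lborel = distr lborel borel (\<lambda>x :: vec3. - x)"
    using lborel_affine[of "-1" "0 :: vec3"] by (simp add: density_1 one_ennreal_def[symmetric])
  then have "(\<integral>\<^sup>+x. f x \<partial>lborel) = (\<integral>\<^sup>+x. f x \<partial>distr lborel borel (\<lambda>x. - x))" by simp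
  also have "\<dots> = (\<integral>\<^sup>+x. f (- x) \<partial>lborel)"
    by (subst nn_integral_distr) auto
  finally show ?thesis ..
qed

lemma distr_sphere_measure_minus: "distr sphere_measure sphere_measure uminus = sphere_measure"
proof (rule measure_eqI)
  fix A assume "A \<in> sets (distr sphere_measure sphere_measure uminus)"
  then have A [measurable]: "A \<in> sets borel" by simp
  have "emeasure (distr sphere_measure sphere_measure uminus) A =
      (\<integral>\<^sup>+\<omega>. indicator A \<omega> \<partial>distr sphere_measure sphere_measure uminus)" by simp
  also have "\<dots> = (\<integral>\<^sup>+\<omega>. indicator A (- \<omega>) \<partial>sphere_measure)"
    by (subst nn_integral_distr) auto
  also have "\<dots> = (\<integral>\<^sup>+x. 3 * indicator (cball 0 1) x * indicator A (- (x /\<^sub>R norm x)) \<partial>lborel)"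
    by (subst nn_integral_sphere_measure) auto
  also have "\<dots> = (\<integral>\<^sup>+x. 3 * indicator (cball 0 1) (- x) * indicator A ((- x) /\<^sub>R norm (- x)) \<partial>lborel)"
    by (intro nn_integral_cong) (simp add: indicator_def)
  also have "\<dots> = (\<integral>\<^sup>+x. 3 * indicator (cball 0 1) x * indicator A (x /\<^sub>R norm x) \<partial>lborel)"
    by (rule nn_integral_lborel_minus[of "\<lambda>x. 3 * indicator (cball 0 1) x * indicator A (x /\<^sub>R norm x)"]) measurable
  also have "\<dots> = (\<integral>\<^sup>+\<omega>. indicator A \<omega> \<partial>sphere_measure)"
    by (subst nn_integral_sphere_measure) auto
  also have "\<dots> = emeasure sphere_measure A" by simp
  finally show "emeasure (distr sphere_measure sphere_measure uminus) A = emeasure sphere_measure A" .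
qed simp

text \<open>The hemisphere and its antipode cover the sphere and overlap only on the equator, where
  the integrand vanishes.\<close>

lemma hemisphere_integral:
  fixes g :: "vec3 \<Rightarrow> real"
  assumes g [measurable]: "g \<in> borel_measurable borel" and even: "\<And>\<omega>. g (- \<omega>) = g \<omega>"
    and equator: "\<And>\<omega>. \<omega> \<bullet> u = 0 \<Longrightarrow> g \<omega> = 0"
  shows "(LINT \<omega>:{\<omega>. 0 \<le> \<omega> \<bullet> u}|sphere_measure. g \<omega>) = (\<integral>\<omega>. g \<omega> / 2 \<partial>sphere_measure)"
proof -
  let ?h = "\<lambda>\<omega>. indicator {\<omega>. 0 \<le> \<omega> \<bullet> u} \<omega> * g \<omega>"
  have hm [measurable]: "?h \<in> borel_measurable sphere_measure" by measurable
  have um: "uminus \<in> measurable sphere_measure sphere_measure" by measurable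
  have split: "g \<omega> = ?h \<omega> + ?h (- \<omega>)" for \<omega>
    using equator[of \<omega>] even[of \<omega>] by (auto simp: indicator_def)
  have h': "(\<integral>\<omega>. ?h (- \<omega>) \<partial>sphere_measure) = (\<integral>\<omega>. ?h \<omega> \<partial>sphere_measure)"
    using integral_distr[OF um hm] by (simp add: distr_sphere_measure_minus)
  have "(\<integral>\<omega>. ?h \<omega> \<partial>sphere_measure) = (\<integral>\<omega>. g \<omega> / 2 \<partial>sphere_measure)"
  proof (cases "integrable sphere_measure ?h")
    case True
    then have i': "integrable sphere_measure (\<lambda>\<omega>. ?h (- \<omega>))"
      using integrable_distr[OF um, of ?h] by (simp add: distr_sphere_measure_minus)
    have "(\<integral>\<omega>. g \<omega> \<partial>sphere_measure) = (\<integral>\<omega>. ?h \<omega> + ?h (- \<omega>) \<partial>sphere_measure)"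
      by (rule Bochner_Integration.integral_cong[OF refl split])
    also have "\<dots> = (\<integral>\<omega>. ?h \<omega> \<partial>sphere_measure) + (\<integral>\<omega>. ?h (- \<omega>) \<partial>sphere_measure)"
      by (rule Bochner_Integration.integral_add[OF True i'])
    finally show ?thesis using h' by simp
  next
    \<comment> \<open>The integrand contains an arbitrary measurable density. If the integrals do
      not exist, both sides are 0 by convention.\<close>
    case False
    have ng: "\<not> integrable sphere_measure g"
    proof
      assume "integrable sphere_measure g"
      then have "integrable sphere_measure ?h"
        by (rule Bochner_Integration.integrable_bound) (auto simp: indicator_def)
      with False show False ..
    qed
    then have "\<not> integrable sphere_measure (\<lambda>\<omega>. g \<omega> / 2)"
      using integrable_mult_right[of 2 sphere_measure "\<lambda>\<omega>. g \<omega> / 2"] by auto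
    with False ng show ?thesis by (simp add: not_integrable_integral_eq)
  qed
  then show ?thesis by (simp add: set_lebesgue_integral_def)
qed

text \<open>The collision integrand is even in \<open>\<omega>\<close> and vanishes on the equator, so the hemisphere may be replaced by
  the whole sphere at half the rate; the rate is then symmetric in the two particles. Vectors that are not
  of unit length are given rate \<open>0\<close> and the trivial collision, which makes the collision an involution
  for every \<open>\<omega>\<close>.\<close>

definition kac_rate :: "(vec3 \<Rightarrow> vec3 \<Rightarrow> real) \<Rightarrow> vec3 \<Rightarrow> vec3 \<Rightarrow> vec3 \<Rightarrow> real" where
  "kac_rate B \<omega> v w = (if norm \<omega> = 1 \<and> v \<noteq> w then B \<omega> (v - w) / 2 else 0)"

definition unit_post :: "vec3 \<Rightarrow> vec3 \<Rightarrow> vec3 \<Rightarrow> vec3" where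
  "unit_post \<omega> v w = post1 (if norm \<omega> = 1 then \<omega> else 0) v w"

lemma kernel_measurable:
  assumes B: "collision_kernel B" and [measurable]: "p \<in> borel_measurable M" "q \<in> borel_measurable M"
  shows "(\<lambda>x. B (p x) (q x)) \<in> borel_measurable M"
proof -
  have "(\<lambda>x. (p x, q x)) \<in> borel_measurable M" by measurable
  from measurable_compose[OF this, of "\<lambda>(\<omega>, w). B \<omega> w" borel] B show ?thesis
    by (simp add: collision_kernel_def)
qed

lemma collision_kernel_symmetries:
  assumes "collision_kernel B" "norm \<omega> = 1"
  shows "0 \<le> B \<omega> w" "B (- \<omega>) w = B \<omega> w" "B \<omega> (- w) = B \<omega> w" "B \<omega> (reflect \<omega> w) = B \<omega> w"
  using assms unfolding collision_kernel_def reflect_def by metis+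

text \<open>The rate bound is the total area 4 \<pi> times half the norm of \<open>B\<close>, which
  restores the hemisphere area 2 \<pi>.\<close>

lemma kac_collision_model:
  assumes B: "collision_kernel B" "bounded_kernel B"
  shows "collision_model sphere_measure (\<lambda>_. kac_rate B) (\<lambda>_. unit_post) (2 * pi * kernel_norm B)"
proof
  note sym = collision_kernel_symmetries[OF B(1)]
  interpret finite_measure sphere_measure by (rule finite_sphere_measure)
  show "\<exists>A. countable A \<and> A \<subseteq> sets sphere_measure \<and> \<Union> A = space sphere_measure \<and> (\<forall>a\<in>A. emeasure sphere_measure a \<noteq> \<infinity>)"
    by (rule sigma_finite_countable)
  let ?M = "(borel :: real measure) \<Otimes>\<^sub>M sphere_measure \<Otimes>\<^sub>M (borel :: vec3 measure) \<Otimes>\<^sub>M (borel :: vec3 measure)"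
  have [measurable]: "(\<lambda>x. B (fst (snd x)) (fst (snd (snd x)) - snd (snd (snd x)))) \<in> borel_measurable ?M"
    by (rule kernel_measurable[OF B(1)]) measurable
  show "(\<lambda>(t, \<omega>, z, w). kac_rate B \<omega> z w) \<in> borel_measurable ?M"
    unfolding kac_rate_def case_prod_beta' by measurable
  show "(\<lambda>(t, \<omega>, z, w). unit_post \<omega> z w) \<in> borel_measurable ?M"
    unfolding unit_post_def case_prod_beta' by measurable
  fix t :: real and \<omega> v w :: vec3
  let ?\<omega> = "if norm \<omega> = 1 then \<omega> else 0"
  have u: "norm ?\<omega> = 1 \<or> ?\<omega> = 0" by auto
  show "0 \<le> kac_rate B \<omega> v w"
    by (simp add: kac_rate_def sym)
  show "kac_rate B \<omega> w v = kac_rate B \<omega> v w"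
    using sym(3)[of \<omega> "v - w"] by (auto simp: kac_rate_def)
  show "kac_rate B \<omega> (unit_post \<omega> v w) (unit_post \<omega> w v) = kac_rate B \<omega> v w"
    using post1_eq_iff[of \<omega> v w] by (auto simp: kac_rate_def unit_post_def post1_diff sym)
  show "unit_post \<omega> (unit_post \<omega> v w) (unit_post \<omega> w v) = v"
    unfolding unit_post_def by (rule post1_post1[OF u])
  show "(\<integral>\<^sup>+z. (\<integral>\<^sup>+w. G (unit_post \<omega> z w) (unit_post \<omega> w z) \<partial>lborel) \<partial>lborel) = (\<integral>\<^sup>+z. (\<integral>\<^sup>+w. G z w \<partial>lborel) \<partial>lborel)"
    if "(\<lambda>(z, w). G z w) \<in> borel_measurable (borel \<Otimes>\<^sub>M borel)" for G :: "vec3 \<Rightarrow> vec3 \<Rightarrow> ennreal"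
    unfolding unit_post_def by (rule nn_integral_post1[OF u that])
  have "(\<integral>\<^sup>+\<omega>. ennreal (kac_rate B \<omega> v w) \<partial>sphere_measure) \<le> (\<integral>\<^sup>+\<omega>. ennreal (kernel_norm B / 2) \<partial>sphere_measure)"
    using kernel_norm_bound[OF B(2)]
    by (intro nn_integral_mono ennreal_leI) (auto simp: kac_rate_def intro: order_trans[OF abs_ge_self])
  also have "\<dots> = ennreal (2 * pi * kernel_norm B)"
    using kernel_norm_bound(2)[OF B(2)]
    by (simp add: emeasure_sphere_measure_UNIV ennreal_mult[symmetric] mult_ac)
  finally show "(\<integral>\<^sup>+\<omega>. ennreal (kac_rate B \<omega> v w) \<partial>sphere_measure) \<le> ennreal (2 * pi * kernel_norm B)" .
  show "0 \<le> 2 * pi * kernel_norm B"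
    using kernel_norm_bound(2)[OF B(2)] by simp
qed

text \<open>In the applications \<open>k\<close> is the collision difference formed with
  \<open>post1\<close>, and \<open>k'\<close> the same with \<open>unit_post\<close>; the two agree
  on the sphere, which carries the measure.\<close>

lemma kac_hemisphere:
  assumes B: "collision_kernel B" and k: "k \<in> borel_measurable borel"
    and even: "\<And>\<omega>. k (- \<omega>) = k \<omega>" and equator: "\<And>\<omega>. \<omega> \<bullet> (v - w) = 0 \<Longrightarrow> k \<omega> = 0"
    and k': "\<And>\<omega>. norm \<omega> = 1 \<Longrightarrow> k' \<omega> = k \<omega>"
  shows "(LINT \<omega>:{\<omega>. 0 \<le> \<omega> \<bullet> (v - w)}|sphere_measure. B \<omega> (v - w) * k \<omega>) =
    (\<integral>\<omega>. kac_rate B \<omega> v w * k' \<omega> \<partial>sphere_measure)"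
proof -
  let ?g = "\<lambda>\<omega>. (if norm \<omega> = 1 then B \<omega> (v - w) else 0) * k \<omega>"
  have [measurable]: "(\<lambda>\<omega>. B \<omega> (v - w)) \<in> borel_measurable borel"
    by (rule kernel_measurable[OF B]) measurable
  note [measurable] = k
  have "(LINT \<omega>:{\<omega>. 0 \<le> \<omega> \<bullet> (v - w)}|sphere_measure. B \<omega> (v - w) * k \<omega>) =
     (LINT \<omega>:{\<omega>. 0 \<le> \<omega> \<bullet> (v - w)}|sphere_measure. ?g \<omega>)"
    unfolding set_lebesgue_integral_def
    by (rule integral_cong_AE) (use AE_sphere_measure in \<open>measurable, measurable, auto\<close>)
  also have "\<dots> = (\<integral>\<omega>. ?g \<omega> / 2 \<partial>sphere_measure)"
    using even equator by (intro hemisphere_integral) (measurable, auto simp: collision_kernel_symmetries[OF B])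
  also have "(\<lambda>\<omega>. ?g \<omega> / 2) = (\<lambda>\<omega>. kac_rate B \<omega> v w * k' \<omega>)"
    using equator k' by (auto simp: kac_rate_def fun_eq_iff)
  finally show ?thesis .
qed

text \<open>Without transport the solutions themselves satisfy the abstract equations. What remains
  is to rewrite the hemisphere integrals and to extend the curves constantly to negative
  times.\<close>

theorem kac_chaos:
  fixes B :: "vec3 \<Rightarrow> vec3 \<Rightarrow> real" and f :: "real \<Rightarrow> vec3 \<Rightarrow> real"
  assumes B: "collision_kernel B" "bounded_kernel B" and C0: "1 \<le> C0" and B0: "0 < B0"
    and FN: "kac_N_solution B N F" "symmetric N (F 0)" "prob_density (phase N) (F 0)"
    and f: "boltzmann_solution B f" "prob_density lborel (f 0)"
    and E: "\<forall>j\<in>{2..N}. L1_norm (phase j) (corr_error N (F 0) (f 0) j) \<le> ennreal (C0 ^ j * (real j / sqrt (real N)) ^ j)"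
    and E1: "L1_norm (phase 1) (corr_error N (F 0) (f 0) 1) \<le> ennreal (B0 / real N)"
    and t: "0 < t" and j: "j \<in> {1..N}"
  shows "L1_norm (phase j) (\<lambda>z. marginal N (F t) j z - tensor (f t) {1..j} z)
    \<le> ennreal (D2 B0 C0 * exp (2 * D1 * t * kernel_norm B * (2 * pi + 0)) * (real j)\<^sup>2 / real N)"
proof -
  interpret collision_model sphere_measure "\<lambda>_. kac_rate B" "\<lambda>_. unit_post" "2 * pi * kernel_norm B"
    by (rule kac_collision_model[OF B])
  let ?F = "\<lambda>t. F (max 0 t)" and ?f = "\<lambda>t. f (max 0 t)"
  have mF: "mild_solution (phase N) (\<lambda>_ V. V) (kac_master B N) F" and dF: "\<And>t. 0 \<le> t \<Longrightarrow> prob_density (phase N) (F t)"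
    using FN(1) by (auto simp: kac_N_solution_def)
  have mf: "mild_solution lborel (\<lambda>_ v. v) (kac_kinetic B) f"
    using f(1) by (simp add: boltzmann_solution_def)
  have Fi: "integrable (phase N) (F s)" if "0 \<le> s" for s using dF[OF that] by (simp add: prob_density_def)
  have fi: "integrable lborel (f s)" if "0 \<le> s" for s using mf that by (simp add: mild_solution_def)
  have master_eq: "kac_master B N G V = master s N G V"
    if G: "G \<in> borel_measurable (phase N)" and V: "V \<in> space (phase N)" for G V s
    unfolding kac_master_def master_def
  proof (intro arg_cong2[where f="(*)"] refl sum.cong)
    fix i k assume ik: "i \<in> {1..N}" "k \<in> {i<..N}"
    then have k: "k \<in> {1..N}" by auto
    let ?k = "\<lambda>\<omega>. G (V(i := post1 \<omega> (V i) (V k), k := post2 \<omega> (V i) (V k))) - G V"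
    show "(LINT \<omega>:{\<omega>. 0 \<le> \<omega> \<bullet> (V i - V k)}|sphere_measure. B \<omega> (V i - V k) * ?k \<omega>) = pair_op s i k G V"
      unfolding pair_op_def
    proof (rule kac_hemisphere[OF B(1)])
      have "(\<lambda>\<omega>. V(i := post1 \<omega> (V i) (V k), k := post2 \<omega> (V i) (V k))) \<in> measurable borel (phase N)"
        unfolding post2_eq_post1 using ik k V
        by (intro measurable_fun_upd[where J="{1..N}"] measurable_const) (auto simp: insert_absorb)
      from measurable_compose[OF this G] show "?k \<in> borel_measurable borel" by measurable
      show "?k (- \<omega>) = ?k \<omega>" for \<omega> by (simp add: post2_eq_post1 post1_minus)
      show "?k \<omega> = 0" if "\<omega> \<bullet> (V i - V k) = 0" for \<omega>
        using that by (simp add: post2_eq_post1 post1_orthogonal inner_diff_right)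
      show "G (col s \<omega> i k V) - G V = ?k \<omega>" if "norm \<omega> = 1" for \<omega>
        using that by (simp add: col_def unit_post_def post2_eq_post1)
    qed
  qed
  have kinetic_eq: "kac_kinetic B g v = kinetic s g v" if g [measurable]: "g \<in> borel_measurable borel" for g v s
    unfolding kac_kinetic_def kinetic_def
  proof (rule Bochner_Integration.integral_cong[OF refl])
    fix w :: vec3
    let ?k = "\<lambda>\<omega>. g (post1 \<omega> v w) * g (post2 \<omega> v w) - g v * g w"
    show "(LINT \<omega>:{\<omega>. 0 \<le> \<omega> \<bullet> (v - w)}|sphere_measure. B \<omega> (v - w) * ?k \<omega>) =
      (\<integral>\<omega>. kac_rate B \<omega> v w * (g (unit_post \<omega> v w) * g (unit_post \<omega> w v) - g v * g w) \<partial>sphere_measure)"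
    proof (rule kac_hemisphere[OF B(1)])
      show "?k \<in> borel_measurable borel" unfolding post2_eq_post1 by measurable
      show "?k (- \<omega>) = ?k \<omega>" for \<omega> by (simp add: post2_eq_post1 post1_minus)
      show "?k \<omega> = 0" if "\<omega> \<bullet> (v - w) = 0" for \<omega>
        using that by (simp add: post2_eq_post1 post1_orthogonal inner_diff_right)
    qed (simp add: unit_post_def post2_eq_post1)
  qed
  have evF: "evolves (phase N) (\<lambda>s. master s N (?F s)) ?F"
    unfolding evolves_def
  proof (intro conjI allI impI)
    show "integrable (phase N) (?F t)" for t by (rule Fi) simp
    have um: "(\<lambda>(t, z). ?F t z) \<in> borel_measurable (borel \<Otimes>\<^sub>M phase N)"
      by (rule mild_solution_measurable[OF mF])
    show "(\<lambda>(s, z). master s N (?F s) z) \<in> borel_measurable (borel \<Otimes>\<^sub>M phase N)"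
      unfolding master_def case_prod_beta'
      by (intro borel_measurable_times borel_measurable_const borel_measurable_sum
          pair_op_meas[OF um, unfolded case_prod_beta']) auto
    fix t :: real assume t: "0 \<le> t"
    have "AE z in phase N. F t z = F 0 z + (LINT s:{0..t}|lborel. kac_master B N (F s) z)"
      using mF t by (simp add: mild_solution_def)
    then show "AE z in phase N. ?F t z = ?F 0 z + (LINT s:{0..t}|lborel. master s N (?F s) z)"
      using AE_space
    proof eventually_elim
      fix z assume z: "F t z = F 0 z + (LINT s:{0..t}|lborel. kac_master B N (F s) z)" "z \<in> space (phase N)"
      have "(LINT s:{0..t}|lborel. kac_master B N (F s) z) = (LINT s:{0..t}|lborel. master s N (?F s) z)"
        by (rule set_lebesgue_integral_cong) (use z(2) Fi in \<open>auto intro!: master_eq\<close>)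
      with z(1) t show "?F t z = ?F 0 z + (LINT s:{0..t}|lborel. master s N (?F s) z)" by simp
    qed
  qed
  have evf: "evolves lborel (\<lambda>s. kinetic s (?f s)) ?f"
    unfolding evolves_def
  proof (intro conjI allI impI)
    show "integrable lborel (?f t)" for t by (rule fi) simp
    have "(\<lambda>(t, z). ?f t z) \<in> borel_measurable (borel \<Otimes>\<^sub>M borel)"
      using mild_solution_measurable[OF mf] by (simp cong: measurable_cong_sets)
    from kinetic_meas[OF this]
    show "(\<lambda>(s, z). kinetic s (?f s) z) \<in> borel_measurable (borel \<Otimes>\<^sub>M lborel)"
      by (simp cong: measurable_cong_sets)
    fix t :: real assume t: "0 \<le> t"
    have "AE z in lborel. f t z = f 0 z + (LINT s:{0..t}|lborel. kac_kinetic B (f s) z)"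
      using mf t by (simp add: mild_solution_def)
    then show "AE z in lborel. ?f t z = ?f 0 z + (LINT s:{0..t}|lborel. kinetic s (?f s) z)"
    proof eventually_elim
      fix z assume z: "f t z = f 0 z + (LINT s:{0..t}|lborel. kac_kinetic B (f s) z)"
      have "f s \<in> borel_measurable borel" if "0 \<le> s" for s using fi[OF that] by auto
      then have "(LINT s:{0..t}|lborel. kac_kinetic B (f s) z) = (LINT s:{0..t}|lborel. kinetic s (?f s) z)"
        by (intro set_lebesgue_integral_cong) (auto intro!: kinetic_eq)
      with z t show "?f t z = ?f 0 z + (LINT s:{0..t}|lborel. kinetic s (?f s) z)" by simp
    qed
  qed
  have fb: "\<exists>R. \<forall>s. 0 \<le> s \<longrightarrow> s \<le> T \<longrightarrow> (\<integral>v. \<bar>?f s v\<bar> \<partial>lborel) \<le> R" if "0 \<le> T" for T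
    using mild_solution_locally_bounded[OF mf that] by (simp add: max_absorb2)
  have F1: "(\<integral>z. \<bar>?F s z\<bar> \<partial>phase N) \<le> 1" for s
    using prob_density_L1[OF dF[of "max 0 s"]] by simp
  note main = chaos_bound[OF evF _ F1 evf _ fb _ _ _ C0 B0, where \<Lambda>="2 * pi * kernel_norm B" and t=t and j=j]
  have bound: "gap N (F t) (f t) \<psi> \<le> D2 B0 C0 * exp (2 * D1 * t * (2 * pi * kernel_norm B)) * (real j)\<^sup>2 / N"
    and mass: "(\<integral>v. f t v \<partial>lborel) = 1" if "test_on N {1..j} \<psi>" for \<psi>
    using main[OF _ _ _ _ _ _ _ _ _ _ _ that] FN f E E1 t j by simp_all
  have "(\<integral>v. f t v \<partial>lborel) = 1"
    by (rule mass[of "\<lambda>_. 0"]) (simp add: test_on_def)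
  then have "L1_norm (phase j) (\<lambda>z. marginal N (F t) j z - tensor (f t) {1..j} z)
    \<le> ennreal (D2 B0 C0 * exp (2 * D1 * t * (2 * pi * kernel_norm B)) * (real j)\<^sup>2 / N)"
    using t j by (intro L1_marginal_le_of_gap Fi fi bound) auto
  then show ?thesis by (simp add: mult_ac)
qed

section \<open>The soft spheres model\<close>

lemma modulation_norm_bound:
  assumes "modulation h"
  shows "0 \<le> r \<Longrightarrow> h r \<le> modulation_norm h" and "0 \<le> r \<Longrightarrow> 0 \<le> h r" and "0 \<le> modulation_norm h"
proof -
  have h: "bounded (h ` {0..})" "\<And>r. 0 \<le> r \<Longrightarrow> 0 \<le> h r"
    using assms by (auto simp: modulation_def)
  obtain K where K: "\<And>x. x \<in> h ` {0..} \<Longrightarrow> norm x \<le> K"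
    using h(1) unfolding bounded_iff by blast
  have "bdd_above ((\<lambda>r. \<bar>h r\<bar>) ` {0..})"
    using K by (intro bdd_aboveI[of _ K]) fastforce
  then have le: "\<bar>h r\<bar> \<le> modulation_norm h" if "0 \<le> r" for r
    unfolding modulation_norm_def using that by (intro cSUP_upper) auto
  show "0 \<le> r \<Longrightarrow> h r \<le> modulation_norm h" using le[of r] by simp
  show "0 \<le> r \<Longrightarrow> 0 \<le> h r" by (rule h(2))
  show "0 \<le> modulation_norm h" using le[of 0] by simp
qed

section \<open>Collision directions and the free flow\<close>

lemma borel_measurable_fst':
  "f \<in> borel_measurable M \<Longrightarrow> (\<lambda>x. fst (f x :: 'a::second_countable_topology \<times> 'b::second_countable_topology)) \<in> borel_measurable M"
  by (rule measurable_compose[where g=fst and N=borel], assumption, subst borel_prod[symmetric], rule measurable_fst)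

lemma borel_measurable_snd':
  "f \<in> borel_measurable M \<Longrightarrow> (\<lambda>x. snd (f x :: 'a::second_countable_topology \<times> 'b::second_countable_topology)) \<in> borel_measurable M"
  by (rule measurable_compose[where g=snd and N=borel], assumption, subst borel_prod[symmetric], rule measurable_snd)

lemma direction_unit: "norm (direction x y) = 1 \<or> direction x y = 0"
  by (cases "x = y") (auto simp: direction_def)

lemma norm_direction: "x \<noteq> y \<Longrightarrow> norm (direction x y) = 1"
  by (simp add: direction_def)

text \<open>Exchanging the particles reverses the direction, but the collision and \<open>B\<close>
  are even in it.\<close>

lemma direction_swap: "direction y x = - direction x y"
  by (simp add: direction_def norm_minus_commute flip: scaleR_minus_right)

lemma direction_measurable [measurable (raw)]:
  assumes [measurable]: "p \<in> borel_measurable M" "q \<in> borel_measurable M"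
  shows "(\<lambda>x. direction (p x) (q x)) \<in> borel_measurable M"
  unfolding direction_def by measurable

lemma free_flow1_alt: "free_flow1 t z = (fst z + t *\<^sub>R snd z, snd z)"
  by (simp add: free_flow1_def case_prod_beta')

lemma free_flow1_measurable [measurable (raw)]:
  assumes [measurable]: "t \<in> borel_measurable M" "z \<in> borel_measurable M"
  shows "(\<lambda>x. free_flow1 (t x) (z x)) \<in> borel_measurable M"
proof -
  note [measurable (raw)] = borel_measurable_fst' borel_measurable_snd'
  show ?thesis unfolding free_flow1_alt by measurable
qed

lemma free_flow1_add: "free_flow1 s (free_flow1 t z) = free_flow1 (s + t) z"
  by (simp add: free_flow1_alt scaleR_add_left add_ac)

lemma free_flow1_0 [simp]: "free_flow1 0 z = z"
  by (simp add: free_flow1_alt)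

lemma nn_integral_lborel_prod:
  fixes f :: "vec3 \<times> vec3 \<Rightarrow> ennreal"
  assumes f: "f \<in> borel_measurable borel"
  shows "(\<integral>\<^sup>+z. f z \<partial>lborel) = (\<integral>\<^sup>+x. (\<integral>\<^sup>+v. f (x, v) \<partial>lborel) \<partial>lborel)"
    and "(\<integral>\<^sup>+z. f z \<partial>lborel) = (\<integral>\<^sup>+v. (\<integral>\<^sup>+x. f (x, v) \<partial>lborel) \<partial>lborel)"
proof -
  have f': "f \<in> borel_measurable (lborel \<Otimes>\<^sub>M lborel)"
    using f unfolding lborel_prod by simp
  show "(\<integral>\<^sup>+z. f z \<partial>lborel) = (\<integral>\<^sup>+x. (\<integral>\<^sup>+v. f (x, v) \<partial>lborel) \<partial>lborel)"
    using lborel.nn_integral_fst[OF f'] by (simp add: lborel_prod)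
  show "(\<integral>\<^sup>+z. f z \<partial>lborel) = (\<integral>\<^sup>+v. (\<integral>\<^sup>+x. f (x, v) \<partial>lborel) \<partial>lborel)"
    using lborel_pair.nn_integral_snd[OF f'] by (simp add: lborel_prod)
qed

text \<open>At fixed velocity the flow is a translation of the position.\<close>

lemma nn_integral_free_flow1:
  assumes [measurable]: "f \<in> borel_measurable borel"
  shows "(\<integral>\<^sup>+z. f (free_flow1 t z) \<partial>lborel) = (\<integral>\<^sup>+z. f z \<partial>lborel)"
proof -
  have "(\<integral>\<^sup>+z. f (free_flow1 t z) \<partial>lborel) = (\<integral>\<^sup>+v. (\<integral>\<^sup>+x. f (x + t *\<^sub>R v, v) \<partial>lborel) \<partial>lborel)"
  proof -
    have "(\<lambda>z. f (free_flow1 t z)) \<in> borel_measurable borel" by measurable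
    from nn_integral_lborel_prod(2)[OF this] show ?thesis by (simp add: free_flow1_alt)
  qed
  also have "\<dots> = (\<integral>\<^sup>+v. (\<integral>\<^sup>+x. f (x, v) \<partial>lborel) \<partial>lborel)"
    by (intro nn_integral_cong nn_integral_lborel_translate) measurable
  also have "\<dots> = (\<integral>\<^sup>+z. f z \<partial>lborel)"
    by (rule nn_integral_lborel_prod(2)[symmetric]) measurable
  finally show ?thesis .
qed

lemma distr_free_flow1: "distr lborel lborel (free_flow1 t) = lborel"
proof (rule measure_eqI)
  fix A assume "A \<in> sets (distr lborel lborel (free_flow1 t))"
  then have A [measurable]: "A \<in> sets borel" by simp
  have "emeasure (distr lborel lborel (free_flow1 t)) A = (\<integral>\<^sup>+z. indicator A z \<partial>distr lborel lborel (free_flow1 t))"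
    by simp
  also have "\<dots> = (\<integral>\<^sup>+z. indicator A (free_flow1 t z) \<partial>lborel)"
    by (subst nn_integral_distr) auto
  also have "\<dots> = (\<integral>\<^sup>+z. indicator A z \<partial>lborel)"
    by (rule nn_integral_free_flow1) measurable
  also have "\<dots> = emeasure lborel A" by simp
  finally show "emeasure (distr lborel lborel (free_flow1 t)) A = emeasure lborel A" .
qed simp


lemma distr_PiM_lborel_map:
  fixes T :: "'z::euclidean_space \<Rightarrow> 'z" and I :: "nat set"
  assumes "finite I" and Tm [measurable]: "T \<in> borel_measurable borel" and T: "distr lborel lborel T = lborel"
  shows "distr (PiM I (\<lambda>_. lborel)) (PiM I (\<lambda>_. lborel)) (\<lambda>z. \<lambda>i\<in>I. T (z i)) = PiM I (\<lambda>_. lborel)"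
    (is "distr ?I ?I ?f = _")
proof -
  interpret product_sigma_finite "\<lambda>_::nat. lborel :: 'z measure" by (rule product_sigma_finite_lborel)
  have "(\<lambda>z :: nat \<Rightarrow> 'z. z i) \<in> borel_measurable ?I" if "i \<in> I" for i
    using measurable_component_singleton[OF that, of "\<lambda>_. lborel"] by simp
  then have f: "?f \<in> measurable ?I ?I"
    by (intro measurable_restrict) (auto intro: measurable_compose[OF _ Tm])
  show ?thesis
  proof (rule PiM_eqI)
    fix A :: "nat \<Rightarrow> 'z set" assume A: "\<And>i. i \<in> I \<Longrightarrow> A i \<in> sets lborel"
    have TA: "T -` A i \<in> sets borel" if "i \<in> I" for i
      using measurable_sets[OF Tm, of "A i"] A[OF that] by simp
    have pre: "?f -` PiE I A \<inter> space ?I = PiE I (\<lambda>i. T -` A i)"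
      by (auto simp: space_PiM PiE_iff)
    have "emeasure (distr ?I ?I ?f) (PiE I A) = emeasure ?I (PiE I (\<lambda>i. T -` A i))"
      using A assms(1) f by (subst emeasure_distr) (auto simp: pre[symmetric] intro!: sets_PiM_I_finite)
    also have "\<dots> = (\<Prod>i\<in>I. emeasure lborel (T -` A i))"
      using TA assms(1) by (intro emeasure_PiM) auto
    also have "\<dots> = (\<Prod>i\<in>I. emeasure lborel (A i))"
    proof (rule prod.cong[OF refl])
      fix i assume i: "i \<in> I"
      have "emeasure lborel (A i) = emeasure (distr lborel lborel T) (A i)" by (simp add: T)
      also have "\<dots> = emeasure lborel (T -` A i)"
        using A[OF i] by (subst emeasure_distr) auto
      finally show "emeasure lborel (T -` A i) = emeasure lborel (A i)" ..
    qed
    finally show "emeasure (distr ?I ?I ?f) (PiE I A) = (\<Prod>i\<in>I. emeasure lborel (A i))" .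
  qed (simp_all add: assms(1))
qed

lemma free_flow_measurable:
  "(\<lambda>(t, z). free_flow N t z) \<in> measurable (borel \<Otimes>\<^sub>M phase N) (phase N)"
  unfolding free_flow_def case_prod_beta'
proof (rule measurable_restrict)
  fix i assume i: "i \<in> {1..N}"
  have "(\<lambda>x. snd x i) \<in> measurable (borel \<Otimes>\<^sub>M phase N) (lborel :: (vec3 \<times> vec3) measure)"
    by (rule measurable_compose[OF measurable_snd measurable_component_singleton[OF i]])
  then have [measurable]: "(\<lambda>x. snd x i :: vec3 \<times> vec3) \<in> borel_measurable (borel \<Otimes>\<^sub>M phase N)" by simp
  show "(\<lambda>x. free_flow1 (fst x) (snd x i)) \<in> measurable (borel \<Otimes>\<^sub>M phase N) lborel" by measurable
qed

lemma free_flow_measurable': "free_flow N t \<in> measurable (phase N) (phase N)"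
  using measurable_compose[OF measurable_Pair1'[of t] free_flow_measurable] by simp

lemma distr_free_flow: "distr (phase N) (phase N) (free_flow N t) = phase N"
proof -
  have "free_flow1 t \<in> borel_measurable borel" by measurable
  from distr_PiM_lborel_map[OF _ this distr_free_flow1] show ?thesis
    by (simp add: free_flow_def[abs_def])
qed

lemma integral_free_flow:
  fixes G :: "(nat \<Rightarrow> vec3 \<times> vec3) \<Rightarrow> real"
  assumes "G \<in> borel_measurable (phase N)"
  shows "(\<integral>z. G (free_flow N t z) \<partial>phase N) = (\<integral>z. G z \<partial>phase N)"
  using integral_distr[OF free_flow_measurable' assms, of t] by (simp add: distr_free_flow)

lemma integral_free_flow1:
  fixes g :: "vec3 \<times> vec3 \<Rightarrow> real"
  assumes "g \<in> borel_measurable borel"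
  shows "(\<integral>z. g (free_flow1 t z) \<partial>lborel) = (\<integral>z. g z \<partial>lborel)"
proof -
  have m: "free_flow1 t \<in> measurable lborel lborel" by measurable
  have "(\<integral>z. g z \<partial>distr lborel lborel (free_flow1 t)) = (\<integral>z. g (free_flow1 t z) \<partial>lborel)"
    by (rule integral_distr[OF m]) (use assms in simp)
  then show ?thesis by (simp add: distr_free_flow1)
qed

text \<open>At coinciding positions \<open>direction\<close> is 0, where \<open>B\<close> is subject
  to no condition, not even a sign; the rate is set to 0 there. The equations do not change, because
  the collision with \<omega> = 0 is trivial.\<close>

definition soft_rate ::
  "(real \<Rightarrow> real) \<Rightarrow> (vec3 \<Rightarrow> vec3 \<Rightarrow> real) \<Rightarrow> vec3 \<times> vec3 \<Rightarrow> vec3 \<times> vec3 \<Rightarrow> real" where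
  "soft_rate h B z w = (if fst z = fst w then 0
     else h (norm (fst z - fst w)) * B (direction (fst z) (fst w)) (snd z - snd w))"

definition soft_post :: "vec3 \<times> vec3 \<Rightarrow> vec3 \<times> vec3 \<Rightarrow> vec3 \<times> vec3" where
  "soft_post z w = (fst z, post1 (direction (fst z) (fst w)) (snd z) (snd w))"

lemma fst_soft_post [simp]: "fst (soft_post z w) = fst z"
  by (simp add: soft_post_def)

lemma snd_soft_post_swap: "snd (soft_post w z) = post1 (direction (fst z) (fst w)) (snd w) (snd z)"
  by (simp add: soft_post_def direction_swap[of "fst w"] post1_minus)

lemma soft_post_soft_post: "soft_post (soft_post z w) (soft_post w z) = z"
proof -
  have "snd (soft_post z w) = post1 (direction (fst z) (fst w)) (snd z) (snd w)"
    by (simp add: soft_post_def)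
  then have "snd (soft_post (soft_post z w) (soft_post w z)) = snd z"
    unfolding soft_post_def[of "soft_post z w"] snd_soft_post_swap
    using post1_post1[OF direction_unit] by simp
  then show ?thesis by (simp add: prod_eq_iff)
qed

lemma soft_post_measurable [measurable (raw)]:
  assumes [measurable]: "p \<in> borel_measurable M" "q \<in> borel_measurable M"
  shows "(\<lambda>x. soft_post (p x) (q x)) \<in> borel_measurable M"
proof -
  note [measurable (raw)] = borel_measurable_fst' borel_measurable_snd'
  show ?thesis unfolding soft_post_def by measurable
qed

text \<open>Positions are unchanged, so after reordering the integrals the claim is
  \<open>nn_integral_post1\<close> in the velocities at fixed positions.\<close>

lemma nn_integral_soft_post:
  fixes G :: "vec3 \<times> vec3 \<Rightarrow> vec3 \<times> vec3 \<Rightarrow> ennreal"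
  assumes G: "(\<lambda>(z, w). G z w) \<in> borel_measurable (borel \<Otimes>\<^sub>M borel)"
  shows "(\<integral>\<^sup>+z. (\<integral>\<^sup>+w. G (soft_post z w) (soft_post w z) \<partial>lborel) \<partial>lborel) = (\<integral>\<^sup>+z. (\<integral>\<^sup>+w. G z w \<partial>lborel) \<partial>lborel)"
proof -
  have split: "(\<integral>\<^sup>+z. (\<integral>\<^sup>+w. H z w \<partial>lborel) \<partial>lborel) =
      (\<integral>\<^sup>+x. (\<integral>\<^sup>+y. (\<integral>\<^sup>+v. (\<integral>\<^sup>+w. H (x, v) (y, w) \<partial>lborel) \<partial>lborel) \<partial>lborel) \<partial>lborel)"
    if H: "(\<lambda>(z, w). H z w) \<in> borel_measurable (borel \<Otimes>\<^sub>M borel)" for H :: "vec3 \<times> vec3 \<Rightarrow> vec3 \<times> vec3 \<Rightarrow> ennreal"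
  proof -
    have Hm: "(\<lambda>x. H (p x) (q x)) \<in> borel_measurable M" if "p \<in> borel_measurable M" "q \<in> borel_measurable M"
      for p q and M :: "'x measure"
      using measurable_compose[OF measurable_Pair[OF that] H] by simp
    have Hm1: "(\<lambda>z. \<integral>\<^sup>+w. H z w \<partial>lborel) \<in> borel_measurable borel"
      by (rule lborel.borel_measurable_nn_integral) (use H in \<open>simp cong: measurable_cong_sets\<close>)
    have "(\<integral>\<^sup>+z. (\<integral>\<^sup>+w. H z w \<partial>lborel) \<partial>lborel) = (\<integral>\<^sup>+x. (\<integral>\<^sup>+v. (\<integral>\<^sup>+w. H (x, v) w \<partial>lborel) \<partial>lborel) \<partial>lborel)"
      by (rule nn_integral_lborel_prod(1)[OF Hm1])
    also have "\<dots> = (\<integral>\<^sup>+x. (\<integral>\<^sup>+v. (\<integral>\<^sup>+y. (\<integral>\<^sup>+w. H (x, v) (y, w) \<partial>lborel) \<partial>lborel) \<partial>lborel) \<partial>lborel)"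
      by (intro nn_integral_cong nn_integral_lborel_prod(1) Hm) measurable
    also have "\<dots> = (\<integral>\<^sup>+x. (\<integral>\<^sup>+y. (\<integral>\<^sup>+v. (\<integral>\<^sup>+w. H (x, v) (y, w) \<partial>lborel) \<partial>lborel) \<partial>lborel) \<partial>lborel)"
    proof (rule nn_integral_cong)
      fix x :: vec3
      have "(\<lambda>(a, w). H (x, fst a) (snd a, w)) \<in> borel_measurable ((lborel \<Otimes>\<^sub>M lborel) \<Otimes>\<^sub>M lborel)"
        unfolding case_prod_beta' by (intro Hm; measurable)
      from lborel.borel_measurable_nn_integral[OF this]
      have "(\<lambda>(v, y). \<integral>\<^sup>+w. H (x, v) (y, w) \<partial>lborel) \<in> borel_measurable (lborel \<Otimes>\<^sub>M lborel)"
        by (simp add: case_prod_beta')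
      from lborel_pair.Fubini'[OF this]
      show "(\<integral>\<^sup>+v. (\<integral>\<^sup>+y. (\<integral>\<^sup>+w. H (x, v) (y, w) \<partial>lborel) \<partial>lborel) \<partial>lborel) =
        (\<integral>\<^sup>+y. (\<integral>\<^sup>+v. (\<integral>\<^sup>+w. H (x, v) (y, w) \<partial>lborel) \<partial>lborel) \<partial>lborel)" ..
    qed
    finally show ?thesis .
  qed
  have Gm: "(\<lambda>x. G (p x) (q x)) \<in> borel_measurable M" if "p \<in> borel_measurable M" "q \<in> borel_measurable M"
    for p q and M :: "'x measure"
    using measurable_compose[OF measurable_Pair[OF that] G] by simp
  have Gp: "(\<lambda>(z, w). G (soft_post z w) (soft_post w z)) \<in> borel_measurable (borel \<Otimes>\<^sub>M borel)"
    unfolding case_prod_beta' by (intro Gm; measurable)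
  have "(\<integral>\<^sup>+v. (\<integral>\<^sup>+w. G (soft_post (x, v) (y, w)) (soft_post (y, w) (x, v)) \<partial>lborel) \<partial>lborel) =
      (\<integral>\<^sup>+v. (\<integral>\<^sup>+w. G (x, v) (y, w) \<partial>lborel) \<partial>lborel)" for x y
  proof -
    have "(\<lambda>(v, w). G (x, v) (y, w)) \<in> borel_measurable (borel \<Otimes>\<^sub>M borel)"
      unfolding case_prod_beta' by (intro Gm; measurable)
    from nn_integral_post1[OF direction_unit this, of x y] show ?thesis
      by (simp add: soft_post_def direction_swap[of y x] post1_minus)
  qed
  then show ?thesis
    unfolding split[OF G] split[OF Gp] by simp
qed

lemma soft_rate_measurable:
  assumes B: "collision_kernel B" and h: "modulation h"
    and [measurable]: "p \<in> borel_measurable M" "q \<in> borel_measurable M"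
  shows "(\<lambda>x. soft_rate h B (p x) (q x)) \<in> borel_measurable M"
proof -
  note [measurable (raw)] = borel_measurable_fst' borel_measurable_snd'
  have hm: "h \<in> borel_measurable borel" using h by (simp add: modulation_def)
  have [measurable]: "(\<lambda>x. h (norm (fst (p x) - fst (q x)))) \<in> borel_measurable M"
    by (rule measurable_compose[OF _ hm]) measurable
  have [measurable]: "(\<lambda>x. B (direction (fst (p x)) (fst (q x))) (snd (p x) - snd (q x))) \<in> borel_measurable M"
    by (rule kernel_measurable[OF B]) measurable
  show ?thesis unfolding soft_rate_def by measurable
qed

lemma soft_rate_bounds:
  assumes B: "collision_kernel B" "bounded_kernel B" and h: "modulation h"
  shows "0 \<le> soft_rate h B z w" and "soft_rate h B z w \<le> modulation_norm h * kernel_norm B"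
proof -
  note hb = modulation_norm_bound[OF h] and Bb = kernel_norm_bound[OF B(2)]
  show "0 \<le> soft_rate h B z w"
    using hb by (auto simp: soft_rate_def norm_direction collision_kernel_symmetries(1)[OF B(1)])
  show "soft_rate h B z w \<le> modulation_norm h * kernel_norm B"
    using hb Bb by (auto simp: soft_rate_def norm_direction collision_kernel_symmetries(1)[OF B(1)]
        intro!: mult_mono order_trans[OF abs_ge_self Bb(1)])
qed

text \<open>The exchange reverses both the direction and the relative velocity; each sign is
  absorbed by one symmetry of \<open>B\<close>.\<close>

lemma soft_rate_swap:
  assumes B: "collision_kernel B"
  shows "soft_rate h B w z = soft_rate h B z w"
  using collision_kernel_symmetries(2,3)[OF B norm_direction, of "fst z" "fst w" "snd z - snd w"]
    collision_kernel_symmetries(2)[OF B norm_direction, of "fst z" "fst w" "snd w - snd z"]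
  by (auto simp: soft_rate_def direction_swap[of "fst w" "fst z"] norm_minus_commute)

text \<open>The collision reflects the relative velocity, which is the remaining symmetry of
  \<open>B\<close>.\<close>

lemma soft_rate_soft_post:
  assumes B: "collision_kernel B"
  shows "soft_rate h B (soft_post z w) (soft_post w z) = soft_rate h B z w"
proof -
  have "snd (soft_post z w) - snd (soft_post w z) = reflect (direction (fst z) (fst w)) (snd z - snd w)"
    unfolding snd_soft_post_swap[of w z] by (simp add: soft_post_def[of z w] post1_diff)
  then show ?thesis
    using collision_kernel_symmetries(4)[OF B norm_direction] by (simp add: soft_rate_def)
qed

text \<open>The interaction picture: conjugating the collisions at time \<open>t\<close> with the free flow removes the
  transport term, at the price of a time-dependent collision rate.\<close>

lemma soft_collision_model:
  assumes B: "collision_kernel B" "bounded_kernel B" and h: "modulation h"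
  shows "collision_model (count_space (UNIV :: unit set))
    (\<lambda>t _ z w. soft_rate h B (free_flow1 t z) (free_flow1 t w))
    (\<lambda>t _ z w. free_flow1 (- t) (soft_post (free_flow1 t z) (free_flow1 t w)))
    (modulation_norm h * kernel_norm B)"
proof
  let ?\<nu> = "count_space (UNIV :: unit set)"
  show "\<exists>A. countable A \<and> A \<subseteq> sets ?\<nu> \<and> \<Union> A = space ?\<nu> \<and> (\<forall>a\<in>A. emeasure ?\<nu> a \<noteq> \<infinity>)"
    by (intro exI[of _ "{UNIV}"]) simp
  let ?M = "(borel :: real measure) \<Otimes>\<^sub>M ?\<nu> \<Otimes>\<^sub>M (borel :: (vec3 \<times> vec3) measure) \<Otimes>\<^sub>M (borel :: (vec3 \<times> vec3) measure)"
  show "(\<lambda>(t, \<omega>, z, w). soft_rate h B (free_flow1 t z) (free_flow1 t w)) \<in> borel_measurable ?M"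
    unfolding case_prod_beta' by (intro soft_rate_measurable[OF B(1) h]) measurable
  show "(\<lambda>(t, \<omega>, z, w). free_flow1 (- t) (soft_post (free_flow1 t z) (free_flow1 t w))) \<in> borel_measurable ?M"
    unfolding case_prod_beta' by measurable
  fix t :: real and z w :: "vec3 \<times> vec3"
  show "0 \<le> soft_rate h B (free_flow1 t z) (free_flow1 t w)"
    by (rule soft_rate_bounds[OF B h])
  show "soft_rate h B (free_flow1 t w) (free_flow1 t z) = soft_rate h B (free_flow1 t z) (free_flow1 t w)"
    by (rule soft_rate_swap[OF B(1)])
  show "soft_rate h B
      (free_flow1 t (free_flow1 (- t) (soft_post (free_flow1 t z) (free_flow1 t w))))
      (free_flow1 t (free_flow1 (- t) (soft_post (free_flow1 t w) (free_flow1 t z)))) =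
    soft_rate h B (free_flow1 t z) (free_flow1 t w)"
    by (simp add: free_flow1_add soft_rate_soft_post[OF B(1)])
  show "free_flow1 (- t) (soft_post
      (free_flow1 t (free_flow1 (- t) (soft_post (free_flow1 t z) (free_flow1 t w))))
      (free_flow1 t (free_flow1 (- t) (soft_post (free_flow1 t w) (free_flow1 t z))))) = z"
    by (simp add: free_flow1_add soft_post_soft_post)
  show "(\<integral>\<^sup>+\<omega>. ennreal (soft_rate h B (free_flow1 t z) (free_flow1 t w)) \<partial>?\<nu>) \<le> ennreal (modulation_norm h * kernel_norm B)"
    using soft_rate_bounds[OF B h] by (simp add: nn_integral_count_space_finite ennreal_leI)
  show "0 \<le> modulation_norm h * kernel_norm B"
    using modulation_norm_bound(3)[OF h] kernel_norm_bound(2)[OF B(2)] by simp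
  fix G :: "vec3 \<times> vec3 \<Rightarrow> vec3 \<times> vec3 \<Rightarrow> ennreal"
  assume G: "(\<lambda>(z, w). G z w) \<in> borel_measurable (borel \<Otimes>\<^sub>M borel)"
  have Gm: "(\<lambda>x. G (p x) (q x)) \<in> borel_measurable M" if "p \<in> borel_measurable M" "q \<in> borel_measurable M"
    for p q and M :: "'x measure"
    using measurable_compose[OF measurable_Pair[OF that] G] by simp
  have flow: "(\<integral>\<^sup>+z. (\<integral>\<^sup>+w. H (free_flow1 s z) (free_flow1 s w) \<partial>lborel) \<partial>lborel) = (\<integral>\<^sup>+z. (\<integral>\<^sup>+w. H z w \<partial>lborel) \<partial>lborel)"
    if H: "(\<lambda>(z, w). H z w) \<in> borel_measurable (borel \<Otimes>\<^sub>M borel)" for H :: "vec3 \<times> vec3 \<Rightarrow> vec3 \<times> vec3 \<Rightarrow> ennreal" and s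
  proof -
    have "(\<lambda>w. H z w) \<in> borel_measurable borel" for z
      using measurable_compose[OF measurable_Pair1'[of z] H] by simp
    then have "(\<integral>\<^sup>+z. (\<integral>\<^sup>+w. H (free_flow1 s z) (free_flow1 s w) \<partial>lborel) \<partial>lborel) =
        (\<integral>\<^sup>+z. (\<integral>\<^sup>+w. H (free_flow1 s z) w \<partial>lborel) \<partial>lborel)"
      by (intro nn_integral_cong nn_integral_free_flow1)
    also have "\<dots> = (\<integral>\<^sup>+z. (\<integral>\<^sup>+w. H z w \<partial>lborel) \<partial>lborel)"
      by (rule nn_integral_free_flow1, rule lborel.borel_measurable_nn_integral)
         (use H in \<open>simp cong: measurable_cong_sets\<close>)
    finally show ?thesis .
  qed
  \<comment> \<open>The three factors of the conjugated collision are removed one at a time: the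
    forward flow, the collision, the backward flow.\<close>
  let ?H1 = "\<lambda>z w. G (free_flow1 (- t) (soft_post z w)) (free_flow1 (- t) (soft_post w z))"
  let ?H2 = "\<lambda>z w. G (free_flow1 (- t) z) (free_flow1 (- t) w)"
  have "(\<lambda>(z, w). ?H1 z w) \<in> borel_measurable (borel \<Otimes>\<^sub>M borel)"
    unfolding case_prod_beta' by (intro Gm; measurable)
  from flow[OF this, of t]
  have "(\<integral>\<^sup>+z. (\<integral>\<^sup>+w. ?H1 (free_flow1 t z) (free_flow1 t w) \<partial>lborel) \<partial>lborel) = (\<integral>\<^sup>+z. (\<integral>\<^sup>+w. ?H1 z w \<partial>lborel) \<partial>lborel)" .
  also have "\<dots> = (\<integral>\<^sup>+z. (\<integral>\<^sup>+w. ?H2 z w \<partial>lborel) \<partial>lborel)"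
    by (rule nn_integral_soft_post[of ?H2]) (unfold case_prod_beta', intro Gm; measurable)
  also have "\<dots> = (\<integral>\<^sup>+z. (\<integral>\<^sup>+w. G z w \<partial>lborel) \<partial>lborel)"
    by (rule flow[OF G])
  finally show "(\<integral>\<^sup>+z. (\<integral>\<^sup>+w. G (free_flow1 (- t) (soft_post (free_flow1 t z) (free_flow1 t w)))
      (free_flow1 (- t) (soft_post (free_flow1 t w) (free_flow1 t z))) \<partial>lborel) \<partial>lborel) =
    (\<integral>\<^sup>+z. (\<integral>\<^sup>+w. G z w \<partial>lborel) \<partial>lborel)" .
qed

section \<open>The Povzner equation in the abstract model\<close>

lemma integral_unit: "(\<integral>\<omega>. k \<omega> \<partial>count_space (UNIV :: unit set)) = (k () :: real)"
  by (simp add: lebesgue_integral_count_space_finite UNIV_unit)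

lemma soft_kinetic_integrand:
  assumes "z = (x, v)" "w = (y, v1)"
  shows "(let \<omega> = direction x y in h (norm (x - y)) * B \<omega> (v - v1) *
      (g (x, post1 \<omega> v v1) * g (y, post2 \<omega> v v1) - g (x, v) * g (y, v1))) =
    soft_rate h B z w * (g (soft_post z w) * g (soft_post w z) - g z * g w)"
proof (cases "x = y")
  case True
  then have "direction x y = 0" by (simp add: direction_def)
  then show ?thesis using assms True by (simp add: soft_rate_def post2_eq_post1 Let_def)
next
  case False
  then show ?thesis
    using assms by (simp add: soft_rate_def soft_post_def post2_eq_post1 Let_def direction_swap[of y x] post1_minus)
qed

text \<open>\<open>soft_kinetic\<close> integrates over position and velocity successively, the
  abstract operator over their product. Fubini identifies the two where the integrand is integrable
  in \<open>w\<close>. This holds for almost every \<open>z\<close>, because the collision preserves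
  the measure and both gain and loss are controlled by the squared norm of \<open>g\<close>.\<close>

lemma soft_kinetic_AE:
  fixes g :: "vec3 \<times> vec3 \<Rightarrow> real"
  assumes B: "collision_kernel B" "bounded_kernel B" and h: "modulation h" and g: "integrable lborel g"
  shows "AE z in lborel. soft_kinetic h B g z =
    (\<integral>w. soft_rate h B z w * (g (soft_post z w) * g (soft_post w z) - g z * g w) \<partial>lborel)"
proof -
  have [measurable]: "g \<in> borel_measurable borel" using g by auto
  let ?K = "\<lambda>z w. soft_rate h B z w * (g (soft_post z w) * g (soft_post w z) - g z * g w)"
  let ?m = "modulation_norm h * kernel_norm B"
  note rb = soft_rate_bounds[OF B h]
  have [measurable]: "(\<lambda>x. soft_rate h B (p x) (q x)) \<in> borel_measurable M"
    if "p \<in> borel_measurable M" "q \<in> borel_measurable M" for p q and M :: "'x measure"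
    by (rule soft_rate_measurable[OF B(1) h that])
  have Km: "(\<lambda>x. ?K (fst x) (snd x)) \<in> borel_measurable (lborel \<Otimes>\<^sub>M lborel)"
    by measurable
  have gg: "(\<integral>\<^sup>+z. (\<integral>\<^sup>+w. ennreal \<bar>g z\<bar> * ennreal \<bar>g w\<bar> \<partial>lborel) \<partial>lborel) < \<infinity>"
  proof -
    have "(\<integral>\<^sup>+w. ennreal \<bar>g w\<bar> \<partial>lborel) < \<infinity>"
      using g by (simp add: integrable_iff_bounded)
    then show ?thesis
      by (simp add: nn_integral_cmult nn_integral_multc ennreal_mult_less_top)
  qed
  have "(\<integral>\<^sup>+x. ennreal (norm (?K (fst x) (snd x))) \<partial>(lborel \<Otimes>\<^sub>M lborel)) =
      (\<integral>\<^sup>+z. (\<integral>\<^sup>+w. ennreal (norm (?K z w)) \<partial>lborel) \<partial>lborel)"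
    using Km by (subst lborel.nn_integral_fst[symmetric]) simp_all
  also have "\<dots> \<le> (\<integral>\<^sup>+z. (\<integral>\<^sup>+w. ennreal ?m * (ennreal \<bar>g (soft_post z w)\<bar> * ennreal \<bar>g (soft_post w z)\<bar>)
      + ennreal ?m * (ennreal \<bar>g z\<bar> * ennreal \<bar>g w\<bar>) \<partial>lborel) \<partial>lborel)"
  proof (intro nn_integral_mono)
    fix z w
    have "norm (?K z w) \<le> ?m * (\<bar>g (soft_post z w) * g (soft_post w z)\<bar> + \<bar>g z * g w\<bar>)"
      using rb[of z w] unfolding real_norm_def abs_mult[of "soft_rate h B z w"]
      by (intro mult_mono abs_triangle_ineq4) auto
    also have "\<dots> = ?m * (\<bar>g (soft_post z w)\<bar> * \<bar>g (soft_post w z)\<bar>) + ?m * (\<bar>g z\<bar> * \<bar>g w\<bar>)"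
      by (simp add: abs_mult distrib_left)
    finally have "ennreal (norm (?K z w)) \<le> ennreal (?m * (\<bar>g (soft_post z w)\<bar> * \<bar>g (soft_post w z)\<bar>) + ?m * (\<bar>g z\<bar> * \<bar>g w\<bar>))"
      by (rule ennreal_leI)
    also have "\<dots> = ennreal ?m * (ennreal \<bar>g (soft_post z w)\<bar> * ennreal \<bar>g (soft_post w z)\<bar>)
      + ennreal ?m * (ennreal \<bar>g z\<bar> * ennreal \<bar>g w\<bar>)"
      using order_trans[OF rb] by (simp add: ennreal_plus ennreal_mult)
    finally show "ennreal (norm (?K z w)) \<le> \<dots>" .
  qed
  also have "\<dots> = ennreal ?m * (\<integral>\<^sup>+z. (\<integral>\<^sup>+w. ennreal \<bar>g (soft_post z w)\<bar> * ennreal \<bar>g (soft_post w z)\<bar> \<partial>lborel) \<partial>lborel)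
      + ennreal ?m * (\<integral>\<^sup>+z. (\<integral>\<^sup>+w. ennreal \<bar>g z\<bar> * ennreal \<bar>g w\<bar> \<partial>lborel) \<partial>lborel)"
    by (subst nn_integral_add, measurable, subst nn_integral_add, measurable,
        intro arg_cong2[where f="(+)"]; (subst nn_integral_cmult, measurable, subst nn_integral_cmult, measurable))
  also have "(\<integral>\<^sup>+z. (\<integral>\<^sup>+w. ennreal \<bar>g (soft_post z w)\<bar> * ennreal \<bar>g (soft_post w z)\<bar> \<partial>lborel) \<partial>lborel) =
      (\<integral>\<^sup>+z. (\<integral>\<^sup>+w. ennreal \<bar>g z\<bar> * ennreal \<bar>g w\<bar> \<partial>lborel) \<partial>lborel)"
    by (rule nn_integral_soft_post[of "\<lambda>z w. ennreal \<bar>g z\<bar> * ennreal \<bar>g w\<bar>"]) measurable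
  also have "ennreal ?m * (\<integral>\<^sup>+z. (\<integral>\<^sup>+w. ennreal \<bar>g z\<bar> * ennreal \<bar>g w\<bar> \<partial>lborel) \<partial>lborel)
      + ennreal ?m * (\<integral>\<^sup>+z. (\<integral>\<^sup>+w. ennreal \<bar>g z\<bar> * ennreal \<bar>g w\<bar> \<partial>lborel) \<partial>lborel) < \<infinity>"
    using gg by (simp add: ennreal_mult_less_top)
  finally have "integrable (lborel \<Otimes>\<^sub>M lborel) (\<lambda>x. ?K (fst x) (snd x))"
    using Km by (intro integrableI_bounded) auto
  from lborel_pair.AE_integrable_fst'[OF this]
  have "AE z in lborel. integrable lborel (?K z)" by simp
  then show ?thesis
  proof eventually_elim
    fix z assume int: "integrable lborel (?K z)"
    obtain x v where z: "z = (x, v)" by (cases z)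
    have "integrable (lborel \<Otimes>\<^sub>M lborel) (\<lambda>(y, w). ?K z (y, w))"
      using int unfolding lborel_prod by (simp add: case_prod_beta')
    from lborel_pair.integral_snd[OF this]
    have "(\<integral>v1. (\<integral>y. ?K z (y, v1) \<partial>lborel) \<partial>lborel) = (\<integral>w. ?K z w \<partial>lborel)"
      by (simp add: lborel_prod case_prod_beta')
    then show "soft_kinetic h B g z = (\<integral>w. ?K z w \<partial>lborel)"
      unfolding soft_kinetic_def z by (simp add: soft_kinetic_integrand[OF refl refl])
  qed
qed

lemma soft_kinetic_meas:
  fixes u :: "real \<Rightarrow> vec3 \<times> vec3 \<Rightarrow> real"
  assumes B: "collision_kernel B" and h: "modulation h"
    and u: "(\<lambda>(t, z). u t z) \<in> borel_measurable (borel \<Otimes>\<^sub>M borel)"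
  shows "(\<lambda>(t, z). soft_kinetic h B (u t) z) \<in> borel_measurable (borel \<Otimes>\<^sub>M borel)"
proof -
  have um: "(\<lambda>x. u (p x) (q x)) \<in> borel_measurable M" if "p \<in> borel_measurable M" "q \<in> borel_measurable M"
    for p q and M :: "'x measure"
    using measurable_compose[OF measurable_Pair[OF that] u] by simp
  let ?K = "\<lambda>t z w. soft_rate h B z w * (u t (soft_post z w) * u t (soft_post w z) - u t z * u t w)"
  have Km: "(\<lambda>x. ?K (r x) (p x) (q x)) \<in> borel_measurable M"
    if [measurable]: "r \<in> borel_measurable M" "p \<in> borel_measurable M" "q \<in> borel_measurable M"
    for r p q and M :: "'x measure"
    by (intro borel_measurable_times borel_measurable_diff um soft_rate_measurable[OF B h]; measurable)
  have "(\<lambda>x. \<integral>v1. (\<integral>y. ?K (fst x) (snd x) (y, v1) \<partial>lborel) \<partial>lborel) \<in> borel_measurable (borel \<Otimes>\<^sub>M borel)"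
    by (intro lborel.borel_measurable_lebesgue_integral, simp only: case_prod_beta',
        intro lborel.borel_measurable_lebesgue_integral, simp only: case_prod_beta', intro Km; measurable)
  moreover have "soft_kinetic h B (u t) z = (\<integral>v1. (\<integral>y. ?K t z (y, v1) \<partial>lborel) \<partial>lborel)" for t z
    by (cases z) (simp add: soft_kinetic_def soft_kinetic_integrand[OF refl refl])
  ultimately show ?thesis by (simp add: case_prod_beta')
qed

lemma free_flow_apply: "i \<in> {1..N} \<Longrightarrow> free_flow N t z i = free_flow1 t (z i)"
  by (simp add: free_flow_def)

lemma free_flow_add: "free_flow N s (free_flow N t z) = free_flow N (s + t) z"
  by (auto simp: free_flow_def free_flow1_add)

lemma free_flow_0: "z \<in> space (phase N) \<Longrightarrow> free_flow N 0 z = z"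
  by (auto simp: free_flow_def space_PiM PiE_def extensional_def fun_eq_iff)

text \<open>Pulled back along the free flow, the solutions satisfy the abstract equations. The flow
  preserves Lebesgue measure and moves each particle separately, so it maps test functions on
  \<open>{1..j}\<close> to such functions, and gaps agree before and after the pull-back.\<close>

theorem soft_chaos:
  fixes B :: "vec3 \<Rightarrow> vec3 \<Rightarrow> real" and f :: "real \<Rightarrow> vec3 \<times> vec3 \<Rightarrow> real"
  assumes B: "collision_kernel B" "bounded_kernel B" and C0: "1 \<le> C0" and B0: "0 < B0"
    and h: "modulation h"
    and FN: "soft_N_solution h B N F" "symmetric N (F 0)" "prob_density (phase N) (F 0)"
    and f: "povzner_solution h B f" "prob_density lborel (f 0)"
    and E: "\<forall>j\<in>{2..N}. L1_norm (phase j) (corr_error N (F 0) (f 0) j) \<le> ennreal (C0 ^ j * (real j / sqrt (real N)) ^ j)"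
    and E1: "L1_norm (phase 1) (corr_error N (F 0) (f 0) 1) \<le> ennreal (B0 / real N)"
    and t: "0 < t" and j: "j \<in> {1..N}"
  shows "L1_norm (phase j) (\<lambda>z. marginal N (F t) j z - tensor (f t) {1..j} z)
    \<le> ennreal (D2 B0 C0 * exp (2 * D1 * t * kernel_norm B * (2 * pi + modulation_norm h)) * (real j)\<^sup>2 / real N)"
proof -
  interpret collision_model "count_space (UNIV :: unit set)"
    "\<lambda>t _ z w. soft_rate h B (free_flow1 t z) (free_flow1 t w)"
    "\<lambda>t _ z w. free_flow1 (- t) (soft_post (free_flow1 t z) (free_flow1 t w))"
    "modulation_norm h * kernel_norm B"
    by (rule soft_collision_model[OF B h])
  \<comment> \<open>The case t \<le> 0 makes \<open>F' 0\<close> equal to \<open>F 0\<close> as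
    functions; \<open>free_flow N 0\<close> restricts its argument and is the identity on the phase
    space only.\<close>
  define F' where "F' = (\<lambda>t z. if t \<le> 0 then F 0 z else F t (free_flow N t z))"
  define f' where "f' = (\<lambda>t z. if t \<le> 0 then f 0 z else f t (free_flow1 t z))"
  have F'0: "F' 0 = F 0" and f'0: "f' 0 = f 0" by (simp_all add: F'_def f'_def)
  have F': "F' s z = F s (free_flow N s z)" if "0 \<le> s" "z \<in> space (phase N)" for s z
    using that by (auto simp: F'_def free_flow_0)
  have f': "f' s = (\<lambda>z. f s (free_flow1 s z))" if "0 \<le> s" for s
    using that by (auto simp: f'_def)
  have mF: "mild_solution (phase N) (free_flow N) (soft_master h B N) F"
    and dF: "\<And>t. 0 \<le> t \<Longrightarrow> prob_density (phase N) (F t)"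
    using FN(1) by (auto simp: soft_N_solution_def)
  have mf: "mild_solution lborel free_flow1 (soft_kinetic h B) f"
    using f(1) by (simp add: povzner_solution_def)
  have Fi: "integrable (phase N) (F s)" if "0 \<le> s" for s using dF[OF that] by (simp add: prob_density_def)
  have fi: "integrable lborel (f s)" if "0 \<le> s" for s using mf that by (simp add: mild_solution_def)
  have F'i: "integrable (phase N) (\<lambda>z. F s (free_flow N s z))" if "0 \<le> s" for s
    using integrable_distr[OF free_flow_measurable', of N s "F s"] Fi[OF that] by (simp add: distr_free_flow)
  have f'i: "integrable lborel (\<lambda>z. f s (free_flow1 s z))" if "0 \<le> s" for s
  proof -
    have "free_flow1 s \<in> measurable lborel lborel" by measurable
    from integrable_distr[OF this, of "f s"] fi[OF that] show ?thesis by (simp add: distr_free_flow1)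
  qed
  have evF: "evolves (phase N) (\<lambda>s. master s N (F' s)) F'"
    unfolding evolves_def
  proof (intro conjI allI impI)
    show "integrable (phase N) (F' t)" if "0 \<le> t" for t
      using F'i[OF that] F'[OF that] by (simp cong: Bochner_Integration.integrable_cong)
    have um: "(\<lambda>(t, z). F (max 0 t) z) \<in> borel_measurable (borel \<Otimes>\<^sub>M phase N)"
      by (rule mild_solution_measurable[OF mF])
    have [measurable]: "F 0 \<in> borel_measurable (phase N)" using Fi[of 0] by simp
    have "(\<lambda>x. (fst x, free_flow N (fst x) (snd x))) \<in> measurable (borel \<Otimes>\<^sub>M phase N) (borel \<Otimes>\<^sub>M phase N)"
      using free_flow_measurable[of N] by (intro measurable_Pair) (auto simp: case_prod_beta')
    from measurable_compose[OF this um]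
    have [measurable]: "(\<lambda>x. F (max 0 (fst x)) (free_flow N (fst x) (snd x))) \<in> borel_measurable (borel \<Otimes>\<^sub>M phase N)"
      by simp
    have "(\<lambda>x. if fst x \<le> 0 then F 0 (snd x) else F (max 0 (fst x)) (free_flow N (fst x) (snd x))) \<in> borel_measurable (borel \<Otimes>\<^sub>M phase N)"
      by measurable
    also have "(\<lambda>x. if fst x \<le> 0 then F 0 (snd x) else F (max 0 (fst x)) (free_flow N (fst x) (snd x))) = (\<lambda>(t, z). F' t z)"
      by (auto simp: F'_def fun_eq_iff)
    finally have F'm: "(\<lambda>(t, z). F' t z) \<in> borel_measurable (borel \<Otimes>\<^sub>M phase N)" .
    show "(\<lambda>(s, z). master s N (F' s) z) \<in> borel_measurable (borel \<Otimes>\<^sub>M phase N)"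
      unfolding master_def case_prod_beta'
      by (intro borel_measurable_times borel_measurable_const borel_measurable_sum
          pair_op_meas[OF F'm, unfolded case_prod_beta']) auto
    \<comment> \<open>Conjugation with the flow turns a collision of the abstract model into an
      original collision at the point reached at time \<open>s\<close>.\<close>
    have master_eq: "soft_master h B N (F s) (free_flow N s z) = master s N (F' s) z"
      if s: "0 \<le> s" and z: "z \<in> space (phase N)" for s z
      unfolding soft_master_def master_def
    proof (intro arg_cong2[where f="(*)"] refl sum.cong)
      fix i k assume ik: "i \<in> {1..N}" "k \<in> {i<..N}"
      then have k: "k \<in> {1..N}" and ne: "i \<noteq> k" by auto
      let ?zi = "free_flow1 s (z i)" and ?zk = "free_flow1 s (z k)"
      let ?\<omega> = "direction (fst ?zi) (fst ?zk)"
      have cs: "col s () i k z \<in> space (phase N)"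
        by (rule col_space[OF z ik(1) k])
      have col: "free_flow N s (col s () i k z) = (free_flow N s z)(i := soft_post ?zi ?zk, k := soft_post ?zk ?zi)"
        using ik(1) k ne by (auto simp: free_flow_def col_def fun_eq_iff free_flow1_add)
      have "pair_op s i k (F' s) z = soft_rate h B ?zi ?zk * (F s (free_flow N s (col s () i k z)) - F s (free_flow N s z))"
        unfolding pair_op_def integral_unit F'[OF s cs] F'[OF s z] ..
      also have "\<dots> = (let \<omega> = ?\<omega> in h (norm (fst ?zi - fst ?zk)) * B \<omega> (snd ?zi - snd ?zk) *
          (F s (collide \<omega> i k (free_flow N s z)) - F s (free_flow N s z)))"
      proof (cases "fst ?zi = fst ?zk")
        case True
        then have "?\<omega> = 0" by (simp add: direction_def)
        moreover have "collide 0 i k (free_flow N s z) = free_flow N s z"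
          by (auto simp: collide_def post2_eq_post1 fun_eq_iff)
        ultimately show ?thesis using True by (simp add: soft_rate_def Let_def)
      next
        case False
        have "collide ?\<omega> i k (free_flow N s z) = (free_flow N s z)(i := soft_post ?zi ?zk, k := soft_post ?zk ?zi)"
          using ik(1) k by (simp add: collide_def post2_eq_post1 soft_post_def free_flow_apply
              direction_swap[of "fst ?zk" "fst ?zi"] post1_minus)
        then show ?thesis using False col by (simp add: soft_rate_def Let_def)
      qed
      finally show "(let \<omega> = direction (fst (free_flow N s z i)) (fst (free_flow N s z k)) in
          h (norm (fst (free_flow N s z i) - fst (free_flow N s z k))) * B \<omega> (snd (free_flow N s z i) - snd (free_flow N s z k)) *
          (F s (collide \<omega> i k (free_flow N s z)) - F s (free_flow N s z))) = pair_op s i k (F' s) z"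
        using ik(1) k by (simp add: free_flow_apply)
    qed
    fix t :: real assume t: "0 \<le> t"
    have "AE z in phase N. F t z = F 0 (free_flow N (- t) z) + (LINT s:{0..t}|lborel. soft_master h B N (F s) (free_flow N (- (t - s)) z))"
      using mF t by (simp add: mild_solution_def)
    \<comment> \<open>As the flow preserves the measure, Duhamel's formula also holds at the
      transported point, for almost every starting point; there the backward flows reduce to the
      forward flow up to time \<open>s\<close>.\<close>
    then have "AE z in distr (phase N) (phase N) (free_flow N t).
        F t z = F 0 (free_flow N (- t) z) + (LINT s:{0..t}|lborel. soft_master h B N (F s) (free_flow N (- (t - s)) z))"
      by (simp only: distr_free_flow)
    from AE_distrD[OF free_flow_measurable' this] AE_space
    show "AE z in phase N. F' t z = F' 0 z + (LINT s:{0..t}|lborel. master s N (F' s) z)"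
    proof eventually_elim
      fix z assume z: "F t (free_flow N t z) = F 0 (free_flow N (- t) (free_flow N t z)) +
        (LINT s:{0..t}|lborel. soft_master h B N (F s) (free_flow N (- (t - s)) (free_flow N t z)))"
        "z \<in> space (phase N)"
      have "(LINT s:{0..t}|lborel. soft_master h B N (F s) (free_flow N (- (t - s)) (free_flow N t z))) =
          (LINT s:{0..t}|lborel. master s N (F' s) z)"
        by (rule set_lebesgue_integral_cong) (use z(2) master_eq in \<open>auto simp: free_flow_add\<close>)
      with z F'[OF t z(2)] show "F' t z = F' 0 z + (LINT s:{0..t}|lborel. master s N (F' s) z)"
        by (simp add: free_flow_add free_flow_0 F'0)
    qed
  qed
  have F1: "(\<integral>z. \<bar>F' s z\<bar> \<partial>phase N) \<le> 1" if "0 \<le> s" for s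
  proof -
    have "(\<integral>z. \<bar>F' s z\<bar> \<partial>phase N) = (\<integral>z. \<bar>F s (free_flow N s z)\<bar> \<partial>phase N)"
      using F'[OF that] by (intro Bochner_Integration.integral_cong) auto
    also have "\<dots> = (\<integral>z. \<bar>F s z\<bar> \<partial>phase N)"
      using Fi[OF that] by (intro integral_free_flow[of "\<lambda>z. \<bar>F s z\<bar>"]) simp
    finally show ?thesis using prob_density_L1[OF dF[OF that]] by simp
  qed
  let ?f = "\<lambda>t. f (max 0 t)"
  \<comment> \<open>The rate literally delivered by Duhamel's formula; it coincides with
    \<open>kinetic\<close> at the pulled-back density only almost everywhere.\<close>
  define q where "q = (\<lambda>s z. soft_kinetic h B (?f s) (free_flow1 s z))"
  have fm: "(\<lambda>(t, z). ?f t z) \<in> borel_measurable (borel \<Otimes>\<^sub>M borel)"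
    using mild_solution_measurable[OF mf] by (simp cong: measurable_cong_sets)
  have qm: "(\<lambda>(s, z). q s z) \<in> borel_measurable (borel \<Otimes>\<^sub>M lborel)"
  proof -
    have "(\<lambda>x. (fst x, free_flow1 (fst x) (snd x))) \<in> measurable (borel \<Otimes>\<^sub>M lborel) (borel \<Otimes>\<^sub>M borel)"
      by measurable
    from measurable_compose[OF this soft_kinetic_meas[OF B(1) h fm]] show ?thesis
      by (simp add: q_def case_prod_beta')
  qed
  have evf: "evolves lborel q f'"
    unfolding evolves_def
  proof (intro conjI allI impI qm)
    show "integrable lborel (f' t)" if "0 \<le> t" for t
      using f'i[OF that] f'[OF that] by simp
    fix t :: real assume t: "0 \<le> t"
    have ffm: "free_flow1 t \<in> measurable lborel lborel" by measurable
    have "AE z in lborel. f t z = f 0 (free_flow1 (- t) z) + (LINT s:{0..t}|lborel. soft_kinetic h B (f s) (free_flow1 (- (t - s)) z))"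
      using mf t by (simp add: mild_solution_def)
    then have "AE z in distr lborel lborel (free_flow1 t).
        f t z = f 0 (free_flow1 (- t) z) + (LINT s:{0..t}|lborel. soft_kinetic h B (f s) (free_flow1 (- (t - s)) z))"
      by (simp only: distr_free_flow1)
    from AE_distrD[OF ffm this]
    show "AE z in lborel. f' t z = f' 0 z + (LINT s:{0..t}|lborel. q s z)"
    proof eventually_elim
      fix z assume z: "f t (free_flow1 t z) = f 0 (free_flow1 (- t) (free_flow1 t z)) +
        (LINT s:{0..t}|lborel. soft_kinetic h B (f s) (free_flow1 (- (t - s)) (free_flow1 t z)))"
      have "(LINT s:{0..t}|lborel. soft_kinetic h B (f s) (free_flow1 (- (t - s)) (free_flow1 t z))) = (LINT s:{0..t}|lborel. q s z)"
        by (rule set_lebesgue_integral_cong) (auto simp: free_flow1_add q_def)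
      with z show "f' t z = f' 0 z + (LINT s:{0..t}|lborel. q s z)"
        by (simp add: free_flow1_add f'0 f'[OF t])
    qed
  qed
  have qk: "AE z in lborel. q s z = kinetic s (f' s) z" if s: "0 \<le> s" for s
  proof -
    have ffm: "free_flow1 s \<in> measurable lborel lborel" by measurable
    let ?g = "f s"
    have [measurable]: "?g \<in> borel_measurable borel" using fi[OF s] by auto
    let ?K = "\<lambda>z w. soft_rate h B z w * (?g (soft_post z w) * ?g (soft_post w z) - ?g z * ?g w)"
    have "AE z in distr lborel lborel (free_flow1 s). soft_kinetic h B ?g z = (\<integral>w. ?K z w \<partial>lborel)"
      unfolding distr_free_flow1 by (rule soft_kinetic_AE[OF B h fi[OF s]])
    from AE_distrD[OF ffm this] show ?thesis
    proof eventually_elim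
      fix z assume z: "soft_kinetic h B ?g (free_flow1 s z) = (\<integral>w. ?K (free_flow1 s z) w \<partial>lborel)"
      have "(\<lambda>w. ?K (free_flow1 s z) w) \<in> borel_measurable borel"
        using soft_rate_measurable[OF B(1) h, of "\<lambda>_. free_flow1 s z" borel "\<lambda>w. w"] by measurable
      \<comment> \<open>The collision partner, too, is described by its starting point.\<close>
      from integral_free_flow1[OF this, of s]
      have "(\<integral>w. ?K (free_flow1 s z) w \<partial>lborel) = (\<integral>w. ?K (free_flow1 s z) (free_flow1 s w) \<partial>lborel)" ..
      also have "\<dots> = kinetic s (f' s) z"
        unfolding kinetic_def integral_unit f'[OF s] by (simp add: free_flow1_add)
      finally show "q s z = kinetic s (f' s) z" using z s by (simp add: q_def)
    qed
  qed
  have fb: "\<exists>R. \<forall>s. 0 \<le> s \<longrightarrow> s \<le> T \<longrightarrow> (\<integral>v. \<bar>f' s v\<bar> \<partial>lborel) \<le> R" if T: "0 \<le> T" for T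
  proof -
    obtain R where R: "\<And>s. 0 \<le> s \<Longrightarrow> s \<le> T \<Longrightarrow> (\<integral>z. \<bar>f s z\<bar> \<partial>lborel) \<le> R"
      using mild_solution_locally_bounded[OF mf T] by blast
    have "(\<integral>v. \<bar>f' s v\<bar> \<partial>lborel) = (\<integral>z. \<bar>f s z\<bar> \<partial>lborel)" if "0 \<le> s" for s
    proof -
      have "(\<lambda>z. \<bar>f s z\<bar>) \<in> borel_measurable borel" using fi[OF that] by auto
      from integral_free_flow1[OF this, of s] show ?thesis by (simp add: f'[OF that])
    qed
    then show ?thesis using R by auto
  qed
  let ?\<Lambda> = "kernel_norm B * (2 * pi + modulation_norm h)"
  \<comment> \<open>The rate of soft spheres is one of the two summands in the stated
    exponent.\<close>
  have \<Lambda>: "modulation_norm h * kernel_norm B \<le> ?\<Lambda>"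
    using kernel_norm_bound(2)[OF B(2)] by (simp add: algebra_simps)
  have t0: "0 \<le> t" using t by simp
  note main = chaos_bound[OF evF AE_I2[OF refl] F1 evf qk fb FN(3)[folded F'0] FN(2)[folded F'0] f(2)[folded f'0] C0 B0
      E[folded F'0 f'0] E1[folded F'0 f'0] \<Lambda> t0 j]
  have "(\<integral>v. f' t v \<partial>lborel) = 1"
    by (rule main(2)[of "\<lambda>_. 0"]) (simp_all add: test_on_def)
  moreover have "(\<integral>v. f' t v \<partial>lborel) = (\<integral>v. f t v \<partial>lborel)"
    unfolding f'[OF t0] using fi[OF t0] by (intro integral_free_flow1) auto
  ultimately have mass: "(\<integral>v. f t v \<partial>lborel) = 1" by simp
  have bound: "gap N (F t) (f t) \<psi> \<le> D2 B0 C0 * exp (2 * D1 * t * ?\<Lambda>) * (real j)\<^sup>2 / N" if \<psi>: "test_on N {1..j} \<psi>" for \<psi>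
  proof -
    have \<psi>m: "\<psi> \<in> borel_measurable (phase N)" using \<psi> unfolding test_on_def by blast
    have fs: "free_flow N t z \<in> space (phase N)" if "z \<in> space (phase N)" for z
      using measurable_space[OF free_flow_measurable' that] .
    have "test_on N {1..j} (\<lambda>z. \<psi> (free_flow N t z))"
      unfolding test_on_def
    proof (intro conjI ballI impI)
      show "(\<lambda>z. \<psi> (free_flow N t z)) \<in> borel_measurable (phase N)"
        by (rule measurable_compose[OF free_flow_measurable' \<psi>m])
      fix z :: "nat \<Rightarrow> vec3 \<times> vec3" assume z: "z \<in> space (phase N)"
      show "\<bar>\<psi> (free_flow N t z)\<bar> \<le> 1" using \<psi> fs[OF z] unfolding test_on_def by blast
      fix z' :: "nat \<Rightarrow> vec3 \<times> vec3" assume z': "z' \<in> space (phase N)" and eq: "\<forall>i\<in>{1..j}. z i = z' i"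
      have "\<forall>i\<in>{1..j}. free_flow N t z i = free_flow N t z' i"
        using eq j by (auto simp: free_flow_def)
      then show "\<psi> (free_flow N t z) = \<psi> (free_flow N t z')"
        using \<psi> fs[OF z] fs[OF z'] unfolding test_on_def by blast
    qed
    from main(1)[OF _ _ _ this]
    have "gap N (F' t) (f' t) (\<lambda>z. \<psi> (free_flow N t z)) \<le> D2 B0 C0 * exp (2 * D1 * t * ?\<Lambda>) * (real j)\<^sup>2 / N"
      by simp
    moreover have "gap N (F' t) (f' t) (\<lambda>z. \<psi> (free_flow N t z)) = gap N (F t) (f t) \<psi>"
    proof -
      have Fm: "F t \<in> borel_measurable (phase N)" using Fi[OF t0] by simp
      have tm: "tensor (f t) {1..N} \<in> borel_measurable (phase N)"
        using integrable_tensor(1)[of "{1..N}", OF _ fi[OF t0]] by simp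
      have "(\<integral>z. F' t z * \<psi> (free_flow N t z) \<partial>phase N) = (\<integral>z. F t (free_flow N t z) * \<psi> (free_flow N t z) \<partial>phase N)"
        using F'[OF t0] by (intro Bochner_Integration.integral_cong) auto
      also have "\<dots> = (\<integral>z. F t z * \<psi> z \<partial>phase N)"
        by (rule integral_free_flow[of "\<lambda>z. F t z * \<psi> z"]) (intro borel_measurable_times Fm \<psi>m)
      moreover have "tensor (f' t) {1..N} z = tensor (f t) {1..N} (free_flow N t z)" for z
        unfolding tensor_def f'[OF t0] by (intro prod.cong) (auto simp: free_flow_apply)
      moreover have "(\<integral>z. tensor (f t) {1..N} (free_flow N t z) * \<psi> (free_flow N t z) \<partial>phase N) = (\<integral>z. tensor (f t) {1..N} z * \<psi> z \<partial>phase N)"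
        by (rule integral_free_flow[of "\<lambda>z. tensor (f t) {1..N} z * \<psi> z"]) (intro borel_measurable_times tm \<psi>m)
      ultimately show ?thesis by (simp add: gap_def)
    qed
    ultimately show ?thesis by simp
  qed
  have "L1_norm (phase j) (\<lambda>z. marginal N (F t) j z - tensor (f t) {1..j} z)
    \<le> ennreal (D2 B0 C0 * exp (2 * D1 * t * ?\<Lambda>) * (real j)\<^sup>2 / N)"
    using t0 j mass by (intro L1_marginal_le_of_gap Fi fi bound) auto
  then show ?thesis by (simp only: mult.assoc)
qed

theorem theorem4p1:
  fixes B :: "vec3 \<Rightarrow> vec3 \<Rightarrow> real" and N :: nat and C0 B0 :: real
  assumes "collision_kernel B"
    and "bounded_kernel B"
    and "1 \<le> C0"
    and "0 < B0"
  shows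
    "(\<forall>(fN :: real \<Rightarrow> (nat \<Rightarrow> vec3) \<Rightarrow> real) (f :: real \<Rightarrow> vec3 \<Rightarrow> real).
        kac_N_solution B N fN \<and> symmetric N (fN 0) \<and> prob_density (phase N) (fN 0) \<and>
        boltzmann_solution B f \<and> prob_density lborel (f 0) \<and>
        (\<forall>j\<in>{2..N}. L1_norm (phase j) (corr_error N (fN 0) (f 0) j)
            \<le> ennreal (C0 ^ j * (real j / sqrt (real N)) ^ j)) \<and>
        L1_norm (phase 1) (corr_error N (fN 0) (f 0) 1) \<le> ennreal (B0 / real N)
        \<longrightarrow>
        (\<forall>t>0. \<forall>j\<in>{1..N}.
           L1_norm (phase j) (\<lambda>z. marginal N (fN t) j z - tensor (f t) {1..j} z)
             \<le> ennreal (D2 B0 C0 * exp (2 * D1 * t * kernel_norm B * (2 * pi + 0))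
                        * (real j)\<^sup>2 / real N)))
     \<and>
     (\<forall>(h :: real \<Rightarrow> real) (fN :: real \<Rightarrow> (nat \<Rightarrow> vec3 \<times> vec3) \<Rightarrow> real)
        (f :: real \<Rightarrow> vec3 \<times> vec3 \<Rightarrow> real).
        modulation h \<and>
        soft_N_solution h B N fN \<and> symmetric N (fN 0) \<and> prob_density (phase N) (fN 0) \<and>
        povzner_solution h B f \<and> prob_density lborel (f 0) \<and>
        (\<forall>j\<in>{2..N}. L1_norm (phase j) (corr_error N (fN 0) (f 0) j)
            \<le> ennreal (C0 ^ j * (real j / sqrt (real N)) ^ j)) \<and>
        L1_norm (phase 1) (corr_error N (fN 0) (f 0) 1) \<le> ennreal (B0 / real N)
        \<longrightarrow>
        (\<forall>t>0. \<forall>j\<in>{1..N}.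
           L1_norm (phase j) (\<lambda>z. marginal N (fN t) j z - tensor (f t) {1..j} z)
             \<le> ennreal (D2 B0 C0
                        * exp (2 * D1 * t * kernel_norm B * (2 * pi + modulation_norm h))
                        * (real j)\<^sup>2 / real N)))"
proof (intro conjI allI impI ballI, goal_cases)
  case (1 fN f t j)
  then show ?case by (intro kac_chaos assms) auto
next
  case (2 h fN f t j)
  then show ?case by (intro soft_chaos assms) auto
qed


end
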